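(* Let $\Bbbk$ be a field and let $A,A'$ be prime $\Bbbk$-algebras which are module-finite over their centers $Z,Z'$ respectively. Let $w=\mathrm{rk}(A/Z)$ and $w'=\mathrm{rk}(A'/Z')$. Assume that $A\otimes A'$ is prime, and that for each of the pairs $(A,Z)$ and $(A',Z')$ the following hold: the image of the regular trace lies in the center; the center is affine and Cohen–Macaulay; and the algebra has a quasi-basis with respect to some finite generating set of it as a module over its center. Suppose $d$ (resp. $d'$) is an $\overline{\mathcal R}$-discriminant of $A/Z$ (resp. $A'/Z'$). Then $d^{w'}\otimes (d')^{w}$ is an $\overline{\mathcal R}$-discriminant of $(A\otimes A')/(Z\otimes Z')$.
   Context: $\otimes=\otimes_{\Bbbk}$; "affine" means finitely generated as a $\Bbbk$-algebra. Let $R$ be a commutative domain that is a central subalgebra of a prime algebra $B$ with $B$ a finitely generated $R$-module. Let $F$ be the fraction field of $R$, $B_F=B\otimes_RF$, and $w=\mathrm{rk}(B/R)=\dim_FB_F$. The regular trace $\mathrm{tr}:B\to F$ sends $b$ to the trace of left multiplication by $b$ on $B_F$; it is assumed that $\mathrm{tr}(B)\subseteq R$. $\mathrm{MD}(B/R)$ is the ideal of $R$ generated by all $\det\big(\mathrm{tr}(u_iu_j')\big)_{i,j=1}^w$, where $\{u_i\}_{i=1}^w,\{u_i'\}_{i=1}^w$ range over all $w$-element subsets of $B$. For an $R$-module $M$ put $M^\vee=\mathrm{Hom}_R(M,R)$; $M$ is reflexive if the natural map $M\to M^{\vee\vee}$ is an isomorphism. If $B$ is a reflexive $R$-module and $M$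 is an ideal of $B$, then $M^{\vee\vee}$ is viewed as an ideal of $B=B^{\vee\vee}$ containing $M$. An element $d\in B$ is normal if $dB=Bd$. An $\overline{\mathcal R}$-discriminant of $B$ over $R$ is defined when $B$ is reflexive over $R$ (so saying that $d$ is one includes this): it is a normal element $d\in B$ with $(\mathrm{MD}(B/R)B)^{\vee\vee}=dB$. Quasi-basis: a set $\mathbf b=\{b_1,\dots,b_w\}\subseteq B$ is a quasi-basis of $B$ with respect to a finite set $X=\{x_j\}_{j\in J}\subseteq B$ if (a) $\mathbf b\subseteq X$; (b) $\mathbf b$ (i.e. $\{b_i\otimes1\}$) is an $F$-basis of $B_F$; (c) $X$ generates $B$ as an $R$-module; (d) each $x_j$ lies in $\bigcup_{i=1}^wFb_i$. *)

theory Defs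
  imports "HOL-Algebra.Algebra" "HOL-Combinatorics.Permutations" "HOL-Library.Extended_Nat"
begin

section \<open>Rings, centers, algebras\<close>

definition center :: "('a, 'n) ring_scheme \<Rightarrow> 'a set" where
  "center B = {z \<in> carrier B. \<forall>b \<in> carrier B. z \<otimes>\<^bsub>B\<^esub> b = b \<otimes>\<^bsub>B\<^esub> z}"

text \<open>The library locale \<^locale>\<open>algebra\<close> is restricted to commutative algebras and
  \<^locale>\<open>primeideal\<close> to commutative rings, hence the following two predicates.\<close>

definition assoc_algebra :: "('k, 'm) ring_scheme \<Rightarrow> ('k, 'a, 'n) module_scheme \<Rightarrow> bool" where
  "assoc_algebra k A \<longleftrightarrow> module k A \<and> ring A \<and>
     (\<forall>c \<in> carrier k. \<forall>x \<in> carrier A. \<forall>y \<in> carrier A.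
        (c \<odot>\<^bsub>A\<^esub> x) \<otimes>\<^bsub>A\<^esub> y = c \<odot>\<^bsub>A\<^esub> (x \<otimes>\<^bsub>A\<^esub> y) \<and>
        x \<otimes>\<^bsub>A\<^esub> (c \<odot>\<^bsub>A\<^esub> y) = c \<odot>\<^bsub>A\<^esub> (x \<otimes>\<^bsub>A\<^esub> y))"

definition prime_ring :: "('a, 'n) ring_scheme \<Rightarrow> bool" where
  "prime_ring B \<longleftrightarrow> ring B \<and> carrier B \<noteq> {\<zero>\<^bsub>B\<^esub>} \<and>
     (\<forall>I J. ideal I B \<longrightarrow> ideal J B \<longrightarrow> ideal_prod B I J = {\<zero>\<^bsub>B\<^esub>} \<longrightarrow>
        I = {\<zero>\<^bsub>B\<^esub>} \<or> J = {\<zero>\<^bsub>B\<^esub>})"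

text \<open>A subring \<open>R\<close> of \<open>B\<close> is a subset of the carrier; the corresponding ring is
  \<open>B\<lparr>carrier := R\<rparr>\<close>.\<close>

definition linear_span :: "('a, 'n) ring_scheme \<Rightarrow> 'a set \<Rightarrow> 'a set \<Rightarrow> 'a set" where
  "linear_span B R V = generate (add_monoid B) {r \<otimes>\<^bsub>B\<^esub> x | r x. r \<in> R \<and> x \<in> V}"

definition module_finite :: "('a, 'n) ring_scheme \<Rightarrow> 'a set \<Rightarrow> bool" where
  "module_finite B R \<longleftrightarrow>
     (\<exists>V. finite V \<and> V \<subseteq> carrier B \<and> linear_span B R V = carrier B)"

definition affine_subalgebra ::
    "('k, 'm) ring_scheme \<Rightarrow> ('k, 'a, 'n) module_scheme \<Rightarrow> 'a set \<Rightarrow> bool" where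
  "affine_subalgebra k A Z \<longleftrightarrow>
     (\<exists>S. finite S \<and> S \<subseteq> Z \<and>
        Z = generate_ring A ((\<lambda>c. c \<odot>\<^bsub>A\<^esub> \<one>\<^bsub>A\<^esub>) ` carrier k \<union> S))"


section \<open>Localization and Cohen--Macaulay rings\<close>

text \<open>\<open>loc_class R S a s\<close> is the fraction \<open>a / s\<close> as the set of all pairs equivalent to
  \<open>(a, s)\<close>. As for the library's quotient rings, operations on classes are unions over all
  representatives, each of which contributes the same class.\<close>

definition loc_class :: "('a, 'n) ring_scheme \<Rightarrow> 'a set \<Rightarrow> 'a \<Rightarrow> 'a \<Rightarrow> ('a \<times> 'a) set" where
  "loc_class R S a s = {(b, t). b \<in> carrier R \<and> t \<in> S \<and>
     (\<exists>u \<in> S. u \<otimes>\<^bsub>R\<^esub> (a \<otimes>\<^bsub>R\<^esub> t) = u \<otimes>\<^bsub>R\<^esub> (b \<otimes>\<^bsub>R\<^esub> s))}"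

definition localization :: "('a, 'n) ring_scheme \<Rightarrow> 'a set \<Rightarrow> ('a \<times> 'a) set ring" where
  "localization R S =
    \<lparr>carrier = {loc_class R S a s | a s. a \<in> carrier R \<and> s \<in> S},
     monoid.mult = (\<lambda>V W. \<Union>(a, s) \<in> V. \<Union>(b, t) \<in> W.
        loc_class R S (a \<otimes>\<^bsub>R\<^esub> b) (s \<otimes>\<^bsub>R\<^esub> t)),
     monoid.one = loc_class R S \<one>\<^bsub>R\<^esub> \<one>\<^bsub>R\<^esub>,
     ring.zero = loc_class R S \<zero>\<^bsub>R\<^esub> \<one>\<^bsub>R\<^esub>,
     ring.add = (\<lambda>V W. \<Union>(a, s) \<in> V. \<Union>(b, t) \<in> W.
        loc_class R S (a \<otimes>\<^bsub>R\<^esub> t \<oplus>\<^bsub>R\<^esub> b \<otimes>\<^bsub>R\<^esub> s) (s \<otimes>\<^bsub>R\<^esub> t))\<rparr>"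

definition krull_dim :: "('a, 'n) ring_scheme \<Rightarrow> enat" where
  "krull_dim R = Sup {enat n | n. \<exists>P :: nat \<Rightarrow> 'a set.
     (\<forall>i \<le> n. primeideal (P i) R) \<and> (\<forall>i < n. P i \<subset> P (Suc i))}"

definition regular_sequence :: "('a, 'n) ring_scheme \<Rightarrow> 'a list \<Rightarrow> bool" where
  "regular_sequence R xs \<longleftrightarrow> set xs \<subseteq> carrier R \<and> Idl\<^bsub>R\<^esub> (set xs) \<noteq> carrier R \<and>
     (\<forall>i < length xs. \<forall>r \<in> carrier R.
        xs ! i \<otimes>\<^bsub>R\<^esub> r \<in> Idl\<^bsub>R\<^esub> (set (take i xs)) \<longrightarrow> r \<in> Idl\<^bsub>R\<^esub> (set (take i xs)))"

definition depth :: "('a, 'n) ring_scheme \<Rightarrow> 'a set \<Rightarrow> enat" where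
  "depth R I = Sup {enat (length xs) | xs. set xs \<subseteq> I \<and> regular_sequence R xs}"

definition cohen_macaulay_local :: "('a, 'n) ring_scheme \<Rightarrow> bool" where
  "cohen_macaulay_local L \<longleftrightarrow> cring L \<and> noetherian_ring L \<and>
     (\<exists>m. {I. maximalideal I L} = {m} \<and> depth L m = krull_dim L)"

definition cohen_macaulay :: "('a, 'n) ring_scheme \<Rightarrow> bool" where
  "cohen_macaulay R \<longleftrightarrow> cring R \<and> noetherian_ring R \<and>
     (\<forall>m. maximalideal m R \<longrightarrow> cohen_macaulay_local (localization R (carrier R - m)))"


section \<open>Tensor products of algebras\<close>

text \<open>The integral monoid ring of a monoid \<open>G\<close>, on the elements of the free abelian group
  on the carrier of \<open>G\<close>.\<close>

definition int_monoid_ring :: "('a, 'n) monoid_scheme \<Rightarrow> ('a \<Rightarrow>\<^sub>0 int) ring" where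
  "int_monoid_ring G =
    \<lparr>carrier = carrier (free_Abelian_group (carrier G)),
     monoid.mult = (\<lambda>x y. frag_extend (\<lambda>p. frag_extend (\<lambda>q. frag_of (p \<otimes>\<^bsub>G\<^esub> q)) y) x),
     monoid.one = frag_of \<one>\<^bsub>G\<^esub>, ring.zero = 0, ring.add = (+)\<rparr>"

definition tensor_relations ::
    "('r, 'k) ring_scheme \<Rightarrow> ('r, 'a, 'm) module_scheme \<Rightarrow> ('r, 'b, 'n) module_scheme \<Rightarrow>
     ('a \<times> 'b \<Rightarrow>\<^sub>0 int) set" where
  "tensor_relations R M N =
     {frag_of (x \<oplus>\<^bsub>M\<^esub> x', y) - frag_of (x, y) - frag_of (x', y) | x x' y.
        x \<in> carrier M \<and> x' \<in> carrier M \<and> y \<in> carrier N} \<union>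
     {frag_of (x, y \<oplus>\<^bsub>N\<^esub> y') - frag_of (x, y) - frag_of (x, y') | x y y'.
        x \<in> carrier M \<and> y \<in> carrier N \<and> y' \<in> carrier N} \<union>
     {frag_of (r \<odot>\<^bsub>M\<^esub> x, y) - frag_of (x, r \<odot>\<^bsub>N\<^esub> y) | r x y.
        r \<in> carrier R \<and> x \<in> carrier M \<and> y \<in> carrier N}"

definition tensor_kernel ::
    "('r, 'k) ring_scheme \<Rightarrow> ('r, 'a, 'm) module_scheme \<Rightarrow> ('r, 'b, 'n) module_scheme \<Rightarrow>
     ('a \<times> 'b \<Rightarrow>\<^sub>0 int) set" where
  "tensor_kernel R M N =
     generate (free_Abelian_group (carrier M \<times> carrier N)) (tensor_relations R M N)"

text \<open>For algebras \<open>M\<close>, \<open>N\<close> over a commutative ring \<open>R\<close> (neither need be commutative),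
  \<open>tensor_algebra R M N\<close> is \<open>M \<otimes>\<^sub>R N\<close>: the free abelian group on
  \<open>M \<times> N\<close> modulo the subgroup generated by the bilinearity relations, with
  \<open>(x \<otimes> y)(x' \<otimes> y') = xx' \<otimes> yy'\<close>. That subgroup is a two-sided ideal of
  the monoid ring of \<open>M \<times> N\<close>, so the quotient is again a ring.\<close>

definition tensor_algebra ::
    "('r, 'k) ring_scheme \<Rightarrow> ('r, 'a, 'm) module_scheme \<Rightarrow> ('r, 'b, 'n) module_scheme \<Rightarrow>
     ('a \<times> 'b \<Rightarrow>\<^sub>0 int) set ring" where
  "tensor_algebra R M N = int_monoid_ring (M \<times>\<times> N) Quot (tensor_kernel R M N)"

definition pure_tensor ::
    "('r, 'k) ring_scheme \<Rightarrow> ('r, 'a, 'm) module_scheme \<Rightarrow> ('r, 'b, 'n) module_scheme \<Rightarrow>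
     'a \<Rightarrow> 'b \<Rightarrow> ('a \<times> 'b \<Rightarrow>\<^sub>0 int) set" where
  "pure_tensor R M N x y = tensor_kernel R M N +>\<^bsub>int_monoid_ring (M \<times>\<times> N)\<^esub> frag_of (x, y)"

text \<open>The image of \<open>V \<otimes> W\<close> in \<open>M \<otimes> N\<close>, for subalgebras \<open>V\<close>, \<open>W\<close>. Over
  a field \<open>V \<otimes> W \<rightarrow> M \<otimes> N\<close> is injective, so this is \<open>V \<otimes> W\<close> as a
  subalgebra.\<close>

definition tensor_subalgebra ::
    "('r, 'k) ring_scheme \<Rightarrow> ('r, 'a, 'm) module_scheme \<Rightarrow> ('r, 'b, 'n) module_scheme \<Rightarrow>
     'a set \<Rightarrow> 'b set \<Rightarrow> ('a \<times> 'b \<Rightarrow>\<^sub>0 int) set set" where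
  "tensor_subalgebra R M N V W =
     generate (add_monoid (tensor_algebra R M N))
       {pure_tensor R M N x y | x y. x \<in> V \<and> y \<in> W}"


section \<open>Extension of scalars to the fraction field\<close>

text \<open>Throughout, \<open>R\<close> is a central subring of \<open>B\<close> which is a domain, with fraction
  field \<open>F\<close>.\<close>

definition frac_field :: "('a, 'n) ring_scheme \<Rightarrow> 'a set \<Rightarrow> ('a \<times> 'a) set ring" where
  "frac_field B R = localization (B\<lparr>carrier := R\<rparr>) (R - {\<zero>\<^bsub>B\<^esub>})"

definition frac_embed :: "('a, 'n) ring_scheme \<Rightarrow> 'a set \<Rightarrow> 'a \<Rightarrow> ('a \<times> 'a) set" where
  "frac_embed B R r = loc_class (B\<lparr>carrier := R\<rparr>) (R - {\<zero>\<^bsub>B\<^esub>}) r \<one>\<^bsub>B\<^esub>"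

definition algebra_via :: "('r \<Rightarrow> 'a) \<Rightarrow> ('a, 'n) ring_scheme \<Rightarrow> ('r, 'a) module" where
  "algebra_via h S =
    \<lparr>carrier = carrier S, monoid.mult = monoid.mult S, monoid.one = monoid.one S,
     ring.zero = ring.zero S, ring.add = ring.add S, smult = (\<lambda>r x. h r \<otimes>\<^bsub>S\<^esub> x)\<rparr>"

definition frac_ext ::
    "('a, 'n) ring_scheme \<Rightarrow> 'a set \<Rightarrow> ('a \<times> ('a \<times> 'a) set \<Rightarrow>\<^sub>0 int) set ring" where
  "frac_ext B R = tensor_algebra (B\<lparr>carrier := R\<rparr>)
     (algebra_via (\<lambda>r. r) B) (algebra_via (frac_embed B R) (frac_field B R))"

definition frac_tensor ::
    "('a, 'n) ring_scheme \<Rightarrow> 'a set \<Rightarrow> 'a \<Rightarrow> ('a \<times> 'a) set \<Rightarrow>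
     ('a \<times> ('a \<times> 'a) set \<Rightarrow>\<^sub>0 int) set" where
  "frac_tensor B R = pure_tensor (B\<lparr>carrier := R\<rparr>)
     (algebra_via (\<lambda>r. r) B) (algebra_via (frac_embed B R) (frac_field B R))"

definition ext_elem ::
    "('a, 'n) ring_scheme \<Rightarrow> 'a set \<Rightarrow> 'a \<Rightarrow> ('a \<times> ('a \<times> 'a) set \<Rightarrow>\<^sub>0 int) set" where
  "ext_elem B R b = frac_tensor B R b \<one>\<^bsub>frac_field B R\<^esub>"

text \<open>The library treats vector spaces over a subfield of a ring (\<^term>\<open>ring.dim\<close>,
  \<^term>\<open>ring.independent\<close>, \<^term>\<open>ring.Span\<close>). Here the subfield is \<open>1 \<otimes> F\<close>
  inside \<open>B\<^sub>F\<close>, with \<open>f\<close> acting as left multiplication by \<open>1 \<otimes> f\<close>.\<close>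

definition ext_scalar ::
    "('a, 'n) ring_scheme \<Rightarrow> 'a set \<Rightarrow> ('a \<times> 'a) set \<Rightarrow>
     ('a \<times> ('a \<times> 'a) set \<Rightarrow>\<^sub>0 int) set" where
  "ext_scalar B R f = frac_tensor B R \<one>\<^bsub>B\<^esub> f"

definition ext_scalars ::
    "('a, 'n) ring_scheme \<Rightarrow> 'a set \<Rightarrow> ('a \<times> ('a \<times> 'a) set \<Rightarrow>\<^sub>0 int) set set" where
  "ext_scalars B R = ext_scalar B R ` carrier (frac_field B R)"

definition rank :: "('a, 'n) ring_scheme \<Rightarrow> 'a set \<Rightarrow> nat" where
  "rank B R = ring.dim (frac_ext B R) (ext_scalars B R) (carrier (frac_ext B R))"

definition ext_basis ::
    "('a, 'n) ring_scheme \<Rightarrow> 'a set \<Rightarrow> ('a \<times> ('a \<times> 'a) set \<Rightarrow>\<^sub>0 int) set list \<Rightarrow> bool" where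
  "ext_basis B R us \<longleftrightarrow> set us \<subseteq> carrier (frac_ext B R) \<and>
     ring.independent (frac_ext B R) (ext_scalars B R) us \<and>
     ring.Span (frac_ext B R) (ext_scalars B R) us = carrier (frac_ext B R)"


section \<open>Regular trace, modified discriminant ideal\<close>

text \<open>The matrix \<open>c\<close> represents left multiplication by \<open>b \<otimes> 1\<close> with respect to the
  basis \<open>us\<close> of \<open>B\<^sub>F\<close>; its trace does not depend on the basis.\<close>

definition regular_trace :: "('a, 'n) ring_scheme \<Rightarrow> 'a set \<Rightarrow> 'a \<Rightarrow> ('a \<times> 'a) set" where
  "regular_trace B R b = (THE t. \<exists>us c. ext_basis B R us \<and>
     (\<forall>i < length us. \<forall>j < length us. c i j \<in> carrier (frac_field B R)) \<and>
     (\<forall>j < length us. ext_elem B R b \<otimes>\<^bsub>frac_ext B R\<^esub> us ! j =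
        (\<Oplus>\<^bsub>frac_ext B R\<^esub> i \<in> {..<length us}.
           ext_scalar B R (c i j) \<otimes>\<^bsub>frac_ext B R\<^esub> us ! i)) \<and>
     t = (\<Oplus>\<^bsub>frac_field B R\<^esub> i \<in> {..<length us}. c i i))"

definition trace_in_base :: "('a, 'n) ring_scheme \<Rightarrow> 'a set \<Rightarrow> bool" where
  "trace_in_base B R \<longleftrightarrow> (\<forall>b \<in> carrier B. regular_trace B R b \<in> frac_embed B R ` R)"

definition ring_det :: "('a, 'n) ring_scheme \<Rightarrow> nat \<Rightarrow> (nat \<Rightarrow> nat \<Rightarrow> 'a) \<Rightarrow> 'a" where
  "ring_det S n M = (\<Oplus>\<^bsub>S\<^esub> p \<in> {p. p permutes {..<n}}.
     add_pow S (sign p) (\<Otimes>\<^bsub>S\<^esub> i \<in> {..<n}. M i (p i)))"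

definition MD_ideal :: "('a, 'n) ring_scheme \<Rightarrow> 'a set \<Rightarrow> 'a set" where
  "MD_ideal B R = Idl\<^bsub>B\<lparr>carrier := R\<rparr>\<^esub>
     {r \<in> R. \<exists>u u'. u \<in> {..<rank B R} \<rightarrow> carrier B \<and> inj_on u {..<rank B R} \<and>
        u' \<in> {..<rank B R} \<rightarrow> carrier B \<and> inj_on u' {..<rank B R} \<and>
        frac_embed B R r = ring_det (frac_field B R) (rank B R)
          (\<lambda>i j. regular_trace B R (u i \<otimes>\<^bsub>B\<^esub> u' j))}"


section \<open>Reflexive modules and reflexive hulls\<close>

text \<open>Only the additive structure and the scalar multiplication of a \<^typ>\<open>('r, 'a) module\<close>
  record are relevant for a module, so the ring multiplication and the unit are arbitrary
  here.\<close>

definition dual_module ::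
    "('r, 'k) ring_scheme \<Rightarrow> ('r, 'a, 'n) module_scheme \<Rightarrow> ('r, 'a \<Rightarrow> 'r) module" where
  "dual_module R M =
    \<lparr>carrier = {f \<in> carrier M \<rightarrow>\<^sub>E carrier R.
       (\<forall>x \<in> carrier M. \<forall>y \<in> carrier M. f (x \<oplus>\<^bsub>M\<^esub> y) = f x \<oplus>\<^bsub>R\<^esub> f y) \<and>
       (\<forall>r \<in> carrier R. \<forall>x \<in> carrier M. f (r \<odot>\<^bsub>M\<^esub> x) = r \<otimes>\<^bsub>R\<^esub> f x)},
     monoid.mult = undefined, monoid.one = undefined,
     ring.zero = (\<lambda>x \<in> carrier M. \<zero>\<^bsub>R\<^esub>),
     ring.add = (\<lambda>f g. \<lambda>x \<in> carrier M. f x \<oplus>\<^bsub>R\<^esub> g x),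
     smult = (\<lambda>r f. \<lambda>x \<in> carrier M. r \<otimes>\<^bsub>R\<^esub> f x)\<rparr>"

definition dual_map ::
    "('r, 'k) ring_scheme \<Rightarrow> ('r, 'a, 'm) module_scheme \<Rightarrow> ('r, 'b, 'n) module_scheme \<Rightarrow>
     ('a \<Rightarrow> 'b) \<Rightarrow> ('b \<Rightarrow> 'r) \<Rightarrow> ('a \<Rightarrow> 'r)" where
  "dual_map R M N h = (\<lambda>f \<in> carrier (dual_module R N). \<lambda>x \<in> carrier M. f (h x))"

definition bidual_eval ::
    "('r, 'k) ring_scheme \<Rightarrow> ('r, 'a, 'n) module_scheme \<Rightarrow> 'a \<Rightarrow> (('a \<Rightarrow> 'r) \<Rightarrow> 'r)" where
  "bidual_eval R M x = (\<lambda>f \<in> carrier (dual_module R M). f x)"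

text \<open>\<^const>\<open>bidual_eval\<close> is always linear, so being an isomorphism means being bijective.\<close>

definition reflexive_module ::
    "('r, 'k) ring_scheme \<Rightarrow> ('r, 'a, 'n) module_scheme \<Rightarrow> bool" where
  "reflexive_module R M \<longleftrightarrow>
     bij_betw (bidual_eval R M) (carrier M) (carrier (dual_module R (dual_module R M)))"

text \<open>For an ideal \<open>I\<close> of \<open>B\<close> with \<open>B\<close> reflexive over \<open>R\<close>: the image of
  \<open>I\<^sup>\<or>\<^sup>\<or>\<close> in \<open>B\<^sup>\<or>\<^sup>\<or> = B\<close>
  under the double dual of the inclusion of \<open>I\<close> in \<open>B\<close>.\<close>

definition reflexive_hull :: "('a, 'n) ring_scheme \<Rightarrow> 'a set \<Rightarrow> 'a set \<Rightarrow> 'a set" where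
  "reflexive_hull B R I =
     (let S = B\<lparr>carrier := R\<rparr>; M = algebra_via (\<lambda>r. r) B; N = M\<lparr>carrier := I\<rparr> in
      {b \<in> carrier B. bidual_eval S M b \<in>
         dual_map S (dual_module S M) (dual_module S N) (dual_map S N M (\<lambda>x. x)) `
           carrier (dual_module S (dual_module S N))})"


section \<open>Discriminants and quasi-bases\<close>

definition normal_element :: "('a, 'n) ring_scheme \<Rightarrow> 'a \<Rightarrow> bool" where
  "normal_element B d \<longleftrightarrow> d \<in> carrier B \<and> d <#\<^bsub>B\<^esub> carrier B = carrier B #>\<^bsub>B\<^esub> d"

text \<open>The standing assumptions on a pair \<open>(B, R)\<close> are part of the notion of a discriminant:
  without them the regular trace and the modified discriminant ideal are not defined.\<close>

definition discriminant_setting :: "('a, 'n) ring_scheme \<Rightarrow> 'a set \<Rightarrow> bool" where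
  "discriminant_setting B R \<longleftrightarrow> prime_ring B \<and> subring R B \<and> R \<subseteq> center B \<and>
     domain (B\<lparr>carrier := R\<rparr>) \<and> module_finite B R \<and> trace_in_base B R"

definition is_reflexive_discriminant :: "('a, 'n) ring_scheme \<Rightarrow> 'a set \<Rightarrow> 'a \<Rightarrow> bool" where
  "is_reflexive_discriminant B R d \<longleftrightarrow> discriminant_setting B R \<and>
     reflexive_module (B\<lparr>carrier := R\<rparr>) (algebra_via (\<lambda>r. r) B) \<and>
     normal_element B d \<and>
     reflexive_hull B R (ideal_prod B (MD_ideal B R) (carrier B)) = d <#\<^bsub>B\<^esub> carrier B"

definition quasi_basis :: "('a, 'n) ring_scheme \<Rightarrow> 'a set \<Rightarrow> 'a list \<Rightarrow> 'a set \<Rightarrow> bool" where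
  "quasi_basis B R bs V \<longleftrightarrow> finite V \<and> V \<subseteq> carrier B \<and> length bs = rank B R \<and>
     set bs \<subseteq> V \<and>
     ext_basis B R (map (ext_elem B R) bs) \<and>
     linear_span B R V = carrier B \<and>
     (\<forall>x \<in> V. \<exists>b \<in> set bs. \<exists>f \<in> carrier (frac_field B R).
        ext_elem B R x = ext_scalar B R f \<otimes>\<^bsub>frac_ext B R\<^esub> ext_elem B R b)"

end

theory Submission
  imports "Jordan_Normal_Form.Determinant" Defs
begin

text \<open>Write \<open>Z\<close>, \<open>Z'\<close> for the centers. A quasi-basis \<open>b\<close> of \<open>A\<close> yields, after clearing
  a denominator \<open>c\<close>, coordinate functionals \<open>C\<^sub>i : A \<rightarrow> Z\<close> with
  \<open>c y = \<Sum> C\<^sub>i(y) b\<^sub>i\<close> and \<open>C\<^sub>i(y) b\<^sub>i \<in> c A\<close>. Expanding all entries in these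
  coordinates, \<open>MD(A/Z)\<close> is generated by the elements \<open>p q disc(b) / c\<^bsup>2w\<^esup>\<close>, where \<open>p\<close>, \<open>q\<close> are products
  of coordinates, one for each index. The products \<open>b\<^sub>i \<otimes> b'\<^sub>j\<close> are a quasi-basis of \<open>A \<otimes> A'\<close>
  with coordinates \<open>C\<^sub>i \<otimes> C'\<^sub>j\<close>, and by the Kronecker determinant the generators of its modified
  discriminant ideal are the tensor products of \<open>w'\<close>-fold products of generators for \<open>A\<close> with
  \<open>w\<close>-fold products of generators for \<open>A'\<close>.

  The reflexive hull of a submodule \<open>L\<close> of full rank consists of all \<open>y\<close> such that, for each functional
  \<open>f\<close> and each scalar \<open>s\<close>, \<open>f(L) \<subseteq> s Z\<close> implies \<open>f(y) \<in> s Z\<close>. This divisibility closure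
  commutes with \<open>\<otimes>\<close> over a field, since a tensor lies in \<open>U \<otimes> V\<close> as soon as its slices by linear
  forms lie in \<open>U\<close> and \<open>V\<close>, and it turns the powers of an ideal with hull \<open>d A\<close> into \<open>d\<^sup>n A\<close>.\<close>

section \<open>Determinants over commutative rings with a carrier\<close>

text \<open>Taking double duals of A \<otimes> A' directly would need Hom to commute with \<otimes>
  over Z \<otimes> Z', whose elements are in general not pure tensors. The divisibility closure
  avoids this, since it quantifies only over functionals on the whole algebra. It agrees with the
  hull for L containing m B with m \<noteq> 0, because a functional g on L is then recovered as g(m
  -)/m; L = 0 is treated apart. Condition (d) of a quasi-basis makes the description of MD exact: it
  puts p b_i into c A for every coordinate value p = C_i(y), so p b_i / c is an element of A, and p
  q disc(b) / c^(2w) is itself the discriminant of two families in A. The exponent 2w counts one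
  factor c for each row in each of two base changes. The exponents w' and w come from arranging the
  index set as a w by w' grid: the A-entries of one column are the data of one generator for A, and
  there are w' columns; the A'-entries of one row are the data of one generator for A', and there
  are w rows.\<close>

lemma (in cring) poly_evaluation:
  fixes v :: "nat \<Rightarrow> 'a"
  assumes v: "!!n. v n \<in> carrier R"
  obtains h :: "((nat \<Rightarrow>\<^sub>0 nat) \<Rightarrow>\<^sub>0 int) \<Rightarrow> 'a" and var :: "nat \<Rightarrow> (nat \<Rightarrow>\<^sub>0 nat) \<Rightarrow>\<^sub>0 int"
  where "!!p. h p \<in> carrier R" "h 1 = \<one>" "!!p q. h (p + q) = h p \<oplus> h q"
    "!!p q. h (p * q) = h p \<otimes> h q" "!!n. h (var n) = v n"
proof -
  \<comment> \<open>The value of the monomial with exponent vector \<open>m\<close> when the i-th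
    variable is sent to \<open>v i\<close>. Integer polynomials are the free abelian group on
    monomials, so an additive \<open>h\<close> extending \<open>mon\<close> exists, and
    multiplicativity has to be checked on monomials only.\<close>
  define mon where "mon m = gfinprod R (%i. v i [^] poly_mapping.lookup m i) UNIV" for m :: "nat \<Rightarrow>\<^sub>0 nat"
  have fin: "finite {i \<in> UNIV. v i [^] poly_mapping.lookup m i ~= \<one>}" for m :: "nat \<Rightarrow>\<^sub>0 nat"
    by (rule finite_subset[OF _ finite_keys[of m]]) (auto simp: in_keys_iff intro: ccontr)
  have mon: "mon m \<in> carrier R" for m
    unfolding mon_def by (rule gfinprod_closed) (use v in auto)
  have mon_add: "mon (m + m') = mon m \<otimes> mon m'" for m m'
    unfolding mon_def lookup_add
    by (subst gfinprod_distrib[symmetric]) (use v fin in \<open>auto simp: nat_pow_mult\<close>)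
  have mon_0: "mon 0 = \<one>"
    unfolding mon_def by (simp add: gfinprod_def)
  have mon_1: "mon (Poly_Mapping.single n 1) = v n" for n
  proof -
    have "mon (Poly_Mapping.single n 1) = gfinprod R (%i. v i) {n}"
      unfolding mon_def
      by (rule gfinprod_mono_neutral_cong_right) (use v in \<open>auto simp: lookup_single when_def\<close>)
    then show ?thesis using v by simp
  qed
  obtain h where h: "h \<in> hom (free_Abelian_group UNIV) (add_monoid R)"
      and h1: "!!m. h (frag_of m) = mon m"
    using comm_group.free_Abelian_group_universal[OF a_comm_group, of mon UNIV] mon
    by (auto simp: image_subset_iff)
  have hc: "h p \<in> carrier R" for p
    using h by (auto simp: hom_def Pi_def)
  have hadd: "h (p + q) = h p \<oplus> h q" for p q
    using h by (auto simp: hom_def)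
  have h0: "h 0 = \<zero>"
    using hadd[of 0 0] hc[of 0] by (metis add.r_cancel_one add_0)
  have hdiff: "h (p - q) = h p \<ominus> h q" for p q
  proof -
    have "h p = h (p - q) \<oplus> h q" using hadd[of "p - q" q] by simp
    then show ?thesis using hc by (metis add.inv_solve_right minus_eq)
  qed
  have hmult: "h (p * q) = h p \<otimes> h q" for p q
  proof (rule frag_induction[of p UNIV], simp)
    show "h (0 * q) = h 0 \<otimes> h q" using hc h0 by simp
  next
    fix a b assume "h (a * q) = h a \<otimes> h q" "h (b * q) = h b \<otimes> h q"
    then show "h ((a - b) * q) = h (a - b) \<otimes> h q"
      using hc by (simp add: left_diff_distrib hdiff minus_eq l_distr l_minus)
  next
    fix m
    show "h (frag_of m * q) = h (frag_of m) \<otimes> h q"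
    proof (rule frag_induction[of q UNIV], simp)
      show "h (frag_of m * 0) = h (frag_of m) \<otimes> h 0" using hc h0 by simp
    next
      fix a b assume "h (frag_of m * a) = h (frag_of m) \<otimes> h a" "h (frag_of m * b) = h (frag_of m) \<otimes> h b"
      then show "h (frag_of m * (a - b)) = h (frag_of m) \<otimes> h (a - b)"
        using hc by (simp add: right_diff_distrib hdiff minus_eq r_distr r_minus)
    qed (simp add: mult_single h1 mon_add)
  qed
  have "h 1 = \<one>" using h1[of 0] mon_0 by simp
  then show ?thesis
    using that[of h "%n. frag_of (Poly_Mapping.single n 1)"] hc hadd hmult h1 mon_1 by simp
qed


lemma (in cring) ring_det_cong:
  assumes "!!i j. i < n ==> j < n ==> M i j = N i j"
    and "!!i j. i < n ==> j < n ==> N i j \<in> carrier R"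
  shows "ring_det R n M = ring_det R n N"
proof -
  have "(\<Otimes>i\<in>{..<n}. M i (p i)) = (\<Otimes>i\<in>{..<n}. N i (p i))"
       "(\<Otimes>i\<in>{..<n}. N i (p i)) \<in> carrier R" if "p permutes {..<n}" for p
    using that assms permutes_in_image[OF that]
    by (auto intro!: finprod_cong' finprod_closed)
  then show ?thesis
    unfolding ring_det_def by (auto intro!: add.finprod_cong' add.int_pow_closed)
qed

lemma (in cring) ring_det_closed:
  assumes "!!i j. i < n ==> j < n ==> M i j \<in> carrier R"
  shows "ring_det R n M \<in> carrier R"
proof -
  have "(\<Otimes>i\<in>{..<n}. M i (p i)) \<in> carrier R" if "p permutes {..<n}" for p
    using that assms permutes_in_image[OF that] by (auto intro!: finprod_closed)
  then show ?thesis
    unfolding ring_det_def by (auto intro!: add.finprod_closed add.int_pow_closed)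
qed

text \<open>The source is a type with its class operations and the target a ring with a carrier, so
  the homomorphism laws are assumed of a bare function \<open>h\<close>. The permutation expansion
  of the determinant is then transported term by term.\<close>

lemma (in cring) ring_det_evaluation:
  fixes h :: "'c :: comm_ring_1 \<Rightarrow> 'a"
  assumes h: "!!p. h p \<in> carrier R" "h 1 = \<one>" "!!p q. h (p + q) = h p \<oplus> h q"
    "!!p q. h (p * q) = h p \<otimes> h q"
  shows "ring_det R n (%i j. h (M i j)) = h (det (mat n n (%(i, j). M i j)))"
proof -
  have h0: "h 0 = \<zero>"
    using h(3)[of 0 0] h(1)[of 0] by (metis add.r_cancel_one add_0)
  have hsum: "h (sum f I) = (\<Oplus>i\<in>I. h (f i))" if "finite I" for f and I :: "'i set"
    using that by (induction I rule: finite_induct) (auto simp: h h0)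
  have hprod: "h (prod f I) = (\<Otimes>i\<in>I. h (f i))" if "finite I" for f and I :: "'i set"
    using that by (induction I rule: finite_induct) (auto simp: h)
  have hminus: "h (- x) = \<ominus> h x" for x
    using h(3)[of "- x" x] h(1) h0 by (metis add.inv_equality add.left_inverse)
  have sgn: "add_pow R (sign p) (h x) = h (of_int (sign p) * x)" for p :: "nat \<Rightarrow> nat" and x
    using h(1) by (cases "sign p = 1") (auto simp: sign_def hminus add.int_pow_neg)
  have "h (det (mat n n (%(i, j). M i j))) =
      h (\<Sum>p\<in>{p. p permutes {..<n}}. of_int (sign p) * (\<Prod>i\<in>{..<n}. M i (p i)))"
    using permutes_in_image
    by (subst det_def'[of _ n])
      (fastforce simp: atLeast0LessThan intro!: arg_cong[of _ _ h] sum.cong prod.cong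
         arg_cong2[of _ _ _ _ times])+
  also have "\<dots> = (\<Oplus>p\<in>{p. p permutes {..<n}}. add_pow R (sign p) (\<Otimes>i\<in>{..<n}. h (M i (p i))))"
    by (subst hsum) (auto simp: finite_permutations hprod[symmetric] sgn)
  finally show ?thesis by (simp add: ring_det_def)
qed

text \<open>A polynomial identity with integer coefficients: it holds for generic matrices over a
  polynomial ring with integer coefficients, where the type-class determinant applies, and is
  transported to \<open>R\<close> by evaluating the variables at the given entries.\<close>

lemma (in cring) ring_det_mult:
  assumes M: "!!i j. i < n ==> j < n ==> M i j \<in> carrier R"
    and N: "!!i j. i < n ==> j < n ==> N i j \<in> carrier R"
  shows "ring_det R n (%i j. \<Oplus>l\<in>{..<n}. M i l \<otimes> N l j) = ring_det R n M \<otimes> ring_det R n N"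
proof -
  \<comment> \<open>One sequence holds both matrices: the tag \<open>b\<close> selects
    \<open>M\<close> or \<open>N\<close>, the inner pair is the position, and codes out of range get
    zero so that every value lies in the carrier.\<close>
  define v where "v a = (case prod_decode a of (b, c) \<Rightarrow> case prod_decode c of (i, j) \<Rightarrow>
      if i < n & j < n then if b = 0 then M i j else N i j else \<zero>)" for a
  have v: "v a \<in> carrier R" for a
    using M N by (auto simp: v_def split: prod.split)
  obtain h and var :: "nat \<Rightarrow> (nat \<Rightarrow>\<^sub>0 nat) \<Rightarrow>\<^sub>0 int"
    where h: "!!p. h p \<in> carrier R" "h 1 = \<one>" "!!p q. h (p + q) = h p \<oplus> h q"
      "!!p q. h (p * q) = h p \<otimes> h q" and var: "!!n. h (var n) = v n"
    by (rule poly_evaluation[of v]) (use v in auto)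
  have h0: "h 0 = \<zero>"
    using h(3)[of 0 0] h(1)[of 0] by (metis add.r_cancel_one add_0)
  have hsum: "h (sum f I) = (\<Oplus>i\<in>I. h (f i))" if "finite I" for f and I :: "'i set"
    using that by (induction I rule: finite_induct) (auto simp: h h0)
  define M' N' where "M' i j = var (prod_encode (0, prod_encode (i, j)))"
    and "N' i j = var (prod_encode (1, prod_encode (i, j)))" for i j
  have M': "h (M' i j) = M i j" and N': "h (N' i j) = N i j" if "i < n" "j < n" for i j
    using that by (auto simp: M'_def N'_def var v_def)
  note ev = ring_det_evaluation[OF h]
  have "ring_det R n M \<otimes> ring_det R n N =
      ring_det R n (%i j. h (M' i j)) \<otimes> ring_det R n (%i j. h (N' i j))"
    by (intro arg_cong2[of _ _ _ _ "(\<otimes>)"] ring_det_cong) (auto simp: M' N' M N)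
  also have "\<dots> = h (det (mat n n (%(i, j). M' i j) * mat n n (%(i, j). N' i j)))"
    by (subst det_mult[of _ n]) (auto simp: ev h)
  also have "mat n n (%(i, j). M' i j) * mat n n (%(i, j). N' i j) =
      mat n n (%(i, j). \<Sum>l<n. M' i l * N' l j)"
    by (rule eq_matI) (auto simp: scalar_prod_def atLeast0LessThan)
  also have "h (det \<dots>) = ring_det R n (%i j. h (\<Sum>l<n. M' i l * N' l j))"
    by (simp add: ev)
  also have "\<dots> = ring_det R n (%i j. \<Oplus>l\<in>{..<n}. M i l \<otimes> N l j)"
    by (intro ring_det_cong) (auto simp: hsum h M' N' M N intro!: finsum_closed add.finprod_cong')
  finally show ?thesis by simp
qed

section \<open>Determinants of block diagonal matrices and Kronecker products\<close>

lemma det_block_diagonal: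
  fixes B :: "'a :: idom mat"
  assumes B: "B \<in> carrier_mat m m"
  shows "det (mat (n * m) (n * m)
    (%(i, j). if i div m = j div m then B $$ (i mod m, j mod m) else 0)) = det B ^ n"
proof (induction n)
  case 0
  show ?case by (simp add: det_dim_zero)
next
  case (Suc n)
  let ?f = "%(i, j). if i div m = j div m then B $$ (i mod m, j mod m) else 0"

  have "mat (Suc n * m) (Suc n * m) ?f =
      four_block_mat (mat (n * m) (n * m) ?f) (0\<^sub>m (n * m) m) (0\<^sub>m m (n * m)) B" (is "?L = ?R")
  proof (rule eq_matI)
    show "dim_row ?L = dim_row ?R" "dim_col ?L = dim_col ?R" using B by auto
    fix i j assume "i < dim_row ?R" "j < dim_col ?R"
    then have ij: "i < m + n * m" "j < m + n * m" using B by auto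
    have *: "l div m < n" if "l < n * m" for l
      using that by (simp add: less_mult_imp_div_less)
    have **: "l div m = n" "l mod m = l - n * m" if "\<not> l < n * m" "l < m + n * m" for l
    proof -
      have "l = (l - n * m) + n * m" "l - n * m < m" using that by auto
      moreover have "x div m = n" "x mod m = y" if "x = y + n * m" "y < m" for x y
        using that by auto
      ultimately show "l div m = n" "l mod m = l - n * m" by blast+
    qed
    show "?L $$ (i, j) = ?R $$ (i, j)"
      using ij B *[of i] *[of j] **[of i] **[of j]
      by (cases "i < n * m"; cases "j < n * m") auto
  qed
  then show ?case
    using B by (simp add: det_four_block_mat_lower_left_zero[of _ "n * m" _ m] Suc)
qed

text \<open>A row of one Kronecker factor and a column of the other can both be nonzero at one index
  only, which reduces the sum in their matrix product to a single term.\<close>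

lemma sum_delta_div_mod:
  fixes f :: "nat \<Rightarrow> 'a :: comm_monoid_add"
  assumes "a < n" "b < m"
  shows "(\<Sum>l<n * m. if l div m = a & l mod m = b then f l else 0) = f (a * m + b)"
proof -
  have "l div m = a & l mod m = b \<longleftrightarrow> l = a * m + b" for l
    using assms by (metis add.commute div_mult_mod_eq mod_less mod_mult_self1 div_mult_self1
        div_less add_0 gr_implies_not0)
  moreover have "a * m + b < n * m"
  proof -
    have "a * m + b < Suc a * m" using assms by simp
    also have "\<dots> \<le> n * m" using assms by (intro mult_le_mono1) simp
    finally show ?thesis .
  qed
  ultimately show ?thesis by (simp add: sum.delta)
qed

text \<open>A \<otimes> B factors as (A \<otimes> I)(I \<otimes> B). The second factor is block
  diagonal; the first becomes so when rows and columns are permuted simultaneously, and the sign of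
  the permutation then enters squared.\<close>

lemma det_kronecker:
  fixes A B :: "'a :: idom mat"
  assumes A: "A \<in> carrier_mat n n" and B: "B \<in> carrier_mat m m"
  shows "det (mat (n * m) (n * m) (%(i, j). A $$ (i div m, j div m) * B $$ (i mod m, j mod m))) =
    det A ^ m * det B ^ n"
proof -
  let ?N = "n * m"
  \<comment> \<open>Passes from numbering pairs row by row to numbering them column by column,
    extended by the identity beyond \<open>?N\<close>.\<close>
  define p where "p l = (if l < ?N then l mod m * n + l div m else l)" for l
  define KA where "KA = mat ?N ?N (%(i, j). if i mod m = j mod m then A $$ (i div m, j div m) else 0)"
  define KB where "KB = mat ?N ?N (%(i, j). if i div m = j div m then B $$ (i mod m, j mod m) else 0)"
  define D where "D = mat (m * n) (m * n) (%(i, j). if i div n = j div n then A $$ (i mod n, j mod n) else 0)"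
  have D: "D \<in> carrier_mat ?N ?N" by (simp add: D_def mult.commute)
  have dm: "l div m < n" "l mod m < m" if "l < ?N" for l
    using that by (auto simp: less_mult_imp_div_less) (metis mod_less_divisor mult_0_right not_less0 neq0_conv)
  have p: "p l < ?N" "p l div n = l mod m" "p l mod n = l div m" if "l < ?N" for l
  proof -
    have "l mod m * n + l div m < Suc (l mod m) * n" using dm[OF that] by simp
    also have "\<dots> \<le> m * n" using dm[OF that] by (intro mult_le_mono1) simp
    finally show "p l < ?N" using that by (simp add: p_def mult.commute)
    show "p l div n = l mod m" "p l mod n = l div m" using dm[OF that] that by (auto simp: p_def)
  qed
  have perm: "p permutes {0..<?N}"
  proof (rule bij_imp_permutes)
    have "inj_on p {0..<?N}"
    proof (rule inj_onI)
      fix x y assume "x \<in> {0..<?N}" "y \<in> {0..<?N}" "p x = p y"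
      then have "x mod m = y mod m" "x div m = y div m" using p by (metis atLeastLessThan_iff)+
      then show "x = y" by (metis div_mult_mod_eq)
    qed
    moreover have "p ` {0..<?N} \<subseteq> {0..<?N}" using p by auto
    ultimately show "bij_betw p {0..<?N} {0..<?N}"
      by (simp add: bij_betw_def endo_inj_surj)
  qed (auto simp: p_def)
  have KA: "KA = mat ?N ?N (%(i, j). D $$ (p i, p j))"
    by (rule eq_matI) (auto simp: KA_def D_def p mult.commute[of m n])
  have "det KA = det (mat ?N ?N (%(i, j). mat ?N ?N (%(i, j). D $$ (i, p j)) $$ (p i, j)))"
    unfolding KA by (rule arg_cong[of _ _ det], rule eq_matI) (auto simp: p)
  also have "\<dots> = signof p * det (mat ?N ?N (%(i, j). D $$ (i, p j)))"
    by (rule det_permute_rows[OF _ perm]) simp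
  \<comment> \<open>Transposing turns the remaining permutation of columns into one of rows.\<close>
  also have "det (mat ?N ?N (%(i, j). D $$ (i, p j))) = det (transpose_mat (mat ?N ?N (%(i, j). D $$ (i, p j))))"
    by (rule det_transpose[of _ ?N, symmetric]) simp
  also have "transpose_mat (mat ?N ?N (%(i, j). D $$ (i, p j))) = mat ?N ?N (%(i, j). transpose_mat D $$ (p i, j))"
    using D by (intro eq_matI) (auto simp: p)
  also have "det \<dots> = signof p * det D"
    using D by (subst det_permute_rows[OF _ perm]) (auto simp: det_transpose)
  also have "signof p * (signof p * det D) = det D"
    by (simp add: sign_def)
  also have "det D = det A ^ m"
    unfolding D_def by (rule det_block_diagonal[OF A])
  finally have "det KA = det A ^ m" .
  moreover have "det KB = det B ^ n"
    unfolding KB_def by (rule det_block_diagonal[OF B])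
  moreover have "mat ?N ?N (%(i, j). A $$ (i div m, j div m) * B $$ (i mod m, j mod m)) = KA * KB"
  proof (rule eq_matI)
    fix i j assume "i < dim_row (KA * KB)" "j < dim_col (KA * KB)"
    then have ij: "i < ?N" "j < ?N" by (auto simp: KA_def KB_def)
    have "(KA * KB) $$ (i, j) = (\<Sum>l<?N. KA $$ (i, l) * KB $$ (l, j))"
      using ij by (auto simp: KA_def KB_def scalar_prod_def atLeast0LessThan)
    also have "\<dots> = (\<Sum>l<?N. if l div m = j div m & l mod m = i mod m
        then A $$ (i div m, j div m) * B $$ (i mod m, j mod m) else 0)"
      using ij by (intro sum.cong) (auto simp: KA_def KB_def)
    also have "\<dots> = A $$ (i div m, j div m) * B $$ (i mod m, j mod m)"
      using dm[OF ij(1)] dm[OF ij(2)] by (simp add: sum_delta_div_mod)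
    finally show "mat ?N ?N (%(i, j). A $$ (i div m, j div m) * B $$ (i mod m, j mod m)) $$ (i, j) =
        (KA * KB) $$ (i, j)"
      using ij by simp
  qed (auto simp: KA_def KB_def)
  moreover have "det (KA * KB) = det KA * det KB"
    by (rule det_mult[of _ ?N]) (auto simp: KA_def KB_def)
  ultimately show ?thesis by simp
qed

text \<open>Transported from generic matrices, like the product rule: \<open>det_kronecker\<close>
  is stated for integral domains, which integer polynomials form and \<open>R\<close> need
  not.\<close>

lemma (in cring) ring_det_kronecker:
  assumes M: "!!i j. i < n ==> j < n ==> M i j \<in> carrier R"
    and N: "!!i j. i < m ==> j < m ==> N i j \<in> carrier R"
  shows "ring_det R (n * m) (%i j. M (i div m) (j div m) \<otimes> N (i mod m) (j mod m)) =
    ring_det R n M [^] m \<otimes> ring_det R m N [^] n"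
proof -
  define v where "v a = (case prod_decode a of (b, c) \<Rightarrow> case prod_decode c of (i, j) \<Rightarrow>
      if b = 0 then if i < n & j < n then M i j else \<zero>
      else if i < m & j < m then N i j else \<zero>)" for a
  have v: "v a \<in> carrier R" for a
    using M N by (auto simp: v_def split: prod.split)
  obtain h and var :: "nat \<Rightarrow> (nat \<Rightarrow>\<^sub>0 nat) \<Rightarrow>\<^sub>0 int"
    where h: "!!p. h p \<in> carrier R" "h 1 = \<one>" "!!p q. h (p + q) = h p \<oplus> h q"
      "!!p q. h (p * q) = h p \<otimes> h q" and var: "!!n. h (var n) = v n"
    by (rule poly_evaluation[of v]) (use v in auto)
  define M' N' where "M' i j = var (prod_encode (0, prod_encode (i, j)))"
    and "N' i j = var (prod_encode (1, prod_encode (i, j)))" for i j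
  have M': "h (M' i j) = M i j" if "i < n" "j < n" for i j
    using that by (auto simp: M'_def var v_def)
  have N': "h (N' i j) = N i j" if "i < m" "j < m" for i j
    using that by (auto simp: N'_def var v_def)
  have pow: "h (p ^ k) = h p [^] k" for p and k :: nat
    by (induction k) (auto simp: h m_comm)
  have dm: "l div m < n" "l mod m < m" if "l < n * m" for l
    using that by (auto simp: less_mult_imp_div_less) (metis mod_less_divisor mult_0_right not_less0 neq0_conv)
  note ev = ring_det_evaluation[OF h]
  let ?M = "mat n n (%(i, j). M' i j)" and ?N = "mat m m (%(i, j). N' i j)"
  have "ring_det R (n * m) (%i j. M (i div m) (j div m) \<otimes> N (i mod m) (j mod m)) =
      ring_det R (n * m) (%i j. h (M' (i div m) (j div m) * N' (i mod m) (j mod m)))"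
    using dm by (intro ring_det_cong) (auto simp: h M' N' M N)
  also have "\<dots> = h (det (mat (n * m) (n * m) (%(i, j). ?M $$ (i div m, j div m) * ?N $$ (i mod m, j mod m))))"
    unfolding ev using dm by (intro arg_cong[of _ _ h] arg_cong[of _ _ det] eq_matI) auto
  also have "\<dots> = h (det ?M) [^] m \<otimes> h (det ?N) [^] n"
    by (simp add: det_kronecker h pow)
  also have "h (det ?M) = ring_det R n M"
    unfolding ev[symmetric] by (intro ring_det_cong) (auto simp: M' M)
  also have "h (det ?N) = ring_det R m N"
    unfolding ev[symmetric] by (intro ring_det_cong) (auto simp: N' N)
  finally show ?thesis .
qed

section \<open>Tensor products\<close>

lemma frag_extend_add_fun:
  "frag_extend (%p. f p + g p) x = frag_extend f x + frag_extend g x"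
  by (simp add: frag_extend_def frag_cmul_distrib2 sum.distrib)

lemma frag_extend_diff_fun:
  "frag_extend (%p. f p - g p) x = frag_extend f x - frag_extend g x"
  using frag_extend_add_fun[of "%p. f p - g p" g x] by simp

text \<open>The tensor kernel is generated in the free abelian group, while the quotient is formed
  in the monoid ring. These are different records with the same operations, so the generated
  subgroups have to be compared; inverses need to agree on generators only, because the generation
  rules invert nothing else.\<close>

lemma generate_mono_monoid:
  assumes "\<one>\<^bsub>G\<^esub> = \<one>\<^bsub>G'\<^esub>" "!!x y. x \<otimes>\<^bsub>G\<^esub> y = x \<otimes>\<^bsub>G'\<^esub> y" "!!h. h \<in> H ==> inv\<^bsub>G\<^esub> h = inv\<^bsub>G'\<^esub> h"
  shows "generate G H \<subseteq> generate G' H"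
proof
  fix x assume "x \<in> generate G H"
  then show "x \<in> generate G' H"
  proof induction
    case one
    show ?case unfolding assms(1) by (rule generate.one)
  next
    case (incl h)
    then show ?case by (rule generate.incl)
  next
    case (inv h)
    then show ?case unfolding assms(3)[OF inv] by (rule generate.inv)
  next
    case (eng h1 h2)
    show ?case unfolding assms(2) by (rule generate.eng) (use eng in auto)
  qed
qed

section \<open>The integral monoid ring\<close>

context
  fixes G :: "('a, 'n) monoid_scheme" (structure)
  assumes G: "monoid G"
begin

interpretation monoid G by (rule G)

lemma carrier_int_monoid_ring: "x \<in> carrier (int_monoid_ring G) \<longleftrightarrow> Poly_Mapping.keys x \<subseteq> carrier G"
  by (simp add: int_monoid_ring_def)

lemma int_monoid_ring_simps:
  "x \<otimes>\<^bsub>int_monoid_ring G\<^esub> y = frag_extend (%p. frag_extend (%q. frag_of (p \<otimes> q)) y) x"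
  "\<one>\<^bsub>int_monoid_ring G\<^esub> = frag_of \<one>"
  "\<zero>\<^bsub>int_monoid_ring G\<^esub> = 0"
  "x \<oplus>\<^bsub>int_monoid_ring G\<^esub> y = x + y"
  by (simp_all add: int_monoid_ring_def)

lemma int_monoid_ring_mult_closed:
  assumes "Poly_Mapping.keys x \<subseteq> carrier G" "Poly_Mapping.keys y \<subseteq> carrier G"
  shows "Poly_Mapping.keys (frag_extend (%p. frag_extend (%q. frag_of (p \<otimes> q)) y) x) \<subseteq> carrier G"
proof -
  have "Poly_Mapping.keys (frag_extend (%q. frag_of (p \<otimes> q)) y) \<subseteq> carrier G" if "p \<in> carrier G" for p
    using keys_frag_extend[of "%q. frag_of (p \<otimes> q)" y] assms(2) that by (fastforce simp: keys_frag_of)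
  then have "(\<Union>p\<in>Poly_Mapping.keys x. Poly_Mapping.keys (frag_extend (%q. frag_of (p \<otimes> q)) y)) \<subseteq> carrier G"
    using assms(1) by (intro UN_least) auto
  then show ?thesis by (rule order_trans[OF keys_frag_extend])
qed

text \<open>Multiplication is additive in each argument, so induction on integer combinations
  reduces associativity and the unit laws to basis elements, where they are those of
  \<open>G\<close>.\<close>

lemma ring_int_monoid_ring: "ring (int_monoid_ring G)"
proof -
  let ?I = "int_monoid_ring G"
  have assoc: "(x \<otimes>\<^bsub>?I\<^esub> y) \<otimes>\<^bsub>?I\<^esub> z = x \<otimes>\<^bsub>?I\<^esub> (y \<otimes>\<^bsub>?I\<^esub> z)"
    if x: "Poly_Mapping.keys x \<subseteq> carrier G" and y: "Poly_Mapping.keys y \<subseteq> carrier G"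
      and z: "Poly_Mapping.keys z \<subseteq> carrier G" for x y z
    using x
  proof (induction x rule: frag_induction)
    case (one p)
    note p = one
    show ?case using y
    proof (induction y rule: frag_induction)
      case (one q)
      note q = one
      show ?case using z
        by (induction z rule: frag_induction)
          (use p q in \<open>auto simp: int_monoid_ring_simps m_assoc frag_extend_diff frag_extend_diff_fun\<close>)
    qed (auto simp: int_monoid_ring_simps frag_extend_diff frag_extend_diff_fun)
  qed (auto simp: int_monoid_ring_simps frag_extend_diff)
  have one: "\<one>\<^bsub>?I\<^esub> \<otimes>\<^bsub>?I\<^esub> x = x" "x \<otimes>\<^bsub>?I\<^esub> \<one>\<^bsub>?I\<^esub> = x"
    if x: "Poly_Mapping.keys x \<subseteq> carrier G" for x
    using x by (induction x rule: frag_induction)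
      (auto simp: int_monoid_ring_simps frag_extend_diff frag_extend_diff_fun)
  have ab: "abelian_group ?I"
  proof (rule abelian_groupI)
    fix x y assume "x \<in> carrier ?I" "y \<in> carrier ?I"
    then show "x \<oplus>\<^bsub>?I\<^esub> y \<in> carrier ?I"
      using keys_add[of x y] by (force simp: carrier_int_monoid_ring int_monoid_ring_simps)
  next
    fix x assume "x \<in> carrier ?I"
    then show "\<exists>y\<in>carrier ?I. y \<oplus>\<^bsub>?I\<^esub> x = \<zero>\<^bsub>?I\<^esub>"
      by (intro bexI[of _ "- x"]) (auto simp: carrier_int_monoid_ring int_monoid_ring_simps keys_minus)
  qed (auto simp: carrier_int_monoid_ring int_monoid_ring_simps)
  show ?thesis
  proof (rule ringI[OF ab])
    show "monoid ?I"
      by (rule monoidI) (use one assoc int_monoid_ring_mult_closed in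
          \<open>auto simp: carrier_int_monoid_ring int_monoid_ring_simps\<close>)
  qed (auto simp: int_monoid_ring_simps frag_extend_add frag_extend_add_fun)
qed

end

lemma int_monoid_ring_minus:
  assumes G: "monoid G" and x: "x \<in> carrier (int_monoid_ring G)"
  shows "\<ominus>\<^bsub>int_monoid_ring G\<^esub> x = - x"
proof -
  interpret ring "int_monoid_ring G" by (rule ring_int_monoid_ring[OF G])
  have "- x \<in> carrier (int_monoid_ring G)"
    using x by (simp add: int_monoid_ring_def keys_minus)
  moreover have "- x \<oplus>\<^bsub>int_monoid_ring G\<^esub> x = \<zero>\<^bsub>int_monoid_ring G\<^esub>"
    by (simp add: int_monoid_ring_def)
  ultimately show ?thesis using x minus_equality by blast
qed

text \<open>Only a commutative base ring is assumed, because the same development serves A \<otimes>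
  A' over the field and the extension of scalars B \<otimes> F over a central subring.\<close>

locale tensor_pair =
  fixes k :: "('k, 'l) ring_scheme"
    and A :: "('k, 'a, 'm) module_scheme" and B :: "('k, 'b, 'n) module_scheme"
  assumes assocA: "assoc_algebra k A" and assocB: "assoc_algebra k B"
begin

sublocale k: cring k
  using assocA by (simp add: assoc_algebra_def module_def)
sublocale A: ring A using assocA by (simp add: assoc_algebra_def)
sublocale B: ring B using assocB by (simp add: assoc_algebra_def)
sublocale MA: module k A using assocA by (simp add: assoc_algebra_def)
sublocale MB: module k B using assocB by (simp add: assoc_algebra_def)

abbreviation "IR \<equiv> int_monoid_ring (A \<times>\<times> B)"
abbreviation "T \<equiv> tensor_algebra k A B"
abbreviation tens (infixl \<open>\<diamondop>\<close> 70) where "x \<diamondop> y \<equiv> pure_tensor k A B x y"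

lemma monoid_prod: "monoid (A \<times>\<times> B)"
  by (rule DirProd_monoid) (rule A.monoid_axioms B.monoid_axioms)+

sublocale IR: ring IR
  by (rule ring_int_monoid_ring[OF monoid_prod])

lemma smult_mult:
  assumes "c \<in> carrier k"
  shows "x \<in> carrier A ==> x' \<in> carrier A ==> (c \<odot>\<^bsub>A\<^esub> x) \<otimes>\<^bsub>A\<^esub> x' = c \<odot>\<^bsub>A\<^esub> (x \<otimes>\<^bsub>A\<^esub> x')"
    "x \<in> carrier A ==> x' \<in> carrier A ==> x \<otimes>\<^bsub>A\<^esub> (c \<odot>\<^bsub>A\<^esub> x') = c \<odot>\<^bsub>A\<^esub> (x \<otimes>\<^bsub>A\<^esub> x')"
    "y \<in> carrier B ==> y' \<in> carrier B ==> (c \<odot>\<^bsub>B\<^esub> y) \<otimes>\<^bsub>B\<^esub> y' = c \<odot>\<^bsub>B\<^esub> (y \<otimes>\<^bsub>B\<^esub> y')"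
    "y \<in> carrier B ==> y' \<in> carrier B ==> y \<otimes>\<^bsub>B\<^esub> (c \<odot>\<^bsub>B\<^esub> y') = c \<odot>\<^bsub>B\<^esub> (y \<otimes>\<^bsub>B\<^esub> y')"
  using assms assocA assocB by (auto simp: assoc_algebra_def)

lemma tensor_relations_cases:
  assumes "h \<in> tensor_relations k A B"
  obtains (add_left) x x' y where "x \<in> carrier A" "x' \<in> carrier A" "y \<in> carrier B"
      "h = frag_of (x \<oplus>\<^bsub>A\<^esub> x', y) - frag_of (x, y) - frag_of (x', y)"
    | (add_right) x y y' where "x \<in> carrier A" "y \<in> carrier B" "y' \<in> carrier B"
      "h = frag_of (x, y \<oplus>\<^bsub>B\<^esub> y') - frag_of (x, y) - frag_of (x, y')"
    | (balanced) r x y where "r \<in> carrier k" "x \<in> carrier A" "y \<in> carrier B"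
      "h = frag_of (r \<odot>\<^bsub>A\<^esub> x, y) - frag_of (x, r \<odot>\<^bsub>B\<^esub> y)"
  using assms unfolding tensor_relations_def
  by (elim UnE CollectE exE conjE) (rule that; assumption)+

lemma tensor_relationsI:
  "x \<in> carrier A ==> x' \<in> carrier A ==> y \<in> carrier B ==>
    frag_of (x \<oplus>\<^bsub>A\<^esub> x', y) - frag_of (x, y) - frag_of (x', y) \<in> tensor_relations k A B"
  "x \<in> carrier A ==> y \<in> carrier B ==> y' \<in> carrier B ==>
    frag_of (x, y \<oplus>\<^bsub>B\<^esub> y') - frag_of (x, y) - frag_of (x, y') \<in> tensor_relations k A B"
  "r \<in> carrier k ==> x \<in> carrier A ==> y \<in> carrier B ==>
    frag_of (r \<odot>\<^bsub>A\<^esub> x, y) - frag_of (x, r \<odot>\<^bsub>B\<^esub> y) \<in> tensor_relations k A B"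
  unfolding tensor_relations_def 
  subgoal by (rule UnI1, rule UnI1) blast
  subgoal by (rule UnI1, rule UnI2) blast
  subgoal by (rule UnI2) blast
  done

lemma tensor_relations_in_carrier: "tensor_relations k A B \<subseteq> carrier IR"
proof
  have 2: "Poly_Mapping.keys (frag_of a - frag_of b) \<subseteq> S" if "a \<in> S" "b \<in> S" for a b :: "'a \<times> 'b" and S
    using keys_diff[of "frag_of a" "frag_of b"] that by (auto simp: keys_frag_of)
  have 3: "Poly_Mapping.keys (frag_of a - frag_of b - frag_of c) \<subseteq> S"
    if "a \<in> S" "b \<in> S" "c \<in> S" for a b c :: "'a \<times> 'b" and S
    using keys_diff[of "frag_of a - frag_of b" "frag_of c"] keys_diff[of "frag_of a" "frag_of b"] that
    by (auto simp: keys_frag_of)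
  fix h assume "h \<in> tensor_relations k A B"
  then show "h \<in> carrier IR"
    unfolding carrier_int_monoid_ring[OF monoid_prod]
    by (cases rule: tensor_relations_cases) (simp_all add: 2 3 del: Poly_Mapping.keys_minus)
qed

lemma tensor_kernel: "tensor_kernel k A B = generate (add_monoid IR) (tensor_relations k A B)"
proof -
  have "inv\<^bsub>add_monoid IR\<^esub> h = inv\<^bsub>free_Abelian_group (carrier A \<times> carrier B)\<^esub> h"
    if "h \<in> tensor_relations k A B" for h
    using that tensor_relations_in_carrier int_monoid_ring_minus[OF monoid_prod, of h]
    by (auto simp: a_inv_def carrier_int_monoid_ring[OF monoid_prod])
  then show ?thesis
    unfolding tensor_kernel_def
    by (intro equalityI generate_mono_monoid) (auto simp: int_monoid_ring_def)
qed

text \<open>A relation multiplied by a basis element is again one of the relations; additivity in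
  the other factor gives the general case.\<close>

lemma tensor_relations_mult:
  assumes h: "h \<in> tensor_relations k A B" and x: "x \<in> carrier IR"
  shows "h \<otimes>\<^bsub>IR\<^esub> x \<in> tensor_kernel k A B" "x \<otimes>\<^bsub>IR\<^esub> h \<in> tensor_kernel k A B"
proof -
  have sub: "subgroup (tensor_kernel k A B) (add_monoid IR)"
    unfolding tensor_kernel
    by (rule group.generate_is_subgroup) (use IR.a_group tensor_relations_in_carrier in auto)
  have diff: "a - b \<in> tensor_kernel k A B" if "a \<in> tensor_kernel k A B" "b \<in> tensor_kernel k A B" for a b
  proof -
    have c: "a \<in> carrier IR" "b \<in> carrier IR" using that subgroup.subset[OF sub] by auto
    have "a \<ominus>\<^bsub>IR\<^esub> b \<in> tensor_kernel k A B"
      using that subgroup.m_closed[OF sub] subgroup.m_inv_closed[OF sub]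
      by (simp add: a_minus_def a_inv_def)
    then show ?thesis
      using int_monoid_ring_minus[OF monoid_prod c(2)]
      by (simp add: a_minus_def int_monoid_ring_simps[OF monoid_prod])
  qed
  have zero: "0 \<in> tensor_kernel k A B"
    using subgroup.one_closed[OF sub] by (simp add: int_monoid_ring_simps[OF monoid_prod])
  have incl: "r \<in> tensor_kernel k A B" if "r \<in> tensor_relations k A B" for r
    using that unfolding tensor_kernel by (rule generate.incl)
  have x': "Poly_Mapping.keys x \<subseteq> carrier (A \<times>\<times> B)"
    using x by (simp add: carrier_int_monoid_ring[OF monoid_prod])
  note simps = int_monoid_ring_simps[OF monoid_prod] frag_extend_diff frag_extend_diff_fun frag_extend_eq_0
  show "h \<otimes>\<^bsub>IR\<^esub> x \<in> tensor_kernel k A B" using x'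
  proof (induction x rule: frag_induction)
    case (one p)
    obtain u v where p: "p = (u, v)" "u \<in> carrier A" "v \<in> carrier B"
      using one by (cases p) auto
    have "h \<otimes>\<^bsub>IR\<^esub> frag_of p \<in> tensor_relations k A B"
      using h
    proof (cases rule: tensor_relations_cases)
      case (add_left x x' y)
      then show ?thesis
        using tensor_relationsI(1)[of "x \<otimes>\<^bsub>A\<^esub> u" "x' \<otimes>\<^bsub>A\<^esub> u" "y \<otimes>\<^bsub>B\<^esub> v"] p
        by (simp add: simps A.l_distr)
    next
      case (add_right x y y')
      then show ?thesis
        using tensor_relationsI(2)[of "x \<otimes>\<^bsub>A\<^esub> u" "y \<otimes>\<^bsub>B\<^esub> v" "y' \<otimes>\<^bsub>B\<^esub> v"] p
        by (simp add: simps B.l_distr)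
    next
      case (balanced r x y)
      then show ?thesis
        using tensor_relationsI(3)[of r "x \<otimes>\<^bsub>A\<^esub> u" "y \<otimes>\<^bsub>B\<^esub> v"] p
        by (simp add: simps smult_mult)
    qed
    then show ?case by (rule incl)
  qed (auto simp: simps intro: diff zero)
  show "x \<otimes>\<^bsub>IR\<^esub> h \<in> tensor_kernel k A B" using x'
  proof (induction x rule: frag_induction)
    case (one p)
    obtain u v where p: "p = (u, v)" "u \<in> carrier A" "v \<in> carrier B"
      using one by (cases p) auto
    have "frag_of p \<otimes>\<^bsub>IR\<^esub> h \<in> tensor_relations k A B"
      using h
    proof (cases rule: tensor_relations_cases)
      case (add_left x x' y)
      then show ?thesis
        using tensor_relationsI(1)[of "u \<otimes>\<^bsub>A\<^esub> x" "u \<otimes>\<^bsub>A\<^esub> x'" "v \<otimes>\<^bsub>B\<^esub> y"] p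
        by (simp add: simps A.r_distr)
    next
      case (add_right x y y')
      then show ?thesis
        using tensor_relationsI(2)[of "u \<otimes>\<^bsub>A\<^esub> x" "v \<otimes>\<^bsub>B\<^esub> y" "v \<otimes>\<^bsub>B\<^esub> y'"] p
        by (simp add: simps B.r_distr)
    next
      case (balanced r x y)
      then show ?thesis
        using tensor_relationsI(3)[of r "u \<otimes>\<^bsub>A\<^esub> x" "v \<otimes>\<^bsub>B\<^esub> y"] p
        by (simp add: simps smult_mult)
    qed
    then show ?case by (rule incl)
  qed (auto simp: simps intro: diff zero)
qed

lemma tensor_kernel_ideal: "ideal (tensor_kernel k A B) IR"
proof (rule idealI[OF IR.ring_axioms])
  have car: "tensor_relations k A B \<subseteq> carrier (add_monoid IR)" using tensor_relations_in_carrier by simp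
  show sub: "subgroup (tensor_kernel k A B) (add_monoid IR)"
    unfolding tensor_kernel by (rule group.generate_is_subgroup[OF IR.a_group car])
  interpret K: additive_subgroup "tensor_kernel k A B" IR
    by (rule additive_subgroup.intro[OF sub])
  fix a x assume a: "a \<in> tensor_kernel k A B" and x: "x \<in> carrier IR"
  note gen = tensor_kernel
  have inc: "h \<in> carrier IR" if "h \<in> tensor_relations k A B" for h
    using that tensor_relations_in_carrier by blast
  have incK: "h \<in> carrier IR" if "h \<in> generate (add_monoid IR) (tensor_relations k A B)" for h
    using that K.a_Hcarr unfolding tensor_kernel by blast
  from a have "a \<in> generate (add_monoid IR) (tensor_relations k A B)"
    by (simp add: tensor_kernel)
  then have "x \<otimes>\<^bsub>IR\<^esub> a \<in> tensor_kernel k A B & a \<otimes>\<^bsub>IR\<^esub> x \<in> tensor_kernel k A B"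
  proof induction
    case (inv h)
    then show ?case
      unfolding a_inv_def[symmetric]
      using tensor_relations_mult[OF inv x] inc[OF inv] x K.a_inv_closed
      by (simp add: IR.l_minus IR.r_minus)
  next
    case (eng h1 h2)
    then show ?case
      using incK[OF eng(1)] incK[OF eng(2)] x by (simp add: IR.l_distr IR.r_distr)
  qed (use x tensor_relations_mult in auto)
  then show "x \<otimes>\<^bsub>IR\<^esub> a \<in> tensor_kernel k A B" "a \<otimes>\<^bsub>IR\<^esub> x \<in> tensor_kernel k A B" by auto
qed

sublocale K: ideal "tensor_kernel k A B" IR
  by (rule tensor_kernel_ideal)

sublocale T: ring T
  unfolding tensor_algebra_def by (rule K.quotient_is_ring)

lemma frag_in_carrier [simp]:
  "x \<in> carrier A ==> y \<in> carrier B ==> frag_of (x, y) \<in> carrier IR"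
  by (simp add: carrier_int_monoid_ring[OF monoid_prod] keys_frag_of)

lemma quotient_hom: "(+>\<^bsub>IR\<^esub>) (tensor_kernel k A B) \<in> Ring.ring_hom IR T"
  unfolding tensor_algebra_def by (rule K.rcos_ring_hom)

lemma tens_closed [simp]: "x \<in> carrier A ==> y \<in> carrier B ==> x \<diamondop> y \<in> carrier T"
  unfolding pure_tensor_def by (rule ring_hom_memE(1)[OF quotient_hom]) simp

lemma tens_mult:
  assumes "x \<in> carrier A" "y \<in> carrier B" "x' \<in> carrier A" "y' \<in> carrier B"
  shows "(x \<diamondop> y) \<otimes>\<^bsub>T\<^esub> (x' \<diamondop> y') = (x \<otimes>\<^bsub>A\<^esub> x') \<diamondop> (y \<otimes>\<^bsub>B\<^esub> y')"
  using assms ring_hom_memE(2)[OF quotient_hom, of "frag_of (x, y)" "frag_of (x', y')"]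
  unfolding pure_tensor_def by (simp add: int_monoid_ring_simps[OF monoid_prod])

lemma tens_one: "\<one>\<^bsub>A\<^esub> \<diamondop> \<one>\<^bsub>B\<^esub> = \<one>\<^bsub>T\<^esub>"
  using ring_hom_memE(4)[OF quotient_hom]
  unfolding pure_tensor_def by (simp add: int_monoid_ring_simps[OF monoid_prod])

lemma coset_eqI:
  assumes "a \<in> carrier IR" "b \<in> carrier IR" "a - b \<in> tensor_kernel k A B"
  shows "tensor_kernel k A B +>\<^bsub>IR\<^esub> a = tensor_kernel k A B +>\<^bsub>IR\<^esub> b"
proof -
  have "a \<ominus>\<^bsub>IR\<^esub> b \<in> tensor_kernel k A B"
    using assms int_monoid_ring_minus[OF monoid_prod, of b]
    by (simp add: a_minus_def int_monoid_ring_simps[OF monoid_prod])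
  then show ?thesis using assms IR.quotient_eq_iff_same_a_r_cos[OF tensor_kernel_ideal] by blast
qed

lemma rel_in_kernel: "r \<in> tensor_relations k A B ==> r \<in> tensor_kernel k A B"
  unfolding tensor_kernel by (rule generate.incl)

lemma tens_l_distr:
  assumes "x \<in> carrier A" "x' \<in> carrier A" "y \<in> carrier B"
  shows "(x \<oplus>\<^bsub>A\<^esub> x') \<diamondop> y = x \<diamondop> y \<oplus>\<^bsub>T\<^esub> x' \<diamondop> y"
proof -
  have "x \<diamondop> y \<oplus>\<^bsub>T\<^esub> x' \<diamondop> y = tensor_kernel k A B +>\<^bsub>IR\<^esub> (frag_of (x, y) \<oplus>\<^bsub>IR\<^esub> frag_of (x', y))"
    using assms unfolding pure_tensor_def by (subst ring_hom_memE(3)[OF quotient_hom]) auto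
  also have "\<dots> = (x \<oplus>\<^bsub>A\<^esub> x') \<diamondop> y"
    unfolding pure_tensor_def using rel_in_kernel[OF tensor_relationsI(1)[OF assms]] assms
    by (intro coset_eqI[symmetric]) (auto simp: int_monoid_ring_simps[OF monoid_prod] diff_diff_add
      simp flip: int_monoid_ring_simps(4)[OF monoid_prod])
  finally show ?thesis by simp
qed

lemma tens_r_distr:
  assumes "x \<in> carrier A" "y \<in> carrier B" "y' \<in> carrier B"
  shows "x \<diamondop> (y \<oplus>\<^bsub>B\<^esub> y') = x \<diamondop> y \<oplus>\<^bsub>T\<^esub> x \<diamondop> y'"
proof -
  have "x \<diamondop> y \<oplus>\<^bsub>T\<^esub> x \<diamondop> y' = tensor_kernel k A B +>\<^bsub>IR\<^esub> (frag_of (x, y) \<oplus>\<^bsub>IR\<^esub> frag_of (x, y'))"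
    using assms unfolding pure_tensor_def by (subst ring_hom_memE(3)[OF quotient_hom]) auto
  also have "\<dots> = x \<diamondop> (y \<oplus>\<^bsub>B\<^esub> y')"
    unfolding pure_tensor_def using rel_in_kernel[OF tensor_relationsI(2)[OF assms]] assms
    by (intro coset_eqI[symmetric]) (auto simp: int_monoid_ring_simps[OF monoid_prod] diff_diff_add
      simp flip: int_monoid_ring_simps(4)[OF monoid_prod])
  finally show ?thesis by simp
qed

lemma tens_balanced:
  assumes "c \<in> carrier k" "x \<in> carrier A" "y \<in> carrier B"
  shows "(c \<odot>\<^bsub>A\<^esub> x) \<diamondop> y = x \<diamondop> (c \<odot>\<^bsub>B\<^esub> y)"
  unfolding pure_tensor_def using rel_in_kernel[OF tensor_relationsI(3)[OF assms]] assms
  by (intro coset_eqI) auto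

lemma tens_zero [simp]:
  "y \<in> carrier B ==> \<zero>\<^bsub>A\<^esub> \<diamondop> y = \<zero>\<^bsub>T\<^esub>" "x \<in> carrier A ==> x \<diamondop> \<zero>\<^bsub>B\<^esub> = \<zero>\<^bsub>T\<^esub>"
  using tens_l_distr[of "\<zero>\<^bsub>A\<^esub>" "\<zero>\<^bsub>A\<^esub>" y] tens_r_distr[of x "\<zero>\<^bsub>B\<^esub>" "\<zero>\<^bsub>B\<^esub>"]
  by (auto simp: T.add.r_cancel_one')

lemma tens_minus:
  assumes "x \<in> carrier A" "y \<in> carrier B"
  shows "(\<ominus>\<^bsub>A\<^esub> x) \<diamondop> y = \<ominus>\<^bsub>T\<^esub> (x \<diamondop> y)" "x \<diamondop> (\<ominus>\<^bsub>B\<^esub> y) = \<ominus>\<^bsub>T\<^esub> (x \<diamondop> y)"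
  using tens_l_distr[of "\<ominus>\<^bsub>A\<^esub> x" x y] tens_r_distr[of x "\<ominus>\<^bsub>B\<^esub> y" y] assms
  by (simp_all add: A.l_neg B.l_neg T.minus_equality[symmetric])

text \<open>No case for negatives arises, because the negative of a pure tensor is a pure
  tensor.\<close>

lemma tensor_induct [consumes 1, case_names zero tens add]:
  assumes t: "t \<in> carrier T"
    and zero: "P \<zero>\<^bsub>T\<^esub>" and tens: "!!x y. x \<in> carrier A ==> y \<in> carrier B ==> P (x \<diamondop> y)"
    and add: "!!s t. s \<in> carrier T ==> t \<in> carrier T ==> P s ==> P t ==> P (s \<oplus>\<^bsub>T\<^esub> t)"
  shows "P t"
proof -
  note hom = ring_hom_memE[OF quotient_hom]
  let ?q = "(+>\<^bsub>IR\<^esub>) (tensor_kernel k A B)"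
  interpret q: ring_hom_ring IR T ?q
    by (rule ring_hom_ringI2[OF IR.ring_axioms T.ring_axioms quotient_hom])
  obtain a where a: "a \<in> carrier IR" "t = ?q a"
    using t unfolding tensor_algebra_def FactRing_def A_RCOSETS_def' by auto
  \<comment> \<open>The induction rule for integer combinations produces differences, so
    \<open>P\<close> is carried for a class and for its negative together.\<close>
  have "a \<in> carrier IR & P (?q a) & P (?q (\<ominus>\<^bsub>IR\<^esub> a))"
    using a(1)[unfolded carrier_int_monoid_ring[OF monoid_prod]]
  proof (induction a rule: frag_induction)
    case zero
    have "?q \<zero>\<^bsub>IR\<^esub> = \<zero>\<^bsub>T\<^esub>"
      using ring_hom_zero[OF quotient_hom IR.ring_axioms T.ring_axioms] .
    then have "?q \<zero>\<^bsub>IR\<^esub> = \<zero>\<^bsub>T\<^esub> & \<zero>\<^bsub>IR\<^esub> = 0"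
      by (simp add: int_monoid_ring_simps[OF monoid_prod])
    then show ?case using \<open>P \<zero>\<^bsub>T\<^esub>\<close> IR.minus_zero IR.zero_closed by metis
  next
    case (one p)
    then obtain x y where p: "p = (x, y)" "x \<in> carrier A" "y \<in> carrier B" by (cases p) auto
    have "?q (\<ominus>\<^bsub>IR\<^esub> frag_of p) = \<ominus>\<^bsub>T\<^esub> (x \<diamondop> y)"
      unfolding pure_tensor_def p(1)
      using p by (intro q.hom_a_inv) simp
    also have "\<dots> = (\<ominus>\<^bsub>A\<^esub> x) \<diamondop> y" using p by (simp add: tens_minus)
    finally show ?case
      using p tens[of x y] tens[of "\<ominus>\<^bsub>A\<^esub> x" y] by (simp add: pure_tensor_def)
  next
    case (diff a b)
    have ab: "a - b = a \<oplus>\<^bsub>IR\<^esub> (\<ominus>\<^bsub>IR\<^esub> b)"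
      using diff int_monoid_ring_minus[OF monoid_prod, of b]
      by (simp add: int_monoid_ring_simps[OF monoid_prod])
    have ba: "\<ominus>\<^bsub>IR\<^esub> (a \<oplus>\<^bsub>IR\<^esub> (\<ominus>\<^bsub>IR\<^esub> b)) = (\<ominus>\<^bsub>IR\<^esub> a) \<oplus>\<^bsub>IR\<^esub> b"
      using diff by (simp add: IR.minus_add)
    show ?case unfolding ab ba using diff
      by (auto simp: hom(3) hom(1) simp del: int_monoid_ring_minus intro!: add)
  qed
  then show ?thesis using a by simp
qed

text \<open>The source of all maps out of \<open>T\<close>: slices by linear forms, endomorphisms f
  \<otimes> f', and the comparison of B \<otimes> F with a localization. The target is only an
  abelian group, so only additivity is asserted.\<close>

lemma tensor_universal:
  fixes H :: "('c, 'd) ring_scheme"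
  assumes H: "abelian_group H"
    and closed: "!!x y. x \<in> carrier A ==> y \<in> carrier B ==> h x y \<in> carrier H"
    and l: "!!x x' y. x \<in> carrier A ==> x' \<in> carrier A ==> y \<in> carrier B ==>
      h (x \<oplus>\<^bsub>A\<^esub> x') y = h x y \<oplus>\<^bsub>H\<^esub> h x' y"
    and r: "!!x y y'. x \<in> carrier A ==> y \<in> carrier B ==> y' \<in> carrier B ==>
      h x (y \<oplus>\<^bsub>B\<^esub> y') = h x y \<oplus>\<^bsub>H\<^esub> h x y'"
    and bal: "!!c x y. c \<in> carrier k ==> x \<in> carrier A ==> y \<in> carrier B ==>
      h (c \<odot>\<^bsub>A\<^esub> x) y = h x (c \<odot>\<^bsub>B\<^esub> y)"
  obtains f where "!!t. t \<in> carrier T ==> f t \<in> carrier H"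
    "!!s t. s \<in> carrier T ==> t \<in> carrier T ==> f (s \<oplus>\<^bsub>T\<^esub> t) = f s \<oplus>\<^bsub>H\<^esub> f t"
    "!!x y. x \<in> carrier A ==> y \<in> carrier B ==> f (x \<diamondop> y) = h x y"
proof -
  interpret H: abelian_group H by (rule H)
  obtain g where g: "g \<in> hom (free_Abelian_group (carrier A \<times> carrier B)) (add_monoid H)"
    and g_of: "!!p. p \<in> carrier A \<times> carrier B ==> g (frag_of p) = case_prod h p"
    by (rule comm_group.free_Abelian_group_universal[OF H.a_comm_group, of "case_prod h" "carrier A \<times> carrier B"])
      (use closed in auto)
  have gc: "g x \<in> carrier H" if "x \<in> carrier IR" for x
    using that g by (auto simp: hom_def int_monoid_ring_def)
  have gadd: "g (x + y) = g x \<oplus>\<^bsub>H\<^esub> g y" if "x \<in> carrier IR" "y \<in> carrier IR" for x y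
    using that g by (auto simp: hom_def int_monoid_ring_def)
  have gz: "g 0 = \<zero>\<^bsub>H\<^esub>"
    using gadd[of 0 0] gc[of 0] IR.zero_closed
    by (simp add: int_monoid_ring_simps[OF monoid_prod] H.add.r_cancel_one')
  have gdiff: "g (x - y) = g x \<ominus>\<^bsub>H\<^esub> g y" if "x \<in> carrier IR" "y \<in> carrier IR" for x y
  proof -
    have xy: "x - y \<in> carrier IR"
      using IR.minus_closed[OF that] int_monoid_ring_minus[OF monoid_prod, of y] that
      by (simp add: a_minus_def int_monoid_ring_simps[OF monoid_prod])
    have "g x = g (x - y) \<oplus>\<^bsub>H\<^esub> g y" using gadd[OF xy that(2)] by simp
    then show ?thesis using gc that xy by (metis H.add.inv_solve_right H.minus_eq)
  qed
  have diffc: "x - y \<in> carrier IR" if "x \<in> carrier IR" "y \<in> carrier IR" for x y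
    using IR.minus_closed[OF that] int_monoid_ring_minus[OF monoid_prod, of y] that
    by (simp add: a_minus_def int_monoid_ring_simps[OF monoid_prod])
  have rel: "g x = \<zero>\<^bsub>H\<^esub>" if "x \<in> tensor_relations k A B" for x
    using that
  proof (cases rule: tensor_relations_cases)
    case (add_left x x' y)
    then show ?thesis by (simp add: gdiff diffc g_of l closed a_minus_def H.minus_add H.a_ac H.r_neg H.r_neg1)
  next
    case (add_right x y y')
    then show ?thesis by (simp add: gdiff diffc g_of r closed a_minus_def H.minus_add H.a_ac H.r_neg H.r_neg1)
  next
    case (balanced c x y)
    then show ?thesis by (simp add: gdiff g_of bal closed a_minus_def H.r_neg)
  qed
  have ker: "g x = \<zero>\<^bsub>H\<^esub>" if "x \<in> tensor_kernel k A B" for x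
    using that[unfolded tensor_kernel]
  proof induction
    case (inv y)
    then have "y \<in> carrier IR" using tensor_relations_in_carrier by blast
    then show ?case
      unfolding a_inv_def[symmetric]
      using rel[OF inv] int_monoid_ring_minus[OF monoid_prod, of y] gdiff[of 0 y] IR.zero_closed gz
      by (simp add: int_monoid_ring_simps[OF monoid_prod] a_minus_def)
  next
    case (eng y z)
    then have "y \<in> carrier IR" "z \<in> carrier IR"
      using K.a_Hcarr unfolding tensor_kernel by auto
    then show ?case using eng by (simp add: int_monoid_ring_simps[OF monoid_prod] gadd)
  qed (use rel gz in \<open>auto simp: int_monoid_ring_simps[OF monoid_prod]\<close>)
  let ?q = "(+>\<^bsub>IR\<^esub>) (tensor_kernel k A B)"
  \<comment> \<open>A representative is chosen; the value does not depend on it, since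
    \<open>g\<close> vanishes on the kernel.\<close>
  define f where "f t = g (SOME x. x \<in> carrier IR & t = ?q x)" for t
  have fq: "f (?q x) = g x" if x: "x \<in> carrier IR" for x
  proof -
    define y where "y = (SOME y. y \<in> carrier IR & ?q x = ?q y)"
    have y: "y \<in> carrier IR" "?q x = ?q y"
      using someI[of "%y. y \<in> carrier IR & ?q x = ?q y" x] x by (auto simp: y_def)
    then have "x \<ominus>\<^bsub>IR\<^esub> y \<in> tensor_kernel k A B"
      using x IR.quotient_eq_iff_same_a_r_cos[OF tensor_kernel_ideal] by blast
    then have "x - y \<in> tensor_kernel k A B"
      using int_monoid_ring_minus[OF monoid_prod y(1)]
      by (simp add: a_minus_def int_monoid_ring_simps[OF monoid_prod])
    from ker[OF this] have "g x \<ominus>\<^bsub>H\<^esub> g y = \<zero>\<^bsub>H\<^esub>" using gdiff x y by simp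
    then have "g x = g y"
    proof -
      have "g x = (g x \<ominus>\<^bsub>H\<^esub> g y) \<oplus>\<^bsub>H\<^esub> g y"
        using gc[OF x] gc[OF y(1)] by (simp add: a_minus_def H.a_assoc H.l_neg)
      then show ?thesis using gc[OF y(1)] \<open>g x \<ominus>\<^bsub>H\<^esub> g y = \<zero>\<^bsub>H\<^esub>\<close> by simp
    qed
    then show ?thesis unfolding f_def y_def[symmetric] by simp
  qed
  have rep: "\<exists>x \<in> carrier IR. t = ?q x" if "t \<in> carrier T" for t
    using that unfolding tensor_algebra_def FactRing_def A_RCOSETS_def' by auto
  show ?thesis
  proof
    show "f t \<in> carrier H" if "t \<in> carrier T" for t
      using rep[OF that] fq gc by auto
    show "f (s \<oplus>\<^bsub>T\<^esub> t) = f s \<oplus>\<^bsub>H\<^esub> f t" if "s \<in> carrier T" "t \<in> carrier T" for s t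
    proof -
      obtain x where x: "x \<in> carrier IR" "s = ?q x" using rep[OF \<open>s \<in> carrier T\<close>] by (elim bexE)
      obtain y where y: "y \<in> carrier IR" "t = ?q y" using rep[OF \<open>t \<in> carrier T\<close>] by (elim bexE)
      have "s \<oplus>\<^bsub>T\<^esub> t = ?q (x \<oplus>\<^bsub>IR\<^esub> y)"
        unfolding x(2) y(2) by (rule ring_hom_memE(3)[OF quotient_hom x(1) y(1), symmetric])
      then have "f (s \<oplus>\<^bsub>T\<^esub> t) = g (x \<oplus>\<^bsub>IR\<^esub> y)"
        using fq[OF IR.a_closed[OF x(1) y(1)]] by (simp only:)
      also have "\<dots> = g x \<oplus>\<^bsub>H\<^esub> g y"
        using gadd[OF x(1) y(1)] by (simp only: int_monoid_ring_simps[OF monoid_prod])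
      finally show ?thesis unfolding x(2) y(2) fq[OF x(1)] fq[OF y(1)] .
    qed
    show "f (x \<diamondop> y) = h x y" if "x \<in> carrier A" "y \<in> carrier B" for x y
      using fq[of "frag_of (x, y)"] that g_of[of "(x, y)"] by (simp add: pure_tensor_def)
  qed
qed

end

section \<open>Localization at central nonzerodivisors\<close>

text \<open>\<open>B\<close> may be noncommutative: the locale is used for an algebra at the nonzero
  elements of a central domain, and for that domain itself, where it yields the fraction
  field.\<close>

locale central_localization = ring B for B :: "('a, 'n) ring_scheme" (structure) +
  fixes S :: "'a set"
  assumes S_carrier: "S \<subseteq> carrier B"
    and S_one: "\<one> \<in> S"
    and S_mult: "!!s t. s \<in> S ==> t \<in> S ==> s \<otimes> t \<in> S"
    and S_central: "!!s b. s \<in> S ==> b \<in> carrier B ==> s \<otimes> b = b \<otimes> s"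
    and S_regular: "!!s b. s \<in> S ==> b \<in> carrier B ==> s \<otimes> b = \<zero> ==> b = \<zero>"
begin

abbreviation "L \<equiv> localization B S"
abbreviation cls where "cls a s \<equiv> loc_class B S a s"

lemma S_closed [simp]: "s \<in> S ==> s \<in> carrier B"
  using S_carrier by auto

lemma S_lcomm: "s \<in> S ==> a \<in> carrier B ==> b \<in> carrier B ==> s \<otimes> (a \<otimes> b) = a \<otimes> (s \<otimes> b)"
  by (simp add: m_assoc[symmetric] S_central[of s a])

lemma S_cancel:
  assumes "s \<in> S" "a \<in> carrier B" "b \<in> carrier B" "s \<otimes> a = s \<otimes> b"
  shows "a = b"
proof -
  have "s \<otimes> (a \<ominus> b) = \<zero>"
    using assms by (simp add: a_minus_def r_distr r_minus r_neg)
  then have "a \<ominus> b = \<zero>" using S_regular assms by simp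
  then show ?thesis using assms by simp
qed

text \<open>Elements of \<open>S\<close> are regular, so the factor \<open>u\<close> in the
  definition of a class cancels and equality of fractions is plain cross-multiplication.\<close>

lemma mem_cls_iff:
  assumes "a \<in> carrier B" "s \<in> S"
  shows "(b, t) \<in> cls a s \<longleftrightarrow> b \<in> carrier B & t \<in> S & a \<otimes> t = b \<otimes> s"
proof -
  have "(\<exists>u\<in>S. u \<otimes> (a \<otimes> t) = u \<otimes> (b \<otimes> s)) \<longleftrightarrow> a \<otimes> t = b \<otimes> s" if "b \<in> carrier B" "t \<in> S"
  proof
    assume "\<exists>u\<in>S. u \<otimes> (a \<otimes> t) = u \<otimes> (b \<otimes> s)"
    then obtain u where "u \<in> S" "u \<otimes> (a \<otimes> t) = u \<otimes> (b \<otimes> s)" by (elim bexE)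
    then show "a \<otimes> t = b \<otimes> s" using assms that S_cancel[of u "a \<otimes> t" "b \<otimes> s"] by simp
  qed (use S_one in auto)
  then show ?thesis unfolding loc_class_def by auto
qed

lemma cls_eq_iff:
  assumes "a \<in> carrier B" "s \<in> S" "b \<in> carrier B" "t \<in> S"
  shows "cls a s = cls b t \<longleftrightarrow> a \<otimes> t = b \<otimes> s"
proof
  assume "cls a s = cls b t"
  moreover have "(b, t) \<in> cls b t" using assms by (simp add: mem_cls_iff)
  ultimately show "a \<otimes> t = b \<otimes> s" using assms by (metis mem_cls_iff)
next
  assume eq: "a \<otimes> t = b \<otimes> s"
  have "a \<otimes> v = u \<otimes> s \<longleftrightarrow> b \<otimes> v = u \<otimes> t" if "u \<in> carrier B" "v \<in> S" for u v
  proof -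
    have "t \<otimes> (a \<otimes> v) = s \<otimes> (b \<otimes> v)" "t \<otimes> (u \<otimes> s) = s \<otimes> (u \<otimes> t)"
    proof -
      have "t \<otimes> (a \<otimes> v) = (a \<otimes> t) \<otimes> v"
        using assms that by (simp add: S_central[of t a] m_assoc[symmetric])
      also have "\<dots> = s \<otimes> (b \<otimes> v)"
        using assms that eq by (simp add: S_central[of s b] m_assoc[symmetric])
      finally show "t \<otimes> (a \<otimes> v) = s \<otimes> (b \<otimes> v)" .
      have "t \<otimes> (u \<otimes> s) = u \<otimes> (s \<otimes> t)"
        using assms that by (simp add: S_central[of t] m_assoc)
      also have "\<dots> = s \<otimes> (u \<otimes> t)"
        using assms that by (simp add: m_assoc[symmetric] S_central[of s u])
      finally show "t \<otimes> (u \<otimes> s) = s \<otimes> (u \<otimes> t)" .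
    qed
    then show ?thesis
      using assms that S_cancel[of t "a \<otimes> v" "u \<otimes> s"] S_cancel[of s "b \<otimes> v" "u \<otimes> t"] by auto
  qed
  then show "cls a s = cls b t" using assms by (auto simp: mem_cls_iff)
qed

lemma cls_closed [simp]: "a \<in> carrier B ==> s \<in> S ==> cls a s \<in> carrier L"
  unfolding localization_def by auto

lemma carrier_L: "x \<in> carrier L \<longleftrightarrow> (\<exists>a \<in> carrier B. \<exists>s \<in> S. x = cls a s)"
  unfolding localization_def by auto

lemma cls_representative:
  assumes "(a', s') \<in> cls a s" "a \<in> carrier B" "s \<in> S"
  shows "a' \<in> carrier B" "s' \<in> S" "cls a' s' = cls a s"
  using assms by (auto simp: mem_cls_iff cls_eq_iff)

lemma cls_self: "a \<in> carrier B ==> s \<in> S ==> (a, s) \<in> cls a s"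
  by (simp add: mem_cls_iff)

lemma cls_mult_eq:
  assumes "a \<in> carrier B" "s \<in> S" "b \<in> carrier B" "t \<in> S"
    "a' \<in> carrier B" "s' \<in> S" "b' \<in> carrier B" "t' \<in> S"
    and eq: "cls a s = cls a' s'" "cls b t = cls b' t'"
  shows "cls (a \<otimes> b) (s \<otimes> t) = cls (a' \<otimes> b') (s' \<otimes> t')"
proof -
  have 1: "a \<otimes> s' = a' \<otimes> s" "b \<otimes> t' = b' \<otimes> t" using assms by (auto simp: cls_eq_iff)
  have "(a \<otimes> b) \<otimes> (s' \<otimes> t') = (a \<otimes> s') \<otimes> (b \<otimes> t')"
    using assms by (simp add: m_assoc S_lcomm[of s' b])
  also have "\<dots> = (a' \<otimes> s) \<otimes> (b' \<otimes> t)" by (simp add: 1)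
  also have "\<dots> = (a' \<otimes> b') \<otimes> (s \<otimes> t)"
    using assms by (simp add: m_assoc S_lcomm[of s b'])
  finally show ?thesis using assms S_mult by (simp add: cls_eq_iff)
qed

lemma cls_add_eq:
  assumes "a \<in> carrier B" "s \<in> S" "b \<in> carrier B" "t \<in> S"
    "a' \<in> carrier B" "s' \<in> S" "b' \<in> carrier B" "t' \<in> S"
    and eq: "cls a s = cls a' s'" "cls b t = cls b' t'"
  shows "cls (a \<otimes> t \<oplus> b \<otimes> s) (s \<otimes> t) = cls (a' \<otimes> t' \<oplus> b' \<otimes> s') (s' \<otimes> t')"
proof -
  have 1: "a \<otimes> s' = a' \<otimes> s" "b \<otimes> t' = b' \<otimes> t" using assms by (auto simp: cls_eq_iff)
  have comm: "t' \<otimes> (s \<otimes> t) = s \<otimes> (t \<otimes> t')" "s' \<otimes> (s \<otimes> t) = t \<otimes> (s \<otimes> s')"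
    using assms S_mult S_central[of t' "s \<otimes> t"] S_central[of s' "s \<otimes> t"] S_central[of t s]
    by (simp_all add: m_assoc S_lcomm[of t s])
  have "(a \<otimes> t) \<otimes> (s' \<otimes> t') = (a \<otimes> s') \<otimes> (t \<otimes> t')"
    using assms by (simp add: m_assoc S_lcomm[of t s' t'])
  also have "\<dots> = (a' \<otimes> t') \<otimes> (s \<otimes> t)"
    unfolding 1 using assms comm by (simp add: m_assoc)
  finally have 2: "(a \<otimes> t) \<otimes> (s' \<otimes> t') = (a' \<otimes> t') \<otimes> (s \<otimes> t)" .
  have "(b \<otimes> s) \<otimes> (s' \<otimes> t') = (b \<otimes> t') \<otimes> (s \<otimes> s')"
    using assms S_central[of t' "s \<otimes> s'"] by (simp add: m_assoc)
  also have "\<dots> = (b' \<otimes> s') \<otimes> (s \<otimes> t)"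
    unfolding 1 using assms comm by (simp add: m_assoc)
  finally have 3: "(b \<otimes> s) \<otimes> (s' \<otimes> t') = (b' \<otimes> s') \<otimes> (s \<otimes> t)" .
  show ?thesis using assms S_mult 2 3 by (simp add: cls_eq_iff l_distr)
qed

text \<open>The product is a union over all representatives; by \<open>cls_mult_eq\<close> every set
  in this union is the same class.\<close>

lemma mult_cls:
  assumes "a \<in> carrier B" "s \<in> S" "b \<in> carrier B" "t \<in> S"
  shows "cls a s \<otimes>\<^bsub>L\<^esub> cls b t = cls (a \<otimes> b) (s \<otimes> t)"
proof -
  have "cls (a' \<otimes> b') (s' \<otimes> t') = cls (a \<otimes> b) (s \<otimes> t)"
    if "(a', s') \<in> cls a s" "(b', t') \<in> cls b t" for a' s' b' t'
    using cls_representative[OF that(1)] cls_representative[OF that(2)] assms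
    by (intro cls_mult_eq) auto
  then have *: "(\<Union>(b', t')\<in>cls b t. cls (a' \<otimes> b') (s' \<otimes> t')) = cls (a \<otimes> b) (s \<otimes> t)"
    if "(a', s') \<in> cls a s" for a' s'
    using that cls_self[OF assms(3,4)] by (intro SUP_eq_const) (blast, simp only: split_paired_all prod.case)
  have "(\<Union>(a', s')\<in>cls a s. \<Union>(b', t')\<in>cls b t. cls (a' \<otimes> b') (s' \<otimes> t')) = cls (a \<otimes> b) (s \<otimes> t)"
    using cls_self[OF assms(1,2)] by (intro SUP_eq_const) (blast, simp only: split_paired_all prod.case *)
  then show ?thesis by (simp add: localization_def)
qed

lemma add_cls:
  assumes "a \<in> carrier B" "s \<in> S" "b \<in> carrier B" "t \<in> S"
  shows "cls a s \<oplus>\<^bsub>L\<^esub> cls b t = cls (a \<otimes> t \<oplus> b \<otimes> s) (s \<otimes> t)"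
proof -
  have "cls (a' \<otimes> t' \<oplus> b' \<otimes> s') (s' \<otimes> t') = cls (a \<otimes> t \<oplus> b \<otimes> s) (s \<otimes> t)"
    if "(a', s') \<in> cls a s" "(b', t') \<in> cls b t" for a' s' b' t'
    using cls_representative[OF that(1)] cls_representative[OF that(2)] assms
    by (intro cls_add_eq) auto
  then have *: "(\<Union>(b', t')\<in>cls b t. cls (a' \<otimes> t' \<oplus> b' \<otimes> s') (s' \<otimes> t')) = cls (a \<otimes> t \<oplus> b \<otimes> s) (s \<otimes> t)"
    if "(a', s') \<in> cls a s" for a' s'
    using that cls_self[OF assms(3,4)] by (intro SUP_eq_const) (blast, simp only: split_paired_all prod.case)
  have "(\<Union>(a', s')\<in>cls a s. \<Union>(b', t')\<in>cls b t. cls (a' \<otimes> t' \<oplus> b' \<otimes> s') (s' \<otimes> t')) = cls (a \<otimes> t \<oplus> b \<otimes> s) (s \<otimes> t)"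
    using cls_self[OF assms(1,2)] by (intro SUP_eq_const) (blast, simp only: split_paired_all prod.case *)
  then show ?thesis by (simp add: localization_def)
qed

lemma one_L: "\<one>\<^bsub>L\<^esub> = cls \<one> \<one>" and zero_L: "\<zero>\<^bsub>L\<^esub> = cls \<zero> \<one>"
  by (simp_all add: localization_def)

lemma cls_scale:
  assumes "a \<in> carrier B" "s \<in> S" "t \<in> S"
  shows "cls (a \<otimes> t) (s \<otimes> t) = cls a s"
  using assms S_mult S_central[of t s] by (simp add: cls_eq_iff m_assoc)

lemma add_cls_same:
  assumes "a \<in> carrier B" "s \<in> S" "b \<in> carrier B"
  shows "cls a s \<oplus>\<^bsub>L\<^esub> cls b s = cls (a \<oplus> b) s"
  using assms cls_scale[of "a \<oplus> b" s s] by (simp add: add_cls l_distr)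

lemma common_denominator:
  assumes "x \<in> carrier L" "y \<in> carrier L"
  obtains a b s where "a \<in> carrier B" "b \<in> carrier B" "s \<in> S" "x = cls a s" "y = cls b s"
proof -
  obtain a s b t where "a \<in> carrier B" "s \<in> S" "x = cls a s" "b \<in> carrier B" "t \<in> S" "y = cls b t"
    using assms carrier_L by auto
  then show ?thesis
    using that[of "a \<otimes> t" "b \<otimes> s" "s \<otimes> t"] cls_scale[of a s t] cls_scale[of b t s]
      S_central[of s t] S_mult by auto
qed

lemma common_denominator3:
  assumes "x \<in> carrier L" "y \<in> carrier L" "z \<in> carrier L"
  obtains a b c s where "a \<in> carrier B" "b \<in> carrier B" "c \<in> carrier B" "s \<in> S"
    "x = cls a s" "y = cls b s" "z = cls c s"
proof -
  obtain a b s where 1: "a \<in> carrier B" "b \<in> carrier B" "s \<in> S" "x = cls a s" "y = cls b s"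
    using common_denominator assms by metis
  obtain c t where 2: "c \<in> carrier B" "t \<in> S" "z = cls c t" using assms carrier_L by auto
  show ?thesis
    using that[of "a \<otimes> t" "b \<otimes> t" "c \<otimes> s" "s \<otimes> t"] 1 2 cls_scale[of a s t] cls_scale[of b s t]
      cls_scale[of c t s] S_central[of s t] S_mult by auto
qed

text \<open>Any two or three fractions share a denominator, and for equal denominators addition is
  addition of numerators, so the axioms come from those of \<open>B\<close>.\<close>

lemma ring_L: "ring L"
proof (rule ringI)
  show "abelian_group L"
  proof (rule abelian_groupI)
    fix x y assume "x \<in> carrier L" "y \<in> carrier L"
    then obtain a b s where 1: "a \<in> carrier B" "b \<in> carrier B" "s \<in> S" "x = cls a s" "y = cls b s"
      by (rule common_denominator)
    then show "x \<oplus>\<^bsub>L\<^esub> y \<in> carrier L" "x \<oplus>\<^bsub>L\<^esub> y = y \<oplus>\<^bsub>L\<^esub> x"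
      by (auto simp: add_cls_same a_comm)
  next
    fix x y z assume "x \<in> carrier L" "y \<in> carrier L" "z \<in> carrier L"
    then obtain a b c s where "a \<in> carrier B" "b \<in> carrier B" "c \<in> carrier B" "s \<in> S"
        "x = cls a s" "y = cls b s" "z = cls c s"
      by (rule common_denominator3)
    then show "x \<oplus>\<^bsub>L\<^esub> y \<oplus>\<^bsub>L\<^esub> z = x \<oplus>\<^bsub>L\<^esub> (y \<oplus>\<^bsub>L\<^esub> z)"
      by (auto simp: add_cls_same a_assoc)
  next
    fix x assume "x \<in> carrier L"
    then obtain a s where a: "a \<in> carrier B" "s \<in> S" "x = cls a s" using carrier_L by auto
    show "\<zero>\<^bsub>L\<^esub> \<oplus>\<^bsub>L\<^esub> x = x" using a S_one by (simp add: zero_L add_cls)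
    have "cls (\<ominus> a) s \<oplus>\<^bsub>L\<^esub> x = \<zero>\<^bsub>L\<^esub>"
      using a S_one by (simp add: add_cls_same l_neg zero_L cls_eq_iff)
    then show "\<exists>y\<in>carrier L. y \<oplus>\<^bsub>L\<^esub> x = \<zero>\<^bsub>L\<^esub>" using a by (metis cls_closed a_inv_closed)
  qed (use S_one in \<open>auto simp: zero_L\<close>)
  show "monoid L"
  proof (rule monoidI)
    fix x y assume "x \<in> carrier L" "y \<in> carrier L"
    then obtain a b s where "a \<in> carrier B" "b \<in> carrier B" "s \<in> S" "x = cls a s" "y = cls b s"
      by (rule common_denominator)
    then show "x \<otimes>\<^bsub>L\<^esub> y \<in> carrier L" using S_mult by (auto simp: mult_cls)
  next
    fix x y z assume "x \<in> carrier L" "y \<in> carrier L" "z \<in> carrier L"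
    then obtain a b c s where "a \<in> carrier B" "b \<in> carrier B" "c \<in> carrier B" "s \<in> S"
        "x = cls a s" "y = cls b s" "z = cls c s"
      by (rule common_denominator3)
    then show "x \<otimes>\<^bsub>L\<^esub> y \<otimes>\<^bsub>L\<^esub> z = x \<otimes>\<^bsub>L\<^esub> (y \<otimes>\<^bsub>L\<^esub> z)"
      using S_mult by (auto simp: mult_cls m_assoc)
  qed (use S_one in \<open>auto simp: one_L mult_cls carrier_L\<close>)
  fix x y z assume "x \<in> carrier L" "y \<in> carrier L" "z \<in> carrier L"
  then obtain a b c s where *: "a \<in> carrier B" "b \<in> carrier B" "c \<in> carrier B" "s \<in> S"
      "x = cls a s" "y = cls b s" "z = cls c s"
    by (rule common_denominator3)
  then show "(x \<oplus>\<^bsub>L\<^esub> y) \<otimes>\<^bsub>L\<^esub> z = x \<otimes>\<^bsub>L\<^esub> z \<oplus>\<^bsub>L\<^esub> y \<otimes>\<^bsub>L\<^esub> z"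
    "z \<otimes>\<^bsub>L\<^esub> (x \<oplus>\<^bsub>L\<^esub> y) = z \<otimes>\<^bsub>L\<^esub> x \<oplus>\<^bsub>L\<^esub> z \<otimes>\<^bsub>L\<^esub> y"
    using S_mult by (auto simp: mult_cls add_cls_same l_distr r_distr)
qed

end

lemma central_localization_domain:
  assumes "domain R"
  shows "central_localization R (carrier R - {\<zero>\<^bsub>R\<^esub>})"
proof -
  interpret domain R by fact
  show ?thesis
    by unfold_locales (auto simp: m_comm integral_iff)
qed

lemma field_localization_domain:
  assumes "domain R"
  shows "field (localization R (carrier R - {\<zero>\<^bsub>R\<^esub>}))"
proof -
  interpret domain R by fact
  interpret central_localization R "carrier R - {\<zero>\<^bsub>R\<^esub>}" by (rule central_localization_domain[OF assms])
  interpret L: ring L by (rule ring_L)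
  have "cring L"
  proof (rule cringI[OF L.abelian_group_axioms])
    show "comm_monoid L"
    proof (rule L.monoid_comm_monoidI)
      fix x y assume "x \<in> carrier L" "y \<in> carrier L"
      then obtain a b s where "a \<in> carrier R" "b \<in> carrier R" "s \<in> carrier R - {\<zero>\<^bsub>R\<^esub>}" "x = cls a s" "y = cls b s"
        by (rule common_denominator)
      then show "x \<otimes>\<^bsub>L\<^esub> y = y \<otimes>\<^bsub>L\<^esub> x" by (auto simp: mult_cls m_comm)
    qed
  qed (rule L.l_distr)
  then show ?thesis
  proof (rule cring.cring_fieldI2)
    show "\<zero>\<^bsub>L\<^esub> ~= \<one>\<^bsub>L\<^esub>"
      by (simp add: zero_L one_L cls_eq_iff)
    fix x assume x: "x \<in> carrier L" "x ~= \<zero>\<^bsub>L\<^esub>"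
    then obtain a s where a: "a \<in> carrier R" "s \<in> carrier R - {\<zero>\<^bsub>R\<^esub>}" "x = cls a s" using carrier_L by auto
    then have "a ~= \<zero>\<^bsub>R\<^esub>" using x by (auto simp: zero_L cls_eq_iff)
    then have "x \<otimes>\<^bsub>L\<^esub> cls s a = \<one>\<^bsub>L\<^esub>"
      using a by (simp add: mult_cls one_L cls_eq_iff m_comm integral_iff)
    then show "\<exists>y\<in>carrier L. x \<otimes>\<^bsub>L\<^esub> y = \<one>\<^bsub>L\<^esub>"
      using a \<open>a ~= \<zero>\<^bsub>R\<^esub>\<close> by (intro bexI[of _ "cls s a"]) auto
  qed
qed

section \<open>Bases over a central field and traces\<close>

lemma (in abelian_monoid) finsum_swap:
  assumes "finite I" "finite J" "!!i j. i \<in> I ==> j \<in> J ==> f i j \<in> carrier G"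
  shows "(\<Oplus>i\<in>I. \<Oplus>j\<in>J. f i j) = (\<Oplus>j\<in>J. \<Oplus>i\<in>I. f i j)"
  using assms(1,3)
proof (induction I rule: finite_induct)
  case (insert i I)
  have "(\<Oplus>l\<in>insert i I. \<Oplus>j\<in>J. f l j) = (\<Oplus>j\<in>J. f i j) \<oplus> (\<Oplus>j\<in>J. \<Oplus>l\<in>I. f l j)"
    using insert by (subst finsum_insert) (auto intro!: finsum_closed)
  also have "\<dots> = (\<Oplus>j\<in>J. f i j \<oplus> (\<Oplus>l\<in>I. f l j))"
    using insert by (subst finsum_addf) (auto intro!: finsum_closed)
  also have "\<dots> = (\<Oplus>j\<in>J. \<Oplus>l\<in>insert i I. f l j)"
    using insert by (intro finsum_cong') (auto intro!: finsum_closed)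
  finally show ?case .
qed simp

lemma (in abelian_monoid) finsum_lessThan_Suc_head:
  fixes f :: "nat \<Rightarrow> 'a"
  assumes "!!i. i < Suc n ==> f i \<in> carrier G"
  shows "(\<Oplus>i\<in>{..<Suc n}. f i) = f 0 \<oplus> (\<Oplus>i\<in>{..<n}. f (Suc i))"
  using assms
proof (induction n)
  case (Suc n)
  have "(\<Oplus>i\<in>{..<Suc (Suc n)}. f i) = f (Suc n) \<oplus> (\<Oplus>i\<in>{..<Suc n}. f i)"
    using Suc.prems by (subst lessThan_Suc, subst finsum_insert) auto
  also have "\<dots> = f (Suc n) \<oplus> (f 0 \<oplus> (\<Oplus>i\<in>{..<n}. f (Suc i)))"
    using Suc by auto
  also have "\<dots> = f 0 \<oplus> (f (Suc n) \<oplus> (\<Oplus>i\<in>{..<n}. f (Suc i)))"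
    using Suc.prems by (intro a_lcomm finsum_closed) auto
  also have "f (Suc n) \<oplus> (\<Oplus>i\<in>{..<n}. f (Suc i)) = (\<Oplus>i\<in>{..<Suc n}. f (Suc i))"
    using Suc.prems by (subst lessThan_Suc, subst finsum_insert) auto
  finally show ?case .
qed (simp add: lessThan_Suc)

lemma (in abelian_monoid) finsum_delta:
  assumes "finite I" "j \<in> I" "x \<in> carrier G"
  shows "(\<Oplus>i\<in>I. if i = j then x else \<zero>) = x"
  using add.finprod_singleton_swap[of j I "%_. x"] assms by simp

lemma (in ring) combine_eq_finsum:
  assumes "length Ks = length Us" "set Ks \<subseteq> carrier R" "set Us \<subseteq> carrier R"
  shows "combine Ks Us = (\<Oplus>i\<in>{..<length Us}. Ks ! i \<otimes> Us ! i)"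
  using assms
proof (induction Ks Us rule: list_induct2)
  case (Cons k Ks u Us)
  have c: "(k # Ks) ! i \<otimes> (u # Us) ! i \<in> carrier R" if "i < Suc (length Us)" for i
  proof -
    have "(k # Ks) ! i \<in> set (k # Ks)" "(u # Us) ! i \<in> set (u # Us)"
      using that Cons.hyps by (auto intro!: nth_mem simp del: set_simps nth_Cons_Suc)
    then show ?thesis using Cons.prems by blast
  qed
  show ?case using Cons by (simp only: list.size add_0_right add_Suc_right finsum_lessThan_Suc_head[OF c]) simp
qed simp

text \<open>Linear algebra over \<open>F\<close> inside a ring \<open>E\<close>, the scalars acting
  through a central embedding \<open>\<sigma>\<close>. Keeping \<open>F\<close> apart from its image
  lets coefficients be computed in \<open>F\<close>, while \<open>list_basis\<close> connects to
  independence and span over the image, in terms of which \<open>ext_basis\<close> is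
  stated.\<close>

locale central_scalars = F: field F + E: ring E
  for F :: "('f, 'm) ring_scheme" and E :: "('e, 'n) ring_scheme" +
  fixes \<sigma> :: "'f \<Rightarrow> 'e"
  assumes hom: "\<sigma> \<in> Ring.ring_hom F E"
    and central: "!!f e. f \<in> carrier F ==> e \<in> carrier E ==> \<sigma> f \<otimes>\<^bsub>E\<^esub> e = e \<otimes>\<^bsub>E\<^esub> \<sigma> f"
    and nontrivial: "\<one>\<^bsub>E\<^esub> ~= \<zero>\<^bsub>E\<^esub>"
begin

sublocale H: ring_hom_ring F E \<sigma>
  by (rule ring_hom_ringI2[OF F.ring_axioms E.ring_axioms hom])

lemma subfield_image: "subfield (\<sigma> ` carrier F) E"
  by (rule H.img_is_subfield(2)[OF F.carrier_is_subfield nontrivial])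

lemma scalar_inj: "inj_on \<sigma> (carrier F)"
  by (rule H.img_is_subfield(1)[OF F.carrier_is_subfield nontrivial])

lemma scalar_eq_zero: "f \<in> carrier F ==> \<sigma> f = \<zero>\<^bsub>E\<^esub> ==> f = \<zero>\<^bsub>F\<^esub>"
  using inj_onD[OF scalar_inj, of f "\<zero>\<^bsub>F\<^esub>"] by simp

definition comb :: "nat \<Rightarrow> (nat \<Rightarrow> 'f) \<Rightarrow> (nat \<Rightarrow> 'e) \<Rightarrow> 'e" where
  "comb n a u = (\<Oplus>\<^bsub>E\<^esub>i\<in>{..<n}. \<sigma> (a i) \<otimes>\<^bsub>E\<^esub> u i)"

definition basis :: "nat \<Rightarrow> (nat \<Rightarrow> 'e) \<Rightarrow> bool" where
  "basis n u \<longleftrightarrow> (\<forall>i<n. u i \<in> carrier E) &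
     (\<forall>e\<in>carrier E. \<exists>a. (\<forall>i<n. a i \<in> carrier F) & e = comb n a u) &
     (\<forall>a. (\<forall>i<n. a i \<in> carrier F) --> comb n a u = \<zero>\<^bsub>E\<^esub> --> (\<forall>i<n. a i = \<zero>\<^bsub>F\<^esub>))"

lemma comb_closed [simp]:
  "(!!i. i < n ==> a i \<in> carrier F) ==> (!!i. i < n ==> u i \<in> carrier E) ==> comb n a u \<in> carrier E"
  unfolding comb_def by (intro E.finsum_closed) auto

lemma comb_cong:
  assumes "!!i. i < n ==> a i = a' i" "!!i. i < n ==> u i = u' i"
    "!!i. i < n ==> a' i \<in> carrier F" "!!i. i < n ==> u' i \<in> carrier E"
  shows "comb n a u = comb n a' u'"
  unfolding comb_def using assms by (intro E.finsum_cong') auto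

lemma comb_diff:
  assumes "!!i. i < n ==> a i \<in> carrier F" "!!i. i < n ==> a' i \<in> carrier F"
    "!!i. i < n ==> u i \<in> carrier E"
  shows "comb n (%i. a i \<ominus>\<^bsub>F\<^esub> a' i) u = comb n a u \<ominus>\<^bsub>E\<^esub> comb n a' u"
proof -
  have "comb n a u = (\<Oplus>\<^bsub>E\<^esub>i\<in>{..<n}. \<sigma> (a i \<ominus>\<^bsub>F\<^esub> a' i) \<otimes>\<^bsub>E\<^esub> u i \<oplus>\<^bsub>E\<^esub> \<sigma> (a' i) \<otimes>\<^bsub>E\<^esub> u i)"
    unfolding comb_def
    by (rule E.finsum_cong')
      (use assms in \<open>auto simp: E.l_distr[symmetric] H.hom_add[symmetric] F.minus_eq F.a_assoc F.l_neg
        simp del: H.hom_add\<close>)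
  also have "\<dots> = comb n (%i. a i \<ominus>\<^bsub>F\<^esub> a' i) u \<oplus>\<^bsub>E\<^esub> comb n a' u"
    unfolding comb_def using assms by (subst E.finsum_addf) auto
  finally show ?thesis
    using assms by (simp add: E.minus_eq E.a_assoc E.r_neg)
qed

lemma comb_unique:
  assumes "basis n u" "!!i. i < n ==> a i \<in> carrier F" "!!i. i < n ==> a' i \<in> carrier F"
    "comb n a u = comb n a' u" "i < n"
  shows "a i = a' i"
proof -
  have u: "!!i. i < n ==> u i \<in> carrier E" using assms(1) by (auto simp: basis_def)
  have "comb n (%i. a i \<ominus>\<^bsub>F\<^esub> a' i) u = \<zero>\<^bsub>E\<^esub>"
    using comb_diff[OF assms(2,3) u] assms(2-4) u by (simp add: E.minus_eq E.r_neg)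
  moreover have "\<forall>i<n. a i \<ominus>\<^bsub>F\<^esub> a' i \<in> carrier F" using assms(2,3) by auto
  moreover have "\<forall>a. (\<forall>i<n. a i \<in> carrier F) --> comb n a u = \<zero>\<^bsub>E\<^esub> --> (\<forall>i<n. a i = \<zero>\<^bsub>F\<^esub>)"
    using assms(1) unfolding basis_def by (elim conjE)
  ultimately have "\<forall>i<n. a i \<ominus>\<^bsub>F\<^esub> a' i = \<zero>\<^bsub>F\<^esub>" by (elim allE[of _ "%i. a i \<ominus>\<^bsub>F\<^esub> a' i"]) iprover
  then show ?thesis using assms(2,3,5) by simp
qed

lemma mult_comb:
  assumes "x \<in> carrier E" "!!i. i < n ==> a i \<in> carrier F" "!!i. i < n ==> u i \<in> carrier E"
  shows "x \<otimes>\<^bsub>E\<^esub> comb n a u = comb n a (%i. x \<otimes>\<^bsub>E\<^esub> u i)"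
proof -
  have "x \<otimes>\<^bsub>E\<^esub> (\<sigma> (a i) \<otimes>\<^bsub>E\<^esub> u i) = \<sigma> (a i) \<otimes>\<^bsub>E\<^esub> (x \<otimes>\<^bsub>E\<^esub> u i)" if "i < n" for i
    using assms that central[of "a i" x] by (simp add: E.m_assoc[symmetric])
  then show ?thesis
    unfolding comb_def using assms by (subst E.finsum_rdistr) (auto intro!: E.finsum_cong')
qed

text \<open>Substituting one system of linear combinations into another multiplies the coefficient
  matrices; all changes of basis below rest on this.\<close>

lemma comb_comb:
  assumes "!!i. i < n ==> p i \<in> carrier F" "!!l i. l < m ==> i < n ==> q l i \<in> carrier F"
    "!!l. l < m ==> v l \<in> carrier E"
  shows "comb n p (%i. comb m (%l. q l i) v) = comb m (%l. \<Oplus>\<^bsub>F\<^esub>i\<in>{..<n}. q l i \<otimes>\<^bsub>F\<^esub> p i) v"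
proof -
  have 1: "\<sigma> (p i) \<otimes>\<^bsub>E\<^esub> (\<sigma> (q l i) \<otimes>\<^bsub>E\<^esub> v l) = \<sigma> (q l i \<otimes>\<^bsub>F\<^esub> p i) \<otimes>\<^bsub>E\<^esub> v l" if "i < n" "l < m" for i l
    using assms that by (simp add: F.m_comm[of "q l i"] E.m_assoc)
  have "comb n p (%i. comb m (%l. q l i) v) =
      (\<Oplus>\<^bsub>E\<^esub>i\<in>{..<n}. \<Oplus>\<^bsub>E\<^esub>l\<in>{..<m}. \<sigma> (p i) \<otimes>\<^bsub>E\<^esub> (\<sigma> (q l i) \<otimes>\<^bsub>E\<^esub> v l))"
    unfolding comb_def using assms
    by (intro E.finsum_cong') (auto simp: E.finsum_rdistr intro!: E.finsum_closed)
  also have "\<dots> = (\<Oplus>\<^bsub>E\<^esub>l\<in>{..<m}. \<Oplus>\<^bsub>E\<^esub>i\<in>{..<n}. \<sigma> (p i) \<otimes>\<^bsub>E\<^esub> (\<sigma> (q l i) \<otimes>\<^bsub>E\<^esub> v l))"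
    using assms by (intro E.finsum_swap) auto
  also have "\<dots> = (\<Oplus>\<^bsub>E\<^esub>l\<in>{..<m}. \<Oplus>\<^bsub>E\<^esub>i\<in>{..<n}. \<sigma> (q l i \<otimes>\<^bsub>F\<^esub> p i) \<otimes>\<^bsub>E\<^esub> v l)"
    using assms 1 by (intro E.finsum_cong' E.finsum_closed) (auto intro!: E.finsum_closed)
  also have "\<dots> = comb m (%l. \<Oplus>\<^bsub>F\<^esub>i\<in>{..<n}. q l i \<otimes>\<^bsub>F\<^esub> p i) v"
    unfolding comb_def using assms
    by (intro E.finsum_cong')
      (auto simp: E.finsum_ldistr[symmetric] H.hom_finsum Pi_def comp_def intro!: E.finsum_closed F.finsum_closed)
  finally show ?thesis .
qed

lemma comb_unit:
  assumes "j < n" "!!i. i < n ==> u i \<in> carrier E"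
  shows "comb n (%i. if i = j then \<one>\<^bsub>F\<^esub> else \<zero>\<^bsub>F\<^esub>) u = u j"
proof -
  have "comb n (%i. if i = j then \<one>\<^bsub>F\<^esub> else \<zero>\<^bsub>F\<^esub>) u = (\<Oplus>\<^bsub>E\<^esub>i\<in>{..<n}. if i = j then u j else \<zero>\<^bsub>E\<^esub>)"
    unfolding comb_def using assms by (intro E.finsum_cong') auto
  then show ?thesis using assms by (simp add: E.finsum_delta)
qed

lemma basis_coordinates:
  assumes "basis n v" "!!j. j < n ==> u j \<in> carrier E"
  obtains P where "!!i j. i < n ==> j < n ==> P i j \<in> carrier F"
    "!!j. j < n ==> u j = comb n (%i. P i j) v"
proof -
  have "\<forall>j. \<exists>a. j < n --> (\<forall>i<n. a i \<in> carrier F) & u j = comb n a v"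
    using assms unfolding basis_def by blast
  then obtain P where "\<forall>j. j < n --> (\<forall>i<n. P j i \<in> carrier F) & u j = comb n (P j) v"
    by metis
  then show ?thesis using that[of "%i j. P j i"] by simp
qed

lemma inverse_coordinates:
  assumes u: "basis n u" and v: "!!i. i < n ==> v i \<in> carrier E"
    and P: "!!i j. i < n ==> j < n ==> P i j \<in> carrier F" "!!j. j < n ==> u j = comb n (%i. P i j) v"
    and Q: "!!i j. i < n ==> j < n ==> Q i j \<in> carrier F" "!!j. j < n ==> v j = comb n (%i. Q i j) u"
    and "l < n" "j < n"
  shows "(\<Oplus>\<^bsub>F\<^esub>i\<in>{..<n}. Q l i \<otimes>\<^bsub>F\<^esub> P i j) = (if l = j then \<one>\<^bsub>F\<^esub> else \<zero>\<^bsub>F\<^esub>)"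
proof (rule comb_unique[OF u _ _ _ \<open>l < n\<close>, where a = "%l. \<Oplus>\<^bsub>F\<^esub>i\<in>{..<n}. Q l i \<otimes>\<^bsub>F\<^esub> P i j"
      and a' = "%l. if l = j then \<one>\<^bsub>F\<^esub> else \<zero>\<^bsub>F\<^esub>"])
  have uc: "!!i. i < n ==> u i \<in> carrier E" using u by (auto simp: basis_def)
  have "u j = comb n (%i. P i j) (%i. comb n (%l. Q l i) u)"
    unfolding P(2)[OF \<open>j < n\<close>] by (rule comb_cong) (use P Q uc \<open>j < n\<close> in auto)
  also have "\<dots> = comb n (%l. \<Oplus>\<^bsub>F\<^esub>i\<in>{..<n}. Q l i \<otimes>\<^bsub>F\<^esub> P i j) u"
    by (rule comb_comb) (use P(1) Q(1) uc \<open>j < n\<close> in auto)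
  finally show "comb n (%l. \<Oplus>\<^bsub>F\<^esub>i\<in>{..<n}. Q l i \<otimes>\<^bsub>F\<^esub> P i j) u =
      comb n (%l. if l = j then \<one>\<^bsub>F\<^esub> else \<zero>\<^bsub>F\<^esub>) u"
    using comb_unit[OF \<open>j < n\<close> uc] by simp
qed (use P(1) Q(1) \<open>j < n\<close> in \<open>auto intro!: F.finsum_closed\<close>)

text \<open>If P and Q are the mutually inverse coordinate matrices of the two bases, then d P = P
  c, hence c = Q d P, and the diagonal sum of Q d P rearranges to that of d P Q = d.\<close>

lemma trace_unique:
  assumes u: "basis n u" and v: "basis n v" and x: "x \<in> carrier E"
    and c: "!!i j. i < n ==> j < n ==> c i j \<in> carrier F"
      "!!j. j < n ==> x \<otimes>\<^bsub>E\<^esub> u j = comb n (%i. c i j) u"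
    and d: "!!i j. i < n ==> j < n ==> d i j \<in> carrier F"
      "!!j. j < n ==> x \<otimes>\<^bsub>E\<^esub> v j = comb n (%i. d i j) v"
  shows "(\<Oplus>\<^bsub>F\<^esub>i\<in>{..<n}. c i i) = (\<Oplus>\<^bsub>F\<^esub>i\<in>{..<n}. d i i)"
proof -
  have uc: "!!i. i < n ==> u i \<in> carrier E" and vc: "!!i. i < n ==> v i \<in> carrier E"
    using u v by (auto simp: basis_def)
  obtain P where P: "!!i j. i < n ==> j < n ==> P i j \<in> carrier F"
      "!!j. j < n ==> u j = comb n (%i. P i j) v"
    using basis_coordinates[OF v, of u] uc by blast
  obtain Q where Q: "!!i j. i < n ==> j < n ==> Q i j \<in> carrier F"
      "!!j. j < n ==> v j = comb n (%i. Q i j) u"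
    using basis_coordinates[OF u, of v] vc by blast
  note cl = P(1) Q(1) c(1) d(1)
  note QP = inverse_coordinates[OF u vc P Q] and PQ = inverse_coordinates[OF v uc Q P]
  \<comment> \<open>Both sides are coordinates of \<open>x\<close> times \<open>u j\<close> in the
    basis \<open>v\<close>.\<close>
  have dP: "(\<Oplus>\<^bsub>F\<^esub>i\<in>{..<n}. d l i \<otimes>\<^bsub>F\<^esub> P i j) = (\<Oplus>\<^bsub>F\<^esub>i\<in>{..<n}. P l i \<otimes>\<^bsub>F\<^esub> c i j)"
    if "l < n" "j < n" for l j
  proof (rule comb_unique[OF v _ _ _ \<open>l < n\<close>, where a = "%l. \<Oplus>\<^bsub>F\<^esub>i\<in>{..<n}. d l i \<otimes>\<^bsub>F\<^esub> P i j"
        and a' = "%l. \<Oplus>\<^bsub>F\<^esub>i\<in>{..<n}. P l i \<otimes>\<^bsub>F\<^esub> c i j"])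
    have "comb n (%l. \<Oplus>\<^bsub>F\<^esub>i\<in>{..<n}. d l i \<otimes>\<^bsub>F\<^esub> P i j) v = comb n (%i. P i j) (%i. comb n (%l. d l i) v)"
      by (rule comb_comb[symmetric]) (use cl vc that in auto)
    also have "\<dots> = comb n (%i. P i j) (%i. x \<otimes>\<^bsub>E\<^esub> v i)"
      by (rule comb_cong) (use cl vc x d(2) that in auto)
    also have "\<dots> = x \<otimes>\<^bsub>E\<^esub> u j"
      using mult_comb[OF x, of n "%i. P i j" v] P vc that by simp
    also have "\<dots> = comb n (%i. c i j) (%i. comb n (%l. P l i) v)"
      unfolding c(2)[OF \<open>j < n\<close>] by (rule comb_cong) (use cl vc P(2) that in auto)
    also have "\<dots> = comb n (%l. \<Oplus>\<^bsub>F\<^esub>i\<in>{..<n}. P l i \<otimes>\<^bsub>F\<^esub> c i j) v"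
      by (rule comb_comb) (use cl vc that in auto)
    finally show "comb n (%l. \<Oplus>\<^bsub>F\<^esub>i\<in>{..<n}. d l i \<otimes>\<^bsub>F\<^esub> P i j) v =
        comb n (%l. \<Oplus>\<^bsub>F\<^esub>i\<in>{..<n}. P l i \<otimes>\<^bsub>F\<^esub> c i j) v" .
  qed (use cl that in \<open>auto intro!: F.finsum_closed\<close>)
  have cjj: "c j j = (\<Oplus>\<^bsub>F\<^esub>i\<in>{..<n}. \<Oplus>\<^bsub>F\<^esub>k\<in>{..<n}. Q j i \<otimes>\<^bsub>F\<^esub> (d i k \<otimes>\<^bsub>F\<^esub> P k j))" if "j < n" for j
  proof -
    have "c j j = (\<Oplus>\<^bsub>F\<^esub>k\<in>{..<n}. if k = j then c j j else \<zero>\<^bsub>F\<^esub>)"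
      using cl that by (simp add: F.finsum_delta)
    also have "\<dots> = (\<Oplus>\<^bsub>F\<^esub>k\<in>{..<n}. (\<Oplus>\<^bsub>F\<^esub>i\<in>{..<n}. Q j i \<otimes>\<^bsub>F\<^esub> P i k) \<otimes>\<^bsub>F\<^esub> c k j)"
      by (rule F.finsum_cong') (use QP cl that in auto)
    also have "\<dots> = (\<Oplus>\<^bsub>F\<^esub>k\<in>{..<n}. \<Oplus>\<^bsub>F\<^esub>i\<in>{..<n}. Q j i \<otimes>\<^bsub>F\<^esub> (P i k \<otimes>\<^bsub>F\<^esub> c k j))"
      by (rule F.finsum_cong')
        (use cl that in \<open>auto simp: F.finsum_ldistr F.m_assoc intro!: F.finsum_cong' F.finsum_closed\<close>)
    also have "\<dots> = (\<Oplus>\<^bsub>F\<^esub>i\<in>{..<n}. \<Oplus>\<^bsub>F\<^esub>k\<in>{..<n}. Q j i \<otimes>\<^bsub>F\<^esub> (P i k \<otimes>\<^bsub>F\<^esub> c k j))"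
      by (rule F.finsum_swap) (use cl that in auto)
    also have "\<dots> = (\<Oplus>\<^bsub>F\<^esub>i\<in>{..<n}. Q j i \<otimes>\<^bsub>F\<^esub> (\<Oplus>\<^bsub>F\<^esub>k\<in>{..<n}. d i k \<otimes>\<^bsub>F\<^esub> P k j))"
      by (rule F.finsum_cong')
        (use cl that dP in \<open>auto simp: F.finsum_rdistr[symmetric] intro!: F.finsum_closed\<close>)
    also have "\<dots> = (\<Oplus>\<^bsub>F\<^esub>i\<in>{..<n}. \<Oplus>\<^bsub>F\<^esub>k\<in>{..<n}. Q j i \<otimes>\<^bsub>F\<^esub> (d i k \<otimes>\<^bsub>F\<^esub> P k j))"
      by (rule F.finsum_cong')
        (use cl that in \<open>auto simp: F.finsum_rdistr intro!: F.finsum_closed\<close>)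
    finally show ?thesis .
  qed
  have dii: "d i i = (\<Oplus>\<^bsub>F\<^esub>k\<in>{..<n}. \<Oplus>\<^bsub>F\<^esub>j\<in>{..<n}. Q j i \<otimes>\<^bsub>F\<^esub> (d i k \<otimes>\<^bsub>F\<^esub> P k j))" if "i < n" for i
  proof -
    have "d i i = (\<Oplus>\<^bsub>F\<^esub>k\<in>{..<n}. if k = i then d i i else \<zero>\<^bsub>F\<^esub>)"
      using cl that by (simp add: F.finsum_delta)
    also have "\<dots> = (\<Oplus>\<^bsub>F\<^esub>k\<in>{..<n}. d i k \<otimes>\<^bsub>F\<^esub> (\<Oplus>\<^bsub>F\<^esub>j\<in>{..<n}. P k j \<otimes>\<^bsub>F\<^esub> Q j i))"
      by (rule F.finsum_cong') (use PQ cl that in auto)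
    also have "\<dots> = (\<Oplus>\<^bsub>F\<^esub>k\<in>{..<n}. \<Oplus>\<^bsub>F\<^esub>j\<in>{..<n}. Q j i \<otimes>\<^bsub>F\<^esub> (d i k \<otimes>\<^bsub>F\<^esub> P k j))"
      by (rule F.finsum_cong')
        (use cl that in \<open>auto simp: F.finsum_rdistr F.m_ac intro!: F.finsum_cong' F.finsum_closed\<close>)
    finally show ?thesis .
  qed
  have "(\<Oplus>\<^bsub>F\<^esub>j\<in>{..<n}. c j j) =
      (\<Oplus>\<^bsub>F\<^esub>j\<in>{..<n}. \<Oplus>\<^bsub>F\<^esub>i\<in>{..<n}. \<Oplus>\<^bsub>F\<^esub>k\<in>{..<n}. Q j i \<otimes>\<^bsub>F\<^esub> (d i k \<otimes>\<^bsub>F\<^esub> P k j))"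
    by (rule F.finsum_cong') (use cl cjj in \<open>auto intro!: F.finsum_closed\<close>)
  also have "\<dots> = (\<Oplus>\<^bsub>F\<^esub>i\<in>{..<n}. \<Oplus>\<^bsub>F\<^esub>j\<in>{..<n}. \<Oplus>\<^bsub>F\<^esub>k\<in>{..<n}. Q j i \<otimes>\<^bsub>F\<^esub> (d i k \<otimes>\<^bsub>F\<^esub> P k j))"
    by (rule F.finsum_swap) (use cl in \<open>auto intro!: F.finsum_closed\<close>)
  also have "\<dots> = (\<Oplus>\<^bsub>F\<^esub>i\<in>{..<n}. d i i)"
  proof (rule F.finsum_cong')
    fix i assume "i \<in> {..<n}"
    then show "(\<Oplus>\<^bsub>F\<^esub>j\<in>{..<n}. \<Oplus>\<^bsub>F\<^esub>k\<in>{..<n}. Q j i \<otimes>\<^bsub>F\<^esub> (d i k \<otimes>\<^bsub>F\<^esub> P k j)) = d i i"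
      unfolding dii[of i, OF \<open>i \<in> {..<n}\<close>[unfolded lessThan_iff]]
      by (intro F.finsum_swap) (use cl in auto)
  qed (use cl in auto)
  finally show ?thesis .
qed

text \<open>Bridges the list-based notions of independence and span over the image of
  \<open>\<sigma>\<close> and families of coefficients taken in \<open>F\<close>.\<close>

lemma list_basis:
  assumes us: "set us \<subseteq> carrier E"
  shows "E.independent (\<sigma> ` carrier F) us & E.Span (\<sigma> ` carrier F) us = carrier E \<longleftrightarrow>
    basis (length us) ((!) us)"
proof -
  let ?K = "\<sigma> ` carrier F" and ?n = "length us"
  have K: "?K \<subseteq> carrier E" by auto
  have uc: "us ! i \<in> carrier E" if "i < ?n" for i using us that nth_mem by blast
  have comb: "E.combine (map (%i. \<sigma> (a i)) [0..<?n]) us = comb ?n a ((!) us)"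
    if a: "\<forall>i<?n. a i \<in> carrier F" for a
  proof -
    have "E.combine (map (%i. \<sigma> (a i)) [0..<?n]) us =
        (\<Oplus>\<^bsub>E\<^esub>i\<in>{..<?n}. map (%i. \<sigma> (a i)) [0..<?n] ! i \<otimes>\<^bsub>E\<^esub> us ! i)"
      by (rule E.combine_eq_finsum) (use us a in auto)
    also have "\<dots> = comb ?n a ((!) us)"
      unfolding comb_def by (rule E.finsum_cong') (use uc a in auto)
    finally show ?thesis .
  qed
  have lift: "\<exists>a. (\<forall>i<?n. a i \<in> carrier F) & Ks = map (%i. \<sigma> (a i)) [0..<?n]"
    if "length Ks = ?n" "set Ks \<subseteq> ?K" for Ks
  proof -
    have "\<exists>f. f \<in> carrier F & Ks ! i = \<sigma> f" if "i < ?n" for i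
    proof -
      have "Ks ! i \<in> ?K" using that \<open>length Ks = ?n\<close> \<open>set Ks \<subseteq> ?K\<close> nth_mem[of i Ks] by auto
      then show ?thesis by auto
    qed
    then obtain a where "!!i. i < ?n ==> a i \<in> carrier F & Ks ! i = \<sigma> (a i)" by metis
    then show ?thesis using that(1) by (intro exI[of _ a]) (auto intro: nth_equalityI)
  qed
  have span: "E.Span ?K us = {comb ?n a ((!) us) | a. \<forall>i<?n. a i \<in> carrier F}" (is "_ = ?C")
  proof (intro equalityI subsetI)
    fix e assume "e \<in> E.Span ?K us"
    then obtain Ks where Ks: "length Ks = ?n" "set Ks \<subseteq> ?K" "e = E.combine Ks us"
      unfolding E.Span_eq_combine_set_length_version[OF subfield_image us] by blast
    from lift[OF Ks(1,2)] obtain a where "\<forall>i<?n. a i \<in> carrier F" "Ks = map (%i. \<sigma> (a i)) [0..<?n]"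
      by blast
    then show "e \<in> ?C" using Ks comb by auto
  next
    fix e assume "e \<in> ?C"
    then obtain a where a: "\<forall>i<?n. a i \<in> carrier F" "e = comb ?n a ((!) us)" by blast
    then show "e \<in> E.Span ?K us"
      unfolding E.Span_eq_combine_set_length_version[OF subfield_image us]
      using comb[OF a(1)] by (intro CollectI exI[of _ "map (%i. \<sigma> (a i)) [0..<?n]"]) auto
  qed
  have indep: "E.independent ?K us \<longleftrightarrow>
      (\<forall>a. (\<forall>i<?n. a i \<in> carrier F) --> comb ?n a ((!) us) = \<zero>\<^bsub>E\<^esub> --> (\<forall>i<?n. a i = \<zero>\<^bsub>F\<^esub>))"
  proof
    assume ind: "E.independent ?K us"
    show "\<forall>a. (\<forall>i<?n. a i \<in> carrier F) --> comb ?n a ((!) us) = \<zero>\<^bsub>E\<^esub> --> (\<forall>i<?n. a i = \<zero>\<^bsub>F\<^esub>)"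
    proof (intro allI impI)
      fix a i assume a: "\<forall>i<?n. a i \<in> carrier F" "comb ?n a ((!) us) = \<zero>\<^bsub>E\<^esub>" and i: "i < ?n"
      have "set (take ?n (map (%i. \<sigma> (a i)) [0..<?n])) \<subseteq> {\<zero>\<^bsub>E\<^esub>}"
        by (rule E.independent_imp_trivial_combine[OF subfield_image ind]) (use a comb in auto)
      then have "\<sigma> (a i) = \<zero>\<^bsub>E\<^esub>" using i by (auto simp: image_subset_iff)
      then show "a i = \<zero>\<^bsub>F\<^esub>" using scalar_eq_zero a i by blast
    qed
  next
    assume *: "\<forall>a. (\<forall>i<?n. a i \<in> carrier F) --> comb ?n a ((!) us) = \<zero>\<^bsub>E\<^esub> --> (\<forall>i<?n. a i = \<zero>\<^bsub>F\<^esub>)"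
    show "E.independent ?K us"
    proof (rule E.trivial_combine_imp_independent[OF subfield_image us])
      fix Ks assume Ks: "set Ks \<subseteq> ?K" "E.combine Ks us = \<zero>\<^bsub>E\<^esub>"
      \<comment> \<open>The coefficient list need not have the length of \<open>us\<close>; it is
        normalized to that length before being lifted to \<open>F\<close>.\<close>
      obtain Ks' where Ks': "set (take ?n Ks) \<subseteq> set Ks'" "set Ks' \<subseteq> set (take ?n Ks) \<union> {\<zero>\<^bsub>E\<^esub>}"
          "length Ks' = ?n" "E.combine Ks' us = \<zero>\<^bsub>E\<^esub>"
        using E.combine_normalize[OF _ us Ks(2)] Ks(1) K by blast
      have "\<zero>\<^bsub>E\<^esub> \<in> ?K" by (metis F.zero_closed H.hom_zero image_eqI)
      then have "set Ks' \<subseteq> ?K" using Ks' Ks(1) set_take_subset[of ?n Ks] by blast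
      from lift[OF Ks'(3) this] obtain a where a: "\<forall>i<?n. a i \<in> carrier F"
          "Ks' = map (%i. \<sigma> (a i)) [0..<?n]" by blast
      then have "\<forall>i<?n. a i = \<zero>\<^bsub>F\<^esub>" using * comb[OF a(1)] Ks'(4) by auto
      then have "set Ks' \<subseteq> {\<zero>\<^bsub>E\<^esub>}" using a by auto
      then show "set (take ?n Ks) \<subseteq> {\<zero>\<^bsub>E\<^esub>}" using Ks'(1) by blast
    qed
  qed
  have "?C = carrier E \<longleftrightarrow> (\<forall>e\<in>carrier E. \<exists>a. (\<forall>i<?n. a i \<in> carrier F) & e = comb ?n a ((!) us))"
    using uc by (auto 0 3 simp: set_eq_iff)
  then show ?thesis unfolding span indep basis_def using uc by auto
qed

lemma basis_dim:
  assumes "set us \<subseteq> carrier E" "basis (length us) ((!) us)"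
  shows "E.dim (\<sigma> ` carrier F) (carrier E) = length us"
proof -
  have "E.independent (\<sigma> ` carrier F) us" "E.Span (\<sigma> ` carrier F) us = carrier E"
    using assms list_basis by auto
  then have "E.dimension (length us) (\<sigma> ` carrier F) (carrier E)"
    using E.dimension_independent by metis
  then show ?thesis using E.dimI[OF subfield_image] by (simp add: over_def)
qed

end

section \<open>Extension of scalars to the fraction field\<close>

lemma algebra_via_simps [simp]:
  "carrier (algebra_via h S) = carrier S" "monoid.mult (algebra_via h S) = monoid.mult S"
  "monoid.one (algebra_via h S) = monoid.one S" "ring.zero (algebra_via h S) = ring.zero S"
  "ring.add (algebra_via h S) = ring.add S" "r \<odot>\<^bsub>algebra_via h S\<^esub> x = h r \<otimes>\<^bsub>S\<^esub> x"
  by (simp_all add: algebra_via_def)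

lemma ring_algebra_via:
  assumes "ring S" shows "ring (algebra_via h S)"
proof -
  interpret ring S by fact
  show ?thesis
  proof (rule ringI)
    show "abelian_group (algebra_via h S)"
    proof (rule abelian_groupI)
      fix x assume "x \<in> carrier (algebra_via h S)"
      then show "\<exists>y\<in>carrier (algebra_via h S). y \<oplus>\<^bsub>algebra_via h S\<^esub> x = \<zero>\<^bsub>algebra_via h S\<^esub>"
        by (intro bexI[of _ "\<ominus>\<^bsub>S\<^esub> x"]) (auto simp: l_neg)
    qed (auto simp: a_ac)
    show "Group.monoid (algebra_via h S)"
      by (rule monoidI) (auto simp: m_assoc)
  qed (auto simp: l_distr r_distr)
qed

lemma assoc_algebra_via:
  assumes "cring k" "ring S" and h: "!!r. r \<in> carrier k ==> h r \<in> carrier S"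
    "!!r s. r \<in> carrier k ==> s \<in> carrier k ==> h (r \<oplus>\<^bsub>k\<^esub> s) = h r \<oplus>\<^bsub>S\<^esub> h s"
    "!!r s. r \<in> carrier k ==> s \<in> carrier k ==> h (r \<otimes>\<^bsub>k\<^esub> s) = h r \<otimes>\<^bsub>S\<^esub> h s"
    "h \<one>\<^bsub>k\<^esub> = \<one>\<^bsub>S\<^esub>"
    "!!r x. r \<in> carrier k ==> x \<in> carrier S ==> h r \<otimes>\<^bsub>S\<^esub> x = x \<otimes>\<^bsub>S\<^esub> h r"
  shows "assoc_algebra k (algebra_via h S)"
proof -
  interpret S: ring S by fact
  interpret V: ring "algebra_via h S" by (rule ring_algebra_via[OF assms(2)])
  have "module k (algebra_via h S)"
    by (rule moduleI) (use assms(1) h(1-4) V.abelian_group_axioms in \<open>auto simp: S.l_distr S.r_distr S.m_assoc\<close>)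
  moreover have "x \<otimes>\<^bsub>S\<^esub> (h c \<otimes>\<^bsub>S\<^esub> y) = h c \<otimes>\<^bsub>S\<^esub> (x \<otimes>\<^bsub>S\<^esub> y)"
    if "c \<in> carrier k" "x \<in> carrier S" "y \<in> carrier S" for c x y
    using that h(1) h(5)[of c x] by (simp add: S.m_assoc[symmetric])
  ultimately show ?thesis
    using V.ring_axioms h(1) by (auto simp: assoc_algebra_def S.m_assoc)
qed

text \<open>Torsion-freeness of \<open>B\<close> over \<open>R\<close> is an assumption here; for a
  central subring of a prime ring it follows from primeness, see
  \<open>prime_ring_central_domain\<close>.\<close>

locale central_domain = ring B for B :: "('a, 'n) ring_scheme" (structure) +
  fixes R :: "'a set"
  assumes subring_R: "subring R B" and R_center: "R \<subseteq> center B"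
    and domain_R: "domain (B\<lparr>carrier := R\<rparr>)"
    and torsion_free: "!!r b. r \<in> R ==> b \<in> carrier B ==> r \<otimes> b = \<zero> ==> r = \<zero> \<or> b = \<zero>"
begin

abbreviation "RR \<equiv> B\<lparr>carrier := R\<rparr>"
abbreviation "F \<equiv> frac_field B R"
abbreviation "E \<equiv> frac_ext B R"
abbreviation fr where "fr r s \<equiv> loc_class RR (R - {\<zero>}) r s"

lemma R_closed [simp]: "r \<in> R ==> r \<in> carrier B"
  using subringE(1)[OF subring_R] by auto

lemma R_ops [simp]:
  "\<zero> \<in> R" "\<one> \<in> R" "r \<in> R ==> s \<in> R ==> r \<otimes> s \<in> R" "r \<in> R ==> s \<in> R ==> r \<oplus> s \<in> R"
  "r \<in> R ==> \<ominus> r \<in> R"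
  using subringE[OF subring_R] by auto

lemma R_minus [simp]: "r \<in> R ==> s \<in> R ==> r \<ominus> s \<in> R"
  by (simp add: a_minus_def)

lemma R_comm: "r \<in> R ==> b \<in> carrier B ==> b \<otimes> r = r \<otimes> b"
  using R_center by (auto simp: center_def)

lemma R_lcomm: "r \<in> R ==> a \<in> carrier B ==> b \<in> carrier B ==> a \<otimes> (r \<otimes> b) = r \<otimes> (a \<otimes> b)"
  by (simp add: m_assoc[symmetric] R_comm[of r a])

lemma R_mult_swap: "t \<in> R ==> a \<in> carrier B ==> b \<in> carrier B ==> (a \<otimes> b) \<otimes> t = (a \<otimes> t) \<otimes> b"
  using R_comm[of t b] by (simp add: m_assoc)

lemma R_cancel:
  assumes "r \<in> R" "r ~= \<zero>" "a \<in> carrier B" "b \<in> carrier B" "r \<otimes> a = r \<otimes> b"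
  shows "a = b"
proof -
  have "r \<otimes> (a \<ominus> b) = \<zero>"
    using assms by (simp add: a_minus_def r_distr r_minus r_neg)
  then have "a \<ominus> b = \<zero>" using torsion_free[of r "a \<ominus> b"] assms by simp
  then show ?thesis using assms by simp
qed

sublocale R: domain RR by (rule domain_R)

lemma one_not_zero_B: "\<one> ~= \<zero>"
  using R.one_not_zero by simp

lemma R_integral: "r \<in> R ==> s \<in> R ==> r \<otimes> s = \<zero> ==> r = \<zero> \<or> s = \<zero>"
  using R.integral[of r s] by simp

end

text \<open>No assumption is added. The fraction field, the localization and B_F are attached only
  here, so that arguments about functionals can stay in \<open>central_domain\<close>.\<close>

locale central_fractions = central_domain B R
  for B :: "('a, 'n) ring_scheme" (structure) and R :: "'a set"
begin

sublocale LB: central_localization B "R - {\<zero>}"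
  by unfold_locales (auto simp: R_comm one_not_zero_B dest: R_integral torsion_free)

sublocale LR: central_localization RR "R - {\<zero>}"
  using central_localization_domain[OF domain_R] by simp

lemma F_eq: "F = localization RR (R - {\<zero>})"
  by (simp add: frac_field_def)

sublocale F: field F
  using field_localization_domain[OF domain_R] by (simp add: frac_field_def)

lemma F_simps [simp]:
  "r \<in> R ==> s \<in> R ==> s ~= \<zero> ==> fr r s \<in> carrier F"
  "r \<in> R ==> s \<in> R ==> s ~= \<zero> ==> r' \<in> R ==> s' \<in> R ==> s' ~= \<zero> ==>
    fr r s \<otimes>\<^bsub>F\<^esub> fr r' s' = fr (r \<otimes> r') (s \<otimes> s')"
  "r \<in> R ==> s \<in> R ==> s ~= \<zero> ==> r' \<in> R ==> s' \<in> R ==> s' ~= \<zero> ==>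
    fr r s \<oplus>\<^bsub>F\<^esub> fr r' s' = fr (r \<otimes> s' \<oplus> r' \<otimes> s) (s \<otimes> s')"
  using LR.cls_closed[of r s] LR.mult_cls[of r s r' s'] LR.add_cls[of r s r' s'] by (simp_all add: F_eq)

lemma F_one: "\<one>\<^bsub>F\<^esub> = fr \<one> \<one>" and F_zero: "\<zero>\<^bsub>F\<^esub> = fr \<zero> \<one>"
  using LR.one_L LR.zero_L by (simp_all add: F_eq)

lemma F_cases:
  assumes "f \<in> carrier F" obtains r s where "r \<in> R" "s \<in> R" "s ~= \<zero>" "f = fr r s"
  using assms LR.carrier_L[of f] by (auto simp: F_eq)

lemma fr_eq_iff:
  "r \<in> R ==> s \<in> R ==> s ~= \<zero> ==> r' \<in> R ==> s' \<in> R ==> s' ~= \<zero> ==>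
    fr r s = fr r' s' \<longleftrightarrow> r \<otimes> s' = r' \<otimes> s"
  using LR.cls_eq_iff[of r s r' s'] by simp

lemma frac_embed_eq: "frac_embed B R r = fr r \<one>"
  by (simp add: frac_embed_def)

lemma frac_embed_simps [simp]:
  "r \<in> R ==> frac_embed B R r \<in> carrier F"
  "r \<in> R ==> s \<in> R ==> frac_embed B R (r \<oplus> s) = frac_embed B R r \<oplus>\<^bsub>F\<^esub> frac_embed B R s"
  "r \<in> R ==> s \<in> R ==> frac_embed B R (r \<otimes> s) = frac_embed B R r \<otimes>\<^bsub>F\<^esub> frac_embed B R s"
  "frac_embed B R \<one> = \<one>\<^bsub>F\<^esub>" "frac_embed B R \<zero> = \<zero>\<^bsub>F\<^esub>"
  "r \<in> R ==> s \<in> R ==> frac_embed B R r = frac_embed B R s \<longleftrightarrow> r = s"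
  by (auto simp: frac_embed_eq one_not_zero_B F_one F_zero fr_eq_iff)

sublocale X: tensor_pair RR "algebra_via (%r. r) B" "algebra_via (frac_embed B R) F"
proof
  show "assoc_algebra RR (algebra_via (%r. r) B)"
    by (rule assoc_algebra_via) (use R.is_cring ring_axioms R_comm in auto)
  show "assoc_algebra RR (algebra_via (frac_embed B R) F)"
    by (rule assoc_algebra_via) (use R.is_cring F.ring_axioms F.m_comm in auto)
qed

lemma E_eq: "E = tensor_algebra RR (algebra_via (%r. r) B) (algebra_via (frac_embed B R) F)"
  by (simp add: frac_ext_def)

sublocale E: ring E
  unfolding frac_ext_def by (rule X.T.ring_axioms)

abbreviation "ft \<equiv> frac_tensor B R"

lemma ft_simps:
  "b \<in> carrier B ==> f \<in> carrier F ==> ft b f \<in> carrier E"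
  "b \<in> carrier B ==> b' \<in> carrier B ==> f \<in> carrier F ==> f' \<in> carrier F ==>
    ft b f \<otimes>\<^bsub>E\<^esub> ft b' f' = ft (b \<otimes> b') (f \<otimes>\<^bsub>F\<^esub> f')"
  "ft \<one> \<one>\<^bsub>F\<^esub> = \<one>\<^bsub>E\<^esub>"
  "b \<in> carrier B ==> b' \<in> carrier B ==> f \<in> carrier F ==> ft (b \<oplus> b') f = ft b f \<oplus>\<^bsub>E\<^esub> ft b' f"
  "b \<in> carrier B ==> f \<in> carrier F ==> f' \<in> carrier F ==> ft b (f \<oplus>\<^bsub>F\<^esub> f') = ft b f \<oplus>\<^bsub>E\<^esub> ft b f'"
  "r \<in> R ==> b \<in> carrier B ==> f \<in> carrier F ==> ft (r \<otimes> b) f = ft b (frac_embed B R r \<otimes>\<^bsub>F\<^esub> f)"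
  "f \<in> carrier F ==> ft \<zero> f = \<zero>\<^bsub>E\<^esub>"
  using X.tens_closed[of b f] X.tens_mult[of b f b' f'] X.tens_one X.tens_l_distr[of b b' f]
    X.tens_r_distr[of b f f'] X.tens_balanced[of r b f] X.tens_zero(1)[of f]
  by (simp_all add: E_eq frac_tensor_def)

lemma ft_fr:
  assumes "b \<in> carrier B" "r \<in> R" "s \<in> R" "s ~= \<zero>"
  shows "ft b (fr r s) = ft (r \<otimes> b) (fr \<one> s)"
  using assms one_not_zero_B by (simp add: ft_simps(6) frac_embed_eq)

text \<open>Finitely many fractions have a common denominator s, so a sum of tensors over the
  fraction field collapses to b \<otimes> 1/s.\<close>

lemma E_cases:
  assumes "e \<in> carrier E"
  obtains b s where "b \<in> carrier B" "s \<in> R" "s ~= \<zero>" "e = ft b (fr \<one> s)"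
proof -
  have "e \<in> carrier X.T" using assms by (simp add: E_eq)
  then have "\<exists>b s. b \<in> carrier B & s \<in> R & s ~= \<zero> & e = ft b (fr \<one> s)"
  proof (induction rule: X.tensor_induct)
    case zero
    have "\<zero>\<^bsub>X.T\<^esub> = ft \<zero> (fr \<one> \<one>)"
      using ft_simps(7)[of "fr \<one> \<one>"] one_not_zero_B by (simp add: E_eq)
    then show ?case using one_not_zero_B R_ops zero_closed by blast
  next
    case (tens b f)
    then have "f \<in> carrier F" by simp
    then obtain r s where "r \<in> R" "s \<in> R" "s ~= \<zero>" "f = fr r s" by (rule F_cases)
    then have "r \<otimes> b \<in> carrier B & s \<in> R & s ~= \<zero> & X.tens b f = ft (r \<otimes> b) (fr \<one> s)"
      using tens ft_fr[of b r s] by (auto simp: frac_tensor_def)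
    then show ?case by blast
  next
    case (add e e')
    then obtain b s b' s' where b: "b \<in> carrier B" "s \<in> R" "s ~= \<zero>" "e = ft b (fr \<one> s)"
      "b' \<in> carrier B" "s' \<in> R" "s' ~= \<zero>" "e' = ft b' (fr \<one> s')" by auto
    have ss: "s \<otimes> s' ~= \<zero>" using b R_integral by blast
    have "fr \<one> s = fr s' (s \<otimes> s')" "fr \<one> s' = fr s (s \<otimes> s')"
      using b ss R_comm by (auto simp: fr_eq_iff)
    then have "e = ft (s' \<otimes> b) (fr \<one> (s \<otimes> s'))" "e' = ft (s \<otimes> b') (fr \<one> (s \<otimes> s'))"
      using b ss ft_fr[of b s' "s \<otimes> s'"] ft_fr[of b' s "s \<otimes> s'"] by auto
    then have "e \<oplus>\<^bsub>X.T\<^esub> e' = ft (s' \<otimes> b \<oplus> s \<otimes> b') (fr \<one> (s \<otimes> s'))"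
      using b ss by (simp add: ft_simps(4) E_eq[symmetric])
    moreover have "s' \<otimes> b \<oplus> s \<otimes> b' \<in> carrier B" "s \<otimes> s' \<in> R" using b by auto
    ultimately show ?case using ss by iprover
  qed
  then show ?thesis using that by blast
qed

text \<open>The map x \<otimes> r/t -> rx/t from B \<otimes> F to the localization of
  \<open>B\<close> detects the element, since \<open>B\<close> is torsion free. This is what makes B
  -> B_F injective.\<close>

lemma ft_fraction_zero:
  assumes b: "b \<in> carrier B" and s: "s \<in> R" "s ~= \<zero>" and eq: "ft b (fr \<one> s) = \<zero>\<^bsub>E\<^esub>"
  shows "b = \<zero>"
proof -
  interpret L: ring "localization B (R - {\<zero>})" by (rule LB.ring_L)
  \<comment> \<open>A fraction is a set of pairs, so the value is chosen through some
    representative; the fact \<open>h\<close> below shows that the choice is immaterial.\<close>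
  define h where "h x f = (SOME y. \<exists>r\<in>R. \<exists>t\<in>R - {\<zero>}. f = fr r t & y = loc_class B (R - {\<zero>}) (r \<otimes> x) t)"
    for x f
  have h: "h x (fr r t) = LB.cls (r \<otimes> x) t" if "x \<in> carrier B" "r \<in> R" "t \<in> R" "t ~= \<zero>" for x r t
  proof -
    have "\<exists>r'\<in>R. \<exists>t'\<in>R - {\<zero>}. fr r t = fr r' t' & h x (fr r t) = LB.cls (r' \<otimes> x) t'"
      unfolding h_def by (rule someI[of _ "LB.cls (r \<otimes> x) t"]) (use that in blast)
    then obtain r' t' where *: "r' \<in> R" "t' \<in> R" "t' ~= \<zero>" "fr r t = fr r' t'" "h x (fr r t) = LB.cls (r' \<otimes> x) t'"
      by blast
    then have rt: "r \<otimes> t' = r' \<otimes> t" using that by (simp add: fr_eq_iff)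
    have "(r \<otimes> x) \<otimes> t' = (r \<otimes> t') \<otimes> x" "(r' \<otimes> x) \<otimes> t = (r' \<otimes> t) \<otimes> x"
      using that * by (auto intro: R_mult_swap)
    then have "LB.cls (r \<otimes> x) t = LB.cls (r' \<otimes> x) t'"
      using that * rt by (simp add: LB.cls_eq_iff)
    then show ?thesis using * by simp
  qed
  obtain g where g: "!!e. e \<in> carrier X.T ==> g e \<in> carrier LB.L"
    "!!e e'. e \<in> carrier X.T ==> e' \<in> carrier X.T ==> g (e \<oplus>\<^bsub>X.T\<^esub> e') = g e \<oplus>\<^bsub>LB.L\<^esub> g e'"
    "!!x f. x \<in> carrier B ==> f \<in> carrier F ==> g (ft x f) = h x f"
  proof (rule X.tensor_universal[OF L.abelian_group_axioms, of h], goal_cases)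
    case (1 x f)
    then have "f \<in> carrier F" by simp
    then show ?case using 1 by (cases rule: F_cases) (auto simp: h)
  next
    case (2 x x' f)
    then have "f \<in> carrier F" by simp
    then show ?case using 2 by (cases rule: F_cases) (auto simp: h LB.add_cls_same r_distr)
  next
    case (3 x f f')
    then have "f \<in> carrier F" "f' \<in> carrier F" by auto
    obtain r t where 1: "r \<in> R" "t \<in> R" "t ~= \<zero>" "f = fr r t"
      using \<open>f \<in> carrier F\<close> by (rule F_cases)
    obtain r' t' where 2: "r' \<in> R" "t' \<in> R" "t' ~= \<zero>" "f' = fr r' t'"
      using \<open>f' \<in> carrier F\<close> by (rule F_cases)
    note * = 1 2
    then have "t \<otimes> t' ~= \<zero>" using R_integral by blast
    moreover have "(r \<otimes> x) \<otimes> t' = r \<otimes> t' \<otimes> x" "(r' \<otimes> x) \<otimes> t = r' \<otimes> t \<otimes> x"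
      using * 3 by (auto intro: R_mult_swap)
    ultimately show ?case using * 3 by (simp add: h LB.add_cls l_distr)
  next
    case (4 c x f)
    then have "f \<in> carrier F" by simp
    then show ?case using 4 one_not_zero_B
      by (cases rule: F_cases) (auto simp: h frac_embed_eq m_assoc R_comm R_lcomm)
  next
    case (5 g)
    then show ?case using that[of g] by (simp add: frac_tensor_def)
  qed
  have "\<zero>\<^bsub>E\<^esub> = ft \<zero> (fr \<one> s)" using s by (simp add: ft_simps)
  then have "g (ft b (fr \<one> s)) = g (ft \<zero> (fr \<one> s))" using eq by simp
  then have "LB.cls b s = LB.cls \<zero> s" using b s by (simp add: g(3) h)
  then show ?thesis using b s torsion_free[of s b] R_comm[of s b] by (auto simp: LB.cls_eq_iff)
qed

abbreviation "el \<equiv> ext_elem B R"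
abbreviation "sc \<equiv> ext_scalar B R"

lemma ext_elem_simps [simp]:
  "b \<in> carrier B ==> el b \<in> carrier E"
  "b \<in> carrier B ==> b' \<in> carrier B ==> el (b \<oplus> b') = el b \<oplus>\<^bsub>E\<^esub> el b'"
  "b \<in> carrier B ==> b' \<in> carrier B ==> el (b \<otimes> b') = el b \<otimes>\<^bsub>E\<^esub> el b'"
  "el \<one> = \<one>\<^bsub>E\<^esub>" "el \<zero> = \<zero>\<^bsub>E\<^esub>"
  by (simp_all add: ext_elem_def ft_simps)

lemma ext_elem_hom: "el \<in> Ring.ring_hom B E"
  by (rule ring_hom_memI) auto

lemma ext_elem_zero: "b \<in> carrier B ==> el b = \<zero>\<^bsub>E\<^esub> ==> b = \<zero>"
  using ft_fraction_zero[of b \<one>] one_not_zero_B by (simp add: ext_elem_def F_one)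

lemma ext_scalar_frac_embed: "r \<in> R ==> sc (frac_embed B R r) = el r"
  using ft_simps(6)[of r \<one> "\<one>\<^bsub>F\<^esub>"] by (simp add: ext_scalar_def ext_elem_def)

lemma ext_scalar_mult_elem:
  "f \<in> carrier F ==> b \<in> carrier B ==> sc f \<otimes>\<^bsub>E\<^esub> el b = ft b f"
  by (simp add: ext_scalar_def ext_elem_def ft_simps)

sublocale S: central_scalars F E sc
proof
  show "sc \<in> Ring.ring_hom F E"
    by (rule ring_hom_memI) (auto simp: ext_scalar_def ft_simps)
  show "\<one>\<^bsub>E\<^esub> ~= \<zero>\<^bsub>E\<^esub>"
    using ext_elem_zero[of \<one>] one_not_zero_B by auto
  fix f e assume f: "f \<in> carrier F" and e: "e \<in> carrier E"
  from e obtain b s where b: "b \<in> carrier B" "s \<in> R" "s ~= \<zero>" "e = ft b (fr \<one> s)" by (rule E_cases)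
  then show "sc f \<otimes>\<^bsub>E\<^esub> e = e \<otimes>\<^bsub>E\<^esub> sc f"
    using f by (simp add: ext_scalar_def ft_simps F.m_comm)
qed

lemma ext_basis_iff:
  "ext_basis B R us \<longleftrightarrow> set us \<subseteq> carrier E & S.basis (length us) ((!) us)"
  unfolding ext_basis_def ext_scalars_def using S.list_basis[of us] by auto

lemma rank_eq: "ext_basis B R us ==> rank B R = length us"
  unfolding ext_basis_iff rank_def ext_scalars_def using S.basis_dim by auto

text \<open>Uniqueness in the definition of the trace: any two bases have the common length
  \<open>rank B R\<close>, so \<open>trace_unique\<close> compares them.\<close>

lemma regular_trace_eq:
  assumes us: "ext_basis B R us" and x: "x \<in> carrier B"
    and c: "!!i j. i < length us ==> j < length us ==> c i j \<in> carrier F"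
      "!!j. j < length us ==> el x \<otimes>\<^bsub>E\<^esub> us ! j = S.comb (length us) (%i. c i j) ((!) us)"
  shows "regular_trace B R x = (\<Oplus>\<^bsub>F\<^esub>i\<in>{..<length us}. c i i)"
  unfolding regular_trace_def
proof (rule the_equality)
  show "\<exists>us' c'. ext_basis B R us' & (\<forall>i<length us'. \<forall>j<length us'. c' i j \<in> carrier F) &
      (\<forall>j<length us'. el x \<otimes>\<^bsub>E\<^esub> us' ! j = (\<Oplus>\<^bsub>E\<^esub>i\<in>{..<length us'}. sc (c' i j) \<otimes>\<^bsub>E\<^esub> us' ! i)) &
      (\<Oplus>\<^bsub>F\<^esub>i\<in>{..<length us}. c i i) = (\<Oplus>\<^bsub>F\<^esub>i\<in>{..<length us'}. c' i i)"
    by (rule exI[of _ us], rule exI[of _ c]) (use us c in \<open>simp add: S.comb_def\<close>)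
  fix t assume "\<exists>us c. ext_basis B R us & (\<forall>i<length us. \<forall>j<length us. c i j \<in> carrier F) &
      (\<forall>j<length us. el x \<otimes>\<^bsub>E\<^esub> us ! j = (\<Oplus>\<^bsub>E\<^esub>i\<in>{..<length us}. sc (c i j) \<otimes>\<^bsub>E\<^esub> us ! i)) &
      t = (\<Oplus>\<^bsub>F\<^esub>i\<in>{..<length us}. c i i)"
  then obtain vs d where vs: "ext_basis B R vs" and d: "\<forall>i<length vs. \<forall>j<length vs. d i j \<in> carrier F"
      "\<forall>j<length vs. el x \<otimes>\<^bsub>E\<^esub> vs ! j = S.comb (length vs) (%i. d i j) ((!) vs)"
      "t = (\<Oplus>\<^bsub>F\<^esub>i\<in>{..<length vs}. d i i)"
    by (auto simp: S.comb_def)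
  have len: "length vs = length us" using rank_eq[OF us] rank_eq[OF vs] by simp
  show "t = (\<Oplus>\<^bsub>F\<^esub>i\<in>{..<length us}. c i i)"
    unfolding d(3) len
    by (rule S.trace_unique[of _ "(!) vs" "(!) us" "el x"])
      (use us vs x c d len in \<open>auto simp: ext_basis_iff\<close>)
qed

end

section \<open>More on determinants and additive spans\<close>

lemma (in ring_hom_cring) hom_ring_det:
  assumes M: "!!i j. i < n ==> j < n ==> M i j \<in> carrier R"
  shows "h (ring_det R n M) = ring_det S n (%i j. h (M i j))"
proof -
  have c: "(\<Otimes>i\<in>{..<n}. M i (p i)) \<in> carrier R"
    and hp: "h (\<Otimes>i\<in>{..<n}. M i (p i)) = (\<Otimes>\<^bsub>S\<^esub>i\<in>{..<n}. h (M i (p i)))" if "p permutes {..<n}" for p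
  proof -
    have "(%i. M i (p i)) \<in> {..<n} \<rightarrow> carrier R"
      using M permutes_in_image[OF that] by auto
    then show "(\<Otimes>i\<in>{..<n}. M i (p i)) \<in> carrier R"
      "h (\<Otimes>i\<in>{..<n}. M i (p i)) = (\<Otimes>\<^bsub>S\<^esub>i\<in>{..<n}. h (M i (p i)))"
      by (auto simp: hom_finprod comp_def)
  qed
  have sgn: "h (add_pow R (sign p) x) = add_pow S (sign p) (h x)" if "x \<in> carrier R" for p :: "nat \<Rightarrow> nat" and x
    using that by (cases "sign p = 1") (auto simp: sign_def R.add.int_pow_neg S.add.int_pow_neg)
  have "h (ring_det R n M) =
      (\<Oplus>\<^bsub>S\<^esub>p\<in>{p. p permutes {..<n}}. h (add_pow R (sign p) (\<Otimes>i\<in>{..<n}. M i (p i))))"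
    unfolding ring_det_def by (subst hom_finsum) (auto simp: comp_def c intro!: R.add.int_pow_closed)
  also have "\<dots> = ring_det S n (%i j. h (M i j))"
    unfolding ring_det_def
  proof (rule S.finsum_cong')
    have "(%i. h (M i (p i))) \<in> {..<n} \<rightarrow> carrier S" if "p permutes {..<n}" for p
      using M permutes_in_image[OF that] by auto
    then show "(%p. add_pow S (sign p) (\<Otimes>\<^bsub>S\<^esub>i\<in>{..<n}. h (M i (p i)))) \<in> {p. p permutes {..<n}} \<rightarrow> carrier S"
      by (auto intro!: S.add.int_pow_closed S.finprod_closed)
  qed (auto simp: sgn c hp)
  finally show ?thesis .
qed

text \<open>In the Leibniz expansion the row factors do not depend on the permutation, and the
  column factors cease to do so after reindexing.\<close>

lemma (in cring) ring_det_scale: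
  assumes M: "!!i j. i < n ==> j < n ==> M i j \<in> carrier R"
    and p: "!!i. i < n ==> p i \<in> carrier R" and q: "!!i. i < n ==> q i \<in> carrier R"
  shows "ring_det R n (%i j. p i \<otimes> M i j \<otimes> q j) =
    (\<Otimes>i\<in>{..<n}. p i) \<otimes> (\<Otimes>i\<in>{..<n}. q i) \<otimes> ring_det R n M"
proof -
  have trm: "(\<Otimes>i\<in>{..<n}. p i \<otimes> M i (s i) \<otimes> q (s i)) =
      (\<Otimes>i\<in>{..<n}. p i) \<otimes> (\<Otimes>i\<in>{..<n}. q i) \<otimes> (\<Otimes>i\<in>{..<n}. M i (s i))" (is ?eq)
    and trm_closed: "(\<Otimes>i\<in>{..<n}. M i (s i)) \<in> carrier R" if s: "s permutes {..<n}" for s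
  proof -
    have sn: "s i < n" if "i < n" for i using permutes_in_image[OF s, of i] that by simp
    have "(\<Otimes>i\<in>{..<n}. q (s i)) = (\<Otimes>i\<in>s ` {..<n}. q i)"
      by (rule finprod_reindex[symmetric]) (use q sn permutes_inj_on[OF s] in auto)
    then have "(\<Otimes>i\<in>{..<n}. q (s i)) = (\<Otimes>i\<in>{..<n}. q i)"
      by (simp add: permutes_image[OF s])
    moreover have "(\<Otimes>i\<in>{..<n}. p i \<otimes> M i (s i) \<otimes> q (s i)) =
        (\<Otimes>i\<in>{..<n}. p i) \<otimes> (\<Otimes>i\<in>{..<n}. M i (s i)) \<otimes> (\<Otimes>i\<in>{..<n}. q (s i))"
    proof -
      have "(\<Otimes>i\<in>{..<n}. p i \<otimes> M i (s i) \<otimes> q (s i)) =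
          (\<Otimes>i\<in>{..<n}. p i \<otimes> M i (s i)) \<otimes> (\<Otimes>i\<in>{..<n}. q (s i))"
        by (rule finprod_multf) (use p q M sn in auto)
      also have "(\<Otimes>i\<in>{..<n}. p i \<otimes> M i (s i)) = (\<Otimes>i\<in>{..<n}. p i) \<otimes> (\<Otimes>i\<in>{..<n}. M i (s i))"
        by (rule finprod_multf) (use p M sn in auto)
      finally show ?thesis .
    qed
    ultimately show ?eq
      using p q M sn by (simp add: m_ac finprod_closed Pi_def)
    show "(\<Otimes>i\<in>{..<n}. M i (s i)) \<in> carrier R" using M sn by (auto intro!: finprod_closed)
  qed
  have P: "(\<Otimes>i\<in>{..<n}. p i) \<otimes> (\<Otimes>i\<in>{..<n}. q i) \<in> carrier R"
    using p q by (auto intro!: finprod_closed)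
  show ?thesis
    unfolding ring_det_def using P trm_closed
    by (subst finsum_rdistr) (auto simp: trm add_pow_rdistr_int finite_permutations
        intro!: finsum_cong' add.int_pow_closed)
qed

section \<open>Additive spans, and determinants with entries in them\<close>

context ring
begin

abbreviation "aspan V \<equiv> generate (add_monoid R) V"

lemma aspan_closed: "V \<subseteq> carrier R ==> x \<in> aspan V ==> x \<in> carrier R"
  using group.generate_incl[OF a_group, of V] by auto

lemma aspan_incl: "x \<in> V ==> x \<in> aspan V"
  by (rule generate.incl)

lemma aspan_zero: "\<zero> \<in> aspan V"
  using generate.one[of "add_monoid R" V] by simp

lemma aspan_add: "x \<in> aspan V ==> y \<in> aspan V ==> x \<oplus> y \<in> aspan V"
  using generate.eng[of x "add_monoid R" V y] by simp

lemma aspan_minus: "V \<subseteq> carrier R ==> x \<in> aspan V ==> \<ominus> x \<in> aspan V"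
  using group.generate_m_inv_closed[OF a_group, of V x] by (simp add: a_inv_def)

lemma aspan_induct [consumes 2, case_names incl zero minus add]:
  assumes "V \<subseteq> carrier R" "x \<in> aspan V"
    and "!!x. x \<in> V ==> P x" "P \<zero>" "!!x. x \<in> V ==> P x ==> P (\<ominus> x)"
    "!!x y. x \<in> aspan V ==> y \<in> aspan V ==> P x ==> P y ==> P (x \<oplus> y)"
  shows "P x"
  using assms(2)
proof induction
  case (inv h)
  then show ?case using assms(3,5) unfolding a_inv_def[symmetric] by blast
qed (use assms in auto)

lemma aspan_finsum:
  assumes "finite I" "V \<subseteq> carrier R" "!!i. i \<in> I ==> f i \<in> aspan V"
  shows "(\<Oplus>i\<in>I. f i) \<in> aspan V"
  using assms(1,3)
proof (induction I rule: finite_induct)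
  case (insert i I)
  then show ?case
    using aspan_closed[OF assms(2)] by (subst finsum_insert) (auto intro: aspan_add)
qed (simp add: aspan_zero)

lemma aspan_mult:
  assumes V: "V \<subseteq> carrier R" and W: "W \<subseteq> carrier R" and x: "x \<in> aspan V" and y: "y \<in> aspan W"
    and Z: "Z \<subseteq> carrier R" and VW: "!!a b. a \<in> V ==> b \<in> W ==> a \<otimes> b \<in> aspan Z"
  shows "x \<otimes> y \<in> aspan Z"
  using V x
proof (induction rule: aspan_induct)
  case (incl a)
  show ?case using W y
  proof (induction rule: aspan_induct)
    case (minus b)
    then have "a \<in> carrier R" "b \<in> carrier R" using V W incl by auto
    then show ?case using minus aspan_minus[OF Z, of "a \<otimes> b"] by (simp add: r_minus)
  next
    case (add u v)
    then show ?case using V incl aspan_closed[OF W] by (auto simp: r_distr aspan_add)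
  qed (use VW incl V aspan_zero in auto)
next
  case (minus a)
  then have "a \<in> carrier R" using V by auto
  then show ?case using minus aspan_closed[OF W y] aspan_minus[OF Z, of "a \<otimes> y"] by (simp add: l_minus)
next
  case (add u v)
  then show ?case using aspan_closed[OF V] aspan_closed[OF W y] by (auto simp: l_distr aspan_add)
qed (use aspan_closed[OF W y] aspan_zero in auto)

end

lemma (in cring) aspan_finprod:
  assumes "finite I" "!!i. i \<in> I ==> G i \<subseteq> carrier R" "!!i. i \<in> I ==> x i \<in> aspan (G i)"
  shows "(\<Otimes>i\<in>I. x i) \<in> aspan {\<Otimes>i\<in>I. g i | g. \<forall>i\<in>I. g i \<in> G i}"
  using assms
proof (induction I rule: finite_induct)
  case empty
  then show ?case by (auto intro!: aspan_incl)
next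
  case (insert i I)
  let ?P = "%I. {\<Otimes>i\<in>I. g i | g. \<forall>i\<in>I. g i \<in> G i}"
  have c: "?P I \<subseteq> carrier R" "?P (insert i I) \<subseteq> carrier R"
    using insert.prems(1) by (auto intro!: finprod_closed)
  have "x i \<otimes> (\<Otimes>i\<in>I. x i) \<in> aspan (?P (insert i I))"
  proof (rule aspan_mult[OF _ c(1) _ _ c(2)])
    fix a b assume a: "a \<in> G i" and "b \<in> ?P I"
    then obtain g where g: "b = (\<Otimes>i\<in>I. g i)" "\<forall>i\<in>I. g i \<in> G i" by auto
    have "a \<otimes> b = (\<Otimes>j\<in>insert i I. (g(i := a)) j)"
    proof -
      have gc: "!!j. j \<in> I ==> g j \<in> carrier R" using g insert.prems(1) by blast
      have ac: "a \<in> carrier R" using a insert.prems(1) by blast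
      have "(\<Otimes>j\<in>insert i I. (g(i := a)) j) = (g(i := a)) i \<otimes> (\<Otimes>j\<in>I. (g(i := a)) j)"
        by (rule finprod_insert) (use insert.hyps gc ac in auto)
      also have "(\<Otimes>j\<in>I. (g(i := a)) j) = (\<Otimes>j\<in>I. g j)"
        by (rule finprod_cong') (use insert.hyps gc in auto)
      finally show ?thesis using g by simp
    qed
    moreover have "\<forall>j\<in>insert i I. (g(i := a)) j \<in> G j" using a g by auto
    ultimately show "a \<otimes> b \<in> aspan (?P (insert i I))"
      by (intro aspan_incl) blast
  qed (use insert in auto)
  moreover have "(\<Otimes>i\<in>insert i I. x i) = x i \<otimes> (\<Otimes>i\<in>I. x i)"
  proof (rule finprod_insert)
    have "x j \<in> carrier R" if "j \<in> insert i I" for j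
      by (rule aspan_closed[OF insert.prems(1)[OF that] insert.prems(2)[OF that]])
    then show "x \<in> I \<rightarrow> carrier R" "x i \<in> carrier R" by auto
  qed (use insert.hyps in auto)
  ultimately show ?case by simp
qed

lemma (in cring) aspan_sign:
  assumes "V \<subseteq> carrier R" "x \<in> aspan V"
  shows "add_pow R (sign p) x \<in> aspan V"
  using assms aspan_minus[OF assms] aspan_closed[OF assms]
  by (cases "sign p = 1") (auto simp: sign_def add.int_pow_neg)

text \<open>Each term of the Leibniz expansion takes one entry from every row, hence one factor from
  every span.\<close>

lemma (in cring) ring_det_in_aspan_rows:
  assumes G: "!!i. i < n ==> G i \<subseteq> carrier R"
    and M: "!!i j. i < n ==> j < n ==> M i j \<in> aspan (G i)"
  shows "ring_det R n M \<in> aspan {\<Otimes>i\<in>{..<n}. g i | g. \<forall>i<n. g i \<in> G i}"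
proof -
  let ?V = "{\<Otimes>i\<in>{..<n}. g i | g. \<forall>i<n. g i \<in> G i}"
  have V: "?V \<subseteq> carrier R" using G by (auto intro!: finprod_closed)
  have "(\<Otimes>i\<in>{..<n}. M i (p i)) \<in> aspan {\<Otimes>i\<in>{..<n}. g i | g. \<forall>i\<in>{..<n}. g i \<in> G i}"
    if "p permutes {..<n}" for p
    by (rule aspan_finprod) (use G M permutes_in_image[OF that] in auto)
  moreover have "{\<Otimes>i\<in>{..<n}. g i | g. \<forall>i\<in>{..<n}. g i \<in> G i} = ?V" by auto
  ultimately have "add_pow R (sign p) (\<Otimes>i\<in>{..<n}. M i (p i)) \<in> aspan ?V" if "p permutes {..<n}" for p
    using that by (intro aspan_sign[OF V]) simp
  then show ?thesis
    unfolding ring_det_def by (intro aspan_finsum V) (auto simp: finite_permutations)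
qed

text \<open>As for rows, after reindexing each Leibniz term by the inverse permutation. Both
  versions occur: of the two coordinate determinants in \<open>disc_expand\<close>, one carries the
  basis index on its columns and the other on its rows.\<close>

lemma (in cring) ring_det_in_aspan_cols:
  assumes G: "!!i. i < n ==> G i \<subseteq> carrier R"
    and M: "!!i j. i < n ==> j < n ==> M i j \<in> aspan (G j)"
  shows "ring_det R n M \<in> aspan {\<Otimes>i\<in>{..<n}. g i | g. \<forall>i<n. g i \<in> G i}"
proof -
  let ?V = "{\<Otimes>i\<in>{..<n}. g i | g. \<forall>i<n. g i \<in> G i}"
  have V: "?V \<subseteq> carrier R" using G by (auto intro!: finprod_closed)
  have "(\<Otimes>i\<in>{..<n}. M i (p i)) \<in> aspan {\<Otimes>i\<in>{..<n}. g i | g. \<forall>i\<in>{..<n}. g i \<in> G i}"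
    if p: "p permutes {..<n}" for p
  proof -
    have pn: "inv_into UNIV p i < n" if "i < n" for i
      using permutes_in_image[OF permutes_inv[OF p], of i] that by simp
    have Mc: "M i j \<in> carrier R" if "i < n" "j < n" for i j
      using aspan_closed[OF G M] that by blast
    have "(\<Otimes>i\<in>{..<n}. M i (p i)) = (\<Otimes>i\<in>{..<n}. M (inv_into UNIV p (p i)) (p i))"
      using permutes_in_image[OF p] Mc by (intro finprod_cong') (auto simp: permutes_inverses[OF p])
    also have "\<dots> = (\<Otimes>j\<in>p ` {..<n}. M (inv_into UNIV p j) j)"
      by (rule finprod_reindex[symmetric]) (use Mc pn permutes_in_image[OF p] permutes_inj_on[OF p] in auto)
    also have "p ` {..<n} = {..<n}" by (rule permutes_image[OF p])
    finally show ?thesis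
      using G M pn by (auto intro!: aspan_finprod)
  qed
  moreover have "{\<Otimes>i\<in>{..<n}. g i | g. \<forall>i\<in>{..<n}. g i \<in> G i} = ?V" by auto
  ultimately have "add_pow R (sign p) (\<Otimes>i\<in>{..<n}. M i (p i)) \<in> aspan ?V" if "p permutes {..<n}" for p
    using that by (intro aspan_sign[OF V]) simp
  then show ?thesis
    unfolding ring_det_def by (intro aspan_finsum V) (auto simp: finite_permutations)
qed

section \<open>Coordinates with respect to a quasi-basis\<close>

context central_domain
begin

lemma finsum_RR:
  assumes "finite I" "!!i. i \<in> I ==> f i \<in> R"
  shows "finsum RR f I = finsum B f I" "finsum RR f I \<in> R"
proof -
  have "finsum RR f I = finsum B f I & finsum RR f I \<in> R"
    using assms
  proof (induction I rule: finite_induct)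
    case empty
    then show ?case using R.finsum_empty[of f] by simp
  next
    case (insert i I)
    have "finsum RR f (insert i I) = f i \<oplus>\<^bsub>RR\<^esub> finsum RR f I"
      by (rule R.finsum_insert) (use insert in auto)
    then show ?case using insert by (subst finsum_insert) auto
  qed
  then show "finsum RR f I = finsum B f I" "finsum RR f I \<in> R" by auto
qed

lemma additive_finsum:
  assumes g: "!!x. x \<in> carrier B ==> g x \<in> R"
    "!!x y. x \<in> carrier B ==> y \<in> carrier B ==> g (x \<oplus> y) = g x \<oplus> g y"
    and I: "finite I" "!!i. i \<in> I ==> f i \<in> carrier B"
  shows "g (finsum B f I) = finsum RR (%i. g (f i)) I"
  using I
proof (induction I rule: finite_induct)
  case empty
  have "g \<zero> \<oplus> g \<zero> = g \<zero>" using g(2)[of \<zero> \<zero>] by simp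
  then have "g \<zero> = \<zero>" using g(1)[of \<zero>] R_closed by (metis add.l_cancel_one' zero_closed)
  then show ?case using R.finsum_empty[of "%i. g (f i)"] by simp
next
  case (insert i I)
  have "finsum RR (%i. g (f i)) (insert i I) = g (f i) \<oplus>\<^bsub>RR\<^esub> finsum RR (%i. g (f i)) I"
    by (rule R.finsum_insert) (use insert g in auto)
  then show ?case using insert g by (subst finsum_insert) (auto intro!: finsum_closed)
qed

lemma RR_minus: "r \<in> R ==> \<ominus>\<^bsub>RR\<^esub> r = \<ominus> r"
  using R.minus_equality[of "\<ominus> r" r] by (simp add: l_neg)

end

context central_fractions
begin

sublocale frac: ring_hom_cring RR F "frac_embed B R"
  by (intro ring_hom_cringI R.is_cring F.is_cring ring_hom_memI) auto

lemma fr_sum: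
  assumes "finite I" "!!i. i \<in> I ==> m i \<in> R" "s \<in> R" "s ~= \<zero>"
  shows "(\<Oplus>\<^bsub>F\<^esub>i\<in>I. fr (m i) s) = fr (\<Oplus>\<^bsub>RR\<^esub>i\<in>I. m i) s"
  using assms(1,2)
proof (induction I rule: finite_induct)
  case empty
  then show ?case using assms(3,4) F_zero one_not_zero_B R.finsum_empty[of m] by (auto simp: fr_eq_iff)
next
  case (insert i I)
  have "(\<Oplus>\<^bsub>F\<^esub>i\<in>insert i I. fr (m i) s) = fr (m i) s \<oplus>\<^bsub>F\<^esub> fr (\<Oplus>\<^bsub>RR\<^esub>i\<in>I. m i) s"
    using insert assms(3,4) by (subst F.finsum_insert) auto
  also have "\<dots> = fr (m i \<oplus> (\<Oplus>\<^bsub>RR\<^esub>i\<in>I. m i)) s"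
    using LR.add_cls_same[of "m i" s "\<Oplus>\<^bsub>RR\<^esub>i\<in>I. m i"] insert assms(3,4) finsum_RR(2)[of I m]
    by (simp add: F_eq)
  also have "m i \<oplus> (\<Oplus>\<^bsub>RR\<^esub>i\<in>I. m i) = (\<Oplus>\<^bsub>RR\<^esub>i\<in>insert i I. m i)"
    using insert R.finsum_insert[of I i m] by simp
  finally show ?case .
qed

lemma common_denominator_family:
  fixes a :: "nat \<Rightarrow> ('a \<times> 'a) set"
  assumes "!!i. i < n ==> a i \<in> carrier F"
  obtains s r where "s \<in> R" "s ~= \<zero>" "!!i. i < n ==> r i \<in> R" "!!i. i < n ==> a i = fr (r i) s"
proof -
  have "\<exists>s r. s \<in> R & s ~= \<zero> & (\<forall>i<n. r i \<in> R & a i = fr (r i) s)"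
    using assms
  proof (induction n)
    case 0
    then show ?case using one_not_zero_B by (intro exI[of _ \<one>]) auto
  next
    case (Suc n)
    then obtain s r where s: "s \<in> R" "s ~= \<zero>" "\<forall>i<n. r i \<in> R & a i = fr (r i) s" by auto
    obtain q t where q: "q \<in> R" "t \<in> R" "t ~= \<zero>" "a n = fr q t"
      using Suc.prems[of n] F_cases by blast
    have st: "s \<otimes> t \<in> R" "s \<otimes> t ~= \<zero>" using s q R_integral[of s t] by auto
    define r' where "r' i = (if i = n then q \<otimes> s else r i \<otimes> t)" for i
    have "r' i \<in> R & a i = fr (r' i) (s \<otimes> t)" if "i < Suc n" for i
    proof (cases "i = n")
      case True
      have "q \<otimes> (s \<otimes> t) = (q \<otimes> s) \<otimes> t" using s q by (simp add: m_assoc)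
      then show ?thesis using True s q st by (simp add: r'_def fr_eq_iff)
    next
      case False
      then have i: "r i \<in> R" "a i = fr (r i) s" using s that by auto
      have "r i \<otimes> (s \<otimes> t) = r i \<otimes> t \<otimes> s" using s q i R_comm[of s t] by (simp add: m_assoc)
      then show ?thesis using False s q st i by (simp add: r'_def fr_eq_iff)
    qed
    then show ?case using st by blast
  qed
  then show ?thesis using that by blast
qed

end

text \<open>Denominator-free form of a quasi-basis: the C_i(y)/c are the coordinates of y over the
  fraction field, and \<open>C_split\<close> is what remains of the condition that generators are
  multiples of basis elements. Everything is stated by functions and equations inside
  \<open>B\<close>, so the data can be tensored directly.\<close>

locale quasi_coordinates = central_domain B R
  for B :: "('a, 'n) ring_scheme" (structure) and R :: "'a set" +
  fixes w :: nat and b :: "nat \<Rightarrow> 'a" and c :: 'a and C :: "nat \<Rightarrow> 'a \<Rightarrow> 'a"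
  assumes b_closed [simp]: "!!i. i < w ==> b i \<in> carrier B"
    and c_R [simp]: "c \<in> R" and c_nonzero: "c ~= \<zero>"
    and C_R [simp]: "!!i y. i < w ==> y \<in> carrier B ==> C i y \<in> R"
    and C_add: "!!i y z. i < w ==> y \<in> carrier B ==> z \<in> carrier B ==> C i (y \<oplus> z) = C i y \<oplus> C i z"
    and C_scale: "!!i r y. i < w ==> r \<in> R ==> y \<in> carrier B ==> C i (r \<otimes> y) = r \<otimes> C i y"
    and C_b: "!!i j. i < w ==> j < w ==> C i (b j) = (if i = j then c else \<zero>)"
    and C_sum: "!!y. y \<in> carrier B ==> c \<otimes> y = (\<Oplus>i\<in>{..<w}. C i y \<otimes> b i)"
    and C_split: "!!i y. i < w ==> y \<in> carrier B ==> \<exists>z\<in>carrier B. C i y \<otimes> b i = c \<otimes> z"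
begin

interpretation central_fractions B R by unfold_locales

lemma fr_c [simp]: "r \<in> R ==> fr r c \<in> carrier F"
  by (simp add: c_nonzero)

lemma ext_elem_expand:
  assumes y: "y \<in> carrier B"
  shows "el y = S.comb w (%i. fr (C i y) c) (%i. el (b i))"
proof -
  have 1: "sc (fr r c) = sc (fr \<one> c) \<otimes>\<^bsub>E\<^esub> el r" if "r \<in> R" for r
  proof -
    have "fr r c = fr \<one> c \<otimes>\<^bsub>F\<^esub> frac_embed B R r"
      using that c_nonzero one_not_zero_B by (simp add: frac_embed_eq fr_eq_iff)
    then have "sc (fr r c) = sc (fr \<one> c) \<otimes>\<^bsub>E\<^esub> sc (frac_embed B R r)"
      using that by (simp add: S.H.hom_mult)
    then show ?thesis using that by (simp add: ext_scalar_frac_embed)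
  qed
  interpret el: ring_hom_ring B E el
    by (rule ring_hom_ringI2[OF ring_axioms E.ring_axioms ext_elem_hom])
  have "S.comb w (%i. fr (C i y) c) (%i. el (b i)) = (\<Oplus>\<^bsub>E\<^esub>i\<in>{..<w}. sc (fr \<one> c) \<otimes>\<^bsub>E\<^esub> el (C i y \<otimes> b i))"
    unfolding S.comb_def
  proof (rule E.finsum_cong')
    fix i assume "i \<in> {..<w}"
    then show "sc (fr (C i y) c) \<otimes>\<^bsub>E\<^esub> el (b i) = sc (fr \<one> c) \<otimes>\<^bsub>E\<^esub> el (C i y \<otimes> b i)"
      using 1[of "C i y"] y by (simp add: E.m_assoc)
  qed (use y in auto)
  also have "\<dots> = sc (fr \<one> c) \<otimes>\<^bsub>E\<^esub> (\<Oplus>\<^bsub>E\<^esub>i\<in>{..<w}. el (C i y \<otimes> b i))"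
    by (rule E.finsum_rdistr[symmetric]) (use y in auto)
  also have "(\<Oplus>\<^bsub>E\<^esub>i\<in>{..<w}. el (C i y \<otimes> b i)) = el (c \<otimes> y)"
    unfolding C_sum[OF y] using y by (subst el.hom_finsum) (auto simp: comp_def)
  also have "sc (fr \<one> c) \<otimes>\<^bsub>E\<^esub> el (c \<otimes> y) = sc (fr c c) \<otimes>\<^bsub>E\<^esub> el y"
    using y by (simp add: 1[of c] E.m_assoc)
  also have "fr c c = \<one>\<^bsub>F\<^esub>"
    using c_nonzero one_not_zero_B by (simp add: F_one fr_eq_iff)
  finally show ?thesis using y by simp
qed

abbreviation "us \<equiv> map (%i. el (b i)) [0..<w]"

lemma comb_us: "(!!i. i < w ==> a i \<in> carrier F) ==> S.comb w a ((!) us) = S.comb w a (%i. el (b i))"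
  by (rule S.comb_cong) auto

text \<open>Spanning is \<open>ext_elem_expand\<close> scaled by 1/s. For independence, a relation
  is cleared of denominators, pulled back to \<open>B\<close> along the injective
  \<open>ext_elem\<close>, and read off by applying C_i, which turns it into r_i c = 0.\<close>

lemma basis_us: "ext_basis B R us"
proof -
  have span: "\<exists>a. (\<forall>i<w. a i \<in> carrier F) & e = S.comb w a ((!) us)" if e: "e \<in> carrier E" for e
  proof -
    obtain y s where y: "y \<in> carrier B" "s \<in> R" "s ~= \<zero>" "e = ft y (fr \<one> s)"
      using e by (rule E_cases)
    have s: "fr \<one> s \<in> carrier F" using y by simp
    let ?a = "%i. fr \<one> s \<otimes>\<^bsub>F\<^esub> fr (C i y) c"
    have a: "?a i \<in> carrier F" if "i < w" for i using that y s by (intro F.m_closed) auto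
    have "e = sc (fr \<one> s) \<otimes>\<^bsub>E\<^esub> el y" using y s by (simp add: ext_scalar_mult_elem)
    also have "\<dots> = (\<Oplus>\<^bsub>E\<^esub>i\<in>{..<w}. sc (fr \<one> s) \<otimes>\<^bsub>E\<^esub> (sc (fr (C i y) c) \<otimes>\<^bsub>E\<^esub> el (b i)))"
      unfolding ext_elem_expand[OF y(1)] S.comb_def
      by (rule E.finsum_rdistr) (use y s in auto)
    also have "\<dots> = S.comb w ?a (%i. el (b i))"
      unfolding S.comb_def
    proof (rule E.finsum_cong')
      fix i assume "i \<in> {..<w}"
      then have "fr (C i y) c \<in> carrier F" "el (b i) \<in> carrier E" using y by auto
      then show "sc (fr \<one> s) \<otimes>\<^bsub>E\<^esub> (sc (fr (C i y) c) \<otimes>\<^bsub>E\<^esub> el (b i)) = sc (?a i) \<otimes>\<^bsub>E\<^esub> el (b i)"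
        using s by (simp add: S.H.hom_mult E.m_assoc del: F_simps(2))
    qed (use a in auto)
    finally have e: "e = S.comb w ?a ((!) us)" by (simp only: comb_us[OF a])
    have "\<forall>i<w. ?a i \<in> carrier F" by (intro allI impI a)
    then show ?thesis by (rule exI[of _ ?a, OF conjI]) (rule e)
  qed
  have indep: "a i = \<zero>\<^bsub>F\<^esub>"
    if a: "\<forall>i<w. a i \<in> carrier F" and z: "S.comb w a ((!) us) = \<zero>\<^bsub>E\<^esub>" and i: "i < w" for a i
  proof -
    obtain s r where s: "s \<in> R" "s ~= \<zero>" and r: "!!i. i < w ==> r i \<in> R" "!!i. i < w ==> a i = fr (r i) s"
      using common_denominator_family[of w a] a by blast
    interpret el: ring_hom_ring B E el
      by (rule ring_hom_ringI2[OF ring_axioms E.ring_axioms ext_elem_hom])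
    have sa: "el s \<otimes>\<^bsub>E\<^esub> sc (a i) = el (r i)" if "i < w" for i
    proof -
      have "frac_embed B R s \<otimes>\<^bsub>F\<^esub> a i = frac_embed B R (r i)"
        using r[OF that] s one_not_zero_B R_comm[of s "r i"] by (simp add: frac_embed_eq fr_eq_iff)
      then have "sc (frac_embed B R s) \<otimes>\<^bsub>E\<^esub> sc (a i) = sc (frac_embed B R (r i))"
        using r[OF that] s a that by (metis S.H.hom_mult frac_embed_simps(1))
      then show ?thesis using r[OF that] s by (simp add: ext_scalar_frac_embed)
    qed
    have "\<zero>\<^bsub>E\<^esub> = el s \<otimes>\<^bsub>E\<^esub> S.comb w a (%i. el (b i))"
      using z s comb_us[of a] a by simp
    also have "\<dots> = (\<Oplus>\<^bsub>E\<^esub>i\<in>{..<w}. el s \<otimes>\<^bsub>E\<^esub> (sc (a i) \<otimes>\<^bsub>E\<^esub> el (b i)))"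
      unfolding S.comb_def by (rule E.finsum_rdistr) (use a s in auto)
    also have "\<dots> = (\<Oplus>\<^bsub>E\<^esub>i\<in>{..<w}. el (r i \<otimes> b i))"
      by (rule E.finsum_cong') (use a s r sa in \<open>auto simp: E.m_assoc[symmetric]\<close>)
    also have "\<dots> = el (\<Oplus>i\<in>{..<w}. r i \<otimes> b i)"
      using r(1) by (subst el.hom_finsum) (auto simp: comp_def)
    finally have "(\<Oplus>i\<in>{..<w}. r i \<otimes> b i) = \<zero>"
      using r(1) by (intro ext_elem_zero) (auto intro!: finsum_closed)
    then have "C i (\<Oplus>i\<in>{..<w}. r i \<otimes> b i) = C i \<zero>" by simp
    moreover have "C i (\<Oplus>i\<in>{..<w}. r i \<otimes> b i) = (\<Oplus>\<^bsub>RR\<^esub>j\<in>{..<w}. C i (r j \<otimes> b j))"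
      by (rule additive_finsum) (use i r C_add in auto)
    also have "\<dots> = (\<Oplus>\<^bsub>RR\<^esub>j\<in>{..<w}. if j = i then r i \<otimes> c else \<zero>)"
      by (rule R.finsum_cong') (use i r in \<open>auto simp: C_scale C_b\<close>)
    also have "\<dots> = r i \<otimes> c"
    proof -
      have "\<zero>\<^bsub>RR\<^esub> = \<zero>" by simp
      show ?thesis using R.finsum_delta[of "{..<w}" i "r i \<otimes> c"] i r unfolding \<open>\<zero>\<^bsub>RR\<^esub> = \<zero>\<close> by simp
    qed
    moreover have "C i \<zero> = \<zero>" using C_scale[of i \<zero> \<zero>] i by simp
    ultimately have "r i \<otimes> c = \<zero>" by simp
    then have "r i = \<zero>" using R_integral[of "r i" c] r i c_nonzero by auto
    then show ?thesis using r(2)[OF i] s one_not_zero_B by (simp add: F_zero fr_eq_iff)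
  qed
  have "S.basis w ((!) us)"
    unfolding S.basis_def using span indep by simp
  then show ?thesis unfolding ext_basis_iff by auto
qed

lemma rank_w: "rank B R = w"
  using rank_eq[OF basis_us] by simp

lemma regular_trace_coordinates:
  assumes x: "x \<in> carrier B"
  shows "regular_trace B R x = fr (\<Oplus>\<^bsub>RR\<^esub>i\<in>{..<w}. C i (x \<otimes> b i)) c"
proof -
  have "regular_trace B R x = (\<Oplus>\<^bsub>F\<^esub>i\<in>{..<length us}. fr (C i (x \<otimes> b i)) c)"
  proof (rule regular_trace_eq[OF basis_us x, where c = "%i j. fr (C i (x \<otimes> b j)) c"])
    fix j assume "j < length us"
    then have j: "j < w" by simp
    have "el x \<otimes>\<^bsub>E\<^esub> us ! j = el (x \<otimes> b j)" using j x by simp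
    also have "\<dots> = S.comb w (%i. fr (C i (x \<otimes> b j)) c) (%i. el (b i))"
      using j x by (intro ext_elem_expand) auto
    also have "\<dots> = S.comb w (%i. fr (C i (x \<otimes> b j)) c) ((!) us)"
      using j x by (intro comb_us[symmetric]) auto
    finally show "el x \<otimes>\<^bsub>E\<^esub> us ! j = S.comb (length us) (%i. fr (C i (x \<otimes> b j)) c) ((!) us)" by simp
  qed (use x in auto)
  also have "\<dots> = fr (\<Oplus>\<^bsub>RR\<^esub>i\<in>{..<w}. C i (x \<otimes> b i)) c"
    using x c_nonzero by (subst fr_sum) auto
  finally show ?thesis .
qed

lemma trace_sum_in_R: "x \<in> carrier B ==> (\<Oplus>\<^bsub>RR\<^esub>i\<in>{..<w}. C i (x \<otimes> b i)) \<in> R"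
  by (rule finsum_RR(2)) auto

lemma regular_trace_iff:
  assumes "x \<in> carrier B" "t \<in> R"
  shows "regular_trace B R x = frac_embed B R t \<longleftrightarrow> c \<otimes> t = (\<Oplus>\<^bsub>RR\<^esub>i\<in>{..<w}. C i (x \<otimes> b i))"
  using assms trace_sum_in_R[of x] c_nonzero one_not_zero_B R_comm[of c t]
  by (auto simp: regular_trace_coordinates frac_embed_eq fr_eq_iff)

text \<open>Integrality of the trace becomes divisibility by c of sums in \<open>R\<close>, a
  condition that can be checked on a tensor product without its fraction field.\<close>

lemma trace_in_base_iff:
  "trace_in_base B R \<longleftrightarrow> (\<forall>x\<in>carrier B. \<exists>t\<in>R. c \<otimes> t = (\<Oplus>\<^bsub>RR\<^esub>i\<in>{..<w}. C i (x \<otimes> b i)))"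
  unfolding trace_in_base_def image_iff using regular_trace_iff by blast

end

section \<open>The modified discriminant ideal in coordinates\<close>

lemma (in domain) pow_not_zero: "a \<in> carrier R ==> a ~= \<zero> ==> a [^] (n :: nat) ~= \<zero>"
  by (induction n) (auto simp: integral_iff)

text \<open>The trace as a function into \<open>R\<close> itself. Cancelling c shows that
  \<open>c_tr\<close> determines it, so linearity of \<open>tr\<close> follows from that of the
  coordinates.\<close>

locale quasi_trace = quasi_coordinates +
  fixes tr :: "'a \<Rightarrow> 'a"
  assumes tr_R [simp]: "x \<in> carrier B ==> tr x \<in> R"
    and c_tr: "x \<in> carrier B ==> c \<otimes> tr x = (\<Oplus>\<^bsub>RR\<^esub>i\<in>{..<w}. C i (x \<otimes> b i))"
begin

interpretation central_fractions B R by unfold_locales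

lemma regular_trace_tr: "x \<in> carrier B ==> regular_trace B R x = frac_embed B R (tr x)"
  by (simp add: regular_trace_iff c_tr)

lemma tr_unique: "x \<in> carrier B ==> t \<in> R ==> c \<otimes> t = (\<Oplus>\<^bsub>RR\<^esub>i\<in>{..<w}. C i (x \<otimes> b i)) ==> tr x = t"
  by (rule R_cancel[of c]) (auto simp: c_nonzero c_tr)

lemma tr_add:
  assumes "x \<in> carrier B" "y \<in> carrier B"
  shows "tr (x \<oplus> y) = tr x \<oplus> tr y"
proof (rule tr_unique)
  have "(\<Oplus>\<^bsub>RR\<^esub>i\<in>{..<w}. C i ((x \<oplus> y) \<otimes> b i)) = (\<Oplus>\<^bsub>RR\<^esub>i\<in>{..<w}. C i (x \<otimes> b i) \<oplus>\<^bsub>RR\<^esub> C i (y \<otimes> b i))"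
    by (rule R.finsum_cong') (use assms in \<open>auto simp: l_distr C_add\<close>)
  also have "\<dots> = (\<Oplus>\<^bsub>RR\<^esub>i\<in>{..<w}. C i (x \<otimes> b i)) \<oplus>\<^bsub>RR\<^esub> (\<Oplus>\<^bsub>RR\<^esub>i\<in>{..<w}. C i (y \<otimes> b i))"
    by (rule R.finsum_addf) (use assms in auto)
  finally show "c \<otimes> (tr x \<oplus> tr y) = (\<Oplus>\<^bsub>RR\<^esub>i\<in>{..<w}. C i ((x \<oplus> y) \<otimes> b i))"
    using assms by (simp add: r_distr c_tr)
qed (use assms in auto)

lemma tr_scale:
  assumes "r \<in> R" "x \<in> carrier B"
  shows "tr (r \<otimes> x) = r \<otimes> tr x"
proof (rule tr_unique)
  have "(\<Oplus>\<^bsub>RR\<^esub>i\<in>{..<w}. C i ((r \<otimes> x) \<otimes> b i)) = (\<Oplus>\<^bsub>RR\<^esub>i\<in>{..<w}. r \<otimes>\<^bsub>RR\<^esub> C i (x \<otimes> b i))"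
    by (rule R.finsum_cong') (use assms in \<open>auto simp: m_assoc C_scale\<close>)
  also have "\<dots> = r \<otimes>\<^bsub>RR\<^esub> (\<Oplus>\<^bsub>RR\<^esub>i\<in>{..<w}. C i (x \<otimes> b i))"
    by (rule R.finsum_rdistr[symmetric]) (use assms in auto)
  finally show "c \<otimes> (r \<otimes> tr x) = (\<Oplus>\<^bsub>RR\<^esub>i\<in>{..<w}. C i ((r \<otimes> x) \<otimes> b i))"
    using assms R_lcomm[of r c "tr x"] by (simp add: c_tr)
qed (use assms in auto)

text \<open>Expanding the left argument in the basis costs one factor c; \<open>tr_right\<close> is
  the mirror image.\<close>

lemma tr_left:
  assumes u: "u \<in> carrier B" and v: "v \<in> carrier B"
  shows "c \<otimes> tr (u \<otimes> v) = (\<Oplus>\<^bsub>RR\<^esub>m\<in>{..<w}. C m u \<otimes>\<^bsub>RR\<^esub> tr (b m \<otimes> v))"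
proof -
  have "c \<otimes> tr (u \<otimes> v) = tr ((c \<otimes> u) \<otimes> v)" using u v by (simp add: tr_scale m_assoc)
  also have "(c \<otimes> u) \<otimes> v = (\<Oplus>m\<in>{..<w}. (C m u \<otimes> b m) \<otimes> v)"
    unfolding C_sum[OF u] by (rule finsum_ldistr) (use u v in auto)
  also have "tr \<dots> = (\<Oplus>\<^bsub>RR\<^esub>m\<in>{..<w}. tr ((C m u \<otimes> b m) \<otimes> v))"
    by (rule additive_finsum) (use u v tr_add in auto)
  also have "\<dots> = (\<Oplus>\<^bsub>RR\<^esub>m\<in>{..<w}. C m u \<otimes>\<^bsub>RR\<^esub> tr (b m \<otimes> v))"
    by (rule R.finsum_cong') (use u v in \<open>auto simp: m_assoc tr_scale\<close>)
  finally show ?thesis .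
qed

lemma tr_right:
  assumes u: "u \<in> carrier B" and v: "v \<in> carrier B"
  shows "c \<otimes> tr (u \<otimes> v) = (\<Oplus>\<^bsub>RR\<^esub>m\<in>{..<w}. tr (u \<otimes> b m) \<otimes>\<^bsub>RR\<^esub> C m v)"
proof -
  have "c \<otimes> tr (u \<otimes> v) = tr (u \<otimes> (c \<otimes> v))" using u v by (simp add: tr_scale R_lcomm[of c u v])
  also have "u \<otimes> (c \<otimes> v) = (\<Oplus>m\<in>{..<w}. u \<otimes> (C m v \<otimes> b m))"
    unfolding C_sum[OF v] by (rule finsum_rdistr) (use u v in auto)
  also have "tr \<dots> = (\<Oplus>\<^bsub>RR\<^esub>m\<in>{..<w}. tr (u \<otimes> (C m v \<otimes> b m)))"
    by (rule additive_finsum) (use u v tr_add in auto)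
  also have "\<dots> = (\<Oplus>\<^bsub>RR\<^esub>m\<in>{..<w}. tr (u \<otimes> b m) \<otimes>\<^bsub>RR\<^esub> C m v)"
  proof (rule R.finsum_cong')
    fix m assume "m \<in> {..<w}"
    then show "tr (u \<otimes> (C m v \<otimes> b m)) = tr (u \<otimes> b m) \<otimes>\<^bsub>RR\<^esub> C m v"
      using u v R_comm[of "C m v" "tr (u \<otimes> b m)"] by (simp add: R_lcomm[of "C m v" u "b m"] tr_scale)
  qed (use u v in auto)
  finally show ?thesis .
qed

definition disc :: "(nat \<Rightarrow> 'a) \<Rightarrow> (nat \<Rightarrow> 'a) \<Rightarrow> 'a" where
  "disc u v = ring_det RR w (%i j. tr (u i \<otimes> v j))"

text \<open>The denominator c^(2w): c^w for the expansion of each of the two families in a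
  discriminant.\<close>

definition cc :: 'a where "cc = c [^]\<^bsub>RR\<^esub> w \<otimes> c [^]\<^bsub>RR\<^esub> w"

lemma pow_R [simp]: "r \<in> R ==> r [^]\<^bsub>RR\<^esub> (n :: nat) \<in> R"
  using R.nat_pow_closed[of r n] by simp

lemma cc_R [simp]: "cc \<in> R" and cc_nonzero: "cc ~= \<zero>"
  using R_integral[of "c [^]\<^bsub>RR\<^esub> w" "c [^]\<^bsub>RR\<^esub> w"] R.pow_not_zero[of c w] c_nonzero
  by (auto simp: cc_def)

lemma disc_R:
  assumes "!!i. i < w ==> u i \<in> carrier B" "!!i. i < w ==> v i \<in> carrier B"
  shows "disc u v \<in> R"
  using R.ring_det_closed[of w "%i j. tr (u i \<otimes> v j)"] assms by (simp add: disc_def)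

lemma prod_R: "(!!i. i \<in> I ==> p i \<in> R) ==> (\<Otimes>\<^bsub>RR\<^esub>i\<in>I. p i) \<in> R"
  using R.finprod_closed[of p I] by auto

lemma scaled_disc:
  assumes u: "!!i. i < w ==> u i \<in> carrier B" and v: "!!i. i < w ==> v i \<in> carrier B"
    and p: "!!i. i < w ==> p i \<in> R" and q: "!!i. i < w ==> q i \<in> R"
  shows "ring_det RR w (%i j. p i \<otimes> tr (u i \<otimes> v j) \<otimes> q j) =
    (\<Otimes>\<^bsub>RR\<^esub>i\<in>{..<w}. p i) \<otimes> (\<Otimes>\<^bsub>RR\<^esub>i\<in>{..<w}. q i) \<otimes> disc u v"
  using R.ring_det_scale[of w "%i j. tr (u i \<otimes> v j)" p q] u v p q by (simp add: disc_def)

lemma prod_const: "r \<in> R ==> (\<Otimes>\<^bsub>RR\<^esub>i\<in>{..<n :: nat}. r) = r [^]\<^bsub>RR\<^esub> n"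
  using R.finprod_const[of r "{..<n}"] by simp

text \<open>The matrix of c tr(u_i v_j) is the product of the coordinate matrix of u with the matrix
  of tr(b_m v_j), and similarly on the right; the determinant is multiplicative for each of the two
  products.\<close>

lemma disc_expand:
  assumes u: "!!i. i < w ==> u i \<in> carrier B" and v: "!!i. i < w ==> v i \<in> carrier B"
  shows "cc \<otimes> disc u v = ring_det RR w (%i m. C m (u i)) \<otimes> disc b b \<otimes> ring_det RR w (%n j. C n (v j))"
proof -
  let ?c = "c [^]\<^bsub>RR\<^esub> w"
  have P: "ring_det RR w (%i m. C m (u i)) \<in> R" and N: "ring_det RR w (%n j. C n (v j)) \<in> R"
    using R.ring_det_closed[of w "%i m. C m (u i)"] R.ring_det_closed[of w "%n j. C n (v j)"] u v by auto
  have 1: "?c \<otimes> disc x y = ring_det RR w (%i j. c \<otimes> tr (x i \<otimes> y j))"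
    if "!!i. i < w ==> x i \<in> carrier B" "!!i. i < w ==> y i \<in> carrier B" for x y
  proof -
    have "ring_det RR w (%i j. c \<otimes> tr (x i \<otimes> y j)) = ring_det RR w (%i j. c \<otimes> tr (x i \<otimes> y j) \<otimes> \<one>)"
      by (rule R.ring_det_cong) (use that in auto)
    also have "\<dots> = ?c \<otimes> disc x y"
      using that disc_R[of x y] by (subst scaled_disc) (auto simp: prod_const R.nat_pow_one[simplified])
    finally show ?thesis by simp
  qed
  have 2: "?c \<otimes> disc u v = ring_det RR w (%i m. C m (u i)) \<otimes> disc b v"
  proof -
    have "?c \<otimes> disc u v = ring_det RR w (%i j. c \<otimes> tr (u i \<otimes> v j))"
      by (rule 1) (use u v in auto)
    also have "\<dots> = ring_det RR w (%i j. \<Oplus>\<^bsub>RR\<^esub>m\<in>{..<w}. C m (u i) \<otimes>\<^bsub>RR\<^esub> tr (b m \<otimes> v j))"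
      by (rule R.ring_det_cong) (use u v in \<open>auto simp: tr_left intro!: finsum_RR(2)\<close>)
    also have "\<dots> = ring_det RR w (%i m. C m (u i)) \<otimes>\<^bsub>RR\<^esub> ring_det RR w (%m j. tr (b m \<otimes> v j))"
      by (rule R.ring_det_mult) (use u v in auto)
    finally show ?thesis by (simp add: disc_def)
  qed
  have 3: "?c \<otimes> disc b v = disc b b \<otimes> ring_det RR w (%n j. C n (v j))"
  proof -
    have "?c \<otimes> disc b v = ring_det RR w (%i j. c \<otimes> tr (b i \<otimes> v j))"
      by (rule 1) (use v in auto)
    also have "\<dots> = ring_det RR w (%i j. \<Oplus>\<^bsub>RR\<^esub>m\<in>{..<w}. tr (b i \<otimes> b m) \<otimes>\<^bsub>RR\<^esub> C m (v j))"
      by (rule R.ring_det_cong) (use v in \<open>auto simp: tr_right intro!: finsum_RR(2)\<close>)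
    also have "\<dots> = ring_det RR w (%i m. tr (b i \<otimes> b m)) \<otimes>\<^bsub>RR\<^esub> ring_det RR w (%n j. C n (v j))"
      by (rule R.ring_det_mult) (use v in auto)
    finally show ?thesis by (simp add: disc_def)
  qed
  have "cc \<otimes> disc u v = ?c \<otimes> (ring_det RR w (%i m. C m (u i)) \<otimes> disc b v)"
    using disc_R[OF u v] by (simp add: cc_def m_assoc 2)
  also have "\<dots> = ring_det RR w (%i m. C m (u i)) \<otimes> (?c \<otimes> disc b v)"
    using P disc_R[of b v] v by (intro R_lcomm[symmetric]) auto
  finally show ?thesis using P N disc_R[of b b] by (simp add: 3 m_assoc)
qed

text \<open>Counterpart of \<open>disc_expand\<close> for diagonal coordinate matrices: the elements
  p_i b_i / c and q_i b_i / c exist in \<open>B\<close>, and pulling the row and column scalars out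
  gives their discriminant.\<close>

lemma disc_split:
  assumes y: "!!i. i < w ==> y i \<in> carrier B" and z: "!!i. i < w ==> z i \<in> carrier B"
    and p: "!!i. i < w ==> p i \<in> R" and q: "!!i. i < w ==> q i \<in> R"
    and py: "!!i. i < w ==> p i \<otimes> b i = c \<otimes> y i" and qz: "!!i. i < w ==> q i \<otimes> b i = c \<otimes> z i"
  shows "cc \<otimes> disc y z = (\<Otimes>\<^bsub>RR\<^esub>i\<in>{..<w}. p i) \<otimes> (\<Otimes>\<^bsub>RR\<^esub>i\<in>{..<w}. q i) \<otimes> disc b b"
proof -
  have "c \<otimes> tr (y i \<otimes> z j) \<otimes> c = p i \<otimes> tr (b i \<otimes> b j) \<otimes> q j" if "i < w" "j < w" for i j
  proof -
    have "c \<otimes> tr (y i \<otimes> z j) \<otimes> c = c \<otimes> (c \<otimes> tr (y i \<otimes> z j))"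
      using that y z by (intro R_comm) auto
    also have "\<dots> = tr ((c \<otimes> y i) \<otimes> (c \<otimes> z j))"
      using that y z by (simp add: tr_scale m_assoc R_lcomm[of c "y i" "z j"])
    also have "\<dots> = tr ((p i \<otimes> b i) \<otimes> (q j \<otimes> b j))" using that by (simp add: py qz)
    also have "\<dots> = q j \<otimes> (p i \<otimes> tr (b i \<otimes> b j))"
      using that p q by (simp add: tr_scale m_assoc R_lcomm[of "q j" "b i" "b j"] R_lcomm[of "q j" "p i"])
    also have "\<dots> = p i \<otimes> tr (b i \<otimes> b j) \<otimes> q j"
      using that p q by (intro R_comm[symmetric]) auto
    finally show ?thesis .
  qed
  then have "ring_det RR w (%i j. c \<otimes> tr (y i \<otimes> z j) \<otimes> c) = ring_det RR w (%i j. p i \<otimes> tr (b i \<otimes> b j) \<otimes> q j)"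
    using p q by (intro R.ring_det_cong) auto
  then show ?thesis
    using y z p q by (simp add: scaled_disc prod_const cc_def)
qed

text \<open>The embedding of \<open>R\<close> in its fraction field is an injective homomorphism, so
  the determinants over F are images of determinants over R.\<close>

lemma MD_ideal_disc:
  "MD_ideal B R = Idl\<^bsub>RR\<^esub> {disc u v | u v. u \<in> {..<w} \<rightarrow> carrier B & inj_on u {..<w} &
     v \<in> {..<w} \<rightarrow> carrier B & inj_on v {..<w}}"
proof -
  have "frac_embed B R r = ring_det F w (%i j. regular_trace B R (u i \<otimes> v j)) \<longleftrightarrow> r = disc u v"
    if r: "r \<in> R" and u: "u \<in> {..<w} \<rightarrow> carrier B" and v: "v \<in> {..<w} \<rightarrow> carrier B" for r u v
  proof -
    have "ring_det F w (%i j. regular_trace B R (u i \<otimes> v j)) = ring_det F w (%i j. frac_embed B R (tr (u i \<otimes> v j)))"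
      by (rule F.ring_det_cong) (use u v in \<open>auto simp: regular_trace_tr Pi_def\<close>)
    also have "\<dots> = frac_embed B R (disc u v)"
      unfolding disc_def by (rule frac.hom_ring_det[symmetric]) (use u v in \<open>auto simp: Pi_def\<close>)
    finally show ?thesis using r u v disc_R[of u v] by (simp add: Pi_def)
  qed
  then have "{r \<in> R. \<exists>u v. u \<in> {..<w} \<rightarrow> carrier B & inj_on u {..<w} & v \<in> {..<w} \<rightarrow> carrier B & inj_on v {..<w} &
      frac_embed B R r = ring_det F w (%i j. regular_trace B R (u i \<otimes> v j))} =
    {r \<in> R. \<exists>u v. u \<in> {..<w} \<rightarrow> carrier B & inj_on u {..<w} & v \<in> {..<w} \<rightarrow> carrier B & inj_on v {..<w} & r = disc u v}"
    by (intro Collect_cong conj_cong refl ex_cong1) auto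
  also have "\<dots> = {disc u v | u v. u \<in> {..<w} \<rightarrow> carrier B & inj_on u {..<w} &
     v \<in> {..<w} \<rightarrow> carrier B & inj_on v {..<w}}" (is "?L = ?M")
  proof (intro equalityI subsetI)
    fix r assume "r \<in> ?M"
    then obtain u v where "r = disc u v" "u \<in> {..<w} \<rightarrow> carrier B" "inj_on u {..<w}"
      "v \<in> {..<w} \<rightarrow> carrier B" "inj_on v {..<w}" by auto
    moreover then have "disc u v \<in> R" using disc_R[of u v] by (auto simp: Pi_def)
    ultimately show "r \<in> ?L" by auto
  qed auto
  finally show ?thesis unfolding MD_ideal_def rank_w by simp
qed

text \<open>Elements p q disc(b) / c^(2w), written without division. The sets \<open>G\<close>
  prescribe the factors of the products p and q: all coordinate values in the case of a single
  algebra, only pure tensors of coordinate values in the case of a tensor product.\<close>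

definition split_disc :: "(nat \<Rightarrow> 'a set) \<Rightarrow> 'a set" where
  "split_disc G = {r \<in> R. \<exists>p q. (\<forall>i<w. p i \<in> G i) & (\<forall>i<w. q i \<in> G i) &
     cc \<otimes> r = (\<Otimes>\<^bsub>RR\<^esub>i\<in>{..<w}. p i) \<otimes> (\<Otimes>\<^bsub>RR\<^esub>i\<in>{..<w}. q i) \<otimes> disc b b}"

text \<open>One inclusion expands discriminants by \<open>disc_expand\<close> and distributes both
  coordinate determinants over the spans of the \<open>G i\<close>; the other realizes each element
  of \<open>split_disc G\<close> as a discriminant through \<open>disc_split\<close>. Cancelling
  \<open>cc\<close> identifies the elements.\<close>

lemma MD_ideal_split:
  assumes G: "!!i. i < w ==> G i \<subseteq> R"
    and gen: "!!i y. i < w ==> y \<in> carrier B ==> C i y \<in> generate (add_monoid RR) (G i)"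
    and split: "!!i g. i < w ==> g \<in> G i ==> \<exists>z\<in>carrier B. g \<otimes> b i = c \<otimes> z"
  shows "MD_ideal B R = Idl\<^bsub>RR\<^esub> (split_disc G)"
proof -
  let ?M = "{disc u v | u v. u \<in> {..<w} \<rightarrow> carrier B & inj_on u {..<w} &
     v \<in> {..<w} \<rightarrow> carrier B & inj_on v {..<w}}"
  let ?P = "{\<Otimes>\<^bsub>RR\<^esub>i\<in>{..<w}. g i | g. \<forall>i<w. g i \<in> G i}"
  let ?PP = "{x \<otimes> y | x y. x \<in> ?P & y \<in> ?P}"
  have MR: "?M \<subseteq> carrier RR" using disc_R by (auto simp: Pi_def)
  have ER: "split_disc G \<subseteq> carrier RR" by (auto simp: split_disc_def)
  interpret J: ideal "Idl\<^bsub>RR\<^esub> (split_disc G)" RR by (rule R.genideal_ideal[OF ER])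
  interpret M: ideal "Idl\<^bsub>RR\<^esub> ?M" RR by (rule R.genideal_ideal[OF MR])
  have PR: "?P \<subseteq> R"
  proof
    fix x assume "x \<in> ?P"
    then obtain g where g: "x = (\<Otimes>\<^bsub>RR\<^esub>i\<in>{..<w}. g i)" "\<forall>i<w. g i \<in> G i" by blast
    then have "g i \<in> R" if "i \<in> {..<w}" for i using G[of i] that by auto
    then show "x \<in> R" unfolding g(1) by (rule prod_R)
  qed
  have PPR: "?PP \<subseteq> carrier RR"
  proof
    fix t assume "t \<in> ?PP"
    then obtain x y where "t = x \<otimes> y" "x \<in> ?P" "y \<in> ?P" by blast
    then show "t \<in> carrier RR" using subsetD[OF PR] by simp
  qed
  have D: "disc b b \<in> R" by (rule disc_R) auto
  have base: "\<exists>y z. (\<forall>i<w. y i \<in> carrier B & p i \<otimes> b i = c \<otimes> y i) &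
      (\<forall>i<w. z i \<in> carrier B & q i \<otimes> b i = c \<otimes> z i) & disc y z \<in> R &
      cc \<otimes> disc y z = (\<Otimes>\<^bsub>RR\<^esub>i\<in>{..<w}. p i) \<otimes> (\<Otimes>\<^bsub>RR\<^esub>i\<in>{..<w}. q i) \<otimes> disc b b"
    if p: "\<forall>i<w. p i \<in> G i" and q: "\<forall>i<w. q i \<in> G i" for p q
  proof -
    have "\<forall>i. \<exists>y. i < w --> y \<in> carrier B & p i \<otimes> b i = c \<otimes> y"
      using split p by blast
    then obtain y where y: "!!i. i < w ==> y i \<in> carrier B" "!!i. i < w ==> p i \<otimes> b i = c \<otimes> y i" by metis
    have "\<forall>i. \<exists>z. i < w --> z \<in> carrier B & q i \<otimes> b i = c \<otimes> z"
      using split q by blast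
    then obtain z where z: "!!i. i < w ==> z i \<in> carrier B" "!!i. i < w ==> q i \<otimes> b i = c \<otimes> z i" by metis
    have "p i \<in> R" "q i \<in> R" if "i < w" for i using p q G[OF that] that by auto
    then have "cc \<otimes> disc y z = (\<Otimes>\<^bsub>RR\<^esub>i\<in>{..<w}. p i) \<otimes> (\<Otimes>\<^bsub>RR\<^esub>i\<in>{..<w}. q i) \<otimes> disc b b"
      by (intro disc_split y z)
    moreover have "disc y z \<in> R" by (rule disc_R[OF y(1) z(1)])
    ultimately have "(\<forall>i<w. y i \<in> carrier B & p i \<otimes> b i = c \<otimes> y i) &
      (\<forall>i<w. z i \<in> carrier B & q i \<otimes> b i = c \<otimes> z i) & disc y z \<in> R &
      cc \<otimes> disc y z = (\<Otimes>\<^bsub>RR\<^esub>i\<in>{..<w}. p i) \<otimes> (\<Otimes>\<^bsub>RR\<^esub>i\<in>{..<w}. q i) \<otimes> disc b b"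
      using y z by simp
    then show ?thesis by (rule exI[of _ y, OF exI[of _ z]])
  qed
  \<comment> \<open>Solvability of cc r = t disc(b) with r in the ideal is additive in
    \<open>t\<close>, so it extends from products of generators to the span containing the product
    of the coordinate determinants.\<close>
  have lift: "\<exists>r\<in>Idl\<^bsub>RR\<^esub> (split_disc G). cc \<otimes> r = t \<otimes> disc b b"
    if "t \<in> generate (add_monoid RR) ?PP" for t
    using PPR that
  proof (induction rule: R.aspan_induct)
    case (incl t)
    then obtain p q where pq: "\<forall>i<w. p i \<in> G i" "\<forall>i<w. q i \<in> G i"
        "t = (\<Otimes>\<^bsub>RR\<^esub>i\<in>{..<w}. p i) \<otimes> (\<Otimes>\<^bsub>RR\<^esub>i\<in>{..<w}. q i)" by blast
    from base[OF pq(1,2)] obtain y z where yz: "disc y z \<in> R" "cc \<otimes> disc y z = t \<otimes> disc b b"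
      unfolding pq(3) by blast
    then have "disc y z \<in> split_disc G" unfolding split_disc_def using pq by blast
    then show ?case using R.genideal_self[OF ER] yz by blast
  next
    case zero
    have "cc \<otimes> \<zero> = \<zero> \<otimes> disc b b" using D by simp
    then show ?case using J.zero_closed by (intro bexI[of _ \<zero>]) auto
  next
    case (minus t)
    then obtain r where r: "r \<in> Idl\<^bsub>RR\<^esub> (split_disc G)" "cc \<otimes> r = t \<otimes> disc b b" by blast
    have "t \<in> R" using minus PPR by auto
    moreover have "r \<in> R" using J.Icarr[OF r(1)] by simp
    ultimately have "cc \<otimes> (\<ominus>\<^bsub>RR\<^esub> r) = (\<ominus>\<^bsub>RR\<^esub> t) \<otimes> disc b b"
      using r D by (simp add: RR_minus r_minus l_minus)
    then show ?case using J.a_inv_closed[OF r(1)] by blast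
  next
    case (add s t)
    then obtain q r where q: "q \<in> Idl\<^bsub>RR\<^esub> (split_disc G)" "cc \<otimes> q = s \<otimes> disc b b"
      and r: "r \<in> Idl\<^bsub>RR\<^esub> (split_disc G)" "cc \<otimes> r = t \<otimes> disc b b" by blast
    have "s \<in> R" "t \<in> R" using add.hyps R.aspan_closed[OF PPR] by auto
    moreover have "q \<in> R" "r \<in> R" using J.Icarr q(1) r(1) by auto
    ultimately have "cc \<otimes> (q \<oplus>\<^bsub>RR\<^esub> r) = (s \<oplus>\<^bsub>RR\<^esub> t) \<otimes> disc b b"
      using q r D by (simp add: r_distr l_distr)
    then show ?case using J.a_closed[OF q(1) r(1)] by blast
  qed
  have "r \<in> Idl\<^bsub>RR\<^esub> (split_disc G)" if "r \<in> ?M" for r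
  proof -
    from that obtain u v where r: "r = disc u v" and u: "!!i. i < w ==> u i \<in> carrier B"
      and v: "!!i. i < w ==> v i \<in> carrier B" by (auto simp: Pi_def)
    let ?U = "ring_det RR w (%i m. C m (u i))" and ?V = "ring_det RR w (%n j. C n (v j))"
    have U: "?U \<in> generate (add_monoid RR) ?P"
      by (rule R.ring_det_in_aspan_cols) (use G gen u in auto)
    have V: "?V \<in> generate (add_monoid RR) ?P"
      by (rule R.ring_det_in_aspan_rows) (use G gen v in auto)
    have PR': "?P \<subseteq> carrier RR" using PR by simp
    have UR: "?U \<in> R" "?V \<in> R" using R.aspan_closed[OF PR' U] R.aspan_closed[OF PR' V] by auto
    have "?U \<otimes>\<^bsub>RR\<^esub> ?V \<in> generate (add_monoid RR) ?PP"
      by (rule R.aspan_mult[OF PR' PR' U V PPR]) (intro R.aspan_incl, auto)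
    from lift[OF this] obtain s where s: "s \<in> Idl\<^bsub>RR\<^esub> (split_disc G)" "cc \<otimes> s = ?U \<otimes> ?V \<otimes> disc b b"
      by auto
    have "cc \<otimes> r = ?U \<otimes> disc b b \<otimes> ?V"
      unfolding r by (rule disc_expand[OF u v])
    then have "cc \<otimes> r = cc \<otimes> s"
      unfolding s(2) using UR D R_mult_swap[of ?V ?U "disc b b"] by simp
    then have "r = s"
      by (rule R_cancel[OF cc_R cc_nonzero, rotated 2]) (use J.Icarr[OF s(1)] disc_R[OF u v] r in auto)
    then show ?thesis using s by simp
  qed
  then have 1: "Idl\<^bsub>RR\<^esub> ?M \<subseteq> Idl\<^bsub>RR\<^esub> (split_disc G)"
    by (intro R.genideal_minimal J.is_ideal) blast
  have "r \<in> Idl\<^bsub>RR\<^esub> ?M" if r: "r \<in> split_disc G" for r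
  proof -
    obtain p q where pq: "\<forall>i<w. p i \<in> G i" "\<forall>i<w. q i \<in> G i" "r \<in> R"
        "cc \<otimes> r = (\<Otimes>\<^bsub>RR\<^esub>i\<in>{..<w}. p i) \<otimes> (\<Otimes>\<^bsub>RR\<^esub>i\<in>{..<w}. q i) \<otimes> disc b b"
      using r unfolding split_disc_def by blast
    obtain y z where y: "!!i. i < w ==> y i \<in> carrier B" "!!i. i < w ==> p i \<otimes> b i = c \<otimes> y i"
      and z: "!!i. i < w ==> z i \<in> carrier B" "!!i. i < w ==> q i \<otimes> b i = c \<otimes> z i"
      and yz: "disc y z \<in> R" "cc \<otimes> disc y z = (\<Otimes>\<^bsub>RR\<^esub>i\<in>{..<w}. p i) \<otimes> (\<Otimes>\<^bsub>RR\<^esub>i\<in>{..<w}. q i) \<otimes> disc b b"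
      using base[OF pq(1,2)] by blast
    have rd: "r = disc y z"
      using R_cancel[OF cc_R cc_nonzero, of r "disc y z"] pq yz by simp
    \<comment> \<open>Generators of the modified discriminant ideal come from injective families. If
      two of the elements x_i = f_i b_i / c coincide, applying C_i shows f_i = 0 and the product
      vanishes, so a family that is not injective contributes only zero.\<close>
    have zero: "(\<Otimes>\<^bsub>RR\<^esub>i\<in>{..<w}. f i) = \<zero>"
      if f: "\<forall>i<w. f i \<in> G i" and fx: "!!i. i < w ==> f i \<otimes> b i = c \<otimes> x i" and ninj: "\<not> inj_on x {..<w}" for f x
    proof -
      obtain i j where ij: "i < w" "j < w" "x i = x j" "i ~= j"
        using ninj by (auto simp: inj_on_def)
      have fR: "f i \<in> R" if "i < w" for i using f G[OF that] that by auto
      have "f i \<otimes> b i = f j \<otimes> b j" using ij fx by simp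
      then have "C i (f i \<otimes> b i) = C i (f j \<otimes> b j)" by simp
      then have "f i \<otimes> c = \<zero>" using ij fR by (simp add: C_scale C_b)
      then have fi: "f i = \<zero>" using R_integral[of "f i" c] ij fR c_nonzero by auto
      have "{..<w} = insert i ({..<w} - {i})" using ij by auto
      then have "(\<Otimes>\<^bsub>RR\<^esub>i\<in>{..<w}. f i) = f i \<otimes>\<^bsub>RR\<^esub> (\<Otimes>\<^bsub>RR\<^esub>i\<in>{..<w} - {i}. f i)"
        using fR ij R.finprod_insert[of "{..<w} - {i}" i f] by auto
      then show ?thesis using fi prod_R[of "{..<w} - {i}" f] fR by simp
    qed
    have PR2: "(\<Otimes>\<^bsub>RR\<^esub>i\<in>{..<w}. p i) \<in> R" "(\<Otimes>\<^bsub>RR\<^esub>i\<in>{..<w}. q i) \<in> R"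
      using pq G by (auto intro!: prod_R)
    show ?thesis
    proof (cases "inj_on y {..<w} & inj_on z {..<w}")
      case True
      then have "r \<in> ?M" unfolding rd using y z by blast
      then show ?thesis using R.genideal_self[OF MR] by blast
    next
      case False
      then have "cc \<otimes> r = \<zero>"
        using zero[of p y] zero[of q z] pq y z PR2 D by auto
      then have "r = \<zero>" using R_integral[of cc r] pq(3) cc_nonzero by auto
      then show ?thesis using M.zero_closed by simp
    qed
  qed
  then have 2: "Idl\<^bsub>RR\<^esub> (split_disc G) \<subseteq> Idl\<^bsub>RR\<^esub> ?M"
    by (intro R.genideal_minimal M.is_ideal) blast
  show ?thesis unfolding MD_ideal_disc using 1 2 by blast
qed

end

section \<open>Reflexive hulls\<close>

context central_domain
begin

text \<open>Elements of the dual of \<open>B\<close> as plain functions, with no condition outside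
  the carrier; this spares the restrictions that \<open>dual_module\<close> carries, and
  \<open>dual_BM\<close> relates the two.\<close>

definition functional :: "('a \<Rightarrow> 'a) \<Rightarrow> bool" where
  "functional f \<longleftrightarrow> (\<forall>x\<in>carrier B. f x \<in> R) &
     (\<forall>x\<in>carrier B. \<forall>y\<in>carrier B. f (x \<oplus> y) = f x \<oplus> f y) &
     (\<forall>r\<in>R. \<forall>x\<in>carrier B. f (r \<otimes> x) = r \<otimes> f x)"

lemma functionalD:
  assumes "functional f"
  shows "x \<in> carrier B ==> f x \<in> R" "x \<in> carrier B ==> y \<in> carrier B ==> f (x \<oplus> y) = f x \<oplus> f y"
    "r \<in> R ==> x \<in> carrier B ==> f (r \<otimes> x) = r \<otimes> f x" "f \<zero> = \<zero>"
proof -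
  show *: "x \<in> carrier B ==> f x \<in> R" "x \<in> carrier B ==> y \<in> carrier B ==> f (x \<oplus> y) = f x \<oplus> f y"
    "r \<in> R ==> x \<in> carrier B ==> f (r \<otimes> x) = r \<otimes> f x" for x y r
    using assms by (auto simp: functional_def)
  show "f \<zero> = \<zero>" using *(3)[of \<zero> \<zero>] *(1)[of \<zero>] by simp
qed

text \<open>The membership test "\<open>f(L) \<subseteq> sR\<close> forces \<open>f(y) \<in> sR\<close>" describes the reflexive hull
  through functionals on \<open>B\<close> alone; \<open>s = 0\<close> is allowed, which covers \<open>L = 0\<close>.\<close>

definition div_closure :: "'a set \<Rightarrow> 'a set" where
  "div_closure L = {y \<in> carrier B. \<forall>f s. functional f --> s \<in> R -->
     (\<forall>x\<in>L. \<exists>t\<in>R. f x = s \<otimes> t) --> (\<exists>t\<in>R. f y = s \<otimes> t)}"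

lemma div_closureI:
  assumes "y \<in> carrier B" "!!f s. functional f ==> s \<in> R ==> \<forall>x\<in>L. \<exists>t\<in>R. f x = s \<otimes> t ==> \<exists>t\<in>R. f y = s \<otimes> t"
  shows "y \<in> div_closure L"
  using assms unfolding div_closure_def by blast

lemma div_closureD:
  assumes "y \<in> div_closure L" "functional f" "s \<in> R" "!!x. x \<in> L ==> \<exists>t\<in>R. f x = s \<otimes> t"
  shows "\<exists>t\<in>R. f y = s \<otimes> t"
  using assms unfolding div_closure_def by blast

lemma div_closure_carrier: "y \<in> div_closure L ==> y \<in> carrier B"
  by (simp add: div_closure_def)

lemma div_closure_incl: "L \<subseteq> carrier B ==> L \<subseteq> div_closure L"
  by (auto simp: div_closure_def)

text \<open>A test passed by L' is passed by L. Together with \<open>div_closure_incl\<close> this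
  is the closure-operator property behind \<open>div_closure_eqI\<close>.\<close>

lemma div_closure_least:
  assumes "L \<subseteq> div_closure L'" shows "div_closure L \<subseteq> div_closure L'"
proof
  fix y assume y: "y \<in> div_closure L"
  show "y \<in> div_closure L'"
  proof (rule div_closureI)
    show "y \<in> carrier B" using y by (rule div_closure_carrier)
    fix f s assume f: "functional f" "s \<in> R" "\<forall>x\<in>L'. \<exists>t\<in>R. f x = s \<otimes> t"
    have "\<exists>t\<in>R. f x = s \<otimes> t" if "x \<in> L" for x
      by (rule div_closureD[OF _ f(1,2)]) (use that assms f(3) in auto)
    then show "\<exists>t\<in>R. f y = s \<otimes> t" by (rule div_closureD[OF y f(1,2)])
  qed
qed

lemma div_closure_eqI:
  "L \<subseteq> div_closure L' ==> L' \<subseteq> div_closure L ==> div_closure L = div_closure L'"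
  using div_closure_least by blast

lemma div_closure_idem: "div_closure (div_closure L) = div_closure L"
  using div_closure_least[of "div_closure L" L] div_closure_incl[of "div_closure L"] div_closure_carrier by blast

lemma div_closure_zero: "\<zero> \<in> div_closure L"
  by (rule div_closureI) (auto simp: functionalD intro!: bexI[of _ \<zero>])

lemma div_closure_add:
  assumes "y \<in> div_closure L" "z \<in> div_closure L" shows "y \<oplus> z \<in> div_closure L"
proof (rule div_closureI)
  have yz: "y \<in> carrier B" "z \<in> carrier B" using assms by (auto intro: div_closure_carrier)
  then show "y \<oplus> z \<in> carrier B" by simp
  fix f s assume f: "functional f" "s \<in> R" "\<forall>x\<in>L. \<exists>t\<in>R. f x = s \<otimes> t"
  obtain t u where "t \<in> R" "f y = s \<otimes> t" "u \<in> R" "f z = s \<otimes> u"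
    using div_closureD[OF assms(1) f(1,2)] div_closureD[OF assms(2) f(1,2)] f(3) by blast
  then show "\<exists>t\<in>R. f (y \<oplus> z) = s \<otimes> t"
    using f yz by (intro bexI[of _ "t \<oplus> u"]) (auto simp: functionalD(2) r_distr)
qed

lemma functional_scale:
  assumes "functional f" "r \<in> R" shows "functional (%x. r \<otimes> f x)"
  using assms R_lcomm[of _ r] unfolding functional_def by (auto simp: r_distr)

lemma functional_mult:
  assumes f: "functional f" and e: "e \<in> carrier B"
  shows "functional (%x. f (e \<otimes> x))"
  unfolding functional_def
proof (intro conjI ballI)
  fix r x assume "r \<in> R" "x \<in> carrier B"
  then show "f (e \<otimes> (r \<otimes> x)) = r \<otimes> f (e \<otimes> x)"
    using e f R_lcomm[of r e x] by (simp add: functionalD(3))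
qed (use e f in \<open>auto simp: functionalD r_distr\<close>)

text \<open>Left multiplication by \<open>e\<close> is R-linear because \<open>R\<close> is central,
  so f(e -) is again a functional, and a test for e y against L' becomes one for y against
  L.\<close>

lemma div_closure_mult:
  assumes y: "y \<in> div_closure L" and e: "e \<in> carrier B" and L: "L \<subseteq> carrier B"
    and eL: "!!x. x \<in> L ==> e \<otimes> x \<in> div_closure L'"
  shows "e \<otimes> y \<in> div_closure L'"
proof (rule div_closureI)
  show "e \<otimes> y \<in> carrier B" using e div_closure_carrier[OF y] by simp
  fix f s assume f: "functional f" "s \<in> R" "\<forall>x\<in>L'. \<exists>t\<in>R. f x = s \<otimes> t"
  show "\<exists>t\<in>R. f (e \<otimes> y) = s \<otimes> t"
  proof (rule div_closureD[OF y functional_mult[OF f(1) e] f(2)])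
    fix x assume "x \<in> L"
    then show "\<exists>t\<in>R. f (e \<otimes> x) = s \<otimes> t"
      using div_closureD[OF eL f(1,2)] f(3) by blast
  qed
qed

lemma div_closure_scale:
  assumes "y \<in> div_closure L" "r \<in> R" "L \<subseteq> carrier B"
    and "!!x. x \<in> L ==> r \<otimes> x \<in> div_closure L'"
  shows "r \<otimes> y \<in> div_closure L'"
  by (rule div_closure_mult) (use assms in auto)

lemma div_closure_smult:
  assumes y: "y \<in> div_closure L" and r: "r \<in> R"
  shows "r \<otimes> y \<in> div_closure L"
proof (rule div_closureI)
  show "r \<otimes> y \<in> carrier B" using r div_closure_carrier[OF y] by simp
  fix f s assume f: "functional f" "s \<in> R" "\<forall>x\<in>L. \<exists>t\<in>R. f x = s \<otimes> t"
  obtain t where "t \<in> R" "f y = s \<otimes> t" using div_closureD[OF y f(1,2)] f(3) by blast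
  then show "\<exists>t\<in>R. f (r \<otimes> y) = s \<otimes> t"
    using f r div_closure_carrier[OF y] R_lcomm[of s r t]
    by (intro bexI[of _ "r \<otimes> t"]) (auto simp: functionalD)
qed

text \<open>Only generators need to be tested, since a closure is stable under sums and
  scalars.\<close>

lemma div_closure_ideal_prod:
  assumes I: "I \<subseteq> R"
  shows "div_closure (ideal_prod B (Idl\<^bsub>RR\<^esub> I) (carrier B)) = div_closure {r \<otimes> a | r a. r \<in> I & a \<in> carrier B}"
    (is "div_closure ?L = div_closure ?X")
proof (rule div_closure_eqI)
  have IR: "I \<subseteq> carrier RR" using I by simp
  have X: "?X \<subseteq> carrier B" using I by auto
  \<comment> \<open>The scalars carrying all of \<open>B\<close> into the closure form an ideal of
    \<open>R\<close> that contains \<open>I\<close>, hence the ideal generated by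
    \<open>I\<close>.\<close>
  let ?J = "{r \<in> R. \<forall>a\<in>carrier B. r \<otimes> a \<in> div_closure ?X}"
  have "ideal ?J RR"
  proof (rule idealI[OF R.ring_axioms])
    show "subgroup ?J (add_monoid RR)"
    proof (rule group.subgroupI[OF R.a_group])
      show "?J ~= {}" using div_closure_zero by (auto intro!: exI[of _ \<zero>])
      fix x assume x: "x \<in> ?J"
      have "\<ominus> x \<otimes> a \<in> div_closure ?X" if "a \<in> carrier B" for a
        using x that div_closure_smult[of "x \<otimes> a" ?X "\<ominus> \<one>"] by (auto simp: l_minus)
      then show "inv\<^bsub>add_monoid RR\<^esub> x \<in> ?J"
        using x unfolding a_inv_def[symmetric] by (auto simp: RR_minus)
    qed (auto simp: l_distr intro: div_closure_add)
    fix a x assume a: "a \<in> ?J" and x: "x \<in> carrier RR"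
    have "(x \<otimes> a) \<otimes> y \<in> div_closure ?X" if "y \<in> carrier B" for y
      using div_closure_smult[of "a \<otimes> y" ?X x] a x that by (auto simp: m_assoc)
    then show "x \<otimes>\<^bsub>RR\<^esub> a \<in> ?J" "a \<otimes>\<^bsub>RR\<^esub> x \<in> ?J"
      using a x R_comm[of x a] by auto
  qed
  moreover have "I \<subseteq> ?J" using I div_closure_incl[OF X] by auto
  ultimately have J: "Idl\<^bsub>RR\<^esub> I \<subseteq> ?J" by (rule R.genideal_minimal)
  show "?L \<subseteq> div_closure ?X"
  proof
    fix y assume "y \<in> ?L"
    then show "y \<in> div_closure ?X"
      by (induction rule: ideal_prod.induct) (use J in \<open>auto intro: div_closure_add\<close>)
  qed
  have L: "?L \<subseteq> carrier B"
  proof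
    fix y assume "y \<in> ?L"
    then show "y \<in> carrier B"
      by (induction rule: ideal_prod.induct) (use J in auto)
  qed
  show "?X \<subseteq> div_closure ?L"
    using R.genideal_self[OF IR] div_closure_incl[OF L] ideal_prod.prod[of _ "Idl\<^bsub>RR\<^esub> I" _ "carrier B" B] by blast
qed

abbreviation "BM \<equiv> algebra_via (%r. r) B"

lemma dual_BM: "f \<in> carrier (dual_module RR BM) \<longleftrightarrow> f \<in> extensional (carrier B) & functional f"
  by (auto simp: dual_module_def functional_def PiE_def Pi_def extensional_def)

lemma functional_restrict:
  "functional f ==> restrict f (carrier B) \<in> carrier (dual_module RR BM)"
  by (auto simp: dual_BM functional_def)

lemma dual_submodule:
  "g \<in> carrier (dual_module RR (BM\<lparr>carrier := L\<rparr>)) \<longleftrightarrow> g \<in> extensional L & (\<forall>x\<in>L. g x \<in> R) &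
    (\<forall>x\<in>L. \<forall>y\<in>L. g (x \<oplus> y) = g x \<oplus> g y) & (\<forall>r\<in>R. \<forall>x\<in>L. g (r \<otimes> x) = r \<otimes> g x)"
  by (auto simp: dual_module_def algebra_via_def PiE_def Pi_def extensional_def)

lemma dual_ops:
  "g \<oplus>\<^bsub>dual_module RR (BM\<lparr>carrier := L\<rparr>)\<^esub> h = (\<lambda>x\<in>L. g x \<oplus> h x)"
  "r \<odot>\<^bsub>dual_module RR (BM\<lparr>carrier := L\<rparr>)\<^esub> g = (\<lambda>x\<in>L. r \<otimes> g x)"
  by (auto simp: dual_module_def algebra_via_def)

lemma bidual_iff:
  "\<phi> \<in> carrier (dual_module RR (dual_module RR M)) \<longleftrightarrow>
    \<phi> \<in> extensional (carrier (dual_module RR M)) & (\<forall>g\<in>carrier (dual_module RR M). \<phi> g \<in> R) &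
    (\<forall>g\<in>carrier (dual_module RR M). \<forall>h\<in>carrier (dual_module RR M).
      \<phi> (g \<oplus>\<^bsub>dual_module RR M\<^esub> h) = \<phi> g \<oplus> \<phi> h) &
    (\<forall>r\<in>R. \<forall>g\<in>carrier (dual_module RR M). \<phi> (r \<odot>\<^bsub>dual_module RR M\<^esub> g) = r \<otimes> \<phi> g)"
  unfolding dual_module_def[of RR "dual_module RR M"] by (auto simp: PiE_def Pi_def extensional_def)

text \<open>What the double dual of the inclusion means on elements: evaluation at y on functionals
  of \<open>B\<close> factors through restriction to \<open>L\<close>, via a linear form \<phi> on
  the dual of \<open>L\<close>.\<close>

lemma reflexive_hull_iff:
  assumes L: "L \<subseteq> carrier B"
  shows "y \<in> reflexive_hull B R L \<longleftrightarrow> y \<in> carrier B &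
    (\<exists>\<phi>\<in>carrier (dual_module RR (dual_module RR (BM\<lparr>carrier := L\<rparr>))).
      \<forall>f. functional f --> f y = \<phi> (restrict f L))" (is "_ \<longleftrightarrow> _ & ?R")
proof -
  let ?N = "BM\<lparr>carrier := L\<rparr>" and ?D = "carrier (dual_module RR BM)"
  let ?res = "dual_map RR ?N BM (%x. x)"
  have res: "?res f = restrict f L" if "f \<in> ?D" for f
    using that by (simp add: dual_map_def)
  have "y \<in> reflexive_hull B R L \<longleftrightarrow> y \<in> carrier B &
      (\<exists>\<phi>\<in>carrier (dual_module RR (dual_module RR ?N)). (\<lambda>f\<in>?D. f y) = (\<lambda>f\<in>?D. \<phi> (?res f)))"
    unfolding reflexive_hull_def Let_def
    by (auto simp: image_iff bidual_eval_def dual_map_def[of RR "dual_module RR BM"])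
  also have "\<dots> \<longleftrightarrow> y \<in> carrier B & ?R"
  proof (intro conj_cong refl bex_cong)
    fix \<phi> assume y: "y \<in> carrier B"
    show "(\<lambda>f\<in>?D. f y) = (\<lambda>f\<in>?D. \<phi> (?res f)) \<longleftrightarrow> (\<forall>f. functional f --> f y = \<phi> (restrict f L))"
    proof
      assume eq: "(\<lambda>f\<in>?D. f y) = (\<lambda>f\<in>?D. \<phi> (?res f))"
      show "\<forall>f. functional f --> f y = \<phi> (restrict f L)"
      proof (intro allI impI)
        fix f assume f: "functional f"
        let ?f = "restrict f (carrier B)"
        have "?f \<in> ?D" using f by (rule functional_restrict)
        then have "?f y = \<phi> (restrict ?f L)" using fun_cong[OF eq, of ?f] res[of ?f] by simp
        moreover have "restrict ?f L = restrict f L" using L by (intro ext) (auto simp: restrict_def)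
        ultimately show "f y = \<phi> (restrict f L)" using y by simp
      qed
    next
      assume "\<forall>f. functional f --> f y = \<phi> (restrict f L)"
      then show "(\<lambda>f\<in>?D. f y) = (\<lambda>f\<in>?D. \<phi> (?res f))"
        using res by (intro restrict_ext) (auto simp: dual_BM)
    qed
  qed
  finally show ?thesis .
qed

text \<open>Linearity is checked after multiplication by \<open>m\<close>, which can be
  cancelled.\<close>

lemma functional_divide:
  assumes m: "m \<in> R" "m ~= \<zero>" and f: "functional f" and h: "!!x. x \<in> carrier B ==> h x \<in> R"
    "!!x. x \<in> carrier B ==> f x = m \<otimes> h x"
  shows "functional h"
  unfolding functional_def
proof (intro conjI ballI)
  fix x y assume xy: "x \<in> carrier B" "y \<in> carrier B"
  show "h (x \<oplus> y) = h x \<oplus> h y"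
    by (rule R_cancel[OF m]) (use xy m h(1) f in \<open>auto simp: r_distr functionalD(2) h(2)[symmetric]\<close>)
next
  fix r x assume rx: "r \<in> R" "x \<in> carrier B"
  show "h (r \<otimes> x) = r \<otimes> h x"
    by (rule R_cancel[OF m])
      (use rx m h(1) f R_lcomm[of m r "h x"] in \<open>auto simp: functionalD(3) h(2)[symmetric]\<close>)
qed (use h in auto)

text \<open>If f = s g on L with g in the dual of L, then f(y) = \<phi>(s g) = s \<phi>(g) for the
  bidual element \<phi> that represents y.\<close>

lemma reflexive_hull_subset:
  assumes L: "L \<subseteq> carrier B" and add: "!!x y. x \<in> L ==> y \<in> L ==> x \<oplus> y \<in> L"
    and scale: "!!r x. r \<in> R ==> x \<in> L ==> r \<otimes> x \<in> L"
  shows "reflexive_hull B R L \<subseteq> div_closure L"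
proof
  fix y assume "y \<in> reflexive_hull B R L"
  then obtain \<phi> where y: "y \<in> carrier B"
    and \<phi>: "\<phi> \<in> carrier (dual_module RR (dual_module RR (BM\<lparr>carrier := L\<rparr>)))"
    and \<phi>f: "!!f. functional f ==> f y = \<phi> (restrict f L)"
    unfolding reflexive_hull_iff[OF L] by blast
  show "y \<in> div_closure L"
  proof (rule div_closureI[OF y])
    fix f s assume f: "functional f" and s: "s \<in> R" and fL: "\<forall>x\<in>L. \<exists>t\<in>R. f x = s \<otimes> t"
    \<comment> \<open>For s = 0 every t solves f(x) = s t and an arbitrary choice would not be
      linear, so \<open>g\<close> is zero then; for s \<noteq> 0 the quotient is unique.\<close>
    define g where "g = (\<lambda>x\<in>L. if s = \<zero> then \<zero> else (SOME t. t \<in> R & f x = s \<otimes> t))"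
    have g: "g x \<in> R" "f x = s \<otimes> g x" if "x \<in> L" for x
    proof -
      have ex: "\<exists>t. t \<in> R & f x = s \<otimes> t" using fL that by blast
      have "g x \<in> R & f x = s \<otimes> g x"
      proof (cases "s = \<zero>")
        case True
        then show ?thesis using ex that by (auto simp: g_def)
      next
        case False
        then have "g x = (SOME t. t \<in> R & f x = s \<otimes> t)" using that by (simp add: g_def)
        then show ?thesis using someI_ex[OF ex] by (simp only:)
      qed
      then show "g x \<in> R" "f x = s \<otimes> g x" by blast+
    qed
    have Lc: "!!x. x \<in> L ==> x \<in> carrier B" using L by auto
    have gN: "g \<in> carrier (dual_module RR (BM\<lparr>carrier := L\<rparr>))"
    proof (cases "s = \<zero>")
      case True
      then show ?thesis using add scale by (auto simp: dual_submodule g_def)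
    next
      case False
      have "g (x \<oplus> z) = g x \<oplus> g z" if "x \<in> L" "z \<in> L" for x z
        by (rule R_cancel[OF s False])
          (use that g(1) add[OF that] f Lc s in \<open>auto simp: r_distr functionalD(2) g(2)[symmetric]\<close>)
      moreover have "g (r \<otimes> x) = r \<otimes> g x" if "r \<in> R" "x \<in> L" for r x
        by (rule R_cancel[OF s False])
          (use that g(1) scale[OF that] f Lc s R_lcomm[of s r "g x"] in \<open>auto simp: functionalD(3) g(2)[symmetric]\<close>)
      ultimately show ?thesis using g by (auto simp: dual_submodule g_def)
    qed
    have "restrict f L = s \<odot>\<^bsub>dual_module RR (BM\<lparr>carrier := L\<rparr>)\<^esub> g"
      unfolding dual_ops by (intro restrict_ext) (use g in auto)
    then have "f y = \<phi> (s \<odot>\<^bsub>dual_module RR (BM\<lparr>carrier := L\<rparr>)\<^esub> g)"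
      using \<phi>f[OF f] by simp
    also have "\<dots> = s \<otimes> \<phi> g" using \<phi> gN s unfolding bidual_iff by blast
    finally show "\<exists>t\<in>R. f y = s \<otimes> t" using \<phi> gN unfolding bidual_iff by blast
  qed
qed

text \<open>With m B \<subseteq> L, every g in the dual of L gives the functional g(m -) on B, and
  this maps L into m R. The test for y yields g(m y) = m t, and g -> t is the bidual element
  sought.\<close>

lemma div_closure_subset_full:
  assumes L: "L \<subseteq> carrier B" and m: "m \<in> R" "m ~= \<zero>" "!!x. x \<in> carrier B ==> m \<otimes> x \<in> L"
    and add: "!!x y. x \<in> L ==> y \<in> L ==> x \<oplus> y \<in> L" and scale: "!!r x. r \<in> R ==> x \<in> L ==> r \<otimes> x \<in> L"
  shows "div_closure L \<subseteq> reflexive_hull B R L"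
proof
  fix y assume y: "y \<in> div_closure L"
  then have yc: "y \<in> carrier B" by (rule div_closure_carrier)
  let ?N = "dual_module RR (BM\<lparr>carrier := L\<rparr>)"
  define \<phi> where "\<phi> = (\<lambda>g\<in>carrier ?N. SOME t. t \<in> R & g (m \<otimes> y) = m \<otimes> t)"
  have \<phi>: "\<phi> g \<in> R" "g (m \<otimes> y) = m \<otimes> \<phi> g" if g: "g \<in> carrier ?N" for g
  proof -
    have "functional (%x. g (m \<otimes> x))"
      unfolding functional_def
    proof (intro conjI ballI)
      fix r x assume "r \<in> R" "x \<in> carrier B"
      then show "g (m \<otimes> (r \<otimes> x)) = r \<otimes> g (m \<otimes> x)"
        using g m R_lcomm[of r m x] by (simp add: dual_submodule)
    qed (use g m in \<open>auto simp: dual_submodule r_distr\<close>)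
    moreover have "\<exists>t\<in>R. g (m \<otimes> x) = m \<otimes> t" if "x \<in> L" for x
      using g that m(1) by (auto simp: dual_submodule)
    ultimately have "\<exists>t\<in>R. g (m \<otimes> y) = m \<otimes> t"
      using div_closureD[OF y _ m(1), of "%x. g (m \<otimes> x)"] by blast
    then have "\<exists>t. t \<in> R & g (m \<otimes> y) = m \<otimes> t" by blast
    from someI_ex[OF this] show "\<phi> g \<in> R" "g (m \<otimes> y) = m \<otimes> \<phi> g" using g by (auto simp: \<phi>_def)
  qed
  have gadd: "(\<lambda>x\<in>L. g x \<oplus> h x) \<in> carrier ?N" if "g \<in> carrier ?N" "h \<in> carrier ?N" for g h
    using that add scale by (auto simp: dual_submodule r_distr a_ac)
  have gscale: "(\<lambda>x\<in>L. r \<otimes> g x) \<in> carrier ?N" if "g \<in> carrier ?N" "r \<in> R" for g r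
    using that add scale R_lcomm[of _ r] by (auto simp: dual_submodule r_distr)
  have \<phi>B: "\<phi> \<in> carrier (dual_module RR ?N)"
    unfolding bidual_iff
  proof (intro conjI ballI)
    fix g h assume gh: "g \<in> carrier ?N" "h \<in> carrier ?N"
    show "\<phi> (g \<oplus>\<^bsub>?N\<^esub> h) = \<phi> g \<oplus> \<phi> h"
      unfolding dual_ops
      by (rule R_cancel[OF m(1,2)])
        (use gh \<phi> gadd[OF gh] m yc \<phi>(2)[OF gadd[OF gh]] in \<open>auto simp: r_distr\<close>)
  next
    fix r g assume rg: "r \<in> R" "g \<in> carrier ?N"
    show "\<phi> (r \<odot>\<^bsub>?N\<^esub> g) = r \<otimes> \<phi> g"
      unfolding dual_ops
      by (rule R_cancel[OF m(1,2)])
        (use rg \<phi> gscale[OF rg(2,1)] m yc \<phi>(2)[OF gscale[OF rg(2,1)]] R_lcomm[of m r "\<phi> g"] in auto)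
  qed (use \<phi>(1) in \<open>auto simp: \<phi>_def extensional_def\<close>)
  have "f y = \<phi> (restrict f L)" if f: "functional f" for f
  proof (rule R_cancel[OF m(1,2)])
    have rN: "restrict f L \<in> carrier ?N"
      using f L add scale by (auto simp: dual_submodule functional_def subset_iff)
    show "\<phi> (restrict f L) \<in> carrier B" using \<phi>(1)[OF rN] by simp
    show "m \<otimes> f y = m \<otimes> \<phi> (restrict f L)"
      using \<phi>(2)[OF rN] m yc f by (simp add: functionalD(3))
  qed (use f yc functionalD in auto)
  then show "y \<in> reflexive_hull B R L"
    unfolding reflexive_hull_iff[OF L] using yc \<phi>B by blast
qed

text \<open>There is no nonzero m with m B \<subseteq> L here. Instead the test with s = 0 forces
  f(y) = 0 for every functional, so the zero bidual element represents y.\<close>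

lemma div_closure_subset_zero: "div_closure {\<zero>} \<subseteq> reflexive_hull B R {\<zero>}"
proof
  fix y assume y: "y \<in> div_closure {\<zero>}"
  let ?N = "dual_module RR (BM\<lparr>carrier := {\<zero>}\<rparr>)"
  have yc: "y \<in> carrier B" using y by (rule div_closure_carrier)
  have fy: "f y = \<zero>" if "functional f" for f
  proof -
    have "\<exists>t\<in>R. f x = \<zero> \<otimes> t" if "x \<in> {\<zero>}" for x
      using that functionalD(4)[OF \<open>functional f\<close>] by (intro bexI[of _ \<zero>]) auto
    then have "\<exists>t\<in>R. f y = \<zero> \<otimes> t" by (intro div_closureD[OF y \<open>functional f\<close>]) auto
    then show ?thesis by auto
  qed
  have ext: "(\<lambda>x\<in>{\<zero>}. g x \<oplus> h x) \<in> carrier ?N" if "g \<in> carrier ?N" "h \<in> carrier ?N" for g h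
    using that by (auto simp: dual_submodule r_distr a_ac)
  have ext2: "(\<lambda>x\<in>{\<zero>}. r \<otimes> g x) \<in> carrier ?N" if "g \<in> carrier ?N" "r \<in> R" for g r
    using that R_lcomm[of _ r] by (auto simp: dual_submodule r_distr)
  have "(\<lambda>g\<in>carrier ?N. \<zero>) \<in> carrier (dual_module RR ?N)"
    unfolding bidual_iff using ext ext2 by (auto simp: dual_ops)
  moreover have "restrict f {\<zero>} \<in> carrier ?N" if "functional f" for f
    using functionalD[OF that] by (auto simp: dual_submodule)
  ultimately show "y \<in> reflexive_hull B R {\<zero>}"
    unfolding reflexive_hull_iff[of "{\<zero>}", simplified] using yc fy
    by (auto intro!: bexI[of _ "\<lambda>g\<in>carrier ?N. \<zero>"])
qed

lemma ideal_prod_cases: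
  assumes "ideal I RR"
  shows "ideal_prod B I (carrier B) \<subseteq> carrier B"
    "x \<in> ideal_prod B I (carrier B) ==> r \<in> R ==> r \<otimes> x \<in> ideal_prod B I (carrier B)"
proof -
  interpret I: ideal I RR by fact
  have Ic: "i \<in> R" if "i \<in> I" for i using I.Icarr[OF that] by simp
  have "x \<in> carrier B & (\<forall>r\<in>R. r \<otimes> x \<in> ideal_prod B I (carrier B))" if "x \<in> ideal_prod B I (carrier B)" for x
    using that
  proof induction
    case (prod i j)
    have "r \<otimes> (i \<otimes> j) \<in> ideal_prod B I (carrier B)" if "r \<in> R" for r
    proof -
      have "r \<otimes> i \<in> I" using I.I_l_closed[OF prod(1), of r] that by simp
      then have "(r \<otimes> i) \<otimes> j \<in> ideal_prod B I (carrier B)" using prod(2) by (rule ideal_prod.prod)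
      then show ?thesis using that prod Ic by (simp add: m_assoc)
    qed
    then show ?case using prod Ic by auto
  qed (auto simp: r_distr intro: ideal_prod.sum)
  then show "ideal_prod B I (carrier B) \<subseteq> carrier B"
    "x \<in> ideal_prod B I (carrier B) ==> r \<in> R ==> r \<otimes> x \<in> ideal_prod B I (carrier B)" by auto
qed

text \<open>A nonzero element m of the ideal supplies m B \<subseteq> I B; the zero ideal is the
  remaining case.\<close>

lemma reflexive_hull_ideal_prod:
  assumes I: "ideal I RR"
  shows "reflexive_hull B R (ideal_prod B I (carrier B)) = div_closure (ideal_prod B I (carrier B))"
    (is "reflexive_hull B R ?L = _")
proof (intro equalityI)
  interpret I: ideal I RR by fact
  note L = ideal_prod_cases[OF I]
  have add: "x \<oplus> y \<in> ?L" if "x \<in> ?L" "y \<in> ?L" for x y using that by (rule ideal_prod.sum)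
  show "reflexive_hull B R ?L \<subseteq> div_closure ?L"
    by (rule reflexive_hull_subset) (use L add in auto)
  show "div_closure ?L \<subseteq> reflexive_hull B R ?L"
  proof (cases "I = {\<zero>}")
    case True
    have "x = \<zero>" if "x \<in> ?L" for x
      using that by induction (auto simp: True)
    moreover have "\<zero> \<otimes> \<zero> \<in> ?L" by (rule ideal_prod.prod) (auto simp: True)
    then have "\<zero> \<in> ?L" by simp
    ultimately have "?L = {\<zero>}" by blast
    then show ?thesis using div_closure_subset_zero by simp
  next
    case False
    then obtain m where m: "m \<in> I" "m ~= \<zero>" using I.zero_closed by auto
    then have "m \<in> R" using I.Icarr by auto
    then show ?thesis
      by (intro div_closure_subset_full[of _ m]) (use L add m in \<open>auto intro: ideal_prod.prod\<close>)
  qed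
qed

end

section \<open>Reflexivity in coordinates\<close>

lemma (in central_domain) dual_BM_ops:
  "g \<oplus>\<^bsub>dual_module RR BM\<^esub> h = (\<lambda>x\<in>carrier B. g x \<oplus> h x)"
  "r \<odot>\<^bsub>dual_module RR BM\<^esub> g = (\<lambda>x\<in>carrier B. r \<otimes> g x)"
  by (auto simp: dual_module_def)

lemma (in central_domain) functional_cong:
  assumes "functional f" "!!x. x \<in> carrier B ==> g x = f x"
  shows "functional g"
  using assms by (simp add: functional_def)

lemma (in central_domain) functional_add:
  assumes "functional f" "functional g" shows "functional (%x. f x \<oplus> g x)"
  unfolding functional_def
proof (intro conjI ballI)
  fix x y assume "x \<in> carrier B" "y \<in> carrier B"
  then show "f (x \<oplus> y) \<oplus> g (x \<oplus> y) = f x \<oplus> g x \<oplus> (f y \<oplus> g y)"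
    using functionalD[OF assms(1)] functionalD[OF assms(2)] by (simp add: a_ac)
qed (use functionalD[OF assms(1)] functionalD[OF assms(2)] in \<open>auto simp: r_distr\<close>)

context quasi_coordinates
begin

lemma C_functional: "i < w ==> functional (C i)"
  by (simp add: functional_def C_add C_scale)

lemma coordinates_eqI:
  assumes "y \<in> carrier B" "z \<in> carrier B" "!!i. i < w ==> C i y = C i z"
  shows "y = z"
proof (rule R_cancel[OF c_R c_nonzero assms(1,2)])
  show "c \<otimes> y = c \<otimes> z"
    unfolding C_sum[OF assms(1)] C_sum[OF assms(2)]
    by (rule finsum_cong') (use assms in auto)
qed

text \<open>The coordinates are functionals and already separate points.\<close>

lemma torsionless:
  assumes "y \<in> carrier B" "!!f. functional f ==> f y = \<zero>"
  shows "y = \<zero>"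
  by (rule coordinates_eqI) (use assms in \<open>auto simp: C_functional functionalD\<close>)

text \<open>Dividing f(y) by c for every functional f defines an element of the bidual; reflexivity
  represents it as evaluation at some x, and then y and c x have the same coordinates.\<close>

lemma reflexive_imp_closed:
  assumes refl: "reflexive_module RR BM" and y: "y \<in> div_closure {c \<otimes> x | x. x \<in> carrier B}"
  shows "\<exists>x\<in>carrier B. y = c \<otimes> x"
proof -
  let ?D = "carrier (dual_module RR BM)"
  have yc: "y \<in> carrier B" using y by (rule div_closure_carrier)
  have "\<exists>t. t \<in> R & f y = c \<otimes> t" if f: "functional f" for f
  proof -
    have "\<exists>t\<in>R. f x = c \<otimes> t" if "x \<in> {c \<otimes> x | x. x \<in> carrier B}" for x
      using that functionalD[OF f] by auto
    from div_closureD[OF y f c_R this] show ?thesis by blast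
  qed
  then obtain q where q: "!!f. functional f ==> q f \<in> R & f y = c \<otimes> q f" by metis
  define \<phi> where "\<phi> = restrict q ?D"
  have \<phi>: "\<phi> f \<in> R" "f y = c \<otimes> \<phi> f" if "f \<in> ?D" for f
    using q[of f] that by (auto simp: \<phi>_def dual_BM)
  have add: "(\<lambda>x\<in>carrier B. f x \<oplus> g x) \<in> ?D" if "f \<in> ?D" "g \<in> ?D" for f g
    using functional_restrict[OF functional_add, of f g] that by (simp add: dual_BM)
  have scale: "(\<lambda>x\<in>carrier B. r \<otimes> f x) \<in> ?D" if "r \<in> R" "f \<in> ?D" for r f
    using functional_restrict[OF functional_scale, of f r] that by (simp add: dual_BM)
  have "\<phi> \<in> carrier (dual_module RR (dual_module RR BM))"
    unfolding bidual_iff dual_BM_ops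
  proof (intro conjI ballI)
    fix f g assume fg: "f \<in> ?D" "g \<in> ?D"
    show "\<phi> (\<lambda>x\<in>carrier B. f x \<oplus> g x) = \<phi> f \<oplus> \<phi> g"
      by (rule R_cancel[OF c_R c_nonzero])
        (use \<phi>(1) \<phi>(2)[OF fg(1)] \<phi>(2)[OF fg(2)] \<phi>(2)[OF add[OF fg]] fg add[OF fg] yc in \<open>auto simp: r_distr\<close>)
  next
    fix r f assume rf: "r \<in> R" "f \<in> ?D"
    show "\<phi> (\<lambda>x\<in>carrier B. r \<otimes> f x) = r \<otimes> \<phi> f"
      by (rule R_cancel[OF c_R c_nonzero])
        (use \<phi>(1) \<phi>(2)[OF rf(2)] \<phi>(2)[OF scale[OF rf]] rf scale[OF rf] yc R_lcomm[of c r "\<phi> f"] in auto)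
  qed (use \<phi> in \<open>auto simp: \<phi>_def\<close>)
  then obtain x where x: "x \<in> carrier B" "\<phi> = bidual_eval RR BM x"
    using refl unfolding reflexive_module_def bij_betw_def by auto
  have "C i y = C i (c \<otimes> x)" if i: "i < w" for i
  proof -
    let ?f = "restrict (C i) (carrier B)"
    have f: "?f \<in> ?D" using C_functional[OF i] by (rule functional_restrict)
    have "C i y = c \<otimes> \<phi> ?f" using \<phi>(2)[OF f] yc by simp
    also have "\<phi> ?f = C i x" using f x by (simp add: bidual_eval_def)
    finally show ?thesis using i x C_scale[of i c x] by simp
  qed
  then have "y = c \<otimes> x" using coordinates_eqI[of y "c \<otimes> x"] x yc by simp
  then show ?thesis using x by blast
qed

text \<open>Since c f is the sum of the f(b_i) C_i, a bidual element \<phi> satisfies c \<phi>(f) =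
  f(y) for y the sum of the \<phi>(C_i) b_i. This y passes the tests for c B, so y = c x and \<phi>
  is evaluation at x. Reflexivity thus amounts to closedness of c B, a condition that can be
  tensored.\<close>

lemma reflexive_if_closed:
  assumes closed: "!!y. y \<in> div_closure {c \<otimes> x | x. x \<in> carrier B} ==> \<exists>x\<in>carrier B. y = c \<otimes> x"
  shows "reflexive_module RR BM"
proof -
  let ?D = "carrier (dual_module RR BM)"
  have add: "(\<lambda>x\<in>carrier B. f x \<oplus> g x) \<in> ?D" if "f \<in> ?D" "g \<in> ?D" for f g
    using functional_restrict[OF functional_add, of f g] that by (simp add: dual_BM)
  have scale: "(\<lambda>x\<in>carrier B. r \<otimes> f x) \<in> ?D" if "r \<in> R" "f \<in> ?D" for r f
    using functional_restrict[OF functional_scale, of f r] that by (simp add: dual_BM)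
  have eval: "bidual_eval RR BM x \<in> carrier (dual_module RR (dual_module RR BM))" if "x \<in> carrier B" for x
    unfolding bidual_iff dual_BM_ops bidual_eval_def
    using that add scale by (auto simp: dual_BM functionalD)
  have inj: "x = y" if "x \<in> carrier B" "y \<in> carrier B" "bidual_eval RR BM x = bidual_eval RR BM y" for x y
  proof (rule coordinates_eqI[OF that(1,2)])
    fix i assume i: "i < w"
    let ?f = "restrict (C i) (carrier B)"
    have f: "?f \<in> ?D" using C_functional[OF i] by (rule functional_restrict)
    then show "C i x = C i y"
      using fun_cong[OF that(3), of ?f] that by (simp add: bidual_eval_def)
  qed
  have surj: "\<exists>x\<in>carrier B. \<phi> = bidual_eval RR BM x"
    if "\<phi> \<in> carrier (dual_module RR (dual_module RR BM))" for \<phi>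
  proof -
    have ext: "\<phi> \<in> extensional ?D" and \<phi>R: "!!f. f \<in> ?D ==> \<phi> f \<in> R"
      and \<phi>add: "!!f g. f \<in> ?D ==> g \<in> ?D ==> \<phi> (\<lambda>x\<in>carrier B. f x \<oplus> g x) = \<phi> f \<oplus> \<phi> g"
      and \<phi>scale: "!!r f. r \<in> R ==> f \<in> ?D ==> \<phi> (\<lambda>x\<in>carrier B. r \<otimes> f x) = r \<otimes> \<phi> f"
      using that unfolding bidual_iff dual_BM_ops by auto
    \<comment> \<open>\<phi> lives on restricted functions; \<Phi> accepts any functional and hides
      the restriction.\<close>
    define \<Phi> where "\<Phi> f = \<phi> (restrict f (carrier B))" for f
    have \<Phi>R: "\<Phi> f \<in> R" if "functional f" for f
      using \<phi>R[OF functional_restrict[OF that]] by (simp add: \<Phi>_def)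
    have \<Phi>cong: "\<Phi> f = \<Phi> g" if "!!x. x \<in> carrier B ==> f x = g x" for f g
    proof -
      have "restrict f (carrier B) = restrict g (carrier B)" using that by (rule restrict_ext)
      then show ?thesis by (simp add: \<Phi>_def)
    qed
    have \<Phi>add: "\<Phi> (%x. f x \<oplus> g x) = \<Phi> f \<oplus> \<Phi> g" if "functional f" "functional g" for f g
    proof -
      have "restrict (%x. f x \<oplus> g x) (carrier B) =
          (\<lambda>x\<in>carrier B. restrict f (carrier B) x \<oplus> restrict g (carrier B) x)" by (rule restrict_ext) simp
      then show ?thesis
        using \<phi>add[OF functional_restrict[OF that(1)] functional_restrict[OF that(2)]] by (simp only: \<Phi>_def)
    qed
    have \<Phi>scale: "\<Phi> (%x. r \<otimes> f x) = r \<otimes> \<Phi> f" if "functional f" "r \<in> R" for f r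
    proof -
      have "restrict (%x. r \<otimes> f x) (carrier B) = (\<lambda>x\<in>carrier B. r \<otimes> restrict f (carrier B) x)"
        by (rule restrict_ext) simp
      then show ?thesis
        using \<phi>scale[OF that(2) functional_restrict[OF that(1)]] by (simp only: \<Phi>_def)
    qed
    define y where "y = (\<Oplus>i\<in>{..<w}. \<Phi> (C i) \<otimes> b i)"
    have yc: "y \<in> carrier B"
      unfolding y_def using \<Phi>R C_functional by (auto intro!: finsum_closed)
    have \<Phi>y: "c \<otimes> \<Phi> f = f y" if f: "functional f" for f
    proof -
      \<comment> \<open>Linearity of \<Phi> on a sum needs the partial sums to be functionals, so
        both facts go through one induction on the number of terms.\<close>
      have step: "functional (%x. \<Oplus>i\<in>{..<n}. f (b i) \<otimes> C i x) &
          \<Phi> (%x. \<Oplus>i\<in>{..<n}. f (b i) \<otimes> C i x) = (\<Oplus>i\<in>{..<n}. f (b i) \<otimes> \<Phi> (C i))" if "n \<le> w" for n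
        using that
      proof (induction n)
        case 0
        have z: "functional (%x. \<zero>)" by (auto simp: functional_def)
        have "\<Phi> (%x. \<zero> \<otimes> \<zero>) = \<zero> \<otimes> \<Phi> (%x. \<zero>)" by (rule \<Phi>scale[OF z]) simp
        then have "\<Phi> (%x. \<zero>) = \<zero>" using \<Phi>R[OF z] by simp
        then show ?case using z by simp
      next
        case (Suc n)
        let ?g = "%x. \<Oplus>i\<in>{..<n}. f (b i) \<otimes> C i x" and ?h = "%x. f (b n) \<otimes> C n x"
        have n: "n < w" "f (b n) \<in> R" using Suc.prems functionalD[OF f] by auto
        have h: "functional ?h" "\<Phi> ?h = f (b n) \<otimes> \<Phi> (C n)"
          using functional_scale[OF C_functional[OF n(1)] n(2)] \<Phi>scale[OF C_functional[OF n(1)] n(2)] by auto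
        have g: "functional ?g" "\<Phi> ?g = (\<Oplus>i\<in>{..<n}. f (b i) \<otimes> \<Phi> (C i))" using Suc by auto
        have eq: "(\<Oplus>i\<in>{..<Suc n}. f (b i) \<otimes> C i x) = ?h x \<oplus> ?g x" if "x \<in> carrier B" for x
          using that Suc.prems functionalD[OF f] by (subst lessThan_Suc, subst finsum_insert) auto
        have "functional (%x. \<Oplus>i\<in>{..<Suc n}. f (b i) \<otimes> C i x)"
          by (rule functional_cong[OF functional_add[OF h(1) g(1)] eq])
        moreover have "\<Phi> (%x. \<Oplus>i\<in>{..<Suc n}. f (b i) \<otimes> C i x) = \<Phi> ?h \<oplus> \<Phi> ?g"
          using \<Phi>cong[of "%x. \<Oplus>i\<in>{..<Suc n}. f (b i) \<otimes> C i x", OF eq] \<Phi>add[OF h(1) g(1)] by simp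
        moreover have "\<Phi> ?h \<oplus> \<Phi> ?g = (\<Oplus>i\<in>{..<Suc n}. f (b i) \<otimes> \<Phi> (C i))"
          unfolding h(2) g(2) using n Suc.prems functionalD[OF f] \<Phi>R C_functional
          by (subst lessThan_Suc, subst finsum_insert) auto
        ultimately show ?case by simp
      qed
      have fsum: "f (\<Oplus>i\<in>{..<w}. r i \<otimes> b i) = (\<Oplus>i\<in>{..<w}. f (b i) \<otimes> r i)"
        if r: "!!i. i < w ==> r i \<in> R" for r
      proof -
        have "f (\<Oplus>i\<in>{..<w}. r i \<otimes> b i) = (\<Oplus>\<^bsub>RR\<^esub>i\<in>{..<w}. f (r i \<otimes> b i))"
          by (rule additive_finsum) (use r functionalD[OF f] in auto)
        also have "\<dots> = (\<Oplus>i\<in>{..<w}. f (r i \<otimes> b i))"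
          by (rule finsum_RR(1)) (use r functionalD[OF f] in auto)
        also have "\<dots> = (\<Oplus>i\<in>{..<w}. f (b i) \<otimes> r i)"
        proof (rule finsum_cong')
          fix i assume "i \<in> {..<w}"
          then have i: "i < w" by simp
          show "f (r i \<otimes> b i) = f (b i) \<otimes> r i"
            using i r[OF i] functionalD(1,3)[OF f] R_comm[of "r i" "f (b i)"] by simp
        qed (use r functionalD[OF f] in auto)
        finally show ?thesis .
      qed
      have "c \<otimes> \<Phi> f = \<Phi> (%x. c \<otimes> f x)" using \<Phi>scale[OF f c_R] by simp
      also have "\<dots> = \<Phi> (%x. \<Oplus>i\<in>{..<w}. f (b i) \<otimes> C i x)"
      proof (rule \<Phi>cong)
        fix x assume x: "x \<in> carrier B"
        have "c \<otimes> f x = f (c \<otimes> x)" using x functionalD[OF f] by simp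
        then show "c \<otimes> f x = (\<Oplus>i\<in>{..<w}. f (b i) \<otimes> C i x)"
          unfolding C_sum[OF x] using fsum[of "%i. C i x"] x by simp
      qed
      also have "\<dots> = (\<Oplus>i\<in>{..<w}. f (b i) \<otimes> \<Phi> (C i))" using step[of w] by simp
      also have "\<dots> = f y" unfolding y_def using fsum[of "%i. \<Phi> (C i)"] \<Phi>R C_functional by simp
      finally show ?thesis .
    qed
    have "y \<in> div_closure {c \<otimes> x | x. x \<in> carrier B}"
    proof (rule div_closureI[OF yc])
      fix f s assume f: "functional f" and s: "s \<in> R" and fs: "\<forall>x\<in>{c \<otimes> x | x. x \<in> carrier B}. \<exists>t\<in>R. f x = s \<otimes> t"
      have fs': "\<exists>t\<in>R. f (c \<otimes> x) = s \<otimes> t" if "x \<in> carrier B" for x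
        using that by (intro fs[rule_format]) blast
      show "\<exists>t\<in>R. f y = s \<otimes> t"
      proof (cases "s = \<zero>")
        case True
        have "f x = \<zero>" if "x \<in> carrier B" for x
        proof -
          obtain t where "t \<in> R" "f (c \<otimes> x) = s \<otimes> t" using fs'[OF \<open>x \<in> carrier B\<close>] by blast
          then have "c \<otimes> f x = \<zero>" using True functionalD[OF f] that by simp
          then show ?thesis using R_integral[of c "f x"] c_nonzero functionalD[OF f] that by auto
        qed
        then show ?thesis using yc True by (intro bexI[of _ \<zero>]) auto
      next
        case False
        have "\<exists>t. x \<in> carrier B --> t \<in> R & c \<otimes> f x = s \<otimes> t" for x
        proof (cases "x \<in> carrier B")
          case True
          then obtain t where "t \<in> R" "f (c \<otimes> x) = s \<otimes> t" using fs'[OF \<open>x \<in> carrier B\<close>] by blast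
          then show ?thesis using functionalD[OF f] True by auto
        qed auto
        \<comment> \<open>h = c f / s is a functional with c f = s h, so that f(y) = \<Phi>(c f) = s
          \<Phi>(h).\<close>
        then obtain h where h: "!!x. x \<in> carrier B ==> h x \<in> R & c \<otimes> f x = s \<otimes> h x" by metis
        have hf: "functional h"
          by (rule functional_divide[OF s False functional_scale[OF f c_R]]) (use h in auto)
        have "f y = \<Phi> (%x. c \<otimes> f x)" using \<Phi>y[OF f] \<Phi>scale[OF f c_R] by simp
        also have "\<dots> = \<Phi> (%x. s \<otimes> h x)" by (rule \<Phi>cong) (use h in auto)
        also have "\<dots> = s \<otimes> \<Phi> h" by (rule \<Phi>scale[OF hf s])
        finally show ?thesis using \<Phi>R[OF hf] by blast
      qed
    qed
    from closed[OF this] obtain x where x: "x \<in> carrier B" "y = c \<otimes> x" by blast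
    have "\<phi> f = bidual_eval RR BM x f" for f
    proof (cases "f \<in> ?D")
      case True
      then have f: "functional f" "restrict f (carrier B) = f" by (auto simp: dual_BM extensional_restrict)
      have "\<phi> f = f x"
      proof (rule R_cancel[OF c_R c_nonzero])
        show "c \<otimes> \<phi> f = c \<otimes> f x" using \<Phi>y[OF f(1)] x functionalD[OF f(1)] by (simp add: \<Phi>_def f(2))
      qed (use \<phi>R[OF True] functionalD[OF f(1)] x in auto)
      then show ?thesis using True by (simp add: bidual_eval_def)
    next
      case False
      then show ?thesis using ext by (simp add: bidual_eval_def extensional_def)
    qed
    then show ?thesis using x by blast
  qed
  show ?thesis
    unfolding reflexive_module_def bij_betw_def
  proof
    show "inj_on (bidual_eval RR BM) (carrier BM)" using inj by (auto intro: inj_onI)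
    show "bidual_eval RR BM ` carrier BM = carrier (dual_module RR (dual_module RR BM))"
    proof (intro equalityI subsetI)
      fix \<phi> assume "\<phi> \<in> carrier (dual_module RR (dual_module RR BM))"
      from surj[OF this] show "\<phi> \<in> bidual_eval RR BM ` carrier BM" by auto
    qed (use eval in auto)
  qed
qed

end

section \<open>Prime rings and normal elements\<close>

text \<open>For central r, the set r B and the annihilator of r are two-sided ideals with product
  zero, so primeness makes one of them zero.\<close>

lemma prime_ring_central_regular:
  assumes prime: "prime_ring B" and r: "r \<in> center B" and x: "x \<in> carrier B"
    and rx: "r \<otimes>\<^bsub>B\<^esub> x = \<zero>\<^bsub>B\<^esub>"
  shows "r = \<zero>\<^bsub>B\<^esub> \<or> x = \<zero>\<^bsub>B\<^esub>"
proof -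
  interpret ring B using prime by (simp add: prime_ring_def)
  have rc: "r \<in> carrier B" "!!y. y \<in> carrier B ==> y \<otimes>\<^bsub>B\<^esub> r = r \<otimes>\<^bsub>B\<^esub> y"
    using r by (auto simp: center_def)
  have comm: "r \<otimes>\<^bsub>B\<^esub> (a \<otimes>\<^bsub>B\<^esub> y) = a \<otimes>\<^bsub>B\<^esub> (r \<otimes>\<^bsub>B\<^esub> y)" if "a \<in> carrier B" "y \<in> carrier B" for a y
    using that rc(1) rc(2)[of a] by (simp add: m_assoc[symmetric])
  let ?I = "{r \<otimes>\<^bsub>B\<^esub> y | y. y \<in> carrier B}" and ?J = "{y \<in> carrier B. r \<otimes>\<^bsub>B\<^esub> y = \<zero>\<^bsub>B\<^esub>}"
  have I: "ideal ?I B"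
  proof (rule idealI[OF ring_axioms])
    show "subgroup ?I (add_monoid B)"
    proof (rule group.subgroupI[OF a_group])
      show "?I \<subseteq> carrier (add_monoid B)" "?I ~= {}" using rc by auto
      fix a b assume "a \<in> ?I"
      then obtain y where y: "y \<in> carrier B" "a = r \<otimes>\<^bsub>B\<^esub> y" by blast
      then have "\<ominus>\<^bsub>B\<^esub> a = r \<otimes>\<^bsub>B\<^esub> (\<ominus>\<^bsub>B\<^esub> y)" using rc by (simp add: r_minus)
      then show "inv\<^bsub>add_monoid B\<^esub> a \<in> ?I" unfolding a_inv_def[symmetric] using y by blast
      assume "b \<in> ?I"
      then obtain z where z: "z \<in> carrier B" "b = r \<otimes>\<^bsub>B\<^esub> z" by blast
      then have "a \<oplus>\<^bsub>B\<^esub> b = r \<otimes>\<^bsub>B\<^esub> (y \<oplus>\<^bsub>B\<^esub> z)" using y rc by (simp add: r_distr)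
      moreover have "y \<oplus>\<^bsub>B\<^esub> z \<in> carrier B" using y z by simp
      ultimately show "a \<otimes>\<^bsub>add_monoid B\<^esub> b \<in> ?I" by auto
    qed
    fix a x assume "a \<in> ?I" and x: "x \<in> carrier B"
    then obtain y where y: "y \<in> carrier B" "a = r \<otimes>\<^bsub>B\<^esub> y" by blast
    have "x \<otimes>\<^bsub>B\<^esub> a = r \<otimes>\<^bsub>B\<^esub> (x \<otimes>\<^bsub>B\<^esub> y)" using x y comm[of x y] by simp
    then show "x \<otimes>\<^bsub>B\<^esub> a \<in> ?I" using x y m_closed by blast
    have "a \<otimes>\<^bsub>B\<^esub> x = r \<otimes>\<^bsub>B\<^esub> (y \<otimes>\<^bsub>B\<^esub> x)" using x y rc by (simp add: m_assoc)
    then show "a \<otimes>\<^bsub>B\<^esub> x \<in> ?I" using x y m_closed by blast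
  qed
  have J: "ideal ?J B"
  proof (rule idealI[OF ring_axioms])
    show "subgroup ?J (add_monoid B)"
    proof (rule group.subgroupI[OF a_group])
      fix a assume "a \<in> ?J"
      then show "inv\<^bsub>add_monoid B\<^esub> a \<in> ?J"
        unfolding a_inv_def[symmetric] using rc(1) by (auto simp: r_minus)
    next
      have "\<zero>\<^bsub>B\<^esub> \<in> ?J" using rc(1) by simp
      then show "?J ~= {}" by blast
    qed (use rc(1) in \<open>auto simp: r_distr\<close>)
    fix a x assume "a \<in> ?J" "x \<in> carrier B"
    then show "x \<otimes>\<^bsub>B\<^esub> a \<in> ?J" "a \<otimes>\<^bsub>B\<^esub> x \<in> ?J"
      using rc(1) comm[of x a] m_assoc[of r a x, symmetric] by auto
  qed
  have "ideal_prod B ?I ?J = {\<zero>\<^bsub>B\<^esub>}"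
  proof (intro equalityI subsetI)
    fix y assume "y \<in> ideal_prod B ?I ?J"
    then show "y \<in> {\<zero>\<^bsub>B\<^esub>}"
    proof induction
      case (prod i j)
      then obtain y where "y \<in> carrier B" "i = r \<otimes>\<^bsub>B\<^esub> y" by blast
      then show ?case using prod rc(1) comm[of y j] by (simp add: m_assoc)
    qed auto
  next
    have "r \<otimes>\<^bsub>B\<^esub> \<zero>\<^bsub>B\<^esub> \<in> ?I" by blast
    moreover have "\<zero>\<^bsub>B\<^esub> \<in> ?J" using rc(1) by simp
    ultimately have "(r \<otimes>\<^bsub>B\<^esub> \<zero>\<^bsub>B\<^esub>) \<otimes>\<^bsub>B\<^esub> \<zero>\<^bsub>B\<^esub> \<in> ideal_prod B ?I ?J" by (rule ideal_prod.prod)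
    then have "\<zero>\<^bsub>B\<^esub> \<in> ideal_prod B ?I ?J" using rc(1) by simp
    moreover fix y assume "y \<in> {\<zero>\<^bsub>B\<^esub>}"
    ultimately show "y \<in> ideal_prod B ?I ?J" by blast
  qed
  then have "?I = {\<zero>\<^bsub>B\<^esub>} \<or> ?J = {\<zero>\<^bsub>B\<^esub>}" using prime I J unfolding prime_ring_def by blast
  moreover have "r \<otimes>\<^bsub>B\<^esub> \<one>\<^bsub>B\<^esub> \<in> ?I" "x \<in> ?J" using x rx by blast+
  ultimately show ?thesis using rc(1) by auto
qed

lemma prime_ring_central_domain:
  assumes prime: "prime_ring B" and sub: "subring R B" and cen: "R \<subseteq> center B"
  shows "central_domain B R"
proof -
  interpret ring B using prime by (simp add: prime_ring_def)
  have Rc: "r \<in> carrier B" if "r \<in> R" for r using that subringE(1)[OF sub] by auto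
  have comm: "r \<otimes>\<^bsub>B\<^esub> s = s \<otimes>\<^bsub>B\<^esub> r" if "r \<in> R" "s \<in> R" for r s
    using that cen Rc by (auto simp: center_def)
  have one: "\<one>\<^bsub>B\<^esub> ~= \<zero>\<^bsub>B\<^esub>"
  proof
    assume "\<one>\<^bsub>B\<^esub> = \<zero>\<^bsub>B\<^esub>"
    then have "carrier B = {\<zero>\<^bsub>B\<^esub>}" using carrier_one_zero by simp
    then show False using prime by (simp add: prime_ring_def)
  qed
  interpret R: ring "B\<lparr>carrier := R\<rparr>" by (rule subring_is_ring[OF sub])
  have "cring (B\<lparr>carrier := R\<rparr>)"
  proof (rule cringI[OF R.abelian_group_axioms])
    show "comm_monoid (B\<lparr>carrier := R\<rparr>)"
      by (rule R.monoid_comm_monoidI) (use comm in auto)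
  qed (use R.l_distr in auto)
  moreover have reg: "r = \<zero>\<^bsub>B\<^esub> \<or> b = \<zero>\<^bsub>B\<^esub>" if "r \<in> R" "b \<in> carrier B" "r \<otimes>\<^bsub>B\<^esub> b = \<zero>\<^bsub>B\<^esub>" for r b
    using prime_ring_central_regular[OF prime] cen that by blast
  ultimately have "domain (B\<lparr>carrier := R\<rparr>)"
    by (intro domain.intro domain_axioms.intro) (use one Rc in auto)
  then show ?thesis
    by (intro central_domain.intro central_domain_axioms.intro ring_axioms sub cen) (use reg in auto)
qed

context ring
begin

lemma normal_element_iff:
  "normal_element R d \<longleftrightarrow> d \<in> carrier R & (\<forall>x\<in>carrier R. \<exists>y\<in>carrier R. d \<otimes> x = y \<otimes> d) &
    (\<forall>x\<in>carrier R. \<exists>y\<in>carrier R. x \<otimes> d = d \<otimes> y)"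
proof -
  have "d <# carrier R = (%x. d \<otimes> x) ` carrier R" "carrier R #> d = (%x. x \<otimes> d) ` carrier R"
    by (auto simp: l_coset_def r_coset_def)
  then show ?thesis unfolding normal_element_def by (auto simp: set_eq_iff image_iff Bex_def)
qed

lemma normal_element_pow:
  assumes "normal_element R d" shows "normal_element R (d [^] (n :: nat))"
proof (induction n)
  case 0
  then show ?case by (auto simp: normal_element_iff intro!: bexI)
next
  case (Suc n)
  let ?e = "d [^] n"
  have d: "d \<in> carrier R" "?e \<in> carrier R" using assms Suc by (auto simp: normal_element_iff)
  show ?case
    unfolding normal_element_iff
  proof (intro conjI ballI)
    fix x assume x: "x \<in> carrier R"
    obtain y where y: "y \<in> carrier R" "d \<otimes> x = y \<otimes> d" using assms x by (auto simp: normal_element_iff)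
    obtain z where z: "z \<in> carrier R" "?e \<otimes> y = z \<otimes> ?e" using Suc y by (auto simp: normal_element_iff)
    have "?e \<otimes> d \<otimes> x = ?e \<otimes> y \<otimes> d" using x y d by (simp add: m_assoc)
    also have "\<dots> = z \<otimes> (?e \<otimes> d)" using z d by (simp add: m_assoc)
    finally show "\<exists>y\<in>carrier R. d [^] Suc n \<otimes> x = y \<otimes> d [^] Suc n" using z by auto
    obtain y where y: "y \<in> carrier R" "x \<otimes> ?e = ?e \<otimes> y" using Suc x by (auto simp: normal_element_iff)
    obtain z where z: "z \<in> carrier R" "y \<otimes> d = d \<otimes> z" using assms y by (auto simp: normal_element_iff)
    have "x \<otimes> (?e \<otimes> d) = ?e \<otimes> (y \<otimes> d)" using x y d by (simp add: m_assoc[symmetric])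
    also have "\<dots> = ?e \<otimes> d \<otimes> z" using z d by (simp add: m_assoc)
    finally show "\<exists>y\<in>carrier R. x \<otimes> d [^] Suc n = d [^] Suc n \<otimes> y" using z by auto
  qed (use d in auto)
qed

end

section \<open>Normal elements and the closures of powers of an ideal\<close>

context central_domain
begin

lemma div_closure_mono:
  assumes "L \<subseteq> L'" "L' \<subseteq> carrier B" shows "div_closure L \<subseteq> div_closure L'"
  using assms div_closure_incl[of L'] by (intro div_closure_least) auto

text \<open>If \<open>e\<delta> = m\<close> is a nonzero scalar, then dividing by \<open>\<delta>\<close> is the functional
  operation \<open>f \<mapsto> f(e -)\<close> up to the factor \<open>m\<close>.\<close>

lemma div_closure_normal:
  assumes \<delta>: "\<delta> \<in> carrier B" and e: "e \<in> carrier B" and m: "m \<in> R" "m ~= \<zero>" "e \<otimes> \<delta> = m"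
    and closed: "div_closure {\<delta> \<otimes> x | x. x \<in> carrier B} = {\<delta> \<otimes> x | x. x \<in> carrier B}"
    and L: "L \<subseteq> carrier B"
  shows "div_closure {\<delta> \<otimes> x | x. x \<in> L} = {\<delta> \<otimes> x | x. x \<in> div_closure L}" (is "?l = ?r")
proof (intro equalityI subsetI)
  have \<delta>L: "{\<delta> \<otimes> x | x. x \<in> L} \<subseteq> carrier B" using \<delta> L by auto
  fix x assume x: "x \<in> ?l"
  have "?l \<subseteq> div_closure {\<delta> \<otimes> x | x. x \<in> carrier B}"
    by (rule div_closure_mono) (use L \<delta> in auto)
  \<comment> \<open>Closedness of \<delta> B gives x the form \<delta> a; what remains is that
    \<open>a\<close> passes the tests for \<open>L\<close>.\<close>
  then obtain a where a: "a \<in> carrier B" "x = \<delta> \<otimes> a" using x unfolding closed by blast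
  have "a \<in> div_closure L"
  proof (rule div_closureI[OF a(1)])
    fix f s assume f: "functional f" and s: "s \<in> R" and fL: "\<forall>x\<in>L. \<exists>t\<in>R. f x = s \<otimes> t"
    have fm: "f (e \<otimes> (\<delta> \<otimes> y)) = m \<otimes> f y" if "y \<in> carrier B" for y
      using that \<delta> e m functionalD(3)[OF f m(1)] by (simp add: m_assoc[symmetric])
    \<comment> \<open>The test for x uses the functional f(e -), which takes the value m f(y) at
      \<delta> y, and the divisor m s; the factor m is cancelled afterwards.\<close>
    have "\<exists>t\<in>R. f (e \<otimes> x) = m \<otimes> s \<otimes> t"
    proof (rule div_closureD[OF x functional_mult[OF f e]])
      fix z assume "z \<in> {\<delta> \<otimes> x | x. x \<in> L}"
      then obtain y where y: "y \<in> L" "z = \<delta> \<otimes> y" by blast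
      obtain t where t: "t \<in> R" "f y = s \<otimes> t" using fL y by blast
      have "f (e \<otimes> z) = m \<otimes> s \<otimes> t" using fm[of y] y t L m s by (auto simp: m_assoc)
      then show "\<exists>t\<in>R. f (e \<otimes> z) = m \<otimes> s \<otimes> t" using t by blast
    qed (use m s in auto)
    then obtain t where t: "t \<in> R" "m \<otimes> f a = m \<otimes> s \<otimes> t" using fm[OF a(1)] a(2) by auto
    have "f a = s \<otimes> t"
      by (rule R_cancel[OF m(1,2)]) (use t m s a functionalD[OF f] in \<open>auto simp: m_assoc\<close>)
    then show "\<exists>t\<in>R. f a = s \<otimes> t" using t by blast
  qed
  then show "x \<in> ?r" using a by blast
next
  fix x assume "x \<in> ?r"
  then obtain y where y: "y \<in> div_closure L" "x = \<delta> \<otimes> y" by blast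
  have "{\<delta> \<otimes> x | x. x \<in> L} \<subseteq> div_closure {\<delta> \<otimes> x | x. x \<in> L}"
    by (rule div_closure_incl) (use L \<delta> in auto)
  then show "x \<in> ?l" unfolding y(2)
    by (intro div_closure_mult[OF y(1) \<delta> L]) blast
qed

text \<open>\<open>I\<close> is a set of generators and no sums are formed: closures are stable
  under addition, so the additive span would have the same closure.\<close>

primrec ideal_power :: "'a set \<Rightarrow> nat \<Rightarrow> 'a set" where
  "ideal_power I 0 = carrier B"
| "ideal_power I (Suc n) = {r \<otimes> x | r x. r \<in> I & x \<in> ideal_power I n}"

lemma ideal_power_carrier: "I \<subseteq> R ==> ideal_power I n \<subseteq> carrier B"
  by (induction n) (auto simp: subset_iff)

lemma ideal_power_full: "I \<subseteq> R ==> m \<in> I ==> x \<in> carrier B ==> m [^] n \<otimes> x \<in> ideal_power I n"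
proof (induction n arbitrary: x)
  case (Suc n)
  then have mR: "m \<in> R" by auto
  have "m [^] Suc n \<otimes> x = m \<otimes> (m [^] n \<otimes> x)"
    using Suc.prems mR R_comm[of m "m [^] n"] by (simp add: m_assoc)
  then show ?case using Suc by auto
qed simp

lemma R_pow: "r \<in> R ==> r [^] (n :: nat) \<in> R"
  by (induction n) auto

lemma R_pow_nonzero: "r \<in> R ==> r ~= \<zero> ==> r [^] (n :: nat) ~= \<zero>"
  by (induction n) (use one_not_zero_B R_integral R_pow in auto)

text \<open>Induction on n. I^n B has closure d^n B, so I I^n B and d^n (I B) have the same closure;
  \<open>div_closure_normal\<close> pulls d^n out of it and leaves d^n (d B).\<close>

lemma div_closure_ideal_power:
  assumes d: "normal_element B d" and I: "I \<subseteq> R"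
    and torsionless: "!!y. y \<in> carrier B ==> (!!f. functional f ==> f y = \<zero>) ==> y = \<zero>"
    and base: "div_closure {r \<otimes> a | r a. r \<in> I & a \<in> carrier B} = {d \<otimes> x | x. x \<in> carrier B}"
  shows "div_closure (ideal_power I n) = {d [^] n \<otimes> x | x. x \<in> carrier B}"
proof -
  have dc: "d \<in> carrier B" using d by (simp add: normal_element_iff)
  have one_set: "{\<one> \<otimes> x | x. x \<in> carrier B} = carrier B"
  proof (intro equalityI subsetI)
    fix y assume "y \<in> carrier B"
    then have "y = \<one> \<otimes> y" by simp
    then show "y \<in> {\<one> \<otimes> x | x. x \<in> carrier B}" using \<open>y \<in> carrier B\<close> by blast
  qed auto
  have zero: "div_closure Y = {\<zero>}" if "Y \<subseteq> {\<zero>}" for Y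
  proof (intro equalityI subsetI)
    fix y assume y: "y \<in> div_closure Y"
    have "f y = \<zero>" if f: "functional f" for f
    proof -
      have "\<exists>t\<in>R. f y = \<zero> \<otimes> t"
      proof (rule div_closureD[OF y f])
        fix x assume "x \<in> Y"
        then have "f x = \<zero> \<otimes> \<zero>" using that \<open>Y \<subseteq> {\<zero>}\<close> functionalD(4)[OF f] by auto
        then show "\<exists>t\<in>R. f x = \<zero> \<otimes> t" using R_ops(1) by blast
      qed auto
      then show ?thesis by auto
    qed
    then show "y \<in> {\<zero>}" using torsionless[OF div_closure_carrier[OF y]] by auto
  qed (use div_closure_zero in auto)
  show ?thesis
  proof (cases "I \<subseteq> {\<zero>}")
    \<comment> \<open>The ideal is zero, hence so is d, and no nonzero scalar is at hand. The two
      sides are compared directly; for n = 0 both are all of \<open>B\<close>.\<close>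
    case True
    have "{r \<otimes> a | r a. r \<in> I & a \<in> carrier B} \<subseteq> {\<zero>}" using True by auto
    from zero[OF this] have "{d \<otimes> x | x. x \<in> carrier B} = {\<zero>}" using base by simp
    then have "d \<otimes> \<one> \<in> {\<zero>}" using one_closed by blast
    then have d0: "d = \<zero>" using dc by simp
    show ?thesis
    proof (cases n)
      case 0
      have "div_closure (carrier B) = carrier B"
        using div_closure_incl[of "carrier B"] div_closure_carrier by blast
      then show ?thesis using 0 one_set by simp
    next
      case (Suc k)
      have "ideal_power I n \<subseteq> {\<zero>}"
      proof
        fix y assume "y \<in> ideal_power I n"
        then obtain r x where "r \<in> I" "x \<in> ideal_power I k" "y = r \<otimes> x" unfolding Suc by auto
        moreover then have "r = \<zero>" "x \<in> carrier B" using True ideal_power_carrier[OF I, of k] by auto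
        ultimately show "y \<in> {\<zero>}" by simp
      qed
      moreover have "{d [^] n \<otimes> x | x. x \<in> carrier B} = {\<zero>}"
      proof (intro equalityI subsetI)
        have dn: "d [^] n = \<zero>" using Suc d0 by simp
        fix y
        show "y \<in> {\<zero>}" if "y \<in> {d [^] n \<otimes> x | x. x \<in> carrier B}" using that unfolding dn by auto
        assume "y \<in> {\<zero>}"
        then have "y = d [^] n \<otimes> \<zero>" using dn by simp
        then show "y \<in> {d [^] n \<otimes> x | x. x \<in> carrier B}" using zero_closed by blast
      qed
      ultimately show ?thesis using zero by simp
    qed
  next
    case False
    then obtain m where m: "m \<in> I" "m ~= \<zero>" by auto
    then have mR: "m \<in> R" using I by auto
    show ?thesis
    proof (induction n)
      case 0
      have "div_closure (carrier B) = carrier B"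
        using div_closure_incl[of "carrier B"] div_closure_carrier by blast
      then show ?case using one_set by simp
    next
      case (Suc n)
      let ?\<delta> = "d [^] n" and ?IB = "{r \<otimes> a | r a. r \<in> I & a \<in> carrier B}"
      have \<delta>c: "?\<delta> \<in> carrier B" using dc by simp
      have IB: "?IB \<subseteq> carrier B" using I by auto
      \<comment> \<open>m^n lies in the closure, which is d^n B, so some right multiple of d^n is a
        nonzero scalar. Normality turns this into e d^n = m^n, the hypothesis of
        \<open>div_closure_normal\<close>.\<close>
      have "m [^] n \<otimes> \<one> \<in> div_closure (ideal_power I n)"
        using ideal_power_full[OF I m(1) one_closed] div_closure_incl[OF ideal_power_carrier[OF I]] by blast
      then obtain e' where "e' \<in> carrier B" "?\<delta> \<otimes> e' = m [^] n" using Suc mR by auto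
      then obtain e where e: "e \<in> carrier B" "e \<otimes> ?\<delta> = m [^] n"
        using normal_element_pow[OF d, of n] unfolding normal_element_iff by metis
      have closed: "div_closure {?\<delta> \<otimes> x | x. x \<in> carrier B} = {?\<delta> \<otimes> x | x. x \<in> carrier B}"
        using div_closure_idem[of "ideal_power I n"] Suc by simp
      have "div_closure (ideal_power I (Suc n)) = div_closure {?\<delta> \<otimes> x | x. x \<in> ?IB}"
      proof (rule div_closure_eqI; rule subsetI)
        fix y assume "y \<in> ideal_power I (Suc n)"
        then obtain r x where r: "r \<in> I" "x \<in> ideal_power I n" "y = r \<otimes> x" by auto
        then have "x \<in> div_closure (ideal_power I n)" using div_closure_incl[OF ideal_power_carrier[OF I]] by blast
        then obtain z where z: "z \<in> carrier B" "x = ?\<delta> \<otimes> z" using Suc by blast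
        have "y = ?\<delta> \<otimes> (r \<otimes> z)" using r z I \<delta>c R_lcomm[of r ?\<delta> z] by auto
        then have "y \<in> {?\<delta> \<otimes> x | x. x \<in> ?IB}" using r z by blast
        moreover have "{?\<delta> \<otimes> x | x. x \<in> ?IB} \<subseteq> carrier B" using \<delta>c IB by auto
        ultimately show "y \<in> div_closure {?\<delta> \<otimes> x | x. x \<in> ?IB}" using div_closure_incl by blast
      next
        fix y assume "y \<in> {?\<delta> \<otimes> x | x. x \<in> ?IB}"
        then obtain r z where r: "r \<in> I" "z \<in> carrier B" "y = ?\<delta> \<otimes> (r \<otimes> z)" by blast
        then have y: "y = r \<otimes> (?\<delta> \<otimes> z)" using I \<delta>c R_lcomm[of r ?\<delta> z] by auto
        have "?\<delta> \<otimes> z \<in> div_closure (ideal_power I n)" using Suc r by blast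
        then show "y \<in> div_closure (ideal_power I (Suc n))" unfolding y
        proof (rule div_closure_scale)
          show "r \<in> R" using r I by auto
          fix x assume "x \<in> ideal_power I n"
          then have "r \<otimes> x \<in> ideal_power I (Suc n)" using r by auto
          then show "r \<otimes> x \<in> div_closure (ideal_power I (Suc n))"
            using div_closure_incl[OF ideal_power_carrier[OF I]] by blast
        qed (rule ideal_power_carrier[OF I])
      qed
      also have "\<dots> = {?\<delta> \<otimes> x | x. x \<in> div_closure ?IB}"
        by (rule div_closure_normal[OF \<delta>c e(1) R_pow[OF mR] R_pow_nonzero[OF mR m(2)] e(2) closed IB])
      also have "\<dots> = {d [^] Suc n \<otimes> x | x. x \<in> carrier B}"
      proof (intro equalityI subsetI)
        fix y assume "y \<in> {?\<delta> \<otimes> x | x. x \<in> div_closure ?IB}"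
        then obtain x where "x \<in> carrier B" "y = ?\<delta> \<otimes> (d \<otimes> x)" unfolding base by blast
        then have "x \<in> carrier B" "y = d [^] Suc n \<otimes> x" using dc by (auto simp: m_assoc)
        then show "y \<in> {d [^] Suc n \<otimes> x | x. x \<in> carrier B}" by blast
      next
        fix y assume "y \<in> {d [^] Suc n \<otimes> x | x. x \<in> carrier B}"
        then obtain x where "x \<in> carrier B" "y = ?\<delta> \<otimes> (d \<otimes> x)" using dc by (auto simp: m_assoc)
        then show "y \<in> {?\<delta> \<otimes> x | x. x \<in> div_closure ?IB}" unfolding base by blast
      qed
      finally show ?case .
    qed
  qed
qed

section \<open>From a quasi-basis to quasi-coordinates\<close>

interpretation central_fractions B R by unfold_locales

text \<open>Condition (d) gives each generator a relation s x = r b_i, and a common denominator c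
  brings them all to the form c x = r b_i. Combining generators provides every element with
  coordinates p_i such that p_i b_i lies in c B; independence over F makes them unique, hence linear
  in the element.\<close>

lemma quasi_coordinates_exist:
  assumes qb: "quasi_basis B R bs V"
  obtains c C where "quasi_coordinates B R (length bs) ((!) bs) c C"
proof -
  let ?w = "length bs"
  have V: "finite V" "V \<subseteq> carrier B" "set bs \<subseteq> V" "linear_span B R V = carrier B"
    and basis: "ext_basis B R (map el bs)"
    and mult: "!!x. x \<in> V ==> \<exists>b\<in>set bs. \<exists>f\<in>carrier F. el x = sc f \<otimes>\<^bsub>E\<^esub> el b"
    using qb unfolding quasi_basis_def by auto
  have bc: "bs ! i \<in> carrier B" if "i < ?w" for i using V nth_mem[OF that] by auto
  \<comment> \<open>The relation x = f b_i holds in B_F; once the denominator of f is cleared it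
    descends, because \<open>B\<close> embeds in B_F.\<close>
  have single: "\<exists>s r. s \<in> R & s ~= \<zero> & r \<in> R & (\<exists>i<?w. s \<otimes> x = r \<otimes> bs ! i)" if x: "x \<in> V" for x
  proof -
    obtain i f where i: "i < ?w" "f \<in> carrier F" "el x = sc f \<otimes>\<^bsub>E\<^esub> el (bs ! i)"
      using mult[OF x] by (metis in_set_conv_nth)
    obtain r s where f: "r \<in> R" "s \<in> R" "s ~= \<zero>" "f = fr r s" using i(2) by (rule F_cases)
    have xc: "x \<in> carrier B" using x V by auto
    have "el (s \<otimes> x) = sc (frac_embed B R s) \<otimes>\<^bsub>E\<^esub> (sc f \<otimes>\<^bsub>E\<^esub> el (bs ! i))"
      using f xc i by (simp add: ext_scalar_frac_embed)
    also have "\<dots> = sc (frac_embed B R s \<otimes>\<^bsub>F\<^esub> f) \<otimes>\<^bsub>E\<^esub> el (bs ! i)"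
      using f i bc by (simp add: S.H.hom_mult E.m_assoc del: F_simps(2) frac_embed_simps(3))
    also have "frac_embed B R s \<otimes>\<^bsub>F\<^esub> f = frac_embed B R r"
      using f one_not_zero_B R_comm[of s r] by (simp add: frac_embed_eq fr_eq_iff)
    also have "sc (frac_embed B R r) \<otimes>\<^bsub>E\<^esub> el (bs ! i) = el (r \<otimes> bs ! i)"
      using f i bc by (simp add: ext_scalar_frac_embed)
    finally have eq: "el (s \<otimes> x) = el (r \<otimes> bs ! i)" .
    have "el (s \<otimes> x \<ominus> r \<otimes> bs ! i) = \<zero>\<^bsub>E\<^esub>"
    proof -
      interpret el: ring_hom_ring B E el
        by (rule ring_hom_ringI2[OF ring_axioms E.ring_axioms ext_elem_hom])
      have c: "r \<otimes> bs ! i \<in> carrier B" "s \<otimes> x \<in> carrier B"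
        using f xc i bc by auto
      have "el (s \<otimes> x \<ominus> r \<otimes> bs ! i) = el (s \<otimes> x) \<oplus>\<^bsub>E\<^esub> el (\<ominus> (r \<otimes> bs ! i))"
        unfolding a_minus_def by (rule ext_elem_simps(2)) (use c in auto)
      also have "el (\<ominus> (r \<otimes> bs ! i)) = \<ominus>\<^bsub>E\<^esub> el (s \<otimes> x)"
        unfolding eq by (rule el.hom_a_inv[OF c(1)])
      also have "el (s \<otimes> x) \<oplus>\<^bsub>E\<^esub> \<ominus>\<^bsub>E\<^esub> el (s \<otimes> x) = \<zero>\<^bsub>E\<^esub>"
        by (rule E.r_neg[OF ext_elem_simps(1)[OF c(2)]])
      finally show ?thesis .
    qed
    then have "s \<otimes> x \<ominus> r \<otimes> bs ! i = \<zero>"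
      using f xc i bc by (intro ext_elem_zero) auto
    then have "s \<otimes> x = r \<otimes> bs ! i" using f xc i bc by simp
    then show ?thesis using f i by blast
  qed
  have "\<exists>c. c \<in> R & c ~= \<zero> & (\<forall>x\<in>W. \<exists>i<?w. \<exists>r\<in>R. c \<otimes> x = r \<otimes> bs ! i)" if "finite W" "W \<subseteq> V" for W
    using that
  proof (induction W rule: finite_induct)
    case empty
    then show ?case using one_not_zero_B R_ops(2) by blast
  next
    case (insert x W)
    then obtain c where c: "c \<in> R" "c ~= \<zero>" "\<forall>x\<in>W. \<exists>i<?w. \<exists>r\<in>R. c \<otimes> x = r \<otimes> bs ! i" by auto
    obtain s r i where s: "s \<in> R" "s ~= \<zero>" "r \<in> R" "i < ?w" "s \<otimes> x = r \<otimes> bs ! i"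
      using single insert.prems by blast
    have "\<exists>i<?w. \<exists>r\<in>R. (s \<otimes> c) \<otimes> y = r \<otimes> bs ! i" if y: "y \<in> insert x W" for y
    proof (cases "y = x")
      case True
      have "x \<in> carrier B" using insert.prems V by auto
      then have "(s \<otimes> c) \<otimes> x = c \<otimes> (s \<otimes> x)" using s c R_lcomm[of c s x] by (simp add: m_assoc)
      also have "\<dots> = (c \<otimes> r) \<otimes> bs ! i" using s c bc by (simp add: m_assoc)
      finally show ?thesis using True s c R_ops(3)[of c r] by blast
    next
      case False
      then obtain j q where q: "j < ?w" "q \<in> R" "c \<otimes> y = q \<otimes> bs ! j" using c y by blast
      have "y \<in> carrier B" using insert.prems V y by auto
      then have "(s \<otimes> c) \<otimes> y = (s \<otimes> q) \<otimes> bs ! j" using s c q bc by (simp add: m_assoc)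
      then show ?thesis using q s R_ops(3)[of s q] by blast
    qed
    moreover have "s \<otimes> c \<in> R" "s \<otimes> c ~= \<zero>" using s c R_integral[of s c] by auto
    ultimately show ?case by blast
  qed
  from this[OF V(1) order_refl]
  obtain c where c: "c \<in> R" "c ~= \<zero>" and cV': "\<forall>x\<in>V. \<exists>i<?w. \<exists>r\<in>R. c \<otimes> x = r \<otimes> bs ! i"
    by (elim exE conjE)
  have cV: "\<exists>i<?w. \<exists>r\<in>R. c \<otimes> x = r \<otimes> bs ! i" if "x \<in> V" for x
    by (rule bspec[OF cV' that])
  \<comment> \<open>\<open>p\<close> is a coordinate vector of c y whose terms are individually
    divisible by c. Both requirements are compatible with sums and scalars, so the generators
    decide.\<close>
  define good where "good y p \<longleftrightarrow> (\<forall>i<?w. p i \<in> R & (\<exists>z\<in>carrier B. p i \<otimes> bs ! i = c \<otimes> z)) &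
    c \<otimes> y = (\<Oplus>i\<in>{..<?w}. p i \<otimes> bs ! i)" for y p
  have goodD: "p i \<in> R" "\<exists>z\<in>carrier B. p i \<otimes> bs ! i = c \<otimes> z" if "good y p" "i < ?w" for y p i
    using that by (simp_all add: good_def)
  have good_sum: "c \<otimes> y = (\<Oplus>i\<in>{..<?w}. p i \<otimes> bs ! i)" if "good y p" for y p
    using that by (simp add: good_def)
  have good_add: "good (y \<oplus> z) (%i. p i \<oplus> q i)"
    if "y \<in> carrier B" "z \<in> carrier B" "good y p" "good z q" for y z p q
    unfolding good_def
  proof (intro conjI allI impI)
    fix i assume i: "i < ?w"
    show "p i \<oplus> q i \<in> R" using goodD(1)[OF that(3) i] goodD(1)[OF that(4) i] by simp
    obtain u where "u \<in> carrier B" "p i \<otimes> bs ! i = c \<otimes> u" using goodD(2)[OF \<open>good y p\<close> i] by (elim bexE)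
    moreover obtain v where "v \<in> carrier B" "q i \<otimes> bs ! i = c \<otimes> v" using goodD(2)[OF \<open>good z q\<close> i] by (elim bexE)
    ultimately show "\<exists>z\<in>carrier B. (p i \<oplus> q i) \<otimes> bs ! i = c \<otimes> z"
      using goodD(1)[OF that(3) i] goodD(1)[OF that(4) i] bc[OF i] c
      by (intro bexI[of _ "u \<oplus> v"]) (auto simp: l_distr r_distr)
  next
    have "(\<Oplus>i\<in>{..<?w}. (p i \<oplus> q i) \<otimes> bs ! i) = (\<Oplus>i\<in>{..<?w}. p i \<otimes> bs ! i \<oplus> q i \<otimes> bs ! i)"
      by (rule finsum_cong') (use goodD(1)[OF that(3)] goodD(1)[OF that(4)] bc in \<open>auto simp: l_distr\<close>)
    also have "\<dots> = (\<Oplus>i\<in>{..<?w}. p i \<otimes> bs ! i) \<oplus> (\<Oplus>i\<in>{..<?w}. q i \<otimes> bs ! i)"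
      by (rule finsum_addf) (use goodD(1)[OF that(3)] goodD(1)[OF that(4)] bc in auto)
    finally show "c \<otimes> (y \<oplus> z) = (\<Oplus>i\<in>{..<?w}. (p i \<oplus> q i) \<otimes> bs ! i)"
      using that(1,2) good_sum[OF that(3)] good_sum[OF that(4)] c by (simp add: r_distr)
  qed
  have good_scale: "good (s \<otimes> y) (%i. s \<otimes> p i)" if "y \<in> carrier B" "s \<in> R" "good y p" for y s p
    unfolding good_def
  proof (intro conjI allI impI)
    fix i assume i: "i < ?w"
    show "s \<otimes> p i \<in> R" using goodD(1)[OF that(3) i] that(2) by simp
    obtain u where "u \<in> carrier B" "p i \<otimes> bs ! i = c \<otimes> u" using goodD(2)[OF \<open>good y p\<close> i] by (elim bexE)
    then show "\<exists>z\<in>carrier B. (s \<otimes> p i) \<otimes> bs ! i = c \<otimes> z"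
      using goodD(1)[OF that(3) i] that(2) bc[OF i] c R_lcomm[of s c u]
      by (intro bexI[of _ "s \<otimes> u"]) (auto simp: m_assoc)
  next
    have "(\<Oplus>i\<in>{..<?w}. (s \<otimes> p i) \<otimes> bs ! i) = (\<Oplus>i\<in>{..<?w}. s \<otimes> (p i \<otimes> bs ! i))"
      by (rule finsum_cong') (use goodD(1)[OF that(3)] that(2) bc in \<open>auto simp: m_assoc\<close>)
    also have "\<dots> = s \<otimes> (\<Oplus>i\<in>{..<?w}. p i \<otimes> bs ! i)"
      by (rule finsum_rdistr[symmetric]) (use goodD(1)[OF that(3)] that(2) bc in auto)
    finally show "c \<otimes> (s \<otimes> y) = (\<Oplus>i\<in>{..<?w}. (s \<otimes> p i) \<otimes> bs ! i)"
      using that(1,2) good_sum[OF that(3)] c R_lcomm[of s c y] by simp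
  qed
  have good_zero: "good \<zero> (%i. \<zero>)"
    unfolding good_def
  proof (intro conjI allI impI)
    fix i assume "i < ?w"
    then show "\<exists>z\<in>carrier B. \<zero> \<otimes> bs ! i = c \<otimes> z" using bc c by (intro bexI[of _ \<zero>]) auto
    have "(\<Oplus>i\<in>{..<?w}. \<zero> \<otimes> bs ! i) = (\<Oplus>i\<in>{..<?w}. \<zero>)"
      by (rule finsum_cong') (use bc in auto)
  next
    have "(\<Oplus>i\<in>{..<?w}. \<zero> \<otimes> bs ! i) = (\<Oplus>i\<in>{..<?w}. \<zero>)"
      by (rule finsum_cong') (use bc in auto)
    then show "c \<otimes> \<zero> = (\<Oplus>i\<in>{..<?w}. \<zero> \<otimes> bs ! i)" using c by simp
  qed simp
  \<comment> \<open>A generator has at most one nonzero coordinate r, and its term r b_i equals c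
    x.\<close>
  have good_gen: "\<exists>p. good x p" if x: "x \<in> V" for x
  proof -
    obtain i r where i: "i < ?w" "r \<in> R" "c \<otimes> x = r \<otimes> bs ! i" using cV[OF x] by blast
    have xc: "x \<in> carrier B" using x V by auto
    have "good x (%j. if j = i then r else \<zero>)"
      unfolding good_def
    proof (intro conjI allI impI)
      fix j assume j: "j < ?w"
      show "\<exists>z\<in>carrier B. (if j = i then r else \<zero>) \<otimes> bs ! j = c \<otimes> z"
      proof (cases "j = i")
        case True
        then show ?thesis using i xc by (intro bexI[of _ x]) auto
      next
        case False
        then show ?thesis using bc[OF j] c by (intro bexI[of _ \<zero>]) auto
      qed
    next
      have "(\<Oplus>j\<in>{..<?w}. (if j = i then r else \<zero>) \<otimes> bs ! j) = (\<Oplus>j\<in>{..<?w}. if j = i then r \<otimes> bs ! i else \<zero>)"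
        by (rule finsum_cong') (use bc i in auto)
      also have "\<dots> = r \<otimes> bs ! i" using i bc by (intro finsum_delta) auto
      finally show "c \<otimes> x = (\<Oplus>j\<in>{..<?w}. (if j = i then r else \<zero>) \<otimes> bs ! j)" using i by simp
    qed (use i in auto)
    then show ?thesis by blast
  qed
  have good_ex: "\<exists>p. good y p" if "y \<in> carrier B" for y
  proof -
    let ?X = "{r \<otimes> x | r x. r \<in> R & x \<in> V}"
    have Xc: "?X \<subseteq> carrier B" using V by auto
    have "y \<in> aspan ?X" using that V(4) by (simp add: linear_span_def)
    from Xc this show ?thesis
    proof (induction rule: aspan_induct)
      case (incl y)
      then obtain r x where "r \<in> R" "x \<in> V" "y = r \<otimes> x" by blast
      moreover then obtain p where "good x p" using good_gen by blast
      ultimately show ?case using good_scale[of x r p] V by blast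
    next
      case (minus y)
      then obtain p where "good y p" by blast
      moreover have "y \<in> carrier B" using minus Xc by blast
      ultimately have "good (\<ominus> \<one> \<otimes> y) (%i. \<ominus> \<one> \<otimes> p i)" by (intro good_scale) auto
      moreover have "\<ominus> \<one> \<otimes> y = \<ominus> y" using \<open>y \<in> carrier B\<close> by (simp add: l_minus)
      ultimately show ?case by auto
    next
      case (add y z)
      then obtain p q where "good y p" "good z q" by blast
      then show ?case using good_add aspan_closed[OF Xc] add.hyps by blast
    qed (use good_zero in blast)
  qed
  have indep: "p i = q i"
    if p: "!!i. i < ?w ==> p i \<in> R" and q: "!!i. i < ?w ==> q i \<in> R"
      and eq: "(\<Oplus>i\<in>{..<?w}. p i \<otimes> bs ! i) = (\<Oplus>i\<in>{..<?w}. q i \<otimes> bs ! i)" and i: "i < ?w" for p q i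
  proof -
    interpret el: ring_hom_ring B E el
      by (rule ring_hom_ringI2[OF ring_axioms E.ring_axioms ext_elem_hom])
    have 1: "el (\<Oplus>i\<in>{..<?w}. p i \<otimes> bs ! i) = S.comb ?w (%i. frac_embed B R (p i)) ((!) (map el bs))"
      if p: "!!i. i < ?w ==> p i \<in> R" for p
    proof -
      have "el (\<Oplus>i\<in>{..<?w}. p i \<otimes> bs ! i) = (\<Oplus>\<^bsub>E\<^esub>i\<in>{..<?w}. el (p i \<otimes> bs ! i))"
        using p bc by (subst el.hom_finsum) (auto simp: comp_def)
      also have "\<dots> = S.comb ?w (%i. frac_embed B R (p i)) ((!) (map el bs))"
        unfolding S.comb_def by (rule E.finsum_cong') (use p bc in \<open>auto simp: ext_scalar_frac_embed\<close>)
      finally show ?thesis .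
    qed
    have "S.basis ?w ((!) (map el bs))" using basis by (simp add: ext_basis_iff)
    then have "frac_embed B R (p i) = frac_embed B R (q i)"
      by (rule S.comb_unique[OF _ _ _ _ i]) (use p q eq 1[OF p, symmetric] 1[OF q, symmetric] in auto)
    then show ?thesis using p q i by simp
  qed
  \<comment> \<open>Coordinates are chosen element by element; \<open>unique\<close> then transfers
    the rules for sums and multiples to the chosen ones.\<close>
  define C where "C i y = (SOME p. good y p) i" for i y
  have C: "good y (%i. C i y)" if "y \<in> carrier B" for y
    using someI_ex[OF good_ex[OF that]] by (simp add: C_def)
  have unique: "C i y = p i" if "y \<in> carrier B" "good y p" "i < ?w" for i y p
    using C[OF that(1)] that by (intro indep[of "%i. C i y" p]) (auto simp: good_def)
  have good_b: "good (bs ! j) (%i. if i = j then c else \<zero>)" if j: "j < ?w" for j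
    unfolding good_def
  proof (intro conjI allI impI)
    fix i assume i: "i < ?w"
    show "\<exists>z\<in>carrier B. (if i = j then c else \<zero>) \<otimes> bs ! i = c \<otimes> z"
    proof (cases "i = j")
      case True
      then show ?thesis using bc[OF i] by auto
    next
      case False
      then show ?thesis using bc[OF i] c by (intro bexI[of _ \<zero>]) auto
    qed
  next
    have "(\<Oplus>i\<in>{..<?w}. (if i = j then c else \<zero>) \<otimes> bs ! i) = (\<Oplus>i\<in>{..<?w}. if i = j then c \<otimes> bs ! j else \<zero>)"
      by (rule finsum_cong') (use bc j c in auto)
    also have "\<dots> = c \<otimes> bs ! j" using j bc c by (intro finsum_delta) auto
    finally show "c \<otimes> bs ! j = (\<Oplus>i\<in>{..<?w}. (if i = j then c else \<zero>) \<otimes> bs ! i)" by simp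
  qed (use c in auto)
  have "quasi_coordinates B R ?w ((!) bs) c C"
  proof
    fix i y z assume "i < ?w" "y \<in> carrier B" "z \<in> carrier B"
    then show "C i (y \<oplus> z) = C i y \<oplus> C i z"
      using unique[OF _ good_add[OF _ _ C C]] by simp
  next
    fix i r y assume "i < ?w" "r \<in> R" "y \<in> carrier B"
    then show "C i (r \<otimes> y) = r \<otimes> C i y"
      using unique[OF _ good_scale[OF _ _ C]] by simp
  next
    fix i j assume "i < ?w" "j < ?w"
    then show "C i (bs ! j) = (if i = j then c else \<zero>)"
      using unique[OF bc good_b] by simp
  next
    fix i y assume iy: "i < ?w" "y \<in> carrier B"
    show "C i y \<in> R" "\<exists>z\<in>carrier B. C i y \<otimes> bs ! i = c \<otimes> z"
      using goodD[OF C[OF iy(2)] iy(1)] by auto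
  next
    fix y assume "y \<in> carrier B"
    then show "c \<otimes> y = (\<Oplus>i\<in>{..<?w}. C i y \<otimes> bs ! i)" by (rule good_sum[OF C])
  qed (use bc c in auto)
  then show ?thesis by (rule that)
qed

end

section \<open>Linear forms and slices of tensors over a field\<close>

definition linear_form :: "('k, 'l) ring_scheme \<Rightarrow> ('k, 'a, 'm) module_scheme \<Rightarrow> ('a \<Rightarrow> 'k) \<Rightarrow> bool" where
  "linear_form k M f \<longleftrightarrow> (\<forall>x\<in>carrier M. f x \<in> carrier k) &
     (\<forall>x\<in>carrier M. \<forall>y\<in>carrier M. f (x \<oplus>\<^bsub>M\<^esub> y) = f x \<oplus>\<^bsub>k\<^esub> f y) &
     (\<forall>c\<in>carrier k. \<forall>x\<in>carrier M. f (c \<odot>\<^bsub>M\<^esub> x) = c \<otimes>\<^bsub>k\<^esub> f x)"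

definition vsubspace :: "('k, 'l) ring_scheme \<Rightarrow> ('k, 'a, 'm) module_scheme \<Rightarrow> 'a set \<Rightarrow> bool" where
  "vsubspace k M U \<longleftrightarrow> U \<subseteq> carrier M & \<zero>\<^bsub>M\<^esub> \<in> U & (\<forall>x\<in>U. \<forall>y\<in>U. x \<oplus>\<^bsub>M\<^esub> y \<in> U) &
     (\<forall>c\<in>carrier k. \<forall>x\<in>U. c \<odot>\<^bsub>M\<^esub> x \<in> U)"

lemma vsubspaceD:
  assumes "vsubspace k M U"
  shows "x \<in> U ==> x \<in> carrier M" "\<zero>\<^bsub>M\<^esub> \<in> U" "x \<in> U ==> y \<in> U ==> x \<oplus>\<^bsub>M\<^esub> y \<in> U"
    "c \<in> carrier k ==> x \<in> U ==> c \<odot>\<^bsub>M\<^esub> x \<in> U"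
  using assms by (auto simp: vsubspace_def)

lemma linear_formD:
  assumes "linear_form k M f"
  shows "x \<in> carrier M ==> f x \<in> carrier k"
    "x \<in> carrier M ==> y \<in> carrier M ==> f (x \<oplus>\<^bsub>M\<^esub> y) = f x \<oplus>\<^bsub>k\<^esub> f y"
    "c \<in> carrier k ==> x \<in> carrier M ==> f (c \<odot>\<^bsub>M\<^esub> x) = c \<otimes>\<^bsub>k\<^esub> f x"
  using assms by (auto simp: linear_form_def)

locale vector_space_on = k: field k + module k M for k (structure) and M (structure)
begin

lemma vsubspace_minus: "vsubspace k M U ==> x \<in> U ==> \<ominus>\<^bsub>M\<^esub> x \<in> U"
  using vsubspaceD(1)[of k M U x] vsubspaceD(4)[of k M U "\<ominus>\<^bsub>k\<^esub> \<one>\<^bsub>k\<^esub>" x] smult_l_minus[of "\<one>\<^bsub>k\<^esub>" x]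
  by (simp add: smult_one)

lemma vsubspace_zero: "vsubspace k M {\<zero>\<^bsub>M\<^esub>}"
  by (auto simp: vsubspace_def)

lemma minus_zero_M [simp]: "\<ominus>\<^bsub>M\<^esub> \<zero>\<^bsub>M\<^esub> = \<zero>\<^bsub>M\<^esub>"
  using vsubspace_minus[OF vsubspace_zero] by blast

lemma vsubspace_carrier: "vsubspace k M (carrier M)"
  by (auto simp: vsubspace_def)

definition add_vector :: "'c set \<Rightarrow> 'c \<Rightarrow> 'c set" where
  "add_vector W e = {y \<oplus>\<^bsub>M\<^esub> c \<odot>\<^bsub>M\<^esub> e | y c. y \<in> W & c \<in> carrier k}"

lemma vsubspace_add_vector:
  assumes W: "vsubspace k M W" and e: "e \<in> carrier M"
  shows "vsubspace k M (add_vector W e)" "W \<subseteq> add_vector W e" "e \<in> add_vector W e"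
proof -
  note Wc = vsubspaceD[OF W]
  show sub: "W \<subseteq> add_vector W e"
  proof
    fix y assume "y \<in> W"
    then have "y = y \<oplus>\<^bsub>M\<^esub> \<zero>\<^bsub>k\<^esub> \<odot>\<^bsub>M\<^esub> e" using e Wc by simp
    then show "y \<in> add_vector W e" unfolding add_vector_def using \<open>y \<in> W\<close> k.zero_closed by blast
  qed
  have "e = \<zero>\<^bsub>M\<^esub> \<oplus>\<^bsub>M\<^esub> \<one>\<^bsub>k\<^esub> \<odot>\<^bsub>M\<^esub> e" using e by (simp add: smult_one)
  then show "e \<in> add_vector W e" unfolding add_vector_def using Wc(2) k.one_closed by blast
  show "vsubspace k M (add_vector W e)"
    unfolding vsubspace_def
  proof (intro conjI ballI)
    show "add_vector W e \<subseteq> carrier M" using Wc e by (auto simp: add_vector_def)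
    show "\<zero>\<^bsub>M\<^esub> \<in> add_vector W e" using sub Wc by auto
  next
    fix x y assume "x \<in> add_vector W e" "y \<in> add_vector W e"
    then obtain u c v d where u: "u \<in> W" "c \<in> carrier k" "x = u \<oplus>\<^bsub>M\<^esub> c \<odot>\<^bsub>M\<^esub> e"
      and v: "v \<in> W" "d \<in> carrier k" "y = v \<oplus>\<^bsub>M\<^esub> d \<odot>\<^bsub>M\<^esub> e" unfolding add_vector_def by blast
    have "x \<oplus>\<^bsub>M\<^esub> y = (u \<oplus>\<^bsub>M\<^esub> v) \<oplus>\<^bsub>M\<^esub> (c \<oplus>\<^bsub>k\<^esub> d) \<odot>\<^bsub>M\<^esub> e"
      using u v e Wc by (simp add: smult_l_distr M.a_ac)
    then show "x \<oplus>\<^bsub>M\<^esub> y \<in> add_vector W e"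
      unfolding add_vector_def using u v Wc(3) k.a_closed by blast
  next
    fix a x assume a: "a \<in> carrier k" and "x \<in> add_vector W e"
    then obtain u c where u: "u \<in> W" "c \<in> carrier k" "x = u \<oplus>\<^bsub>M\<^esub> c \<odot>\<^bsub>M\<^esub> e" unfolding add_vector_def by blast
    have "a \<odot>\<^bsub>M\<^esub> x = a \<odot>\<^bsub>M\<^esub> u \<oplus>\<^bsub>M\<^esub> (a \<otimes>\<^bsub>k\<^esub> c) \<odot>\<^bsub>M\<^esub> e"
      using u a e Wc by (simp add: smult_r_distr smult_assoc1)
    then show "a \<odot>\<^bsub>M\<^esub> x \<in> add_vector W e"
      unfolding add_vector_def using u a Wc(4) k.m_closed by blast
  qed
qed

text \<open>Zorn's lemma gives a subspace W containing U and maximal among those avoiding a.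
  Maximality makes every x congruent modulo W to a unique multiple of a, and that coefficient is the
  form.\<close>

lemma separating_form:
  assumes U: "vsubspace k M U" and a: "a \<in> carrier M" "a \<notin> U"
  obtains f where "linear_form k M f" "!!x. x \<in> U ==> f x = \<zero>\<^bsub>k\<^esub>" "f a = \<one>\<^bsub>k\<^esub>"
proof -
  let ?\<W> = "{W. vsubspace k M W & U \<subseteq> W & a \<notin> W}"
  have "\<exists>W\<in>?\<W>. \<forall>Q\<in>?\<W>. W \<subseteq> Q --> Q = W"
  proof (rule subset_Zorn_nonempty)
    show "?\<W> ~= {}" using U a by blast
    fix \<C> assume \<C>: "\<C> ~= {}" "subset.chain ?\<W> \<C>"
    have mem: "vsubspace k M W" "U \<subseteq> W" "a \<notin> W" if "W \<in> \<C>" for W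
      using that \<C>(2) by (auto simp: subset.chain_def)
    have "vsubspace k M (\<Union>\<C>)"
      unfolding vsubspace_def
    proof (intro conjI ballI)
      show "\<Union>\<C> \<subseteq> carrier M" using vsubspaceD(1)[OF mem(1)] by blast
      show "\<zero>\<^bsub>M\<^esub> \<in> \<Union>\<C>" using \<C>(1) vsubspaceD(2)[OF mem(1)] by blast
    next
      fix x y assume "x \<in> \<Union>\<C>" "y \<in> \<Union>\<C>"
      then obtain W V where W: "W \<in> \<C>" "x \<in> W" "V \<in> \<C>" "y \<in> V" by blast
      then have "W \<subseteq> V \<or> V \<subseteq> W" using subset_chain_def[of ?\<W> \<C>] \<C>(2) by blast
      then show "x \<oplus>\<^bsub>M\<^esub> y \<in> \<Union>\<C>"
        using W vsubspaceD(3)[OF mem(1)[OF W(1)], of x y] vsubspaceD(3)[OF mem(1)[OF W(3)], of x y] by blast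
    next
      fix c x assume "c \<in> carrier k" "x \<in> \<Union>\<C>"
      then show "c \<odot>\<^bsub>M\<^esub> x \<in> \<Union>\<C>" using vsubspaceD(4)[OF mem(1)] by blast
    qed
    moreover have "U \<subseteq> \<Union>\<C>"
    proof -
      obtain W where "W \<in> \<C>" using \<C>(1) by blast
      then show ?thesis using mem(2) by blast
    qed
    moreover have "a \<notin> \<Union>\<C>" using mem(3) by blast
    ultimately show "\<Union>\<C> \<in> ?\<W>" by blast
  qed
  then obtain W where WW: "W \<in> ?\<W>" and mx: "\<forall>Q\<in>?\<W>. W \<subseteq> Q --> Q = W" by (elim bexE)
  have W: "vsubspace k M W" "U \<subseteq> W" "a \<notin> W" using WW by auto
  have max: "Q = W" if "vsubspace k M Q" "U \<subseteq> Q" "a \<notin> Q" "W \<subseteq> Q" for Q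
    by (rule mx[rule_format, OF _ that(4)]) (use that in simp)
  note Wc = vsubspaceD[OF W(1)]
  have ex: "\<exists>c. c \<in> carrier k & x \<ominus>\<^bsub>M\<^esub> c \<odot>\<^bsub>M\<^esub> a \<in> W" if x: "x \<in> carrier M" for x
  proof (cases "x \<in> W")
    case True
    then show ?thesis using a x by (intro exI[of _ "\<zero>\<^bsub>k\<^esub>"]) (simp add: M.minus_eq)
  next
    case False
    note av = vsubspace_add_vector[OF W(1) x]
    have "add_vector W x ~= W" using av(3) False by blast
    \<comment> \<open>Enlarging W by x captures a, by maximality. The coefficient of x in the
      resulting expression is nonzero because a is not in W, so x can be solved for.\<close>
    then have "a \<in> add_vector W x" using max[OF av(1)] av(2) W(2) by blast
    then obtain u c where u: "u \<in> W" "c \<in> carrier k" "a = u \<oplus>\<^bsub>M\<^esub> c \<odot>\<^bsub>M\<^esub> x"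
      unfolding add_vector_def by blast
    have c0: "c ~= \<zero>\<^bsub>k\<^esub>"
    proof
      assume "c = \<zero>\<^bsub>k\<^esub>"
      then have "a = u" using u x Wc by simp
      then show False using u W by simp
    qed
    then have ci: "inv\<^bsub>k\<^esub> c \<in> carrier k" "inv\<^bsub>k\<^esub> c \<otimes>\<^bsub>k\<^esub> c = \<one>\<^bsub>k\<^esub>"
      using u k.field_Units by auto
    have "inv\<^bsub>k\<^esub> c \<odot>\<^bsub>M\<^esub> a = inv\<^bsub>k\<^esub> c \<odot>\<^bsub>M\<^esub> u \<oplus>\<^bsub>M\<^esub> x"
      unfolding u(3) using u ci x Wc by (simp add: smult_r_distr smult_assoc1[symmetric] smult_one)
    then have "x \<ominus>\<^bsub>M\<^esub> inv\<^bsub>k\<^esub> c \<odot>\<^bsub>M\<^esub> a = \<ominus>\<^bsub>M\<^esub> (inv\<^bsub>k\<^esub> c \<odot>\<^bsub>M\<^esub> u)"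
      using x ci u Wc by (simp add: M.minus_eq M.minus_add M.a_ac M.r_neg M.r_neg1 M.r_neg2)
    also have "\<dots> \<in> W" using vsubspace_minus[OF W(1)] Wc(4) ci u by blast
    finally show ?thesis using ci by blast
  qed
  have unique: "c = d" if "c \<in> carrier k" "d \<in> carrier k" "x \<in> carrier M"
      "x \<ominus>\<^bsub>M\<^esub> c \<odot>\<^bsub>M\<^esub> a \<in> W" "x \<ominus>\<^bsub>M\<^esub> d \<odot>\<^bsub>M\<^esub> a \<in> W" for x c d
  proof (rule ccontr)
    assume "c ~= d"
    then have cd: "c \<ominus>\<^bsub>k\<^esub> d ~= \<zero>\<^bsub>k\<^esub>" "c \<ominus>\<^bsub>k\<^esub> d \<in> carrier k" using that by auto
    have "(x \<ominus>\<^bsub>M\<^esub> d \<odot>\<^bsub>M\<^esub> a) \<oplus>\<^bsub>M\<^esub> \<ominus>\<^bsub>M\<^esub> (x \<ominus>\<^bsub>M\<^esub> c \<odot>\<^bsub>M\<^esub> a) = (c \<ominus>\<^bsub>k\<^esub> d) \<odot>\<^bsub>M\<^esub> a"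
      using that a by (simp add: M.minus_eq k.minus_eq M.minus_add smult_l_distr smult_l_minus M.a_ac M.r_neg M.r_neg1 M.r_neg2)
    then have "(c \<ominus>\<^bsub>k\<^esub> d) \<odot>\<^bsub>M\<^esub> a \<in> W" using Wc(3) that vsubspace_minus[OF W(1)] by metis
    then have "inv\<^bsub>k\<^esub> (c \<ominus>\<^bsub>k\<^esub> d) \<odot>\<^bsub>M\<^esub> ((c \<ominus>\<^bsub>k\<^esub> d) \<odot>\<^bsub>M\<^esub> a) \<in> W"
      using Wc(4) cd k.field_Units by auto
    then show False
      using W(3) cd a k.field_Units by (simp add: smult_assoc1[symmetric] smult_one)
  qed
  define f where "f x = (THE c. c \<in> carrier k & x \<ominus>\<^bsub>M\<^esub> c \<odot>\<^bsub>M\<^esub> a \<in> W)" for x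
  have fI: "f x = c" if "c \<in> carrier k" "x \<in> carrier M" "x \<ominus>\<^bsub>M\<^esub> c \<odot>\<^bsub>M\<^esub> a \<in> W" for x c
    unfolding f_def using that unique by (intro the_equality) auto
  have f: "f x \<in> carrier k" "x \<ominus>\<^bsub>M\<^esub> f x \<odot>\<^bsub>M\<^esub> a \<in> W" if "x \<in> carrier M" for x
    using ex[OF that] fI that by auto
  have "linear_form k M f"
    unfolding linear_form_def
  proof (intro conjI ballI)
    fix x y assume xy: "x \<in> carrier M" "y \<in> carrier M"
    have "(x \<oplus>\<^bsub>M\<^esub> y) \<ominus>\<^bsub>M\<^esub> (f x \<oplus>\<^bsub>k\<^esub> f y) \<odot>\<^bsub>M\<^esub> a = (x \<ominus>\<^bsub>M\<^esub> f x \<odot>\<^bsub>M\<^esub> a) \<oplus>\<^bsub>M\<^esub> (y \<ominus>\<^bsub>M\<^esub> f y \<odot>\<^bsub>M\<^esub> a)"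
      using xy f a by (simp add: M.minus_eq smult_l_distr M.minus_add M.a_ac)
    then show "f (x \<oplus>\<^bsub>M\<^esub> y) = f x \<oplus>\<^bsub>k\<^esub> f y"
      using xy f Wc(3) by (intro fI) auto
  next
    fix c x assume cx: "c \<in> carrier k" "x \<in> carrier M"
    have "(c \<odot>\<^bsub>M\<^esub> x) \<ominus>\<^bsub>M\<^esub> (c \<otimes>\<^bsub>k\<^esub> f x) \<odot>\<^bsub>M\<^esub> a = c \<odot>\<^bsub>M\<^esub> (x \<ominus>\<^bsub>M\<^esub> f x \<odot>\<^bsub>M\<^esub> a)"
      using cx f a by (simp add: M.minus_eq smult_r_distr smult_r_minus smult_assoc1)
    then show "f (c \<odot>\<^bsub>M\<^esub> x) = c \<otimes>\<^bsub>k\<^esub> f x"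
      using cx f Wc(4) by (intro fI) auto
  qed (use f in auto)
  moreover have "f x = \<zero>\<^bsub>k\<^esub>" if "x \<in> U" for x
    using that W(2) Wc a by (intro fI) (auto simp: M.minus_eq)
  moreover have "f a = \<one>\<^bsub>k\<^esub>"
    using a Wc by (intro fI) (auto simp: M.minus_eq M.r_neg smult_one)
  ultimately show ?thesis by (rule that)
qed

end

text \<open>An interface symmetric in the two factors, which the concrete construction is not:
  through \<open>swap\<close>, a statement about one factor also yields its mirror image. The last
  two axioms say that the slices id \<otimes> \<mu> and \<nu> \<otimes> id exist.\<close>

locale tensor_space =
  fixes k :: "('k, 'l) ring_scheme" and A :: "('k, 'a, 'm) module_scheme"
    and B :: "('k, 'b, 'n) module_scheme" and T :: "('t, 'o) ring_scheme"
    and \<tau> :: "'a \<Rightarrow> 'b \<Rightarrow> 't"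
  assumes field_k: "field k" and algA: "assoc_algebra k A" and algB: "assoc_algebra k B"
    and ringT: "ring T"
    and \<tau>_closed [simp]: "x \<in> carrier A ==> y \<in> carrier B ==> \<tau> x y \<in> carrier T"
    and \<tau>_mult: "x \<in> carrier A ==> y \<in> carrier B ==> x' \<in> carrier A ==> y' \<in> carrier B ==>
      \<tau> x y \<otimes>\<^bsub>T\<^esub> \<tau> x' y' = \<tau> (x \<otimes>\<^bsub>A\<^esub> x') (y \<otimes>\<^bsub>B\<^esub> y')"
    and \<tau>_one: "\<tau> \<one>\<^bsub>A\<^esub> \<one>\<^bsub>B\<^esub> = \<one>\<^bsub>T\<^esub>"
    and \<tau>_l_distr: "x \<in> carrier A ==> x' \<in> carrier A ==> y \<in> carrier B ==>
      \<tau> (x \<oplus>\<^bsub>A\<^esub> x') y = \<tau> x y \<oplus>\<^bsub>T\<^esub> \<tau> x' y"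
    and \<tau>_r_distr: "x \<in> carrier A ==> y \<in> carrier B ==> y' \<in> carrier B ==>
      \<tau> x (y \<oplus>\<^bsub>B\<^esub> y') = \<tau> x y \<oplus>\<^bsub>T\<^esub> \<tau> x y'"
    and \<tau>_balanced: "c \<in> carrier k ==> x \<in> carrier A ==> y \<in> carrier B ==>
      \<tau> (c \<odot>\<^bsub>A\<^esub> x) y = \<tau> x (c \<odot>\<^bsub>B\<^esub> y)"
    and \<tau>_generate: "carrier T = generate (add_monoid T) {\<tau> x y | x y. x \<in> carrier A & y \<in> carrier B}"
    and right_slice_exists: "linear_form k B \<mu> ==> \<exists>g. (\<forall>t\<in>carrier T. g t \<in> carrier A) &
      (\<forall>s\<in>carrier T. \<forall>t\<in>carrier T. g (s \<oplus>\<^bsub>T\<^esub> t) = g s \<oplus>\<^bsub>A\<^esub> g t) &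
      (\<forall>x\<in>carrier A. \<forall>y\<in>carrier B. g (\<tau> x y) = \<mu> y \<odot>\<^bsub>A\<^esub> x)"
    and left_slice_exists: "linear_form k A \<nu> ==> \<exists>g. (\<forall>t\<in>carrier T. g t \<in> carrier B) &
      (\<forall>s\<in>carrier T. \<forall>t\<in>carrier T. g (s \<oplus>\<^bsub>T\<^esub> t) = g s \<oplus>\<^bsub>B\<^esub> g t) &
      (\<forall>x\<in>carrier A. \<forall>y\<in>carrier B. g (\<tau> x y) = \<nu> x \<odot>\<^bsub>B\<^esub> y)"
begin

lemma swap: "tensor_space k B A T (%y x. \<tau> x y)"
proof (rule tensor_space.intro)
  show "carrier T = generate (add_monoid T) {\<tau> x y | y x. y \<in> carrier B & x \<in> carrier A}"
  proof -
    have "{\<tau> x y | y x. y \<in> carrier B & x \<in> carrier A} = {\<tau> x y | x y. x \<in> carrier A & y \<in> carrier B}" by blast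
    then show ?thesis using \<tau>_generate by simp
  qed
qed (use field_k algA algB ringT in \<open>auto simp: \<tau>_mult \<tau>_one \<tau>_l_distr \<tau>_r_distr \<tau>_balanced
      dest!: right_slice_exists left_slice_exists\<close>)

sublocale k: field k by (rule field_k)
sublocale A: ring A using algA by (simp add: assoc_algebra_def)
sublocale B: ring B using algB by (simp add: assoc_algebra_def)
sublocale T: ring T by (rule ringT)
sublocale VA: vector_space_on k A
  using algA field_k by (simp add: assoc_algebra_def vector_space_on_def)
sublocale VB: vector_space_on k B
  using algB field_k by (simp add: assoc_algebra_def vector_space_on_def)

definition tspan :: "'a set \<Rightarrow> 'b set \<Rightarrow> 't set" where
  "tspan U V = generate (add_monoid T) {\<tau> x y | x y. x \<in> U & y \<in> V}"

lemma \<tau>_zero [simp]: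
  "y \<in> carrier B ==> \<tau> \<zero>\<^bsub>A\<^esub> y = \<zero>\<^bsub>T\<^esub>" "x \<in> carrier A ==> \<tau> x \<zero>\<^bsub>B\<^esub> = \<zero>\<^bsub>T\<^esub>"
  using \<tau>_l_distr[of "\<zero>\<^bsub>A\<^esub>" "\<zero>\<^bsub>A\<^esub>" y] \<tau>_r_distr[of x "\<zero>\<^bsub>B\<^esub>" "\<zero>\<^bsub>B\<^esub>"]
  by (auto simp: T.add.r_cancel_one')

lemma \<tau>_minus:
  assumes "x \<in> carrier A" "y \<in> carrier B"
  shows "\<ominus>\<^bsub>T\<^esub> (\<tau> x y) = \<tau> (\<ominus>\<^bsub>A\<^esub> x) y"
  using \<tau>_l_distr[of "\<ominus>\<^bsub>A\<^esub> x" x y] assms by (intro T.minus_equality) (auto simp: A.l_neg)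

lemma tspan_gens: "U \<subseteq> carrier A ==> V \<subseteq> carrier B ==> {\<tau> x y | x y. x \<in> U & y \<in> V} \<subseteq> carrier T"
  by (intro subsetI, elim CollectE exE conjE) (simp add: subset_iff)

lemma tspan_closed: "U \<subseteq> carrier A ==> V \<subseteq> carrier B ==> t \<in> tspan U V ==> t \<in> carrier T"
  unfolding tspan_def using T.aspan_closed[OF tspan_gens] by blast

lemma tspan_tens: "x \<in> U ==> y \<in> V ==> \<tau> x y \<in> tspan U V"
  unfolding tspan_def by (rule T.aspan_incl) blast

lemma tspan_zero: "\<zero>\<^bsub>T\<^esub> \<in> tspan U V" unfolding tspan_def by (rule T.aspan_zero)

lemma tspan_add: "s \<in> tspan U V ==> t \<in> tspan U V ==> s \<oplus>\<^bsub>T\<^esub> t \<in> tspan U V"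
  unfolding tspan_def by (rule T.aspan_add)

lemma tspan_carrier: "tspan (carrier A) (carrier B) = carrier T"
  unfolding tspan_def by (rule \<tau>_generate[symmetric])

lemma tspan_induct [consumes 3, case_names zero tens add]:
  assumes U: "vsubspace k A U" and V: "V \<subseteq> carrier B" and t: "t \<in> tspan U V"
    and zero: "P \<zero>\<^bsub>T\<^esub>" and tens: "!!x y. x \<in> U ==> y \<in> V ==> P (\<tau> x y)"
    and add: "!!s t. s \<in> tspan U V ==> t \<in> tspan U V ==> P s ==> P t ==> P (s \<oplus>\<^bsub>T\<^esub> t)"
  shows "P t"
proof -
  have Uc: "U \<subseteq> carrier A" using vsubspaceD(1)[OF U] by blast
  from tspan_gens[OF Uc V] t[unfolded tspan_def] show ?thesis
  proof (induction rule: T.aspan_induct)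
    case (minus t)
    then obtain x y where xy: "x \<in> U" "y \<in> V" "t = \<tau> x y" by blast
    then have "\<ominus>\<^bsub>T\<^esub> t = \<tau> (\<ominus>\<^bsub>A\<^esub> x) y" using Uc V by (auto intro!: \<tau>_minus)
    then show ?case using tens[OF VA.vsubspace_minus[OF U xy(1)] xy(2)] by simp
  qed (use zero tens add in \<open>auto simp: tspan_def\<close>)
qed

lemma T_induct [consumes 1, case_names zero tens add]:
  assumes "t \<in> carrier T" "P \<zero>\<^bsub>T\<^esub>" "!!x y. x \<in> carrier A ==> y \<in> carrier B ==> P (\<tau> x y)"
    "!!s t. s \<in> carrier T ==> t \<in> carrier T ==> P s ==> P t ==> P (s \<oplus>\<^bsub>T\<^esub> t)"
  shows "P t"
  using tspan_induct[OF VA.vsubspace_carrier subset_refl, of t P] assms by (simp add: tspan_carrier)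

text \<open>The map id \<otimes> \<mu>. It is a predicate because the locale only provides existence
  and says nothing about values outside the carrier of \<open>T\<close>.\<close>

definition rslice :: "('b \<Rightarrow> 'k) \<Rightarrow> ('t \<Rightarrow> 'a) \<Rightarrow> bool" where
  "rslice \<mu> g \<longleftrightarrow> linear_form k B \<mu> & (\<forall>t\<in>carrier T. g t \<in> carrier A) &
      (\<forall>s\<in>carrier T. \<forall>t\<in>carrier T. g (s \<oplus>\<^bsub>T\<^esub> t) = g s \<oplus>\<^bsub>A\<^esub> g t) &
      (\<forall>x\<in>carrier A. \<forall>y\<in>carrier B. g (\<tau> x y) = \<mu> y \<odot>\<^bsub>A\<^esub> x)"

definition lslice :: "('a \<Rightarrow> 'k) \<Rightarrow> ('t \<Rightarrow> 'b) \<Rightarrow> bool" where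
  "lslice \<mu> g \<longleftrightarrow> linear_form k A \<mu> & (\<forall>t\<in>carrier T. g t \<in> carrier B) &
      (\<forall>s\<in>carrier T. \<forall>t\<in>carrier T. g (s \<oplus>\<^bsub>T\<^esub> t) = g s \<oplus>\<^bsub>B\<^esub> g t) &
      (\<forall>x\<in>carrier A. \<forall>y\<in>carrier B. g (\<tau> x y) = \<mu> x \<odot>\<^bsub>B\<^esub> y)"

lemma rslice_ex: "linear_form k B \<mu> ==> \<exists>g. rslice \<mu> g"
  using right_slice_exists by (simp add: rslice_def)

lemma lslice_ex: "linear_form k A \<mu> ==> \<exists>g. lslice \<mu> g"
  using left_slice_exists by (simp add: lslice_def)

lemma rsliceD:
  assumes "rslice \<mu> g"
  shows "linear_form k B \<mu>" "t \<in> carrier T ==> g t \<in> carrier A"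
    "s \<in> carrier T ==> t \<in> carrier T ==> g (s \<oplus>\<^bsub>T\<^esub> t) = g s \<oplus>\<^bsub>A\<^esub> g t"
    "x \<in> carrier A ==> y \<in> carrier B ==> g (\<tau> x y) = \<mu> y \<odot>\<^bsub>A\<^esub> x" "g \<zero>\<^bsub>T\<^esub> = \<zero>\<^bsub>A\<^esub>"
proof -
  show *: "linear_form k B \<mu>" "t \<in> carrier T ==> g t \<in> carrier A"
    "s \<in> carrier T ==> t \<in> carrier T ==> g (s \<oplus>\<^bsub>T\<^esub> t) = g s \<oplus>\<^bsub>A\<^esub> g t"
    "x \<in> carrier A ==> y \<in> carrier B ==> g (\<tau> x y) = \<mu> y \<odot>\<^bsub>A\<^esub> x" for s t x y
    using assms by (auto simp: rslice_def)
  show "g \<zero>\<^bsub>T\<^esub> = \<zero>\<^bsub>A\<^esub>"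
    using *(3)[of "\<zero>\<^bsub>T\<^esub>" "\<zero>\<^bsub>T\<^esub>"] *(2)[of "\<zero>\<^bsub>T\<^esub>"] by (simp add: A.add.r_cancel_one')
qed

lemma swap_lslice: "tensor_space.rslice k B A T (%y x. \<tau> x y) \<mu> g \<longleftrightarrow> lslice \<mu> g"
  unfolding tensor_space.rslice_def[OF swap] lslice_def by blast

lemma swap_tspan: "tensor_space.tspan T (%y x. \<tau> x y) V U = tspan U V"
proof -
  have "{\<tau> x y | y x. y \<in> V & x \<in> U} = {\<tau> x y | x y. x \<in> U & y \<in> V}" by blast
  then show ?thesis unfolding tensor_space.tspan_def[OF swap] tspan_def by simp
qed

text \<open>Both sides are (\<nu> \<otimes> \<mu>)(t); it suffices to compare them on pure
  tensors.\<close>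

lemma slices_commute:
  assumes g: "rslice \<mu> g" and h: "lslice \<nu> h" and t: "t \<in> carrier T"
  shows "\<nu> (g t) = \<mu> (h t)"
  using t
proof (induction rule: T_induct)
  note G = rsliceD[OF g] and H = tensor_space.rsliceD[OF swap, unfolded swap_lslice, OF h]
  note LG = linear_formD[OF G(1)] and LH = linear_formD[OF H(1)]
  {
    case zero
    have "\<nu> \<zero>\<^bsub>A\<^esub> = \<zero>\<^bsub>k\<^esub>" using LH(3)[of "\<zero>\<^bsub>k\<^esub>" "\<zero>\<^bsub>A\<^esub>"] LH(1)[of "\<zero>\<^bsub>A\<^esub>"] by simp
    moreover have "\<mu> \<zero>\<^bsub>B\<^esub> = \<zero>\<^bsub>k\<^esub>" using LG(3)[of "\<zero>\<^bsub>k\<^esub>" "\<zero>\<^bsub>B\<^esub>"] LG(1)[of "\<zero>\<^bsub>B\<^esub>"] by simp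
    ultimately show ?case using G(5) H(5) by simp
  next
    case (tens x y)
    then show ?case using G(4)[of x y] H(4)[of y x] LG LH by (simp add: k.m_comm)
  next
    case (add s t)
    then show ?case using G(2,3) H(2,3) LG(2) LH(2) by simp
  }
qed

lemma rslice_tspan:
  assumes U: "vsubspace k A U" and V: "V \<subseteq> carrier B" and g: "rslice \<mu> g" and t: "t \<in> tspan U V"
  shows "g t \<in> U"
proof -
  note G = rsliceD[OF g] and UD = vsubspaceD[OF U]
  have Uc: "U \<subseteq> carrier A" using UD(1) by blast
  from U V t show ?thesis
  proof (induction rule: tspan_induct)
    case (tens x y)
    then have "x \<in> carrier A" "y \<in> carrier B" using Uc V by auto
    then show ?case using G(4)[of x y] linear_formD(1)[OF G(1)] UD(4) tens by simp
  next
    case (add s t)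
    then show ?case using G(3) UD(3) tspan_closed[OF Uc V] by simp
  qed (use G UD in auto)
qed

lemma rslice_tspan_zero:
  assumes U: "vsubspace k A U" and V: "V \<subseteq> carrier B" and g: "rslice \<mu> g" and t: "t \<in> tspan U V"
    and \<mu>: "!!y. y \<in> V ==> \<mu> y = \<zero>\<^bsub>k\<^esub>"
  shows "g t = \<zero>\<^bsub>A\<^esub>"
proof -
  note G = rsliceD[OF g] and UD = vsubspaceD[OF U]
  have Uc: "U \<subseteq> carrier A" using UD(1) by blast
  from U V t show ?thesis
  proof (induction rule: tspan_induct)
    case (tens x y)
    then have "x \<in> carrier A" "y \<in> carrier B" using Uc V by auto
    then show ?case using G(4)[of x y] \<mu> tens by simp
  next
    case (add s t)
    then show ?case using G(3) tspan_closed[OF Uc V] by simp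
  qed (use G in auto)
qed

section \<open>The slice criterion for membership in a tensor product of subspaces\<close>

primrec extend_space :: "'b set \<Rightarrow> 'b list \<Rightarrow> 'b set" where
  "extend_space W [] = W"
| "extend_space W (e # es) = VB.add_vector (extend_space W es) e"

lemma extend_space_append: "extend_space W (es @ es') = extend_space (extend_space W es') es"
  by (induction es) auto

lemma vsubspace_extend:
  assumes "vsubspace k B W" "set es \<subseteq> carrier B"
  shows "vsubspace k B (extend_space W es)" "W \<subseteq> extend_space W es"
proof -
  have "vsubspace k B (extend_space W es) & W \<subseteq> extend_space W es"
    using assms(2)
  proof (induction es)
    case (Cons e es)
    then show ?case using VB.vsubspace_add_vector[of "extend_space W es" e] by auto
  qed (use assms in auto)
  then show "vsubspace k B (extend_space W es)" "W \<subseteq> extend_space W es" by auto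
qed

lemma extend_space_mono: "W \<subseteq> W' ==> extend_space W es \<subseteq> extend_space W' es"
  by (induction es) (auto simp: VB.add_vector_def)

lemma tspan_mono: "U \<subseteq> U' ==> V \<subseteq> V' ==> tspan U V \<subseteq> tspan U' V'"
  unfolding tspan_def by (rule T.add.mono_generate) auto

text \<open>A tensor involves finitely many right factors, so it already lies over W enlarged by a
  finite list of vectors, along which an induction can run.\<close>

lemma tspan_finite:
  assumes W: "vsubspace k B W" and V: "V \<subseteq> carrier B" and t: "t \<in> tspan (carrier A) V"
  shows "\<exists>es. set es \<subseteq> V & t \<in> tspan (carrier A) (extend_space W es)"
  using VA.vsubspace_carrier V t
proof (induction rule: tspan_induct)
  case zero
  then show ?case using tspan_zero by (intro exI[of _ "[]"]) auto
next
  case (tens x y)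
  have "y \<in> extend_space W [y]" using VB.vsubspace_add_vector(3)[OF W, of y] tens V by auto
  then show ?case using tens tspan_tens by (intro exI[of _ "[y]"]) auto
next
  case (add s t)
  then obtain es es' where es: "set es \<subseteq> V" "s \<in> tspan (carrier A) (extend_space W es)"
    "set es' \<subseteq> V" "t \<in> tspan (carrier A) (extend_space W es')" by blast
  have 1: "extend_space W es \<subseteq> extend_space W (es @ es')"
    unfolding extend_space_append using vsubspace_extend(2)[OF W, of es'] es V by (intro extend_space_mono) auto
  have 2: "extend_space W es' \<subseteq> extend_space W (es @ es')"
    unfolding extend_space_append
    using vsubspace_extend(2)[OF vsubspace_extend(1)[OF W, of es'], of es] es V by auto
  have "s \<oplus>\<^bsub>T\<^esub> t \<in> tspan (carrier A) (extend_space W (es @ es'))"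
    by (rule tspan_add[OF subsetD[OF tspan_mono[OF subset_refl 1] es(2)] subsetD[OF tspan_mono[OF subset_refl 2] es(4)]])
  then show ?case using es by (intro exI[of _ "es @ es'"]) auto
qed

lemma tspan_add_vector:
  assumes W: "vsubspace k B W" and e: "e \<in> carrier B" and t: "t \<in> tspan (carrier A) (VB.add_vector W e)"
  shows "\<exists>s x. s \<in> tspan (carrier A) W & x \<in> carrier A & t = s \<oplus>\<^bsub>T\<^esub> \<tau> x e"
proof -
  have Wc: "W \<subseteq> carrier B" using vsubspaceD(1)[OF W] by blast
  have V: "VB.add_vector W e \<subseteq> carrier B"
    using vsubspaceD(1)[OF VB.vsubspace_add_vector(1)[OF W e]] by blast
  from VA.vsubspace_carrier V t show ?thesis
  proof (induction rule: tspan_induct)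
    case zero
    have "\<zero>\<^bsub>T\<^esub> = \<zero>\<^bsub>T\<^esub> \<oplus>\<^bsub>T\<^esub> \<tau> \<zero>\<^bsub>A\<^esub> e" using e by simp
    then show ?case using tspan_zero A.zero_closed by blast
  next
    case (tens x y)
    then obtain u c where u: "u \<in> W" "c \<in> carrier k" "y = u \<oplus>\<^bsub>B\<^esub> c \<odot>\<^bsub>B\<^esub> e"
      unfolding VB.add_vector_def by blast
    have "u \<in> carrier B" using u Wc by auto
    then have "\<tau> x y = \<tau> x u \<oplus>\<^bsub>T\<^esub> \<tau> (c \<odot>\<^bsub>A\<^esub> x) e"
      using u tens e by (simp add: \<tau>_r_distr \<tau>_balanced)
    then show ?case using tspan_tens[of x "carrier A" u W] u tens VA.smult_closed by blast
  next
    case (add s t)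
    then obtain s' x t' y where s: "s' \<in> tspan (carrier A) W" "x \<in> carrier A" "s = s' \<oplus>\<^bsub>T\<^esub> \<tau> x e"
      and t: "t' \<in> tspan (carrier A) W" "y \<in> carrier A" "t = t' \<oplus>\<^bsub>T\<^esub> \<tau> y e" by blast
    have c: "s' \<in> carrier T" "t' \<in> carrier T" using s t tspan_closed[OF subset_refl Wc] by auto
    have "s \<oplus>\<^bsub>T\<^esub> t = (s' \<oplus>\<^bsub>T\<^esub> t') \<oplus>\<^bsub>T\<^esub> \<tau> (x \<oplus>\<^bsub>A\<^esub> y) e"
      using s t c e by (simp add: \<tau>_l_distr T.a_ac)
    then show ?case using tspan_add[OF s(1) t(1)] s t A.a_closed by blast
  qed
qed

text \<open>Modulo \<open>[U \<otimes> V] + [A \<otimes> W]\<close> a tensor is \<open>\<Sum> x\<^sub>i \<otimes> e\<^sub>i\<close> with the \<open>e\<^sub>i\<close> independent modulo \<open>W\<close>; dual forms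
  read off the \<open>x\<^sub>i\<close>.\<close>

lemma slice_criterion_aux:
  assumes U: "vsubspace k A U" and W: "vsubspace k B W" and V: "vsubspace k B V"
    and t: "t \<in> tspan (carrier A) V"
    and sl: "!!\<mu> g. rslice \<mu> g ==> (!!y. y \<in> W ==> \<mu> y = \<zero>\<^bsub>k\<^esub>) ==> g t \<in> U"
  shows "\<exists>u v. u \<in> tspan U V & v \<in> tspan (carrier A) W & t = u \<oplus>\<^bsub>T\<^esub> v"
proof -
  have Uc: "U \<subseteq> carrier A" and Wc: "W \<subseteq> carrier B" and Vc: "V \<subseteq> carrier B"
    using vsubspaceD(1)[OF U] vsubspaceD(1)[OF W] vsubspaceD(1)[OF V] by auto
  obtain es where es: "set es \<subseteq> V" "t \<in> tspan (carrier A) (extend_space W es)"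
    using tspan_finite[OF W Vc t] by blast
  \<comment> \<open>\<open>u\<close> accumulates what is already known to lie in U \<otimes> V,
    while \<open>s\<close> is the remainder over the enlarged space. Each step removes one vector e
    from the list: its term either moves to \<open>u\<close> or is absorbed by the smaller
    space.\<close>
  have "\<exists>u' v. u' \<in> tspan U V & v \<in> tspan (carrier A) W & u \<oplus>\<^bsub>T\<^esub> s = u' \<oplus>\<^bsub>T\<^esub> v"
    if "u \<in> tspan U V" "s \<in> tspan (carrier A) (extend_space W es)" "u \<oplus>\<^bsub>T\<^esub> s = t" for u s
    using es(1) that
  proof (induction es arbitrary: u s)
    case Nil
    then show ?case by auto
  next
    case (Cons e es)
    let ?W = "extend_space W es"
    have e: "e \<in> V" "e \<in> carrier B" and es: "set es \<subseteq> V" "set es \<subseteq> carrier B" using Cons.prems Vc by auto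
    note W' = vsubspace_extend[OF W es(2)]
    have W'c: "?W \<subseteq> carrier B" using vsubspaceD(1)[OF W'(1)] by blast
    have uc: "u \<in> carrier T" using Cons.prems tspan_closed[OF Uc Vc] by blast
    obtain s' x where s: "s' \<in> tspan (carrier A) ?W" "x \<in> carrier A" "s = s' \<oplus>\<^bsub>T\<^esub> \<tau> x e"
    proof -
      have "s \<in> tspan (carrier A) (VB.add_vector ?W e)" using Cons.prems(3) by simp
      from tspan_add_vector[OF W'(1) e(2) this] show thesis using that by blast
    qed
    have s'c: "s' \<in> carrier T" using tspan_closed[OF subset_refl W'c s(1)] .
    show ?case
    proof (cases "e \<in> ?W")
      case True
      then have "s \<in> tspan (carrier A) ?W" unfolding s(3) using s by (intro tspan_add tspan_tens) auto
      then show ?thesis using Cons.IH[OF es(1) Cons.prems(2) _ Cons.prems(4)] by blast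
    next
      case False
      \<comment> \<open>A form that vanishes on the smaller space and is 1 at e extracts the
        coefficient x of e, up to the slice of \<open>u\<close>, which lies in U.\<close>
      obtain \<mu> where \<mu>: "linear_form k B \<mu>" "!!y. y \<in> ?W ==> \<mu> y = \<zero>\<^bsub>k\<^esub>" "\<mu> e = \<one>\<^bsub>k\<^esub>"
        using VB.separating_form[OF W'(1) e(2) False] by blast
      obtain g where g: "rslice \<mu> g" using rslice_ex[OF \<mu>(1)] by blast
      note G = rsliceD[OF g]
      have "g t \<in> U" using sl[OF g] \<mu>(2) W'(2) by blast
      moreover have "g t = g u \<oplus>\<^bsub>A\<^esub> x"
        unfolding Cons.prems(4)[symmetric] s(3)
        using G uc s'c s e \<mu>(3) rslice_tspan_zero[OF VA.vsubspace_carrier W'c g s(1) \<mu>(2)]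
        by (simp add: VA.smult_one)
      moreover have gu: "g u \<in> U" using rslice_tspan[OF U Vc g] Cons.prems by blast
      ultimately have "\<ominus>\<^bsub>A\<^esub> g u \<oplus>\<^bsub>A\<^esub> (g u \<oplus>\<^bsub>A\<^esub> x) \<in> U"
        using vsubspaceD(3)[OF U] VA.vsubspace_minus[OF U] by simp
      then have "x \<in> U" using gu Uc s(2) by (simp add: A.r_neg1 subset_iff)
      then have u': "u \<oplus>\<^bsub>T\<^esub> \<tau> x e \<in> tspan U V" using Cons.prems e by (intro tspan_add tspan_tens) auto
      moreover have eq: "u \<oplus>\<^bsub>T\<^esub> s = (u \<oplus>\<^bsub>T\<^esub> \<tau> x e) \<oplus>\<^bsub>T\<^esub> s'"
        unfolding s(3) using uc s'c s e by (simp add: T.a_ac)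
      ultimately show ?thesis using Cons.IH[OF es(1) u' s(1)] Cons.prems(4) by simp
    qed
  qed
  from this[OF tspan_zero es(2)] show ?thesis
    using tspan_closed[OF subset_refl Vc t] by simp
qed

text \<open>Two applications of the auxiliary criterion: with U replaced by 0 and modulo A \<otimes>
  V it places t in A \<otimes> V; modulo zero it then places t in U \<otimes> V.\<close>

lemma slice_criterion:
  assumes U: "vsubspace k A U" and V: "vsubspace k B V" and t: "t \<in> carrier T"
    and r: "!!\<mu> g. rslice \<mu> g ==> g t \<in> U" and l: "!!\<nu> h. lslice \<nu> h ==> h t \<in> V"
  shows "t \<in> tspan U V"
proof -
  have Vc: "V \<subseteq> carrier B" and Uc: "U \<subseteq> carrier A" using vsubspaceD(1)[OF V] vsubspaceD(1)[OF U] by auto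
  have "\<exists>u v. u \<in> tspan {\<zero>\<^bsub>A\<^esub>} (carrier B) & v \<in> tspan (carrier A) V & t = u \<oplus>\<^bsub>T\<^esub> v"
  proof (rule slice_criterion_aux[OF VA.vsubspace_zero V VB.vsubspace_carrier])
    show "t \<in> tspan (carrier A) (carrier B)" using t by (simp add: tspan_carrier)
    fix \<mu> g assume g: "rslice \<mu> g" and \<mu>: "!!y. y \<in> V ==> \<mu> y = \<zero>\<^bsub>k\<^esub>"
    \<comment> \<open>A nonzero g t is detected by a form \<nu>; but \<nu>(g t) = \<mu>(h t) for the
      left slice h along \<nu>, and h t lies in V, where \<mu> vanishes.\<close>
    show "g t \<in> {\<zero>\<^bsub>A\<^esub>}"
    proof (rule ccontr)
      assume "g t \<notin> {\<zero>\<^bsub>A\<^esub>}"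
      then obtain \<nu> where \<nu>: "linear_form k A \<nu>" "\<nu> (g t) = \<one>\<^bsub>k\<^esub>"
        using VA.separating_form[OF VA.vsubspace_zero rsliceD(2)[OF g t]] by blast
      obtain h where h: "lslice \<nu> h" using lslice_ex[OF \<nu>(1)] by blast
      have "\<one>\<^bsub>k\<^esub> = \<zero>\<^bsub>k\<^esub>" using slices_commute[OF g h t] \<nu>(2) \<mu>[OF l[OF h]] by simp
      then show False using k.one_not_zero by simp
    qed
  qed
  then obtain u v where uv: "u \<in> tspan {\<zero>\<^bsub>A\<^esub>} (carrier B)" "v \<in> tspan (carrier A) V" "t = u \<oplus>\<^bsub>T\<^esub> v" by blast
  have "u = \<zero>\<^bsub>T\<^esub>"
    by (rule tspan_induct[OF VA.vsubspace_zero subset_refl uv(1)]) auto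
  then have "t \<in> tspan (carrier A) V" using uv tspan_closed[OF subset_refl Vc uv(2)] by simp
  then have "\<exists>u v. u \<in> tspan U V & v \<in> tspan (carrier A) {\<zero>\<^bsub>B\<^esub>} & t = u \<oplus>\<^bsub>T\<^esub> v"
    by (rule slice_criterion_aux[OF U VB.vsubspace_zero V]) (use r in blast)
  then obtain u v where uv: "u \<in> tspan U V" "v \<in> tspan (carrier A) {\<zero>\<^bsub>B\<^esub>}" "t = u \<oplus>\<^bsub>T\<^esub> v" by blast
  have "v = \<zero>\<^bsub>T\<^esub>"
    by (rule tspan_induct[OF VA.vsubspace_carrier _ uv(2)]) auto
  then show ?thesis using uv tspan_closed[OF Uc Vc uv(1)] by simp
qed

end

section \<open>Reflexive hulls of tensor products\<close>

lemma ball_swap: "(\<forall>x\<in>U. \<forall>y\<in>V. Q x y) = (\<forall>y\<in>V. \<forall>x\<in>U. Q x y)"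
  by blast

text \<open>\<open>S\<close> plays the role of Z \<otimes> Z'. The axioms \<open>kZ\<close> and
  \<open>kZ'\<close> make functionals over Z and Z' linear over the field, and
  \<open>endo_exists\<close> supplies f \<otimes> f', by which functionals on the two factors are
  tensored.\<close>

locale central_tensor = tensor_space k A B T \<tau> + CA: central_domain A Z + CB: central_domain B Z' +
    CT: central_domain T S
  for k :: "('k, 'l) ring_scheme" and A :: "('k, 'a, 'm) module_scheme"
    and B :: "('k, 'b, 'n) module_scheme" and T :: "('t, 'o) ring_scheme"
    and \<tau> :: "'a \<Rightarrow> 'b \<Rightarrow> 't" and Z :: "'a set" and Z' :: "'b set" and S :: "'t set" +
  assumes S_eq: "S = generate (add_monoid T) {\<tau> x y | x y. x \<in> Z & y \<in> Z'}"
    and kZ: "a \<in> carrier k ==> a \<odot>\<^bsub>A\<^esub> \<one>\<^bsub>A\<^esub> \<in> Z" and kZ': "a \<in> carrier k ==> a \<odot>\<^bsub>B\<^esub> \<one>\<^bsub>B\<^esub> \<in> Z'"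
    and endo_exists: "(!!x. x \<in> carrier A ==> f x \<in> carrier A) ==>
      (!!x y. x \<in> carrier A ==> y \<in> carrier A ==> f (x \<oplus>\<^bsub>A\<^esub> y) = f x \<oplus>\<^bsub>A\<^esub> f y) ==>
      (!!a x. a \<in> carrier k ==> x \<in> carrier A ==> f (a \<odot>\<^bsub>A\<^esub> x) = a \<odot>\<^bsub>A\<^esub> f x) ==>
      (!!y. y \<in> carrier B ==> f' y \<in> carrier B) ==>
      (!!x y. x \<in> carrier B ==> y \<in> carrier B ==> f' (x \<oplus>\<^bsub>B\<^esub> y) = f' x \<oplus>\<^bsub>B\<^esub> f' y) ==>
      (!!a y. a \<in> carrier k ==> y \<in> carrier B ==> f' (a \<odot>\<^bsub>B\<^esub> y) = a \<odot>\<^bsub>B\<^esub> f' y) ==>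
      \<exists>h. (\<forall>t\<in>carrier T. h t \<in> carrier T) &
        (\<forall>s\<in>carrier T. \<forall>t\<in>carrier T. h (s \<oplus>\<^bsub>T\<^esub> t) = h s \<oplus>\<^bsub>T\<^esub> h t) &
        (\<forall>x\<in>carrier A. \<forall>y\<in>carrier B. h (\<tau> x y) = \<tau> (f x) (f' y))"
begin

lemma S_tspan: "S = tspan Z Z'"
  unfolding tspan_def by (rule S_eq)

lemma swap_central: "central_tensor k B A T (%y x. \<tau> x y) Z' Z S"
proof (rule central_tensor.intro[OF swap CB.central_domain_axioms CA.central_domain_axioms CT.central_domain_axioms],
    rule central_tensor_axioms.intro)
  have "{\<tau> x y | y x. y \<in> Z' & x \<in> Z} = {\<tau> x y | x y. x \<in> Z & y \<in> Z'}" by blast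
  then show "S = generate (add_monoid T) {\<tau> x y | y x. y \<in> Z' & x \<in> Z}" using S_eq by simp
next
  fix f :: "'b \<Rightarrow> 'b" and f' :: "'a \<Rightarrow> 'a"
  assume f: "!!x. x \<in> carrier B ==> f x \<in> carrier B"
    "!!x y. x \<in> carrier B ==> y \<in> carrier B ==> f (x \<oplus>\<^bsub>B\<^esub> y) = f x \<oplus>\<^bsub>B\<^esub> f y"
    "!!a x. a \<in> carrier k ==> x \<in> carrier B ==> f (a \<odot>\<^bsub>B\<^esub> x) = a \<odot>\<^bsub>B\<^esub> f x"
    "!!y. y \<in> carrier A ==> f' y \<in> carrier A"
    "!!x y. x \<in> carrier A ==> y \<in> carrier A ==> f' (x \<oplus>\<^bsub>A\<^esub> y) = f' x \<oplus>\<^bsub>A\<^esub> f' y"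
    "!!a y. a \<in> carrier k ==> y \<in> carrier A ==> f' (a \<odot>\<^bsub>A\<^esub> y) = a \<odot>\<^bsub>A\<^esub> f' y"
  have "\<exists>h. (\<forall>t\<in>carrier T. h t \<in> carrier T) &
        (\<forall>s\<in>carrier T. \<forall>t\<in>carrier T. h (s \<oplus>\<^bsub>T\<^esub> t) = h s \<oplus>\<^bsub>T\<^esub> h t) &
        (\<forall>x\<in>carrier A. \<forall>y\<in>carrier B. h (\<tau> x y) = \<tau> (f' x) (f y))"
    by (rule endo_exists) (simp_all add: f)
  then show "\<exists>h. (\<forall>t\<in>carrier T. h t \<in> carrier T) &
        (\<forall>s\<in>carrier T. \<forall>t\<in>carrier T. h (s \<oplus>\<^bsub>T\<^esub> t) = h s \<oplus>\<^bsub>T\<^esub> h t) &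
        (\<forall>y\<in>carrier B. \<forall>x\<in>carrier A. h (\<tau> x y) = \<tau> (f' x) (f y))"
    unfolding ball_swap[of "carrier A" "carrier B"] .
qed (use kZ kZ' in auto)

lemma smult_eq: "a \<in> carrier k ==> x \<in> carrier A ==> a \<odot>\<^bsub>A\<^esub> x = (a \<odot>\<^bsub>A\<^esub> \<one>\<^bsub>A\<^esub>) \<otimes>\<^bsub>A\<^esub> x"
  using algA by (simp add: assoc_algebra_def)

lemma smult_mult:
  "a \<in> carrier k ==> x \<in> carrier A ==> y \<in> carrier A ==> x \<otimes>\<^bsub>A\<^esub> (a \<odot>\<^bsub>A\<^esub> y) = a \<odot>\<^bsub>A\<^esub> (x \<otimes>\<^bsub>A\<^esub> y)"
  using algA by (simp add: assoc_algebra_def)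

lemma functional_linear: "CA.functional f ==> a \<in> carrier k ==> x \<in> carrier A ==> f (a \<odot>\<^bsub>A\<^esub> x) = a \<odot>\<^bsub>A\<^esub> f x"
  using CA.functionalD(1,3)[of f] kZ[of a] smult_eq[of a x] smult_eq[of a "f x"] by simp

lemma vsubspace_Z: "vsubspace k A Z"
  unfolding vsubspace_def
proof (intro conjI ballI)
  fix a x assume "a \<in> carrier k" "x \<in> Z"
  then show "a \<odot>\<^bsub>A\<^esub> x \<in> Z" using kZ[of a] by (subst smult_eq) simp_all
qed auto

lemma vsubspace_multiples:
  assumes s: "s \<in> Z" shows "vsubspace k A {s \<otimes>\<^bsub>A\<^esub> u | u. u \<in> Z}"
  unfolding vsubspace_def
proof (intro conjI ballI)
  have "\<zero>\<^bsub>A\<^esub> = s \<otimes>\<^bsub>A\<^esub> \<zero>\<^bsub>A\<^esub>" using s by simp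
  then show "\<zero>\<^bsub>A\<^esub> \<in> {s \<otimes>\<^bsub>A\<^esub> u | u. u \<in> Z}" using CA.R_ops(1) by blast
next
  fix x y assume "x \<in> {s \<otimes>\<^bsub>A\<^esub> u | u. u \<in> Z}" "y \<in> {s \<otimes>\<^bsub>A\<^esub> u | u. u \<in> Z}"
  then obtain u v where "u \<in> Z" "x = s \<otimes>\<^bsub>A\<^esub> u" "v \<in> Z" "y = s \<otimes>\<^bsub>A\<^esub> v" by blast
  then have "x \<oplus>\<^bsub>A\<^esub> y = s \<otimes>\<^bsub>A\<^esub> (u \<oplus>\<^bsub>A\<^esub> v)" "u \<oplus>\<^bsub>A\<^esub> v \<in> Z" using s by (auto simp: A.r_distr)
  then show "x \<oplus>\<^bsub>A\<^esub> y \<in> {s \<otimes>\<^bsub>A\<^esub> u | u. u \<in> Z}" by blast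
next
  fix a x assume a: "a \<in> carrier k" and "x \<in> {s \<otimes>\<^bsub>A\<^esub> u | u. u \<in> Z}"
  then obtain u where u: "u \<in> Z" "x = s \<otimes>\<^bsub>A\<^esub> u" by blast
  have "a \<odot>\<^bsub>A\<^esub> x = s \<otimes>\<^bsub>A\<^esub> (a \<odot>\<^bsub>A\<^esub> u)" using a u s by (simp add: smult_mult)
  moreover have "a \<odot>\<^bsub>A\<^esub> u \<in> Z" using vsubspaceD(4)[OF vsubspace_Z a u(1)] .
  ultimately show "a \<odot>\<^bsub>A\<^esub> x \<in> {s \<otimes>\<^bsub>A\<^esub> u | u. u \<in> Z}" by blast
qed (use s in auto)

lemma vsubspace_div_closure: "vsubspace k A (CA.div_closure P)"
  unfolding vsubspace_def
proof (intro conjI ballI)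
  fix a x assume "a \<in> carrier k" "x \<in> CA.div_closure P"
  then show "a \<odot>\<^bsub>A\<^esub> x \<in> CA.div_closure P"
    using CA.div_closure_smult[of x P "a \<odot>\<^bsub>A\<^esub> \<one>\<^bsub>A\<^esub>"] kZ smult_eq[of a x] CA.div_closure_carrier[of x P] by simp
qed (auto intro: CA.div_closure_zero CA.div_closure_add CA.div_closure_carrier)

lemma \<tau>_S: "x \<in> Z ==> y \<in> Z' ==> \<tau> x y \<in> S"
  unfolding S_tspan by (rule tspan_tens)

lemma Z_subset: "Z \<subseteq> carrier A" and Z'_subset: "Z' \<subseteq> carrier B"
  by auto

lemma S_induct [consumes 1, case_names zero tens add]:
  assumes "s \<in> S" "P \<zero>\<^bsub>T\<^esub>" "!!x y. x \<in> Z ==> y \<in> Z' ==> P (\<tau> x y)"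
    "!!s t. s \<in> S ==> t \<in> S ==> P s ==> P t ==> P (s \<oplus>\<^bsub>T\<^esub> t)"
  shows "P s"
  using tspan_induct[OF vsubspace_Z Z'_subset, of s P] assms unfolding S_tspan by blast

text \<open>Values in \<open>S\<close> and linearity over \<open>S\<close> are additive conditions,
  so they follow from pure tensors in both the scalar and the argument.\<close>

lemma functional_tensor:
  assumes f: "CA.functional f" and f': "CB.functional f'"
  obtains F where "CT.functional F" "!!x y. x \<in> carrier A ==> y \<in> carrier B ==> F (\<tau> x y) = \<tau> (f x) (f' y)"
proof -
  interpret sw: central_tensor k B A T "%y x. \<tau> x y" Z' Z S by (rule swap_central)
  note fD = CA.functionalD[OF f] and f'D = CB.functionalD[OF f']
  have "\<exists>h. (\<forall>t\<in>carrier T. h t \<in> carrier T) &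
        (\<forall>s\<in>carrier T. \<forall>t\<in>carrier T. h (s \<oplus>\<^bsub>T\<^esub> t) = h s \<oplus>\<^bsub>T\<^esub> h t) &
        (\<forall>x\<in>carrier A. \<forall>y\<in>carrier B. h (\<tau> x y) = \<tau> (f x) (f' y))" (is "\<exists>h. ?Q h")
    by (rule endo_exists) (simp_all add: fD f'D functional_linear[OF f] sw.functional_linear[OF f'])
  then obtain h where hh: "?Q h" ..
  have h: "!!t. t \<in> carrier T ==> h t \<in> carrier T"
    "!!s t. s \<in> carrier T ==> t \<in> carrier T ==> h (s \<oplus>\<^bsub>T\<^esub> t) = h s \<oplus>\<^bsub>T\<^esub> h t"
    "!!x y. x \<in> carrier A ==> y \<in> carrier B ==> h (\<tau> x y) = \<tau> (f x) (f' y)"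
    using hh by simp_all
  have h0: "h \<zero>\<^bsub>T\<^esub> = \<zero>\<^bsub>T\<^esub>"
    using h(2)[of "\<zero>\<^bsub>T\<^esub>" "\<zero>\<^bsub>T\<^esub>"] h(1)[of "\<zero>\<^bsub>T\<^esub>"] by (simp add: T.add.r_cancel_one')
  have hS: "h t \<in> S" if "t \<in> carrier T" for t
    using that by (induction rule: T_induct) (use h h0 \<tau>_S fD f'D in auto)
  have "h (s \<otimes>\<^bsub>T\<^esub> t) = s \<otimes>\<^bsub>T\<^esub> h t" if s: "s \<in> S" and t: "t \<in> carrier T" for s t
    using s
  proof (induction rule: S_induct)
    case zero
    then show ?case using t h h0 by simp
  next
    case (tens z z')
    note zz = tens
    show ?case using t
    proof (induction rule: T_induct)
      case zero
      then show ?case using zz h0 by simp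
    next
      case (tens x y)
      then show ?case using zz fD f'D by (simp add: \<tau>_mult h(3))
    next
      case (add s t)
      then show ?case using zz h by (simp add: T.r_distr)
    qed
  next
    case (add s s')
    then show ?case using t h by (simp add: T.l_distr)
  qed
  then have "CT.functional h" unfolding CT.functional_def using h hS by auto
  then show ?thesis using that h(3) by blast
qed

lemma zero_form: "linear_form k A \<nu> ==> \<nu> \<zero>\<^bsub>A\<^esub> = \<zero>\<^bsub>k\<^esub>"
  using linear_formD(3)[of k A \<nu> "\<zero>\<^bsub>k\<^esub>" "\<zero>\<^bsub>A\<^esub>"] linear_formD(1)[of k A \<nu> "\<zero>\<^bsub>A\<^esub>"] by simp

end

context central_tensor
begin

text \<open>If f(g t) were not in s Z, a form \<nu> vanishing on s Z would be 1 at it. For each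
  functional f' on B, f \<otimes> f' maps P \<otimes> P' into (s \<otimes> 1) S, so its value at t
  lies there and is killed by \<nu> \<otimes> id. Hence every f' kills the slice of t along \<nu> f,
  this slice is zero, and commuting slices contradict the choice of \<nu>.\<close>

lemma rslice_div_closure:
  assumes torsionless: "!!y. y \<in> carrier B ==> (!!f. CB.functional f ==> f y = \<zero>\<^bsub>B\<^esub>) ==> y = \<zero>\<^bsub>B\<^esub>"
    and P: "P \<subseteq> carrier A" and P': "P' \<subseteq> carrier B"
    and t: "t \<in> CT.div_closure {\<tau> p p' | p p'. p \<in> P & p' \<in> P'}" and g: "rslice \<mu> g"
  shows "g t \<in> CA.div_closure P"
proof (rule CA.div_closureI)
  interpret sw: central_tensor k B A T "%y x. \<tau> x y" Z' Z S by (rule swap_central)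
  have tc: "t \<in> carrier T" using t by (rule CT.div_closure_carrier)
  note G = rsliceD[OF g]
  show "g t \<in> carrier A" using G(2)[OF tc] .
  fix f s assume f: "CA.functional f" and s: "s \<in> Z" and fP: "\<forall>x\<in>P. \<exists>u\<in>Z. f x = s \<otimes>\<^bsub>A\<^esub> u"
  note fD = CA.functionalD[OF f]
  show "\<exists>u\<in>Z. f (g t) = s \<otimes>\<^bsub>A\<^esub> u"
  proof (rule ccontr)
    assume "\<not> ?thesis"
    then have "f (g t) \<notin> {s \<otimes>\<^bsub>A\<^esub> u | u. u \<in> Z}" by blast
    moreover have "f (g t) \<in> carrier A" using fD(1) G(2)[OF tc] by simp
    ultimately obtain \<nu> where \<nu>: "linear_form k A \<nu>"
        "!!x. x \<in> {s \<otimes>\<^bsub>A\<^esub> u | u. u \<in> Z} ==> \<nu> x = \<zero>\<^bsub>k\<^esub>" "\<nu> (f (g t)) = \<one>\<^bsub>k\<^esub>"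
      using VA.separating_form[OF vsubspace_multiples[OF s]] by blast
    note \<nu>D = linear_formD[OF \<nu>(1)]
    have \<nu>f: "linear_form k A (%x. \<nu> (f x))"
      unfolding linear_form_def using \<nu>D fD functional_linear[OF f] by auto
    obtain h where h: "lslice (%x. \<nu> (f x)) h" using lslice_ex[OF \<nu>f] by blast
    obtain l where l: "lslice \<nu> l" using lslice_ex[OF \<nu>(1)] by blast
    note H = sw.rsliceD[unfolded swap_lslice, OF h] and L = sw.rsliceD[unfolded swap_lslice, OF l]
    have "h t = \<zero>\<^bsub>B\<^esub>"
    proof (rule torsionless[OF H(2)[OF tc]])
      fix f' assume f': "CB.functional f'"
      note f'D = CB.functionalD[OF f']
      obtain F where F: "CT.functional F"
          "!!x y. x \<in> carrier A ==> y \<in> carrier B ==> F (\<tau> x y) = \<tau> (f x) (f' y)"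
        using functional_tensor[OF f f'] by blast
      note FD = CT.functionalD[OF F(1)]
      have "\<exists>v\<in>S. F t = \<tau> s \<one>\<^bsub>B\<^esub> \<otimes>\<^bsub>T\<^esub> v"
      proof (rule CT.div_closureD[OF t F(1)])
        show "\<tau> s \<one>\<^bsub>B\<^esub> \<in> S" using s \<tau>_S CB.R_ops(2) by blast
        fix x assume "x \<in> {\<tau> p p' | p p'. p \<in> P & p' \<in> P'}"
        then obtain p p' where p: "x = \<tau> p p'" "p \<in> P" "p' \<in> P'" by blast
        then obtain u where u: "u \<in> Z" "f p = s \<otimes>\<^bsub>A\<^esub> u" using fP by blast
        have p'c: "p \<in> carrier A" "p' \<in> carrier B" using p P P' by auto
        have "F x = \<tau> s \<one>\<^bsub>B\<^esub> \<otimes>\<^bsub>T\<^esub> \<tau> u (f' p')"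
          using p p'c u s F(2) f'D(1)[OF p'c(2)] by (simp add: \<tau>_mult)
        moreover have "\<tau> u (f' p') \<in> S" using u p'c f'D \<tau>_S by blast
        ultimately show "\<exists>v\<in>S. F x = \<tau> s \<one>\<^bsub>B\<^esub> \<otimes>\<^bsub>T\<^esub> v" by blast
      qed
      then obtain v where v: "v \<in> S" "F t = \<tau> s \<one>\<^bsub>B\<^esub> \<otimes>\<^bsub>T\<^esub> v" by blast
      have "l (\<tau> s \<one>\<^bsub>B\<^esub> \<otimes>\<^bsub>T\<^esub> v) = \<zero>\<^bsub>B\<^esub>" using v(1)
      proof (induction rule: S_induct)
        case zero
        then show ?case using s L(5) by simp
      next
        case (tens z z')
        have "\<nu> (s \<otimes>\<^bsub>A\<^esub> z) = \<zero>\<^bsub>k\<^esub>" using \<nu>(2) tens by blast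
        then show ?case using tens s L(4)[of z' "s \<otimes>\<^bsub>A\<^esub> z"] by (simp add: \<tau>_mult)
      next
        case (add u v)
        then show ?case using s L(3) by (simp add: T.r_distr)
      qed
      \<comment> \<open>Both sides are (\<nu> f \<otimes> f')(t): \<open>l\<close> is \<nu>
        \<otimes> id after f \<otimes> f', and \<open>h\<close> is \<nu> f \<otimes> id before
        f'.\<close>
      moreover have "l (F t) = f' (h t)" using tc
      proof (induction rule: T_induct)
        case zero
        then show ?case using FD(4) L(5) H(5) f'D(4) by simp
      next
        case (tens x y)
        then have c: "f x \<in> Z" "f' y \<in> Z'" "\<nu> (f x) \<in> carrier k" using fD f'D \<nu>D by auto
        then show ?case
          using tens L(4)[of "f' y" "f x"] H(4)[of y x] F(2)[of x y] sw.functional_linear[OF f'] by simp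
      next
        case (add s t)
        then show ?case using FD L H f'D by simp
      qed
      ultimately show "f' (h t) = \<zero>\<^bsub>B\<^esub>" using v(2) by simp
    qed
    then have "\<nu> (f (g t)) = \<mu> \<zero>\<^bsub>B\<^esub>" using slices_commute[OF g h tc] by simp
    then show False using \<nu>(3) sw.zero_form[OF G(1)] k.one_not_zero by simp
  qed
qed

lemma rslice_scale:
  assumes g: "rslice \<mu> g" and z: "z \<in> carrier A" and t: "t \<in> carrier T"
  shows "g (\<tau> z \<one>\<^bsub>B\<^esub> \<otimes>\<^bsub>T\<^esub> t) = z \<otimes>\<^bsub>A\<^esub> g t"
  using t
proof (induction rule: T_induct)
  case zero
  then show ?case using rsliceD(5)[OF g] z by simp
next
  case (tens x y)
  then show ?case
    using rsliceD(4)[OF g, of "z \<otimes>\<^bsub>A\<^esub> x" y] rsliceD(4)[OF g, of x y] z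
      linear_formD(1)[OF rsliceD(1)[OF g]] by (simp add: \<tau>_mult smult_mult)
next
  case (add s t)
  then show ?case using rsliceD(2,3)[OF g] z by (simp add: T.r_distr A.r_distr)
qed

text \<open>The slice criterion splits the claim. A right slice of H is a functional on A mapping P
  into m Z, so y passes as well. If a left slice at y were outside m' Z', a form \<mu> vanishing on
  m' Z' would detect it; but the right slice of H along \<mu> vanishes on P and, by the test with
  divisor zero, at y.\<close>

lemma div_closure_into_multiples:
  assumes H: "!!a. a \<in> carrier A ==> H a \<in> S"
    "!!a a'. a \<in> carrier A ==> a' \<in> carrier A ==> H (a \<oplus>\<^bsub>A\<^esub> a') = H a \<oplus>\<^bsub>T\<^esub> H a'"
    "!!z a. z \<in> Z ==> a \<in> carrier A ==> H (z \<otimes>\<^bsub>A\<^esub> a) = \<tau> z \<one>\<^bsub>B\<^esub> \<otimes>\<^bsub>T\<^esub> H a"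
    and m: "m \<in> Z" "m' \<in> Z'"
    and HP: "!!p. p \<in> P ==> H p \<in> tspan {m \<otimes>\<^bsub>A\<^esub> u | u. u \<in> Z} {m' \<otimes>\<^bsub>B\<^esub> u | u. u \<in> Z'}"
    and y: "y \<in> CA.div_closure P"
  shows "H y \<in> tspan {m \<otimes>\<^bsub>A\<^esub> u | u. u \<in> Z} {m' \<otimes>\<^bsub>B\<^esub> u | u. u \<in> Z'}" (is "_ \<in> tspan ?U ?V")
proof -
  interpret sw: central_tensor k B A T "%y x. \<tau> x y" Z' Z S by (rule swap_central)
  note U = vsubspace_multiples[OF m(1)] and V = sw.vsubspace_multiples[OF m(2)]
  have Vc: "?V \<subseteq> carrier B" using m by auto
  have yc: "y \<in> carrier A" using y by (rule CA.div_closure_carrier)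
  have gH: "CA.functional (%a. g (H a))" if g: "rslice \<mu> g" for \<mu> g
    unfolding CA.functional_def
  proof (intro conjI ballI)
    fix a assume "a \<in> carrier A"
    then show "g (H a) \<in> Z" using rslice_tspan[OF vsubspace_Z Z'_subset g] H(1) unfolding S_tspan by blast
  next
    fix z a assume "z \<in> Z" "a \<in> carrier A"
    then show "g (H (z \<otimes>\<^bsub>A\<^esub> a)) = z \<otimes>\<^bsub>A\<^esub> g (H a)" using rslice_scale[OF g, of z "H a"] H(1,3) by simp
  qed (use H rsliceD[OF g] in auto)
  show ?thesis
  proof (rule slice_criterion[OF U V])
    show "H y \<in> carrier T" using H(1)[OF yc] by simp
    fix \<mu> g assume g: "rslice \<mu> g"
    have "\<exists>t\<in>Z. g (H y) = m \<otimes>\<^bsub>A\<^esub> t"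
    proof (rule CA.div_closureD[OF y gH[OF g] m(1)])
      fix p assume "p \<in> P"
      then show "\<exists>t\<in>Z. g (H p) = m \<otimes>\<^bsub>A\<^esub> t" using rslice_tspan[OF U Vc g HP] by blast
    qed
    then show "g (H y) \<in> ?U" by blast
  next
    fix \<nu> h assume h: "lslice \<nu> h"
    note hD = sw.rsliceD[unfolded swap_lslice, OF h]
    show "h (H y) \<in> ?V"
    proof (rule ccontr)
      assume "h (H y) \<notin> ?V"
      moreover have "h (H y) \<in> carrier B" using hD(2) H(1)[OF yc] by simp
      ultimately obtain \<mu> where \<mu>: "linear_form k B \<mu>" "!!x. x \<in> ?V ==> \<mu> x = \<zero>\<^bsub>k\<^esub>" "\<mu> (h (H y)) = \<one>\<^bsub>k\<^esub>"
        using VB.separating_form[OF V] by blast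
      obtain g where g: "rslice \<mu> g" using rslice_ex[OF \<mu>(1)] by blast
      have "\<exists>t\<in>Z. g (H y) = \<zero>\<^bsub>A\<^esub> \<otimes>\<^bsub>A\<^esub> t"
      proof (rule CA.div_closureD[OF y gH[OF g]])
        fix p assume "p \<in> P"
        then have "g (H p) = \<zero>\<^bsub>A\<^esub>" using rslice_tspan_zero[OF U Vc g HP \<mu>(2)] by blast
        then have "g (H p) = \<zero>\<^bsub>A\<^esub> \<otimes>\<^bsub>A\<^esub> \<zero>\<^bsub>A\<^esub>" by simp
        then show "\<exists>t\<in>Z. g (H p) = \<zero>\<^bsub>A\<^esub> \<otimes>\<^bsub>A\<^esub> t" using CA.R_ops(1) by blast
      qed simp
      then have "g (H y) = \<zero>\<^bsub>A\<^esub>" by auto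
      then have "\<mu> (h (H y)) = \<zero>\<^bsub>k\<^esub>"
        using slices_commute[OF g h, of "H y"] H(1)[OF yc] zero_form[OF hD(1)] by simp
      then show False using \<mu>(3) k.one_not_zero by simp
    qed
  qed
qed

text \<open>The slice along a form that is 1 at x sends the tensor to y.\<close>

lemma \<tau>_nonzero:
  assumes "x \<in> carrier A" "x ~= \<zero>\<^bsub>A\<^esub>" "y \<in> carrier B" "y ~= \<zero>\<^bsub>B\<^esub>"
  shows "\<tau> x y ~= \<zero>\<^bsub>T\<^esub>"
proof
  assume z: "\<tau> x y = \<zero>\<^bsub>T\<^esub>"
  interpret sw: central_tensor k B A T "%y x. \<tau> x y" Z' Z S by (rule swap_central)
  obtain \<nu> where \<nu>: "linear_form k A \<nu>" "\<nu> x = \<one>\<^bsub>k\<^esub>"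
    using VA.separating_form[OF VA.vsubspace_zero assms(1)] assms(2) by blast
  obtain h where h: "lslice \<nu> h" using lslice_ex[OF \<nu>(1)] by blast
  note hD = sw.rsliceD[unfolded swap_lslice, OF h]
  show False using hD(4)[of y x] hD(5) assms z \<nu>(2) by (simp add: VB.smult_one)
qed

lemma multiples_S:
  assumes m: "m \<in> Z" "m' \<in> Z'"
  shows "tspan {m \<otimes>\<^bsub>A\<^esub> u | u. u \<in> Z} {m' \<otimes>\<^bsub>B\<^esub> u | u. u \<in> Z'} = {\<tau> m m' \<otimes>\<^bsub>T\<^esub> v | v. v \<in> S}"
    (is "tspan ?U ?V = _")
proof (intro equalityI subsetI)
  fix t assume t: "t \<in> tspan ?U ?V"
  have "?V \<subseteq> carrier B" using m by auto
  from vsubspace_multiples[OF m(1)] this t have "\<exists>v\<in>S. t = \<tau> m m' \<otimes>\<^bsub>T\<^esub> v"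
  proof (induction rule: tspan_induct)
    case zero
    have "\<zero>\<^bsub>T\<^esub> = \<tau> m m' \<otimes>\<^bsub>T\<^esub> \<zero>\<^bsub>T\<^esub>" using m by simp
    then show ?case using CT.R_ops(1) by blast
  next
    case (tens x y)
    then obtain u u' where "u \<in> Z" "x = m \<otimes>\<^bsub>A\<^esub> u" "u' \<in> Z'" "y = m' \<otimes>\<^bsub>B\<^esub> u'" by blast
    then have "\<tau> x y = \<tau> m m' \<otimes>\<^bsub>T\<^esub> \<tau> u u'" "\<tau> u u' \<in> S" using m \<tau>_S by (auto simp: \<tau>_mult)
    then show ?case by blast
  next
    case (add s t)
    then obtain u v where "u \<in> S" "s = \<tau> m m' \<otimes>\<^bsub>T\<^esub> u" "v \<in> S" "t = \<tau> m m' \<otimes>\<^bsub>T\<^esub> v" by blast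
    then have "s \<oplus>\<^bsub>T\<^esub> t = \<tau> m m' \<otimes>\<^bsub>T\<^esub> (u \<oplus>\<^bsub>T\<^esub> v)" "u \<oplus>\<^bsub>T\<^esub> v \<in> S" using m by (auto simp: T.r_distr)
    then show ?case by blast
  qed
  then show "t \<in> {\<tau> m m' \<otimes>\<^bsub>T\<^esub> v | v. v \<in> S}" by blast
next
  fix t assume "t \<in> {\<tau> m m' \<otimes>\<^bsub>T\<^esub> v | v. v \<in> S}"
  then obtain v where v: "v \<in> S" "t = \<tau> m m' \<otimes>\<^bsub>T\<^esub> v" by blast
  from v(1) show "t \<in> tspan ?U ?V" unfolding v(2)
  proof (induction rule: S_induct)
    case zero
    then show ?case using m tspan_zero by simp
  next
    case (tens z z')
    have "\<tau> m m' \<otimes>\<^bsub>T\<^esub> \<tau> z z' = \<tau> (m \<otimes>\<^bsub>A\<^esub> z) (m' \<otimes>\<^bsub>B\<^esub> z')" using tens m by (simp add: \<tau>_mult)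
    moreover have "\<tau> (m \<otimes>\<^bsub>A\<^esub> z) (m' \<otimes>\<^bsub>B\<^esub> z') \<in> tspan ?U ?V" by (rule tspan_tens) (use tens in blast)+
    ultimately show ?case by simp
  next
    case (add u v)
    then show ?case using m tspan_add by (simp add: T.r_distr)
  qed
qed

text \<open>The divisor \<sigma> need not be a pure tensor, so the test does not split over the
  factors as it stands. With \<gamma> = m \<otimes> m', the functional G = \<gamma> F / \<sigma>
  sends P \<otimes> P' into \<gamma> S, and \<gamma> is a pure tensor:
  \<open>div_closure_into_multiples\<close> passes to the closures one variable at a time.
  Cancelling \<gamma> returns to F and \<sigma>.\<close>

lemma tens_div_closure:
  assumes P: "P \<subseteq> carrier A" and P': "P' \<subseteq> carrier B"
    and m: "m \<in> Z" "m ~= \<zero>\<^bsub>A\<^esub>" "!!x. x \<in> carrier A ==> m \<otimes>\<^bsub>A\<^esub> x \<in> P"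
    and m': "m' \<in> Z'" "m' ~= \<zero>\<^bsub>B\<^esub>" "!!y. y \<in> carrier B ==> m' \<otimes>\<^bsub>B\<^esub> y \<in> P'"
    and q: "q \<in> CA.div_closure P" and q': "q' \<in> CB.div_closure P'"
  shows "\<tau> q q' \<in> CT.div_closure {\<tau> p p' | p p'. p \<in> P & p' \<in> P'}"
proof (rule CT.div_closureI)
  interpret sw: central_tensor k B A T "%y x. \<tau> x y" Z' Z S by (rule swap_central)
  have qc: "q \<in> carrier A" "q' \<in> carrier B"
    using q q' CA.div_closure_carrier CB.div_closure_carrier by auto
  then show "\<tau> q q' \<in> carrier T" by simp
  let ?\<gamma> = "\<tau> m m'"
  have \<gamma>: "?\<gamma> \<in> S" "?\<gamma> ~= \<zero>\<^bsub>T\<^esub>" using m m' \<tau>_S \<tau>_nonzero by auto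
  fix F \<sigma> assume F: "CT.functional F" and \<sigma>: "\<sigma> \<in> S"
    and FP': "\<forall>x\<in>{\<tau> p p' | p p'. p \<in> P & p' \<in> P'}. \<exists>v\<in>S. F x = \<sigma> \<otimes>\<^bsub>T\<^esub> v"
  note FD = CT.functionalD[OF F]
  have FP: "\<exists>v\<in>S. F (\<tau> p p') = \<sigma> \<otimes>\<^bsub>T\<^esub> v" if "p \<in> P" "p' \<in> P'" for p p'
    by (rule bspec[OF FP']) (use that in blast)
  \<comment> \<open>\<gamma> times a pure tensor is in P \<otimes> P', so \<gamma> F has all its
    values in \<sigma> S and can be divided by \<sigma>.\<close>
  have F\<gamma>: "\<exists>v\<in>S. ?\<gamma> \<otimes>\<^bsub>T\<^esub> F t = \<sigma> \<otimes>\<^bsub>T\<^esub> v" if "t \<in> carrier T" for t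
    using that
  proof (induction rule: T_induct)
    case zero
    have "?\<gamma> \<otimes>\<^bsub>T\<^esub> F \<zero>\<^bsub>T\<^esub> = \<sigma> \<otimes>\<^bsub>T\<^esub> \<zero>\<^bsub>T\<^esub>" using FD(4) \<gamma> \<sigma> by simp
    then show ?case using CT.R_ops(1) by blast
  next
    case (tens x y)
    have "?\<gamma> \<otimes>\<^bsub>T\<^esub> F (\<tau> x y) = F (?\<gamma> \<otimes>\<^bsub>T\<^esub> \<tau> x y)" using FD(3)[OF \<gamma>(1)] tens by simp
    also have "?\<gamma> \<otimes>\<^bsub>T\<^esub> \<tau> x y = \<tau> (m \<otimes>\<^bsub>A\<^esub> x) (m' \<otimes>\<^bsub>B\<^esub> y)" using tens m m' by (simp add: \<tau>_mult)
    finally show ?case using FP[OF m(3)[OF tens(1)] m'(3)[OF tens(2)]] by simp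
  next
    case (add s t)
    then obtain u v where "u \<in> S" "?\<gamma> \<otimes>\<^bsub>T\<^esub> F s = \<sigma> \<otimes>\<^bsub>T\<^esub> u" "v \<in> S" "?\<gamma> \<otimes>\<^bsub>T\<^esub> F t = \<sigma> \<otimes>\<^bsub>T\<^esub> v" by blast
    then have "?\<gamma> \<otimes>\<^bsub>T\<^esub> F (s \<oplus>\<^bsub>T\<^esub> t) = \<sigma> \<otimes>\<^bsub>T\<^esub> (u \<oplus>\<^bsub>T\<^esub> v)" "u \<oplus>\<^bsub>T\<^esub> v \<in> S"
      using add FD(1,2) \<gamma> \<sigma> by (auto simp: T.r_distr)
    then show ?case by blast
  qed
  show "\<exists>v\<in>S. F (\<tau> q q') = \<sigma> \<otimes>\<^bsub>T\<^esub> v"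
  proof (cases "\<sigma> = \<zero>\<^bsub>T\<^esub>")
    \<comment> \<open>There is nothing to divide by, but \<gamma> F vanishes and \<gamma> cancels in
      the domain \<open>S\<close>.\<close>
    case True
    obtain v where "v \<in> S" "?\<gamma> \<otimes>\<^bsub>T\<^esub> F (\<tau> q q') = \<sigma> \<otimes>\<^bsub>T\<^esub> v" using F\<gamma>[of "\<tau> q q'"] qc by auto
    then have "?\<gamma> \<otimes>\<^bsub>T\<^esub> F (\<tau> q q') = \<zero>\<^bsub>T\<^esub>" using True by simp
    then have "F (\<tau> q q') = \<zero>\<^bsub>T\<^esub>" using CT.R_integral[OF \<gamma>(1) FD(1)] \<gamma>(2) qc by auto
    then have "F (\<tau> q q') = \<sigma> \<otimes>\<^bsub>T\<^esub> \<zero>\<^bsub>T\<^esub>" using \<sigma> by simp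
    then show ?thesis using CT.R_ops(1) by blast
  next
    case False
    have "\<exists>v. t \<in> carrier T --> v \<in> S & ?\<gamma> \<otimes>\<^bsub>T\<^esub> F t = \<sigma> \<otimes>\<^bsub>T\<^esub> v" for t using F\<gamma> by blast
    then obtain G where G: "!!t. t \<in> carrier T ==> G t \<in> S & ?\<gamma> \<otimes>\<^bsub>T\<^esub> F t = \<sigma> \<otimes>\<^bsub>T\<^esub> G t" by metis
    have Gf: "CT.functional G"
      by (rule CT.functional_divide[OF \<sigma> False CT.functional_scale[OF F \<gamma>(1)]]) (use G in auto)
    note GD = CT.functionalD[OF Gf]
    let ?M = "tspan {m \<otimes>\<^bsub>A\<^esub> u | u. u \<in> Z} {m' \<otimes>\<^bsub>B\<^esub> u | u. u \<in> Z'}"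
    have GP: "G (\<tau> p p') \<in> ?M" if p: "p \<in> P" "p' \<in> P'" for p p'
    proof -
      have c: "\<tau> p p' \<in> carrier T" by (rule \<tau>_closed) (use p P P' in blast)+
      obtain u where u: "u \<in> S" "F (\<tau> p p') = \<sigma> \<otimes>\<^bsub>T\<^esub> u" using FP[OF p] by blast
      have "\<sigma> \<otimes>\<^bsub>T\<^esub> G (\<tau> p p') = ?\<gamma> \<otimes>\<^bsub>T\<^esub> (\<sigma> \<otimes>\<^bsub>T\<^esub> u)" using G[OF c] u by simp
      also have "\<dots> = \<sigma> \<otimes>\<^bsub>T\<^esub> (?\<gamma> \<otimes>\<^bsub>T\<^esub> u)" using CT.R_lcomm[OF \<sigma>, of ?\<gamma> u] \<gamma> u by simp
      finally have "G (\<tau> p p') = ?\<gamma> \<otimes>\<^bsub>T\<^esub> u"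
        using CT.R_cancel[OF \<sigma> False, of "G (\<tau> p p')" "?\<gamma> \<otimes>\<^bsub>T\<^esub> u"] GD(1)[OF c] \<gamma> u by simp
      then show ?thesis unfolding multiples_S[OF m(1) m'(1)] using u by blast
    qed
    have scale: "G (\<tau> (z \<otimes>\<^bsub>A\<^esub> a) (z' \<otimes>\<^bsub>B\<^esub> a')) = \<tau> z z' \<otimes>\<^bsub>T\<^esub> G (\<tau> a a')"
      if "z \<in> Z" "z' \<in> Z'" "a \<in> carrier A" "a' \<in> carrier B" for z z' a a'
      using GD(3)[OF \<tau>_S[OF that(1,2)], of "\<tau> a a'"] that by (simp add: \<tau>_mult)
    \<comment> \<open>The left variable is taken to the closure while p' stays in P'; the mirrored
      locale then treats the right variable with q fixed.\<close>
    have 1: "G (\<tau> q p') \<in> ?M" if p': "p' \<in> P'" for p'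
    proof (rule div_closure_into_multiples[where H = "%a. G (\<tau> a p')", OF _ _ _ m(1) m'(1) _ q])
      have p'c: "p' \<in> carrier B" using p' P' by auto
      show "G (\<tau> a p') \<in> S" if "a \<in> carrier A" for a using GD(1) that p'c by simp
      show "G (\<tau> (a \<oplus>\<^bsub>A\<^esub> a') p') = G (\<tau> a p') \<oplus>\<^bsub>T\<^esub> G (\<tau> a' p')" if "a \<in> carrier A" "a' \<in> carrier A" for a a'
        using GD(2) that p'c by (simp add: \<tau>_l_distr)
      show "G (\<tau> (z \<otimes>\<^bsub>A\<^esub> a) p') = \<tau> z \<one>\<^bsub>B\<^esub> \<otimes>\<^bsub>T\<^esub> G (\<tau> a p')" if "z \<in> Z" "a \<in> carrier A" for z a
        using scale[of z "\<one>\<^bsub>B\<^esub>" a p'] that p'c CB.R_ops(2) by simp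
    qed (rule GP[OF _ p'])
    have "G (\<tau> q q') \<in> sw.tspan {m' \<otimes>\<^bsub>B\<^esub> u | u. u \<in> Z'} {m \<otimes>\<^bsub>A\<^esub> u | u. u \<in> Z}"
    proof (rule sw.div_closure_into_multiples[where H = "%a. G (\<tau> q a)", OF _ _ _ m'(1) m(1) _ q'])
      show "G (\<tau> q a) \<in> S" if "a \<in> carrier B" for a using GD(1) that qc by simp
      show "G (\<tau> q (a \<oplus>\<^bsub>B\<^esub> a')) = G (\<tau> q a) \<oplus>\<^bsub>T\<^esub> G (\<tau> q a')" if "a \<in> carrier B" "a' \<in> carrier B" for a a'
        using GD(2) that qc by (simp add: \<tau>_r_distr)
      show "G (\<tau> q (z \<otimes>\<^bsub>B\<^esub> a)) = \<tau> \<one>\<^bsub>A\<^esub> z \<otimes>\<^bsub>T\<^esub> G (\<tau> q a)" if "z \<in> Z'" "a \<in> carrier B" for z a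
        using scale[of "\<one>\<^bsub>A\<^esub>" z q a] that qc CA.R_ops(2) by simp
      show "G (\<tau> q p') \<in> sw.tspan {m' \<otimes>\<^bsub>B\<^esub> u | u. u \<in> Z'} {m \<otimes>\<^bsub>A\<^esub> u | u. u \<in> Z}" if "p' \<in> P'" for p'
        unfolding swap_tspan by (rule 1[OF that])
    qed
    then obtain u where u: "u \<in> S" "G (\<tau> q q') = ?\<gamma> \<otimes>\<^bsub>T\<^esub> u"
      unfolding swap_tspan multiples_S[OF m(1) m'(1)] by blast
    have "?\<gamma> \<otimes>\<^bsub>T\<^esub> F (\<tau> q q') = \<sigma> \<otimes>\<^bsub>T\<^esub> (?\<gamma> \<otimes>\<^bsub>T\<^esub> u)" using G[of "\<tau> q q'"] qc u by simp
    also have "\<dots> = ?\<gamma> \<otimes>\<^bsub>T\<^esub> (\<sigma> \<otimes>\<^bsub>T\<^esub> u)" using CT.R_lcomm[OF \<gamma>(1), of \<sigma> u] \<sigma> u by simp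
    finally have "F (\<tau> q q') = \<sigma> \<otimes>\<^bsub>T\<^esub> u"
      using CT.R_cancel[OF \<gamma>, of "F (\<tau> q q')" "\<sigma> \<otimes>\<^bsub>T\<^esub> u"] FD(1)[of "\<tau> q q'"] qc \<sigma> u by simp
    then show ?thesis using u by blast
  qed
qed

text \<open>One inclusion slices t into the two closures, the other is
  \<open>tens_div_closure\<close>. The alternatives \<open>full\<close> and \<open>full'\<close>
  cover that lemma's need for nonzero clearing scalars: a factor whose closure is zero contributes
  only zero tensors.\<close>

lemma div_closure_tensor:
  assumes P: "P \<subseteq> carrier A" and P': "P' \<subseteq> carrier B"
    and torsA: "!!y. y \<in> carrier A ==> (!!f. CA.functional f ==> f y = \<zero>\<^bsub>A\<^esub>) ==> y = \<zero>\<^bsub>A\<^esub>"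
    and torsB: "!!y. y \<in> carrier B ==> (!!f. CB.functional f ==> f y = \<zero>\<^bsub>B\<^esub>) ==> y = \<zero>\<^bsub>B\<^esub>"
    and full: "CA.div_closure P \<subseteq> {\<zero>\<^bsub>A\<^esub>} \<or> (\<exists>m\<in>Z. m ~= \<zero>\<^bsub>A\<^esub> & (\<forall>x\<in>carrier A. m \<otimes>\<^bsub>A\<^esub> x \<in> P))"
    and full': "CB.div_closure P' \<subseteq> {\<zero>\<^bsub>B\<^esub>} \<or> (\<exists>m\<in>Z'. m ~= \<zero>\<^bsub>B\<^esub> & (\<forall>x\<in>carrier B. m \<otimes>\<^bsub>B\<^esub> x \<in> P'))"
  shows "CT.div_closure {\<tau> p p' | p p'. p \<in> P & p' \<in> P'} = tspan (CA.div_closure P) (CB.div_closure P')"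
    (is "CT.div_closure ?Y = _")
proof (intro equalityI subsetI)
  interpret sw: central_tensor k B A T "%y x. \<tau> x y" Z' Z S by (rule swap_central)
  fix t assume t: "t \<in> CT.div_closure ?Y"
  have eq: "{\<tau> p p' | p' p. p' \<in> P' & p \<in> P} = ?Y" by blast
  show "t \<in> tspan (CA.div_closure P) (CB.div_closure P')"
  proof (rule slice_criterion[OF vsubspace_div_closure sw.vsubspace_div_closure CT.div_closure_carrier[OF t]])
    show "g t \<in> CA.div_closure P" if "rslice \<mu> g" for \<mu> g
      by (rule rslice_div_closure[OF torsB P P' t that])
    show "h t \<in> CB.div_closure P'" if "lslice \<nu> h" for \<nu> h
      by (rule sw.rslice_div_closure[OF torsA P' P, unfolded eq swap_lslice, OF _ _ t that])
  qed
next
  fix t assume t: "t \<in> tspan (CA.div_closure P) (CB.div_closure P')"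
  have V: "CB.div_closure P' \<subseteq> carrier B" using CB.div_closure_carrier by blast
  have tens: "\<tau> q q' \<in> CT.div_closure ?Y" if q: "q \<in> CA.div_closure P" "q' \<in> CB.div_closure P'" for q q'
  proof (cases "q = \<zero>\<^bsub>A\<^esub> \<or> q' = \<zero>\<^bsub>B\<^esub>")
    case True
    then have "\<tau> q q' = \<zero>\<^bsub>T\<^esub>" using CA.div_closure_carrier[OF q(1)] CB.div_closure_carrier[OF q(2)] by auto
    then show ?thesis using CT.div_closure_zero by simp
  next
    case False
    then obtain m m' where "m \<in> Z" "m ~= \<zero>\<^bsub>A\<^esub>" "\<forall>x\<in>carrier A. m \<otimes>\<^bsub>A\<^esub> x \<in> P"
      "m' \<in> Z'" "m' ~= \<zero>\<^bsub>B\<^esub>" "\<forall>x\<in>carrier B. m' \<otimes>\<^bsub>B\<^esub> x \<in> P'"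
      using full full' q by blast
    then show ?thesis using tens_div_closure[OF P P' _ _ _ _ _ _ q] by blast
  qed
  from vsubspace_div_closure V t show "t \<in> CT.div_closure ?Y"
    by (induction rule: tspan_induct) (auto intro: tens CT.div_closure_zero CT.div_closure_add)
qed

end

section \<open>Quasi-coordinates on a tensor product\<close>

text \<open>Row-major numbering l = i m + j of a grid. Stated for monoids, so that it applies to
  products of scalars and, in the additive monoid of \<open>T\<close>, to sums.\<close>

lemma (in comm_monoid) finprod_div_mod:
  assumes f: "!!i j. i < n ==> j < m ==> f i j \<in> carrier G"
  shows "(\<Otimes>l\<in>{..<n * m :: nat}. f (l div m) (l mod m)) = (\<Otimes>i\<in>{..<n}. \<Otimes>j\<in>{..<m}. f i j)"
  using f
proof (induction n)
  case (Suc n)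
  let ?g = "%l. f (l div m) (l mod m)" and ?J = "(%j. n * m + j) ` {..<m}"
  have eq: "{..<Suc n * m} = {..<n * m} \<union> ?J"
  proof (intro equalityI subsetI)
    fix l assume "l \<in> {..<Suc n * m}"
    then show "l \<in> {..<n * m} \<union> ?J"
      by (cases "l < n * m") (auto intro: image_eqI[of _ _ "l - n * m"])
  qed auto
  have g1: "?g \<in> {..<n * m} \<rightarrow> carrier G"
  proof
    fix l assume "l \<in> {..<n * m}"
    then have "l div m < n" "0 < m" by (auto simp: less_mult_imp_div_less intro: gr0I)
    then show "?g l \<in> carrier G" using Suc.prems by simp
  qed
  have g2: "?g \<in> ?J \<rightarrow> carrier G" using Suc.prems by auto
  have c: "(\<Otimes>j\<in>{..<m}. f i j) \<in> carrier G" if "i < Suc n" for i using Suc.prems that by (intro finprod_closed) auto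
  have "(\<Otimes>l\<in>{..<Suc n * m}. ?g l) = (\<Otimes>l\<in>{..<n * m}. ?g l) \<otimes> (\<Otimes>l\<in>?J. ?g l)"
    unfolding eq by (rule finprod_Un_disjoint) (use g1 g2 in auto)
  also have "(\<Otimes>l\<in>?J. ?g l) = (\<Otimes>j\<in>{..<m}. ?g (n * m + j))"
    using g2 by (rule finprod_reindex) (simp add: inj_on_def)
  also have "\<dots> = (\<Otimes>j\<in>{..<m}. f n j)"
    by (rule finprod_cong') (use Suc.prems in auto)
  also have "(\<Otimes>l\<in>{..<n * m}. ?g l) = (\<Otimes>i\<in>{..<n}. \<Otimes>j\<in>{..<m}. f i j)" using Suc by simp
  also have "\<dots> \<otimes> (\<Otimes>j\<in>{..<m}. f n j) = (\<Otimes>i\<in>{..<Suc n}. \<Otimes>j\<in>{..<m}. f i j)"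
    unfolding lessThan_Suc using c Suc.prems by (subst finprod_insert) (auto intro!: m_comm finprod_closed)
  finally show ?case .
qed simp

lemma (in comm_monoid) finprod_swap:
  assumes "finite I" "!!i j. i \<in> I ==> j \<in> J ==> f i j \<in> carrier G"
  shows "(\<Otimes>i\<in>I. \<Otimes>j\<in>J. f i j) = (\<Otimes>j\<in>J. \<Otimes>i\<in>I. f i j)"
  using assms
proof (induction I rule: finite_induct)
  case empty
  then show ?case by (simp add: finprod_one_eqI)
next
  case (insert x I)
  have "(\<Otimes>j\<in>J. \<Otimes>i\<in>insert x I. f i j) = (\<Otimes>j\<in>J. f x j \<otimes> (\<Otimes>i\<in>I. f i j))"
    by (rule finprod_cong') (use insert in \<open>auto intro!: finprod_insert finprod_closed m_closed\<close>)
  also have "\<dots> = (\<Otimes>j\<in>J. f x j) \<otimes> (\<Otimes>j\<in>J. \<Otimes>i\<in>I. f i j)"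
    by (rule finprod_multf) (use insert in \<open>auto intro!: finprod_closed\<close>)
  also have "\<dots> = (\<Otimes>j\<in>J. f x j) \<otimes> (\<Otimes>i\<in>I. \<Otimes>j\<in>J. f i j)" using insert by simp
  also have "\<dots> = (\<Otimes>i\<in>insert x I. \<Otimes>j\<in>J. f i j)"
    by (rule finprod_insert[symmetric]) (use insert in \<open>auto intro!: finprod_closed\<close>)
  finally show ?case ..
qed

context central_tensor
begin

lemma \<tau>_finsum_left:
  "finite I ==> (!!i. i \<in> I ==> f i \<in> carrier A) ==> y \<in> carrier B ==>
    \<tau> (\<Oplus>\<^bsub>A\<^esub>i\<in>I. f i) y = (\<Oplus>\<^bsub>T\<^esub>i\<in>I. \<tau> (f i) y)"
  by (induction I rule: finite_induct)
    (simp_all add: A.finsum_insert T.finsum_insert Pi_def A.finsum_closed \<tau>_l_distr)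

lemma \<tau>_finsum_right:
  "finite I ==> (!!i. i \<in> I ==> g i \<in> carrier B) ==> x \<in> carrier A ==>
    \<tau> x (\<Oplus>\<^bsub>B\<^esub>i\<in>I. g i) = (\<Oplus>\<^bsub>T\<^esub>i\<in>I. \<tau> x (g i))"
  by (induction I rule: finite_induct)
    (simp_all add: B.finsum_insert T.finsum_insert Pi_def B.finsum_closed \<tau>_r_distr)

lemma \<tau>_finsum:
  assumes f: "!!i. i < n ==> f i \<in> carrier A" and g: "!!j. j < m ==> g j \<in> carrier B"
  shows "(\<Oplus>\<^bsub>T\<^esub>l\<in>{..<n * m :: nat}. \<tau> (f (l div m)) (g (l mod m))) = \<tau> (\<Oplus>\<^bsub>A\<^esub>i\<in>{..<n}. f i) (\<Oplus>\<^bsub>B\<^esub>j\<in>{..<m}. g j)"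
proof -
  have "(\<Oplus>\<^bsub>T\<^esub>l\<in>{..<n * m}. \<tau> (f (l div m)) (g (l mod m))) = (\<Oplus>\<^bsub>T\<^esub>i\<in>{..<n}. \<Oplus>\<^bsub>T\<^esub>j\<in>{..<m}. \<tau> (f i) (g j))"
    by (rule T.add.finprod_div_mod[where f = "%i j. \<tau> (f i) (g j)"]) (simp add: f g)
  also have "\<dots> = (\<Oplus>\<^bsub>T\<^esub>i\<in>{..<n}. \<tau> (f i) (\<Oplus>\<^bsub>B\<^esub>j\<in>{..<m}. g j))"
  proof (rule T.finsum_cong')
    fix i assume "i \<in> {..<n}"
    then show "(\<Oplus>\<^bsub>T\<^esub>j\<in>{..<m}. \<tau> (f i) (g j)) = \<tau> (f i) (\<Oplus>\<^bsub>B\<^esub>j\<in>{..<m}. g j)"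
      using \<tau>_finsum_right[of "{..<m}" g "f i"] f g by simp
  qed (auto simp: f g B.finsum_closed Pi_def)
  also have "\<dots> = \<tau> (\<Oplus>\<^bsub>A\<^esub>i\<in>{..<n}. f i) (\<Oplus>\<^bsub>B\<^esub>j\<in>{..<m}. g j)"
    by (rule \<tau>_finsum_left[symmetric]) (auto simp: f g B.finsum_closed Pi_def)
  finally show ?thesis .
qed

lemma \<tau>_finprod:
  "finite I ==> (!!i. i \<in> I ==> p i \<in> Z) ==> (!!i. i \<in> I ==> p' i \<in> Z') ==>
    (\<Otimes>\<^bsub>CT.RR\<^esub>i\<in>I. \<tau> (p i) (p' i)) = \<tau> (\<Otimes>\<^bsub>CA.RR\<^esub>i\<in>I. p i) (\<Otimes>\<^bsub>CB.RR\<^esub>i\<in>I. p' i)"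
proof (induction I rule: finite_induct)
  case empty
  then show ?case by (simp add: \<tau>_one)
next
  case (insert x I)
  have c: "(\<Otimes>\<^bsub>CA.RR\<^esub>i\<in>I. p i) \<in> Z" "(\<Otimes>\<^bsub>CB.RR\<^esub>i\<in>I. p' i) \<in> Z'"
    using CA.R.finprod_closed[of p I] CB.R.finprod_closed[of p' I] insert by auto
  have "(\<Otimes>\<^bsub>CT.RR\<^esub>i\<in>insert x I. \<tau> (p i) (p' i)) = \<tau> (p x) (p' x) \<otimes>\<^bsub>T\<^esub> (\<Otimes>\<^bsub>CT.RR\<^esub>i\<in>I. \<tau> (p i) (p' i))"
    using insert CT.R.finprod_insert[of I x "%i. \<tau> (p i) (p' i)"] \<tau>_S by simp
  also have "\<dots> = \<tau> (p x \<otimes>\<^bsub>A\<^esub> (\<Otimes>\<^bsub>CA.RR\<^esub>i\<in>I. p i)) (p' x \<otimes>\<^bsub>B\<^esub> (\<Otimes>\<^bsub>CB.RR\<^esub>i\<in>I. p' i))"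
    using insert c by (simp add: \<tau>_mult)
  also have "\<dots> = \<tau> (\<Otimes>\<^bsub>CA.RR\<^esub>i\<in>insert x I. p i) (\<Otimes>\<^bsub>CB.RR\<^esub>i\<in>insert x I. p' i)"
    using insert CA.R.finprod_insert[of I x p] CB.R.finprod_insert[of I x p'] by simp
  finally show ?case .
qed

lemma \<tau>_pow: "x \<in> carrier A ==> y \<in> carrier B ==> \<tau> x y [^]\<^bsub>T\<^esub> (n :: nat) = \<tau> (x [^]\<^bsub>A\<^esub> n) (y [^]\<^bsub>B\<^esub> n)"
  by (induction n) (simp_all add: \<tau>_one \<tau>_mult)

lemma functional_eqI:
  assumes "CT.functional F" "CT.functional G"
    and "!!x y. x \<in> carrier A ==> y \<in> carrier B ==> F (\<tau> x y) = G (\<tau> x y)" and t: "t \<in> carrier T"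
  shows "F t = G t"
  using t by (induction rule: T_induct)
    (simp_all add: CT.functionalD[OF assms(1)] CT.functionalD[OF assms(2)] assms(3))

end

locale tensor_trace = central_tensor k A B T \<tau> Z Z' S + QA: quasi_trace A Z w b c C tr +
    QB: quasi_trace B Z' w' b' c' C' tr'
  for k :: "('k, 'l) ring_scheme" and A :: "('k, 'a, 'm) module_scheme"
    and B :: "('k, 'b, 'n) module_scheme" and T :: "('t, 'o) ring_scheme"
    and \<tau> :: "'a \<Rightarrow> 'b \<Rightarrow> 't" and Z :: "'a set" and Z' :: "'b set" and S :: "'t set"
    and w b c C tr w' b' c' C' tr'
begin

lemma index_bounds: "n < w * w' ==> n div w' < w" "n < w * w' ==> n mod w' < w'"
  by (cases "w' = 0"; simp add: less_mult_imp_div_less)+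

text \<open>The coordinates are D_n = C_i \<otimes> C'_j at n = i w' + j, with denominator c
  \<otimes> c'. The conditions on arguments are additive and hold on pure tensors. The trace is
  chosen from divisibility by c \<otimes> c'; since the quotient is unique, it is tr \<otimes> tr'
  on pure tensors.\<close>

lemma tensor_quasi_trace:
  obtains D trT where "quasi_trace T S (w * w') (%n. \<tau> (b (n div w')) (b' (n mod w'))) (\<tau> c c') D trT"
    "!!n x y. n < w * w' ==> x \<in> carrier A ==> y \<in> carrier B ==>
      D n (\<tau> x y) = \<tau> (C (n div w') x) (C' (n mod w') y)"
    "!!x y. x \<in> carrier A ==> y \<in> carrier B ==> trT (\<tau> x y) = \<tau> (tr x) (tr' y)"
proof -
  let ?b = "%n. \<tau> (b (n div w')) (b' (n mod w'))" and ?c = "\<tau> c c'"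
  have "\<exists>F. n < w * w' --> (CT.functional F &
      (\<forall>x\<in>carrier A. \<forall>y\<in>carrier B. F (\<tau> x y) = \<tau> (C (n div w') x) (C' (n mod w') y)))" for n
  proof (cases "n < w * w'")
    case True
    note i = index_bounds[OF True]
    obtain F where "CT.functional F"
      "!!x y. x \<in> carrier A ==> y \<in> carrier B ==> F (\<tau> x y) = \<tau> (C (n div w') x) (C' (n mod w') y)"
      using functional_tensor[OF QA.C_functional[OF i(1)] QB.C_functional[OF i(2)]] by blast
    then have "CT.functional F &
      (\<forall>x\<in>carrier A. \<forall>y\<in>carrier B. F (\<tau> x y) = \<tau> (C (n div w') x) (C' (n mod w') y))" by simp
    then show ?thesis by (intro exI[of _ F] impI)
  qed simp
  then have "\<exists>D. \<forall>n. n < w * w' --> (CT.functional (D n) &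
      (\<forall>x\<in>carrier A. \<forall>y\<in>carrier B. D n (\<tau> x y) = \<tau> (C (n div w') x) (C' (n mod w') y)))"
    by (intro choice allI)
  then obtain D where D: "\<forall>n. n < w * w' --> (CT.functional (D n) &
      (\<forall>x\<in>carrier A. \<forall>y\<in>carrier B. D n (\<tau> x y) = \<tau> (C (n div w') x) (C' (n mod w') y)))" ..
  have Df: "CT.functional (D n)" if "n < w * w'" for n using D that by simp
  have Dt: "D n (\<tau> x y) = \<tau> (C (n div w') x) (C' (n mod w') y)"
    if "n < w * w'" "x \<in> carrier A" "y \<in> carrier B" for n x y using D that by simp
  note DD = CT.functionalD[OF Df]
  have b: "?b n \<in> carrier T" if "n < w * w'" for n using index_bounds[OF that] by simp
  have cS: "?c \<in> S" using \<tau>_S by simp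
  then have cc: "?c \<in> carrier T" by simp
  have qc: "quasi_coordinates T S (w * w') ?b ?c D"
  proof (rule quasi_coordinates.intro[OF CT.central_domain_axioms], rule quasi_coordinates_axioms.intro)
    show "?c ~= \<zero>\<^bsub>T\<^esub>" using \<tau>_nonzero[of c c'] QA.c_nonzero QB.c_nonzero by simp
    fix i j assume ij: "i < w * w'" "j < w * w'"
    have "i = j \<longleftrightarrow> i div w' = j div w' & i mod w' = j mod w'" by (metis div_mult_mod_eq)
    then show "D i (?b j) = (if i = j then ?c else \<zero>\<^bsub>T\<^esub>)"
      using ij Dt[of i "b (j div w')" "b' (j mod w')"] index_bounds[of i] index_bounds[of j]
        QA.C_b[of "i div w'" "j div w'"] QB.C_b[of "i mod w'" "j mod w'"] by (auto split: if_splits)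
  next
    fix y assume "y \<in> carrier T"
    then show "?c \<otimes>\<^bsub>T\<^esub> y = (\<Oplus>\<^bsub>T\<^esub>i\<in>{..<w * w'}. D i y \<otimes>\<^bsub>T\<^esub> ?b i)"
    proof (induction rule: T_induct)
      case zero
      have "(\<Oplus>\<^bsub>T\<^esub>i\<in>{..<w * w'}. D i \<zero>\<^bsub>T\<^esub> \<otimes>\<^bsub>T\<^esub> ?b i) = \<zero>\<^bsub>T\<^esub>"
        by (rule T.add.finprod_one_eqI) (use b DD(4) in simp)
      then show ?case using cc by simp
    next
      case (tens x y)
      have "?c \<otimes>\<^bsub>T\<^esub> \<tau> x y = \<tau> (c \<otimes>\<^bsub>A\<^esub> x) (c' \<otimes>\<^bsub>B\<^esub> y)" using tens by (simp add: \<tau>_mult)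
      also have "\<dots> = \<tau> (\<Oplus>\<^bsub>A\<^esub>i\<in>{..<w}. C i x \<otimes>\<^bsub>A\<^esub> b i) (\<Oplus>\<^bsub>B\<^esub>j\<in>{..<w'}. C' j y \<otimes>\<^bsub>B\<^esub> b' j)"
        using tens QA.C_sum QB.C_sum by simp
      also have "\<dots> = (\<Oplus>\<^bsub>T\<^esub>n\<in>{..<w * w'}. \<tau> (C (n div w') x \<otimes>\<^bsub>A\<^esub> b (n div w')) (C' (n mod w') y \<otimes>\<^bsub>B\<^esub> b' (n mod w')))"
        by (rule \<tau>_finsum[symmetric]) (use tens in auto)
      also have "\<dots> = (\<Oplus>\<^bsub>T\<^esub>n\<in>{..<w * w'}. D n (\<tau> x y) \<otimes>\<^bsub>T\<^esub> ?b n)"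
        by (rule T.finsum_cong') (use tens Dt index_bounds in \<open>auto simp: \<tau>_mult\<close>)
      finally show ?case .
    next
      case (add s t)
      have "(\<Oplus>\<^bsub>T\<^esub>i\<in>{..<w * w'}. D i (s \<oplus>\<^bsub>T\<^esub> t) \<otimes>\<^bsub>T\<^esub> ?b i) =
          (\<Oplus>\<^bsub>T\<^esub>i\<in>{..<w * w'}. D i s \<otimes>\<^bsub>T\<^esub> ?b i \<oplus>\<^bsub>T\<^esub> D i t \<otimes>\<^bsub>T\<^esub> ?b i)"
        by (rule T.finsum_cong') (use add b DD(1,2) in \<open>auto simp: T.l_distr\<close>)
      also have "\<dots> = (\<Oplus>\<^bsub>T\<^esub>i\<in>{..<w * w'}. D i s \<otimes>\<^bsub>T\<^esub> ?b i) \<oplus>\<^bsub>T\<^esub> (\<Oplus>\<^bsub>T\<^esub>i\<in>{..<w * w'}. D i t \<otimes>\<^bsub>T\<^esub> ?b i)"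
        by (rule T.finsum_addf) (use add b DD(1) in auto)
      finally show ?case using add cc by (simp add: T.r_distr)
    qed
  next
    fix n y assume n: "n < w * w'" and y: "y \<in> carrier T"
    \<comment> \<open>Divisibility of a coordinate term by the denominator is additive in y, and on
      a pure tensor the two factors are divided separately.\<close>
    from y show "\<exists>z\<in>carrier T. D n y \<otimes>\<^bsub>T\<^esub> ?b n = ?c \<otimes>\<^bsub>T\<^esub> z"
    proof (induction rule: T_induct)
      case zero
      have "D n \<zero>\<^bsub>T\<^esub> \<otimes>\<^bsub>T\<^esub> ?b n = ?c \<otimes>\<^bsub>T\<^esub> \<zero>\<^bsub>T\<^esub>" using n b DD(4) cc by simp
      then show ?case using T.zero_closed by (rule rev_bexI[rotated])
    next
      case (tens x y)
      obtain z z' where z: "z \<in> carrier A" "C (n div w') x \<otimes>\<^bsub>A\<^esub> b (n div w') = c \<otimes>\<^bsub>A\<^esub> z"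
        "z' \<in> carrier B" "C' (n mod w') y \<otimes>\<^bsub>B\<^esub> b' (n mod w') = c' \<otimes>\<^bsub>B\<^esub> z'"
        using QA.C_split[OF index_bounds(1)[OF n] tens(1)] QB.C_split[OF index_bounds(2)[OF n] tens(2)]
        by (elim bexE)
      have "D n (\<tau> x y) \<otimes>\<^bsub>T\<^esub> ?b n = ?c \<otimes>\<^bsub>T\<^esub> \<tau> z z'"
        using n tens z Dt index_bounds[OF n] by (simp add: \<tau>_mult)
      moreover have "\<tau> z z' \<in> carrier T" using z by simp
      ultimately show ?case by (rule rev_bexI[rotated])
    next
      case (add s t)
      obtain u v where u: "u \<in> carrier T" "D n s \<otimes>\<^bsub>T\<^esub> ?b n = ?c \<otimes>\<^bsub>T\<^esub> u"
        "v \<in> carrier T" "D n t \<otimes>\<^bsub>T\<^esub> ?b n = ?c \<otimes>\<^bsub>T\<^esub> v" using add by (elim bexE)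
      have "D n (s \<oplus>\<^bsub>T\<^esub> t) \<otimes>\<^bsub>T\<^esub> ?b n = ?c \<otimes>\<^bsub>T\<^esub> (u \<oplus>\<^bsub>T\<^esub> v)"
        using add u n b DD(1,2) cc by (simp add: T.l_distr T.r_distr)
      moreover have "u \<oplus>\<^bsub>T\<^esub> v \<in> carrier T" using u by simp
      ultimately show ?case by (rule rev_bexI[rotated])
    qed
  qed (use cS b DD in simp_all)
  interpret QT: quasi_coordinates T S "w * w'" ?b ?c D by (rule qc)
  let ?\<Phi> = "%t. \<Oplus>\<^bsub>CT.RR\<^esub>n\<in>{..<w * w'}. D n (t \<otimes>\<^bsub>T\<^esub> ?b n)"
  have \<Phi>: "?\<Phi> t = (\<Oplus>\<^bsub>T\<^esub>n\<in>{..<w * w'}. D n (t \<otimes>\<^bsub>T\<^esub> ?b n))" if "t \<in> carrier T" for t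
    by (rule CT.finsum_RR(1)) (use that b DD(1) in auto)
  have \<Phi>_tens: "?c \<otimes>\<^bsub>T\<^esub> \<tau> (tr x) (tr' y) = ?\<Phi> (\<tau> x y)" if x: "x \<in> carrier A" and y: "y \<in> carrier B" for x y
  proof -
    have "?c \<otimes>\<^bsub>T\<^esub> \<tau> (tr x) (tr' y) = \<tau> (c \<otimes>\<^bsub>A\<^esub> tr x) (c' \<otimes>\<^bsub>B\<^esub> tr' y)" using x y by (simp add: \<tau>_mult)
    also have "\<dots> = \<tau> (\<Oplus>\<^bsub>A\<^esub>i\<in>{..<w}. C i (x \<otimes>\<^bsub>A\<^esub> b i)) (\<Oplus>\<^bsub>B\<^esub>j\<in>{..<w'}. C' j (y \<otimes>\<^bsub>B\<^esub> b' j))"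
      using QA.c_tr[OF x] QB.c_tr[OF y] CA.finsum_RR(1)[of "{..<w}" "%i. C i (x \<otimes>\<^bsub>A\<^esub> b i)"]
        CB.finsum_RR(1)[of "{..<w'}" "%i. C' i (y \<otimes>\<^bsub>B\<^esub> b' i)"] x y by simp
    also have "\<dots> = (\<Oplus>\<^bsub>T\<^esub>n\<in>{..<w * w'}. \<tau> (C (n div w') (x \<otimes>\<^bsub>A\<^esub> b (n div w'))) (C' (n mod w') (y \<otimes>\<^bsub>B\<^esub> b' (n mod w'))))"
      by (rule \<tau>_finsum[symmetric]) (use x y in auto)
    also have "\<dots> = (\<Oplus>\<^bsub>T\<^esub>n\<in>{..<w * w'}. D n (\<tau> x y \<otimes>\<^bsub>T\<^esub> ?b n))"
      by (rule T.finsum_cong') (use x y Dt index_bounds in \<open>auto simp: \<tau>_mult\<close>)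
    finally show ?thesis using \<Phi> x y by simp
  qed
  have "\<exists>s\<in>S. ?c \<otimes>\<^bsub>T\<^esub> s = ?\<Phi> t" if "t \<in> carrier T" for t
    using that
  proof (induction rule: T_induct)
    case zero
    have "(\<Oplus>\<^bsub>T\<^esub>n\<in>{..<w * w'}. D n (\<zero>\<^bsub>T\<^esub> \<otimes>\<^bsub>T\<^esub> ?b n)) = \<zero>\<^bsub>T\<^esub>"
      by (rule T.add.finprod_one_eqI) (use b DD(4) in simp)
    then have "?c \<otimes>\<^bsub>T\<^esub> \<zero>\<^bsub>T\<^esub> = ?\<Phi> \<zero>\<^bsub>T\<^esub>" unfolding \<Phi>[OF T.zero_closed] using cc by simp
    then show ?case using CT.R_ops(1) by (rule rev_bexI[rotated])
  next
    case (tens x y)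
    have "\<tau> (tr x) (tr' y) \<in> S" using tens \<tau>_S by simp
    with \<Phi>_tens[OF tens] show ?case by (rule rev_bexI[rotated])
  next
    case (add s t)
    obtain u v where u: "u \<in> S" "?c \<otimes>\<^bsub>T\<^esub> u = ?\<Phi> s" "v \<in> S" "?c \<otimes>\<^bsub>T\<^esub> v = ?\<Phi> t"
      using add by (elim bexE)
    have "?\<Phi> (s \<oplus>\<^bsub>T\<^esub> t) = (\<Oplus>\<^bsub>T\<^esub>n\<in>{..<w * w'}. D n (s \<otimes>\<^bsub>T\<^esub> ?b n) \<oplus>\<^bsub>T\<^esub> D n (t \<otimes>\<^bsub>T\<^esub> ?b n))"
      unfolding \<Phi>[OF T.a_closed[OF add(1,2)]]
      by (rule T.finsum_cong') (use add b DD(1,2) in \<open>auto simp: T.l_distr\<close>)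
    also have "\<dots> = ?\<Phi> s \<oplus>\<^bsub>T\<^esub> ?\<Phi> t"
      unfolding \<Phi>[OF add(1)] \<Phi>[OF add(2)] by (rule T.finsum_addf) (use add b DD(1) in auto)
    finally have "?c \<otimes>\<^bsub>T\<^esub> (u \<oplus>\<^bsub>T\<^esub> v) = ?\<Phi> (s \<oplus>\<^bsub>T\<^esub> t)" using u cc by (simp add: T.r_distr)
    moreover have "u \<oplus>\<^bsub>T\<^esub> v \<in> S" using u by simp
    ultimately show ?case by (rule rev_bexI[rotated])
  qed
  then have "\<forall>t\<in>carrier T. \<exists>s. s \<in> S & ?c \<otimes>\<^bsub>T\<^esub> s = ?\<Phi> t" by blast
  then have "\<exists>f. \<forall>t\<in>carrier T. f t \<in> S & ?c \<otimes>\<^bsub>T\<^esub> f t = ?\<Phi> t" by (rule bchoice)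
  then obtain trT where trT: "\<forall>t\<in>carrier T. trT t \<in> S & ?c \<otimes>\<^bsub>T\<^esub> trT t = ?\<Phi> t" ..
  have qt: "quasi_trace T S (w * w') ?b ?c D trT"
    by (rule quasi_trace.intro[OF qc], rule quasi_trace_axioms.intro) (use trT in simp_all)
  interpret QT: quasi_trace T S "w * w'" ?b ?c D trT by (rule qt)
  have "trT (\<tau> x y) = \<tau> (tr x) (tr' y)" if "x \<in> carrier A" "y \<in> carrier B" for x y
    by (rule QT.tr_unique[OF _ _ \<Phi>_tens[OF that]]) (use that \<tau>_S in auto)
  with qt Dt show thesis by (rule that)
qed

end

section \<open>The discriminant ideal of a tensor product\<close>

lemma (in central_domain) RR_pow: "x [^]\<^bsub>RR\<^esub> (n :: nat) = x [^] n"
  by (simp add: nat_pow_def)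

lemma (in cring) finprod_scaled:
  assumes J: "finite J" and cl: "e \<in> carrier R" "v \<in> carrier R" "!!j. j \<in> J ==> r j \<in> carrier R"
    "!!j. j \<in> J ==> p j \<in> carrier R" "!!j. j \<in> J ==> q j \<in> carrier R"
    and eq: "!!j. j \<in> J ==> e \<otimes> r j = p j \<otimes> q j \<otimes> v"
  shows "e [^] card J \<otimes> (\<Otimes>j\<in>J. r j) = (\<Otimes>j\<in>J. p j) \<otimes> (\<Otimes>j\<in>J. q j) \<otimes> v [^] card J"
proof -
  have "e [^] card J \<otimes> (\<Otimes>j\<in>J. r j) = (\<Otimes>j\<in>J. e \<otimes> r j)"
    using finprod_multf[of "%j. e" J r] finprod_const[of e J] cl by (simp add: Pi_def)
  also have "\<dots> = (\<Otimes>j\<in>J. p j \<otimes> q j \<otimes> v)" by (rule finprod_cong') (use cl eq in auto)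
  also have "\<dots> = (\<Otimes>j\<in>J. p j \<otimes> q j) \<otimes> v [^] card J"
    using finprod_multf[of "%j. p j \<otimes> q j" J "%j. v"] finprod_const[of v J] cl by (simp add: Pi_def)
  also have "(\<Otimes>j\<in>J. p j \<otimes> q j) = (\<Otimes>j\<in>J. p j) \<otimes> (\<Otimes>j\<in>J. q j)"
    using finprod_multf[of p J q] cl by (simp add: Pi_def)
  finally show ?thesis .
qed

context quasi_trace
begin

text \<open>Coordinate values are always realized by an actual discriminant, so the division by
  \<open>cc\<close> is possible for every choice of p and q.\<close>

lemma split_exists:
  assumes p: "!!i. i < w ==> p i \<in> C i ` carrier B" and q: "!!i. i < w ==> q i \<in> C i ` carrier B"
  shows "\<exists>r. r \<in> split_disc (%i. C i ` carrier B) &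
    cc \<otimes> r = (\<Otimes>\<^bsub>RR\<^esub>i\<in>{..<w}. p i) \<otimes> (\<Otimes>\<^bsub>RR\<^esub>i\<in>{..<w}. q i) \<otimes> disc b b"
proof -
  have ex: "\<exists>y. i < w --> y \<in> carrier B & g i \<otimes> b i = c \<otimes> y" if g: "!!i. i < w ==> g i \<in> C i ` carrier B" for g i
  proof (cases "i < w")
    case True
    obtain x where x: "x \<in> carrier B" "g i = C i x" using g[OF True] by auto
    obtain y where "y \<in> carrier B" "C i x \<otimes> b i = c \<otimes> y" using C_split[OF True x(1)] by (elim bexE)
    then show ?thesis using x by (intro exI[of _ y]) simp
  qed simp
  have "\<exists>y. \<forall>i. i < w --> y i \<in> carrier B & p i \<otimes> b i = c \<otimes> y i" by (intro choice allI ex p)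
  then obtain y where y: "\<forall>i. i < w --> y i \<in> carrier B & p i \<otimes> b i = c \<otimes> y i" ..
  have "\<exists>z. \<forall>i. i < w --> z i \<in> carrier B & q i \<otimes> b i = c \<otimes> z i" by (intro choice allI ex q)
  then obtain z where z: "\<forall>i. i < w --> z i \<in> carrier B & q i \<otimes> b i = c \<otimes> z i" ..
  have pq: "p i \<in> R" "q i \<in> R" if "i < w" for i using p[OF that] q[OF that] C_R that by auto
  have "cc \<otimes> disc y z = (\<Otimes>\<^bsub>RR\<^esub>i\<in>{..<w}. p i) \<otimes> (\<Otimes>\<^bsub>RR\<^esub>i\<in>{..<w}. q i) \<otimes> disc b b"
    by (rule disc_split) (use y z pq in auto)
  moreover from this have "disc y z \<in> split_disc (%i. C i ` carrier B)"
    unfolding split_disc_def using disc_R[of y z] y z p q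
    by (intro CollectI conjI exI[of _ p, OF exI[of _ q]] allI impI) simp_all
  ultimately show ?thesis by blast
qed

text \<open>An empty basis would force c = 0. Positivity matters because w and w' become exponents,
  and a zeroth ideal power is the whole algebra even for the zero ideal.\<close>

lemma w_pos: "0 < w"
proof (rule gr0I)
  assume "w = 0"
  then have "c \<otimes> \<one> = \<zero>" using C_sum[of \<one>] by simp
  then show False using c_nonzero by simp
qed

text \<open>The test with divisor zero makes every functional vanish at y, and functionals separate
  points.\<close>

lemma div_closure_zero_set:
  assumes "L \<subseteq> {\<zero>}" shows "div_closure L \<subseteq> {\<zero>}"
proof
  fix y assume y: "y \<in> div_closure L"
  have "f y = \<zero>" if f: "functional f" for f
  proof -
    have "\<exists>t\<in>R. f y = \<zero> \<otimes> t"
    proof (rule div_closureD[OF y f])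
      fix x assume "x \<in> L"
      then have "f x = \<zero> \<otimes> \<zero>" using assms functionalD(4)[OF f] by auto
      then show "\<exists>t\<in>R. f x = \<zero> \<otimes> t" using R_ops(1) by (rule rev_bexI[rotated])
    qed simp
    then show ?thesis by auto
  qed
  then show "y \<in> {\<zero>}" using torsionless[OF div_closure_carrier[OF y]] by simp
qed

end

lemma (in central_domain) ideal_power_iff:
  assumes I: "I \<subseteq> R"
  shows "y \<in> ideal_power I n \<longleftrightarrow>
    (\<exists>r x. (\<forall>j<n. r j \<in> I) & x \<in> carrier B & y = (\<Otimes>\<^bsub>RR\<^esub>j\<in>{..<n}. r j) \<otimes> x)"
proof (induction n arbitrary: y)
  case 0
  show ?case by auto
next
  case (Suc n)
  have prod: "(\<Otimes>\<^bsub>RR\<^esub>j\<in>{..<n}. r j) \<in> R" if "\<forall>j<n. r j \<in> I" for r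
    using R.finprod_closed[of r "{..<n}"] that I by auto
  have step: "(\<Otimes>\<^bsub>RR\<^esub>j\<in>{..<Suc n}. r j) \<otimes> x = r n \<otimes> ((\<Otimes>\<^bsub>RR\<^esub>j\<in>{..<n}. r j) \<otimes> x)"
    if "\<forall>j<Suc n. r j \<in> I" "x \<in> carrier B" for r x
    using R.finprod_insert[of "{..<n}" n r] prod[of r] that I by (simp add: lessThan_Suc Pi_def subset_iff m_assoc)
  show ?case
  proof
    assume "y \<in> ideal_power I (Suc n)"
    then obtain s z where s: "y = s \<otimes> z" "s \<in> I" "z \<in> ideal_power I n" by auto
    then obtain r x where r: "\<forall>j<n. r j \<in> I" "x \<in> carrier B" "z = (\<Otimes>\<^bsub>RR\<^esub>j\<in>{..<n}. r j) \<otimes> x"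
      using Suc.IH by blast
    let ?r = "r(n := s)"
    have "(\<Otimes>\<^bsub>RR\<^esub>j\<in>{..<n}. ?r j) = (\<Otimes>\<^bsub>RR\<^esub>j\<in>{..<n}. r j)"
      by (rule R.finprod_cong') (use r I in auto)
    moreover have "\<forall>j<Suc n. ?r j \<in> I" using r s by (auto simp: less_Suc_eq)
    ultimately show "\<exists>r x. (\<forall>j<Suc n. r j \<in> I) & x \<in> carrier B & y = (\<Otimes>\<^bsub>RR\<^esub>j\<in>{..<Suc n}. r j) \<otimes> x"
      using step[of ?r x] r s by (intro exI[of _ ?r] exI[of _ x]) simp
  next
    assume "\<exists>r x. (\<forall>j<Suc n. r j \<in> I) & x \<in> carrier B & y = (\<Otimes>\<^bsub>RR\<^esub>j\<in>{..<Suc n}. r j) \<otimes> x"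
    then obtain r x where r: "\<forall>j<Suc n. r j \<in> I" "x \<in> carrier B" "y = (\<Otimes>\<^bsub>RR\<^esub>j\<in>{..<Suc n}. r j) \<otimes> x"
      by (elim exE conjE)
    have "(\<Otimes>\<^bsub>RR\<^esub>j\<in>{..<n}. r j) \<otimes> x \<in> ideal_power I n"
      unfolding Suc.IH using r by (intro exI[of _ r] exI[of _ x]) simp
    then show "y \<in> ideal_power I (Suc n)" using r step[OF r(1,2)] by auto
  qed
qed

text \<open>\<open>D\<close> and \<open>trT\<close> come from \<open>tensor_quasi_trace\<close>; the
  two axioms keep their values on pure tensors, which the quasi-trace structure of \<open>T\<close>
  alone does not record.\<close>

locale tensor_discriminant = tensor_trace k A B T \<tau> Z Z' S w b c C tr w' b' c' C' tr' +
    QT: quasi_trace T S "w * w'" "%n. \<tau> (b (n div w')) (b' (n mod w'))" "\<tau> c c'" D trT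
  for k :: "('k, 'l) ring_scheme" and A :: "('k, 'a, 'm) module_scheme"
    and B :: "('k, 'b, 'n) module_scheme" and T :: "('t, 'o) ring_scheme"
    and \<tau> :: "'a \<Rightarrow> 'b \<Rightarrow> 't" and Z :: "'a set" and Z' :: "'b set" and S :: "'t set"
    and w b c C tr w' b' c' C' tr' D trT +
  assumes D_tens: "n < w * w' ==> x \<in> carrier A ==> y \<in> carrier B ==>
      D n (\<tau> x y) = \<tau> (C (n div w') x) (C' (n mod w') y)"
    and trT_tens: "x \<in> carrier A ==> y \<in> carrier B ==> trT (\<tau> x y) = \<tau> (tr x) (tr' y)"
begin

abbreviation "bT \<equiv> %n. \<tau> (b (n div w')) (b' (n mod w'))"

text \<open>The trace matrix of the products b_i \<otimes> b'_j is the Kronecker product of the two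
  trace matrices; the embeddings of Z and Z' put both over the one ring \<open>S\<close>.\<close>

lemma disc_tensor: "QT.disc bT bT = \<tau> (QA.disc b b [^]\<^bsub>A\<^esub> w') (QB.disc b' b' [^]\<^bsub>B\<^esub> w)"
proof -
  have "(%z. \<tau> z \<one>\<^bsub>B\<^esub>) \<in> Ring.ring_hom CA.RR CT.RR"
    by (rule Ring.ring_hom_memI) (auto simp: \<tau>_mult \<tau>_S \<tau>_l_distr \<tau>_one)
  then interpret zl: ring_hom_cring CA.RR CT.RR "%z. \<tau> z \<one>\<^bsub>B\<^esub>"
    by (intro ring_hom_cring.intro CA.R.is_cring CT.R.is_cring ring_hom_cring_axioms.intro)
  have "(%z. \<tau> \<one>\<^bsub>A\<^esub> z) \<in> Ring.ring_hom CB.RR CT.RR"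
    by (rule Ring.ring_hom_memI) (auto simp: \<tau>_mult \<tau>_S \<tau>_r_distr \<tau>_one)
  then interpret zr: ring_hom_cring CB.RR CT.RR "%z. \<tau> \<one>\<^bsub>A\<^esub> z"
    by (intro ring_hom_cring.intro CB.R.is_cring CT.R.is_cring ring_hom_cring_axioms.intro)
  let ?M = "%i j. \<tau> (tr (b i \<otimes>\<^bsub>A\<^esub> b j)) \<one>\<^bsub>B\<^esub>" and ?N = "%i j. \<tau> \<one>\<^bsub>A\<^esub> (tr' (b' i \<otimes>\<^bsub>B\<^esub> b' j))"
  have "QT.disc bT bT = ring_det CT.RR (w * w')
      (%i j. ?M (i div w') (j div w') \<otimes>\<^bsub>CT.RR\<^esub> ?N (i mod w') (j mod w'))"
    unfolding QT.disc_def
  proof (rule CT.R.ring_det_cong)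
    fix i j assume "i < w * w'" "j < w * w'"
    note ij = index_bounds[OF this(1)] index_bounds[OF this(2)]
    then show "trT (bT i \<otimes>\<^bsub>T\<^esub> bT j) = ?M (i div w') (j div w') \<otimes>\<^bsub>CT.RR\<^esub> ?N (i mod w') (j mod w')"
      by (simp add: \<tau>_mult trT_tens)
    show "?M (i div w') (j div w') \<otimes>\<^bsub>CT.RR\<^esub> ?N (i mod w') (j mod w') \<in> carrier CT.RR"
      using ij \<tau>_S by (simp add: \<tau>_mult)
  qed
  also have "\<dots> = ring_det CT.RR w ?M [^]\<^bsub>CT.RR\<^esub> w' \<otimes>\<^bsub>CT.RR\<^esub> ring_det CT.RR w' ?N [^]\<^bsub>CT.RR\<^esub> w"
    by (rule CT.R.ring_det_kronecker) (use \<tau>_S in auto)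
  also have "ring_det CT.RR w ?M = \<tau> (QA.disc b b) \<one>\<^bsub>B\<^esub>"
    unfolding QA.disc_def by (rule zl.hom_ring_det[symmetric]) simp
  also have "ring_det CT.RR w' ?N = \<tau> \<one>\<^bsub>A\<^esub> (QB.disc b' b')"
    unfolding QB.disc_def by (rule zr.hom_ring_det[symmetric]) simp
  also have "\<tau> (QA.disc b b) \<one>\<^bsub>B\<^esub> [^]\<^bsub>CT.RR\<^esub> w' \<otimes>\<^bsub>CT.RR\<^esub> \<tau> \<one>\<^bsub>A\<^esub> (QB.disc b' b') [^]\<^bsub>CT.RR\<^esub> w =
      \<tau> (QA.disc b b [^]\<^bsub>A\<^esub> w') (QB.disc b' b' [^]\<^bsub>B\<^esub> w)"
    using QA.disc_R[of b b] QB.disc_R[of b' b'] by (simp add: CT.RR_pow \<tau>_pow \<tau>_mult)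
  finally show ?thesis .
qed

text \<open>The exponents balance: (c^(2w))^w' \<otimes> (c'^(2w'))^w = (c \<otimes> c')^(2 w
  w').\<close>

lemma cc_tensor: "QT.cc = \<tau> (QA.cc [^]\<^bsub>A\<^esub> w') (QB.cc [^]\<^bsub>B\<^esub> w)"
proof -
  have c: "c \<in> carrier A" "c' \<in> carrier B" by simp_all
  have "QA.cc [^]\<^bsub>A\<^esub> w' = c [^]\<^bsub>A\<^esub> (w * w') \<otimes>\<^bsub>A\<^esub> c [^]\<^bsub>A\<^esub> (w * w')"
    unfolding QA.cc_def CA.RR_pow using c by (simp add: A.pow_mult_distrib A.nat_pow_pow)
  moreover have "QB.cc [^]\<^bsub>B\<^esub> w = c' [^]\<^bsub>B\<^esub> (w * w') \<otimes>\<^bsub>B\<^esub> c' [^]\<^bsub>B\<^esub> (w * w')"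
    unfolding QB.cc_def CB.RR_pow using c by (simp add: B.pow_mult_distrib B.nat_pow_pow mult.commute)
  ultimately show ?thesis unfolding QT.cc_def CT.RR_pow using c by (simp add: \<tau>_pow \<tau>_mult)
qed

text \<open>One grid product is grouped by columns on the side of \<open>A\<close> and by rows on
  the side of \<open>B\<close>, since a column runs through the basis of \<open>A\<close> and a row
  through that of \<open>B\<close>.\<close>

lemma \<tau>_finprod_grid:
  assumes p: "!!i j. i < w ==> j < w' ==> p i j \<in> Z" and p': "!!i j. i < w ==> j < w' ==> p' i j \<in> Z'"
  shows "(\<Otimes>\<^bsub>CT.RR\<^esub>n\<in>{..<w * w'}. \<tau> (p (n div w') (n mod w')) (p' (n div w') (n mod w'))) =
    \<tau> (\<Otimes>\<^bsub>CA.RR\<^esub>j\<in>{..<w'}. \<Otimes>\<^bsub>CA.RR\<^esub>i\<in>{..<w}. p i j) (\<Otimes>\<^bsub>CB.RR\<^esub>i\<in>{..<w}. \<Otimes>\<^bsub>CB.RR\<^esub>j\<in>{..<w'}. p' i j)"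
proof -
  have "(\<Otimes>\<^bsub>CA.RR\<^esub>n\<in>{..<w * w'}. p (n div w') (n mod w')) = (\<Otimes>\<^bsub>CA.RR\<^esub>i\<in>{..<w}. \<Otimes>\<^bsub>CA.RR\<^esub>j\<in>{..<w'}. p i j)"
    by (rule CA.R.finprod_div_mod) (simp add: p)
  also have "\<dots> = (\<Otimes>\<^bsub>CA.RR\<^esub>j\<in>{..<w'}. \<Otimes>\<^bsub>CA.RR\<^esub>i\<in>{..<w}. p i j)"
    by (rule CA.R.finprod_swap) (simp_all add: p)
  finally have 1: "(\<Otimes>\<^bsub>CA.RR\<^esub>n\<in>{..<w * w'}. p (n div w') (n mod w')) = \<dots>" .
  have 2: "(\<Otimes>\<^bsub>CB.RR\<^esub>n\<in>{..<w * w'}. p' (n div w') (n mod w')) = (\<Otimes>\<^bsub>CB.RR\<^esub>i\<in>{..<w}. \<Otimes>\<^bsub>CB.RR\<^esub>j\<in>{..<w'}. p' i j)"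
    by (rule CB.R.finprod_div_mod) (simp add: p')
  show ?thesis
    unfolding 1[symmetric] 2[symmetric] by (rule \<tau>_finprod) (use p p' index_bounds in auto)
qed

text \<open>Multiplying the equations of w' generators for \<open>A\<close> and of w generators for
  \<open>B\<close> gives the equation of one generator for \<open>T\<close>; the resulting powers
  are exactly those of \<open>cc_tensor\<close> and \<open>disc_tensor\<close>.\<close>

lemma scaled_product:
  assumes p: "!!i j. i < w ==> j < w' ==> p i j \<in> Z" and q: "!!i j. i < w ==> j < w' ==> q i j \<in> Z"
    and p': "!!i j. i < w ==> j < w' ==> p' i j \<in> Z'" and q': "!!i j. i < w ==> j < w' ==> q' i j \<in> Z'"
    and r: "!!j. j < w' ==> r j \<in> Z" and r': "!!i. i < w ==> r' i \<in> Z'"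
    and eq: "!!j. j < w' ==> QA.cc \<otimes>\<^bsub>A\<^esub> r j =
      (\<Otimes>\<^bsub>CA.RR\<^esub>i\<in>{..<w}. p i j) \<otimes>\<^bsub>A\<^esub> (\<Otimes>\<^bsub>CA.RR\<^esub>i\<in>{..<w}. q i j) \<otimes>\<^bsub>A\<^esub> QA.disc b b"
    and eq': "!!i. i < w ==> QB.cc \<otimes>\<^bsub>B\<^esub> r' i =
      (\<Otimes>\<^bsub>CB.RR\<^esub>j\<in>{..<w'}. p' i j) \<otimes>\<^bsub>B\<^esub> (\<Otimes>\<^bsub>CB.RR\<^esub>j\<in>{..<w'}. q' i j) \<otimes>\<^bsub>B\<^esub> QB.disc b' b'"
  shows "QT.cc \<otimes>\<^bsub>T\<^esub> \<tau> (\<Otimes>\<^bsub>CA.RR\<^esub>j\<in>{..<w'}. r j) (\<Otimes>\<^bsub>CB.RR\<^esub>i\<in>{..<w}. r' i) =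
    (\<Otimes>\<^bsub>CT.RR\<^esub>n\<in>{..<w * w'}. \<tau> (p (n div w') (n mod w')) (p' (n div w') (n mod w'))) \<otimes>\<^bsub>T\<^esub>
    (\<Otimes>\<^bsub>CT.RR\<^esub>n\<in>{..<w * w'}. \<tau> (q (n div w') (n mod w')) (q' (n div w') (n mod w'))) \<otimes>\<^bsub>T\<^esub> QT.disc bT bT"
proof -
  have rowA: "(\<Otimes>\<^bsub>CA.RR\<^esub>i\<in>{..<w}. g i j) \<in> Z" if "!!i j. i < w ==> j < w' ==> g i j \<in> Z" "j < w'" for g j
    by (rule QA.prod_R) (use that in auto)
  have rowB: "(\<Otimes>\<^bsub>CB.RR\<^esub>j\<in>{..<w'}. g i j) \<in> Z'" if "!!i j. i < w ==> j < w' ==> g i j \<in> Z'" "i < w" for g i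
    by (rule QB.prod_R) (use that in auto)
  have rp: "(\<Otimes>\<^bsub>CA.RR\<^esub>i\<in>{..<w}. p i j) \<in> Z" and rq: "(\<Otimes>\<^bsub>CA.RR\<^esub>i\<in>{..<w}. q i j) \<in> Z" if "j < w'" for j
    using that by (auto intro!: rowA p q)
  have rp': "(\<Otimes>\<^bsub>CB.RR\<^esub>j\<in>{..<w'}. p' i j) \<in> Z'" and rq': "(\<Otimes>\<^bsub>CB.RR\<^esub>j\<in>{..<w'}. q' i j) \<in> Z'" if "i < w" for i
    using that by (auto intro!: rowB p' q')
  let ?PA = "%g. \<Otimes>\<^bsub>CA.RR\<^esub>j\<in>{..<w'}. \<Otimes>\<^bsub>CA.RR\<^esub>i\<in>{..<w}. g i j"
  let ?PB = "%g. \<Otimes>\<^bsub>CB.RR\<^esub>i\<in>{..<w}. \<Otimes>\<^bsub>CB.RR\<^esub>j\<in>{..<w'}. g i j"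
  have PZ: "?PA p \<in> Z" "?PA q \<in> Z" by (rule QA.prod_R, simp add: rp rq)+
  have PZ': "?PB p' \<in> Z'" "?PB q' \<in> Z'" by (rule QB.prod_R, simp add: rp' rq')+
  have dA: "QA.disc b b \<in> Z" and dB: "QB.disc b' b' \<in> Z'" by (simp_all add: QA.disc_R QB.disc_R)
  have rA: "(\<Otimes>\<^bsub>CA.RR\<^esub>j\<in>{..<w'}. r j) \<in> Z" by (rule QA.prod_R) (simp add: r)
  have rB: "(\<Otimes>\<^bsub>CB.RR\<^esub>i\<in>{..<w}. r' i) \<in> Z'" by (rule QB.prod_R) (simp add: r')
  have "QA.cc [^]\<^bsub>CA.RR\<^esub> card {..<w'} \<otimes>\<^bsub>CA.RR\<^esub> (\<Otimes>\<^bsub>CA.RR\<^esub>j\<in>{..<w'}. r j) =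
      ?PA p \<otimes>\<^bsub>CA.RR\<^esub> ?PA q \<otimes>\<^bsub>CA.RR\<^esub> QA.disc b b [^]\<^bsub>CA.RR\<^esub> card {..<w'}"
    by (rule CA.R.finprod_scaled) (simp_all add: r dA rp rq eq)
  then have A1: "QA.cc [^]\<^bsub>A\<^esub> w' \<otimes>\<^bsub>A\<^esub> (\<Otimes>\<^bsub>CA.RR\<^esub>j\<in>{..<w'}. r j) = ?PA p \<otimes>\<^bsub>A\<^esub> ?PA q \<otimes>\<^bsub>A\<^esub> QA.disc b b [^]\<^bsub>A\<^esub> w'"
    by (simp add: CA.RR_pow)
  have "QB.cc [^]\<^bsub>CB.RR\<^esub> card {..<w} \<otimes>\<^bsub>CB.RR\<^esub> (\<Otimes>\<^bsub>CB.RR\<^esub>i\<in>{..<w}. r' i) =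
      ?PB p' \<otimes>\<^bsub>CB.RR\<^esub> ?PB q' \<otimes>\<^bsub>CB.RR\<^esub> QB.disc b' b' [^]\<^bsub>CB.RR\<^esub> card {..<w}"
    by (rule CB.R.finprod_scaled) (simp_all add: r' dB rp' rq' eq')
  then have B1: "QB.cc [^]\<^bsub>B\<^esub> w \<otimes>\<^bsub>B\<^esub> (\<Otimes>\<^bsub>CB.RR\<^esub>i\<in>{..<w}. r' i) = ?PB p' \<otimes>\<^bsub>B\<^esub> ?PB q' \<otimes>\<^bsub>B\<^esub> QB.disc b' b' [^]\<^bsub>B\<^esub> w"
    by (simp add: CB.RR_pow)
  note cl = PZ[THEN CA.R_closed] PZ'[THEN CB.R_closed] dA[THEN CA.R_closed] dB[THEN CB.R_closed]
    rA[THEN CA.R_closed] rB[THEN CB.R_closed] QA.cc_R[THEN CA.R_closed] QB.cc_R[THEN CB.R_closed]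
  have gp: "(\<Otimes>\<^bsub>CT.RR\<^esub>n\<in>{..<w * w'}. \<tau> (p (n div w') (n mod w')) (p' (n div w') (n mod w'))) = \<tau> (?PA p) (?PB p')"
    by (rule \<tau>_finprod_grid) (simp_all add: p p')
  have gq: "(\<Otimes>\<^bsub>CT.RR\<^esub>n\<in>{..<w * w'}. \<tau> (q (n div w') (n mod w')) (q' (n div w') (n mod w'))) = \<tau> (?PA q) (?PB q')"
    by (rule \<tau>_finprod_grid) (simp_all add: q q')
  have "QT.cc \<otimes>\<^bsub>T\<^esub> \<tau> (\<Otimes>\<^bsub>CA.RR\<^esub>j\<in>{..<w'}. r j) (\<Otimes>\<^bsub>CB.RR\<^esub>i\<in>{..<w}. r' i) =
      \<tau> (QA.cc [^]\<^bsub>A\<^esub> w' \<otimes>\<^bsub>A\<^esub> (\<Otimes>\<^bsub>CA.RR\<^esub>j\<in>{..<w'}. r j)) (QB.cc [^]\<^bsub>B\<^esub> w \<otimes>\<^bsub>B\<^esub> (\<Otimes>\<^bsub>CB.RR\<^esub>i\<in>{..<w}. r' i))"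
    unfolding cc_tensor by (rule \<tau>_mult) (simp_all add: cl)
  also have "\<dots> = \<tau> (?PA p) (?PB p') \<otimes>\<^bsub>T\<^esub> \<tau> (?PA q) (?PB q') \<otimes>\<^bsub>T\<^esub> QT.disc bT bT"
    unfolding disc_tensor A1 B1 by (simp add: \<tau>_mult cl)
  finally show ?thesis unfolding gp gq .
qed

abbreviation "EA \<equiv> QA.split_disc (%i. C i ` carrier A)"
abbreviation "EB \<equiv> QB.split_disc (%i. C' i ` carrier B)"
text \<open>Coordinate values at pure tensors only. Their sums give all values of D_n, as
  \<open>MD_ideal_split\<close> requires, and each of them separates into a factor from
  \<open>A\<close> and one from \<open>B\<close>.\<close>

abbreviation "GT \<equiv> %n. {\<tau> p p' | p p'. p \<in> C (n div w') ` carrier A & p' \<in> C' (n mod w') ` carrier B}"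

lemma GT_I: "p \<in> C (n div w') ` carrier A ==> p' \<in> C' (n mod w') ` carrier B ==> \<tau> p p' \<in> GT n"
  by blast

lemma EA_Z: "r \<in> EA ==> r \<in> Z" and EB_Z: "r' \<in> EB ==> r' \<in> Z'"
  by (simp_all add: QA.split_disc_def QB.split_disc_def)

lemma C_image: "i < w ==> p \<in> C i ` carrier A ==> p \<in> Z" "i < w' ==> p' \<in> C' i ` carrier B ==> p' \<in> Z'"
  by auto

lemma grid_index:
  assumes "i < w" "j < w'" shows "i * w' + j < w * w'" "(i * w' + j) div w' = i" "(i * w' + j) mod w' = j"
proof -
  have "i * w' + j < Suc i * w'" using assms by simp
  also have "\<dots> \<le> w * w'" using assms by (intro mult_le_mono1) simp
  finally show "i * w' + j < w * w'" .
qed (use assms in auto)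

lemma GT_grid:
  assumes "\<forall>n<w * w'. P n \<in> GT n"
  shows "\<exists>p p'. (\<forall>i<w. \<forall>j<w'. p i j \<in> C i ` carrier A) & (\<forall>i<w. \<forall>j<w'. p' i j \<in> C' j ` carrier B) &
    (\<forall>n<w * w'. P n = \<tau> (p (n div w') (n mod w')) (p' (n div w') (n mod w')))"
proof -
  have "\<exists>u. n < w * w' --> fst u \<in> C (n div w') ` carrier A & snd u \<in> C' (n mod w') ` carrier B &
      P n = \<tau> (fst u) (snd u)" for n
  proof (cases "n < w * w'")
    case True
    then have "P n \<in> GT n" using assms by simp
    then obtain p p' where "P n = \<tau> p p'" "p \<in> C (n div w') ` carrier A" "p' \<in> C' (n mod w') ` carrier B"
      by (elim CollectE exE conjE)
    then show ?thesis by (intro exI[of _ "(p, p')"]) simp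
  qed simp
  then have "\<exists>u. \<forall>n. n < w * w' --> fst (u n) \<in> C (n div w') ` carrier A &
      snd (u n) \<in> C' (n mod w') ` carrier B & P n = \<tau> (fst (u n)) (snd (u n))"
    by (intro choice allI)
  then obtain u where u: "\<forall>n. n < w * w' --> fst (u n) \<in> C (n div w') ` carrier A &
      snd (u n) \<in> C' (n mod w') ` carrier B & P n = \<tau> (fst (u n)) (snd (u n))" ..
  have "fst (u (i * w' + j)) \<in> C i ` carrier A" "snd (u (i * w' + j)) \<in> C' j ` carrier B"
    if "i < w" "j < w'" for i j
    using u[rule_format, OF grid_index(1)[OF that]] grid_index(2,3)[OF that] by simp_all
  then show ?thesis using u
    by (intro exI[of _ "%i j. fst (u (i * w' + j))", OF exI[of _ "%i j. snd (u (i * w' + j))"]]) simp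
qed

text \<open>A tensor does not determine its factors, so these are chosen at each grid position.
  Column j then yields a generator r_j for \<open>A\<close>, row i a generator r'_i for
  \<open>B\<close>, and cancelling the denominator identifies \<rho> with the tensor of their
  products.\<close>

lemma split_disc_tensor:
  assumes \<rho>: "\<rho> \<in> QT.split_disc GT"
  shows "\<exists>r r'. (\<forall>j<w'. r j \<in> EA) & (\<forall>i<w. r' i \<in> EB) &
    \<rho> = \<tau> (\<Otimes>\<^bsub>CA.RR\<^esub>j\<in>{..<w'}. r j) (\<Otimes>\<^bsub>CB.RR\<^esub>i\<in>{..<w}. r' i)"
proof -
  obtain P Q where P: "\<forall>n<w * w'. P n \<in> GT n" and Q: "\<forall>n<w * w'. Q n \<in> GT n" and \<rho>S: "\<rho> \<in> S"
    and eq: "QT.cc \<otimes>\<^bsub>T\<^esub> \<rho> = (\<Otimes>\<^bsub>CT.RR\<^esub>n\<in>{..<w * w'}. P n) \<otimes>\<^bsub>T\<^esub> (\<Otimes>\<^bsub>CT.RR\<^esub>n\<in>{..<w * w'}. Q n) \<otimes>\<^bsub>T\<^esub> QT.disc bT bT"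
    using \<rho> unfolding QT.split_disc_def by (elim CollectE conjE exE)
  obtain p p' where p: "\<forall>i<w. \<forall>j<w'. p i j \<in> C i ` carrier A" "\<forall>i<w. \<forall>j<w'. p' i j \<in> C' j ` carrier B"
    and Pp: "\<forall>n<w * w'. P n = \<tau> (p (n div w') (n mod w')) (p' (n div w') (n mod w'))"
    using GT_grid[OF P] by (elim exE conjE)
  obtain q q' where q: "\<forall>i<w. \<forall>j<w'. q i j \<in> C i ` carrier A" "\<forall>i<w. \<forall>j<w'. q' i j \<in> C' j ` carrier B"
    and Qq: "\<forall>n<w * w'. Q n = \<tau> (q (n div w') (n mod w')) (q' (n div w') (n mod w'))"
    using GT_grid[OF Q] by (elim exE conjE)
  have pZ: "p i j \<in> Z" "q i j \<in> Z" "p' i j \<in> Z'" "q' i j \<in> Z'" if "i < w" "j < w'" for i j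
    using p q that C_image(1)[OF that(1)] C_image(2)[OF that(2)] by simp_all
  have "\<exists>r. j < w' --> r \<in> EA & QA.cc \<otimes>\<^bsub>A\<^esub> r =
      (\<Otimes>\<^bsub>CA.RR\<^esub>i\<in>{..<w}. p i j) \<otimes>\<^bsub>A\<^esub> (\<Otimes>\<^bsub>CA.RR\<^esub>i\<in>{..<w}. q i j) \<otimes>\<^bsub>A\<^esub> QA.disc b b" for j
  proof (cases "j < w'")
    case True
    have "\<exists>r. r \<in> EA & QA.cc \<otimes>\<^bsub>A\<^esub> r =
        (\<Otimes>\<^bsub>CA.RR\<^esub>i\<in>{..<w}. p i j) \<otimes>\<^bsub>A\<^esub> (\<Otimes>\<^bsub>CA.RR\<^esub>i\<in>{..<w}. q i j) \<otimes>\<^bsub>A\<^esub> QA.disc b b"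
      by (rule QA.split_exists) (use p(1) q(1) True in simp_all)
    then show ?thesis by (elim exE, intro exI impI)
  qed simp
  then have "\<exists>r. \<forall>j. j < w' --> r j \<in> EA & QA.cc \<otimes>\<^bsub>A\<^esub> r j =
      (\<Otimes>\<^bsub>CA.RR\<^esub>i\<in>{..<w}. p i j) \<otimes>\<^bsub>A\<^esub> (\<Otimes>\<^bsub>CA.RR\<^esub>i\<in>{..<w}. q i j) \<otimes>\<^bsub>A\<^esub> QA.disc b b"
    by (intro choice allI)
  then obtain r where r: "\<forall>j. j < w' --> r j \<in> EA & QA.cc \<otimes>\<^bsub>A\<^esub> r j =
      (\<Otimes>\<^bsub>CA.RR\<^esub>i\<in>{..<w}. p i j) \<otimes>\<^bsub>A\<^esub> (\<Otimes>\<^bsub>CA.RR\<^esub>i\<in>{..<w}. q i j) \<otimes>\<^bsub>A\<^esub> QA.disc b b" ..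
  have "\<exists>r. i < w --> r \<in> EB & QB.cc \<otimes>\<^bsub>B\<^esub> r =
      (\<Otimes>\<^bsub>CB.RR\<^esub>j\<in>{..<w'}. p' i j) \<otimes>\<^bsub>B\<^esub> (\<Otimes>\<^bsub>CB.RR\<^esub>j\<in>{..<w'}. q' i j) \<otimes>\<^bsub>B\<^esub> QB.disc b' b'" for i
  proof (cases "i < w")
    case True
    have "\<exists>r. r \<in> EB & QB.cc \<otimes>\<^bsub>B\<^esub> r =
        (\<Otimes>\<^bsub>CB.RR\<^esub>j\<in>{..<w'}. p' i j) \<otimes>\<^bsub>B\<^esub> (\<Otimes>\<^bsub>CB.RR\<^esub>j\<in>{..<w'}. q' i j) \<otimes>\<^bsub>B\<^esub> QB.disc b' b'"
      by (rule QB.split_exists) (use p(2) q(2) True in simp_all)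
    then show ?thesis by (elim exE, intro exI impI)
  qed simp
  then have "\<exists>r. \<forall>i. i < w --> r i \<in> EB & QB.cc \<otimes>\<^bsub>B\<^esub> r i =
      (\<Otimes>\<^bsub>CB.RR\<^esub>j\<in>{..<w'}. p' i j) \<otimes>\<^bsub>B\<^esub> (\<Otimes>\<^bsub>CB.RR\<^esub>j\<in>{..<w'}. q' i j) \<otimes>\<^bsub>B\<^esub> QB.disc b' b'"
    by (intro choice allI)
  then obtain r' where r': "\<forall>i. i < w --> r' i \<in> EB & QB.cc \<otimes>\<^bsub>B\<^esub> r' i =
      (\<Otimes>\<^bsub>CB.RR\<^esub>j\<in>{..<w'}. p' i j) \<otimes>\<^bsub>B\<^esub> (\<Otimes>\<^bsub>CB.RR\<^esub>j\<in>{..<w'}. q' i j) \<otimes>\<^bsub>B\<^esub> QB.disc b' b'" ..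
  let ?t = "\<tau> (\<Otimes>\<^bsub>CA.RR\<^esub>j\<in>{..<w'}. r j) (\<Otimes>\<^bsub>CB.RR\<^esub>i\<in>{..<w}. r' i)"
  have rZ: "r j \<in> Z" if "j < w'" for j using EA_Z r that by simp
  have r'Z: "r' i \<in> Z'" if "i < w" for i using EB_Z r' that by simp
  have PP: "(\<Otimes>\<^bsub>CT.RR\<^esub>n\<in>{..<w * w'}. P n) =
      (\<Otimes>\<^bsub>CT.RR\<^esub>n\<in>{..<w * w'}. \<tau> (p (n div w') (n mod w')) (p' (n div w') (n mod w')))"
  proof (rule CT.R.finprod_cong'[OF refl])
    show "(%n. \<tau> (p (n div w') (n mod w')) (p' (n div w') (n mod w'))) \<in> {..<w * w'} \<rightarrow> carrier CT.RR"
    proof (rule funcsetI)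
      fix n assume "n \<in> {..<w * w'}"
      then have i: "n div w' < w" "n mod w' < w'" using index_bounds by blast+
      show "\<tau> (p (n div w') (n mod w')) (p' (n div w') (n mod w')) \<in> carrier CT.RR"
        using \<tau>_S[OF pZ(1)[OF i] pZ(3)[OF i]] by simp
    qed
  qed (simp add: Pp[rule_format])
  have QQ: "(\<Otimes>\<^bsub>CT.RR\<^esub>n\<in>{..<w * w'}. Q n) =
      (\<Otimes>\<^bsub>CT.RR\<^esub>n\<in>{..<w * w'}. \<tau> (q (n div w') (n mod w')) (q' (n div w') (n mod w')))"
  proof (rule CT.R.finprod_cong'[OF refl])
    show "(%n. \<tau> (q (n div w') (n mod w')) (q' (n div w') (n mod w'))) \<in> {..<w * w'} \<rightarrow> carrier CT.RR"
    proof (rule funcsetI)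
      fix n assume "n \<in> {..<w * w'}"
      then have i: "n div w' < w" "n mod w' < w'" using index_bounds by blast+
      show "\<tau> (q (n div w') (n mod w')) (q' (n div w') (n mod w')) \<in> carrier CT.RR"
        using \<tau>_S[OF pZ(2)[OF i] pZ(4)[OF i]] by simp
    qed
  qed (simp add: Qq[rule_format])
  have "QT.cc \<otimes>\<^bsub>T\<^esub> ?t = QT.cc \<otimes>\<^bsub>T\<^esub> \<rho>"
    unfolding eq PP QQ
    by (rule scaled_product[of p q p' q' r r', OF pZ(1) pZ(2) pZ(3) pZ(4) rZ r'Z])
      (simp_all add: r[rule_format] r'[rule_format])
  moreover have "?t \<in> S"
    by (rule \<tau>_S; rule QA.prod_R QB.prod_R) (simp_all add: rZ r'Z)
  ultimately have "\<rho> = ?t"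
    using CT.R_cancel[OF QT.cc_R QT.cc_nonzero, of \<rho> ?t] \<rho>S by simp
  then show ?thesis using r r' by (intro exI[of _ r, OF exI[of _ r']]) simp
qed

text \<open>The reverse arrangement: the data of r_j fill column j on the side of \<open>A\<close>,
  those of r'_i fill row i on the side of \<open>B\<close>.\<close>

lemma split_disc_tensorI:
  assumes r: "\<forall>j<w'. r j \<in> EA" and r': "\<forall>i<w. r' i \<in> EB"
  shows "\<tau> (\<Otimes>\<^bsub>CA.RR\<^esub>j\<in>{..<w'}. r j) (\<Otimes>\<^bsub>CB.RR\<^esub>i\<in>{..<w}. r' i) \<in> QT.split_disc GT" (is "?t \<in> _")
proof -
  have rZ: "r j \<in> Z" if "j < w'" for j using EA_Z r that by simp
  have r'Z: "r' i \<in> Z'" if "i < w" for i using EB_Z r' that by simp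
  have "\<exists>u. j < w' --> (\<forall>i<w. fst u i \<in> C i ` carrier A) & (\<forall>i<w. snd u i \<in> C i ` carrier A) &
      QA.cc \<otimes>\<^bsub>A\<^esub> r j = (\<Otimes>\<^bsub>CA.RR\<^esub>i\<in>{..<w}. fst u i) \<otimes>\<^bsub>A\<^esub> (\<Otimes>\<^bsub>CA.RR\<^esub>i\<in>{..<w}. snd u i) \<otimes>\<^bsub>A\<^esub> QA.disc b b" for j
  proof (cases "j < w'")
    case True
    then have "r j \<in> EA" using r by simp
    then obtain p q where "\<forall>i<w. p i \<in> C i ` carrier A" "\<forall>i<w. q i \<in> C i ` carrier A"
      "QA.cc \<otimes>\<^bsub>A\<^esub> r j = (\<Otimes>\<^bsub>CA.RR\<^esub>i\<in>{..<w}. p i) \<otimes>\<^bsub>A\<^esub> (\<Otimes>\<^bsub>CA.RR\<^esub>i\<in>{..<w}. q i) \<otimes>\<^bsub>A\<^esub> QA.disc b b"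
      unfolding QA.split_disc_def by (elim CollectE conjE exE)
    then show ?thesis by (intro exI[of _ "(p, q)"]) simp
  qed simp
  then have "\<exists>u. \<forall>j. j < w' --> (\<forall>i<w. fst (u j) i \<in> C i ` carrier A) & (\<forall>i<w. snd (u j) i \<in> C i ` carrier A) &
      QA.cc \<otimes>\<^bsub>A\<^esub> r j = (\<Otimes>\<^bsub>CA.RR\<^esub>i\<in>{..<w}. fst (u j) i) \<otimes>\<^bsub>A\<^esub> (\<Otimes>\<^bsub>CA.RR\<^esub>i\<in>{..<w}. snd (u j) i) \<otimes>\<^bsub>A\<^esub> QA.disc b b"
    by (intro choice allI)
  then obtain u where u: "\<forall>j. j < w' --> (\<forall>i<w. fst (u j) i \<in> C i ` carrier A) & (\<forall>i<w. snd (u j) i \<in> C i ` carrier A) &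
      QA.cc \<otimes>\<^bsub>A\<^esub> r j = (\<Otimes>\<^bsub>CA.RR\<^esub>i\<in>{..<w}. fst (u j) i) \<otimes>\<^bsub>A\<^esub> (\<Otimes>\<^bsub>CA.RR\<^esub>i\<in>{..<w}. snd (u j) i) \<otimes>\<^bsub>A\<^esub> QA.disc b b" ..
  have "\<exists>v. i < w --> (\<forall>j<w'. fst v j \<in> C' j ` carrier B) & (\<forall>j<w'. snd v j \<in> C' j ` carrier B) &
      QB.cc \<otimes>\<^bsub>B\<^esub> r' i = (\<Otimes>\<^bsub>CB.RR\<^esub>j\<in>{..<w'}. fst v j) \<otimes>\<^bsub>B\<^esub> (\<Otimes>\<^bsub>CB.RR\<^esub>j\<in>{..<w'}. snd v j) \<otimes>\<^bsub>B\<^esub> QB.disc b' b'" for i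
  proof (cases "i < w")
    case True
    then have "r' i \<in> EB" using r' by simp
    then obtain p q where "\<forall>i<w'. p i \<in> C' i ` carrier B" "\<forall>i<w'. q i \<in> C' i ` carrier B"
      "QB.cc \<otimes>\<^bsub>B\<^esub> r' i = (\<Otimes>\<^bsub>CB.RR\<^esub>i\<in>{..<w'}. p i) \<otimes>\<^bsub>B\<^esub> (\<Otimes>\<^bsub>CB.RR\<^esub>i\<in>{..<w'}. q i) \<otimes>\<^bsub>B\<^esub> QB.disc b' b'"
      unfolding QB.split_disc_def by (elim CollectE conjE exE)
    then show ?thesis by (intro exI[of _ "(p, q)"]) simp
  qed simp
  then have "\<exists>v. \<forall>i. i < w --> (\<forall>j<w'. fst (v i) j \<in> C' j ` carrier B) & (\<forall>j<w'. snd (v i) j \<in> C' j ` carrier B) &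
      QB.cc \<otimes>\<^bsub>B\<^esub> r' i = (\<Otimes>\<^bsub>CB.RR\<^esub>j\<in>{..<w'}. fst (v i) j) \<otimes>\<^bsub>B\<^esub> (\<Otimes>\<^bsub>CB.RR\<^esub>j\<in>{..<w'}. snd (v i) j) \<otimes>\<^bsub>B\<^esub> QB.disc b' b'"
    by (intro choice allI)
  then obtain v where v: "\<forall>i. i < w --> (\<forall>j<w'. fst (v i) j \<in> C' j ` carrier B) & (\<forall>j<w'. snd (v i) j \<in> C' j ` carrier B) &
      QB.cc \<otimes>\<^bsub>B\<^esub> r' i = (\<Otimes>\<^bsub>CB.RR\<^esub>j\<in>{..<w'}. fst (v i) j) \<otimes>\<^bsub>B\<^esub> (\<Otimes>\<^bsub>CB.RR\<^esub>j\<in>{..<w'}. snd (v i) j) \<otimes>\<^bsub>B\<^esub> QB.disc b' b'" ..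
  let ?P = "%n. \<tau> (fst (u (n mod w')) (n div w')) (fst (v (n div w')) (n mod w'))"
  let ?Q = "%n. \<tau> (snd (u (n mod w')) (n div w')) (snd (v (n div w')) (n mod w'))"
  have eq: "QT.cc \<otimes>\<^bsub>T\<^esub> ?t = (\<Otimes>\<^bsub>CT.RR\<^esub>n\<in>{..<w * w'}. ?P n) \<otimes>\<^bsub>T\<^esub> (\<Otimes>\<^bsub>CT.RR\<^esub>n\<in>{..<w * w'}. ?Q n) \<otimes>\<^bsub>T\<^esub> QT.disc bT bT"
  proof (rule scaled_product[of "%i j. fst (u j) i" "%i j. snd (u j) i" "%i j. fst (v i) j" "%i j. snd (v i) j" r r'])
    fix i j assume ij: "i < w" "j < w'"
    show "fst (u j) i \<in> Z" "snd (u j) i \<in> Z"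
      by (rule C_image(1)[OF ij(1)], use u ij in blast)+
    show "fst (v i) j \<in> Z'" "snd (v i) j \<in> Z'"
      by (rule C_image(2)[OF ij(2)], use v ij in blast)+
  next
    fix j assume j: "j < w'"
    show "r j \<in> Z" by (rule rZ[OF j])
    show "QA.cc \<otimes>\<^bsub>A\<^esub> r j = (\<Otimes>\<^bsub>CA.RR\<^esub>i\<in>{..<w}. fst (u j) i) \<otimes>\<^bsub>A\<^esub> (\<Otimes>\<^bsub>CA.RR\<^esub>i\<in>{..<w}. snd (u j) i) \<otimes>\<^bsub>A\<^esub> QA.disc b b"
      using u j by blast
  next
    fix i assume i: "i < w"
    show "r' i \<in> Z'" by (rule r'Z[OF i])
    show "QB.cc \<otimes>\<^bsub>B\<^esub> r' i = (\<Otimes>\<^bsub>CB.RR\<^esub>j\<in>{..<w'}. fst (v i) j) \<otimes>\<^bsub>B\<^esub> (\<Otimes>\<^bsub>CB.RR\<^esub>j\<in>{..<w'}. snd (v i) j) \<otimes>\<^bsub>B\<^esub> QB.disc b' b'"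
      using v i by blast
  qed
  have PQ: "?P n \<in> GT n & ?Q n \<in> GT n" if n: "n < w * w'" for n
  proof -
    note i = index_bounds[OF n]
    have U: "fst (u (n mod w')) (n div w') \<in> C (n div w') ` carrier A"
      "snd (u (n mod w')) (n div w') \<in> C (n div w') ` carrier A" using u i by simp_all
    have V: "fst (v (n div w')) (n mod w') \<in> C' (n mod w') ` carrier B"
      "snd (v (n div w')) (n mod w') \<in> C' (n mod w') ` carrier B" using v i by simp_all
    show ?thesis by (rule conjI[OF GT_I[OF U(1) V(1)] GT_I[OF U(2) V(2)]])
  qed
  have PG: "\<forall>n<w * w'. ?P n \<in> GT n" and QG: "\<forall>n<w * w'. ?Q n \<in> GT n"
    by (intro allI impI, rule PQ[THEN conjunct1] PQ[THEN conjunct2], assumption)+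
  have tS: "?t \<in> S"
    by (rule \<tau>_S; rule QA.prod_R QB.prod_R) (simp_all add: rZ r'Z)
  show ?thesis unfolding QT.split_disc_def
    by (rule CollectI, rule conjI[OF tS], rule exI[of _ ?P], rule exI[of _ ?Q], rule conjI[OF PG conjI[OF QG eq]])
qed

end

context quasi_trace
begin

lemma MD_ideal_image: "MD_ideal B R = Idl\<^bsub>RR\<^esub> (split_disc (%i. C i ` carrier B))"
proof (rule MD_ideal_split)
  fix i y assume "i < w" "y \<in> carrier B"
  then have "C i y \<in> C i ` carrier B" by (intro imageI)
  then show "C i y \<in> generate (add_monoid RR) (C i ` carrier B)" by (rule generate.incl)
next
  fix i g assume i: "i < w" and "g \<in> C i ` carrier B"
  then obtain y where "y \<in> carrier B" "g = C i y" by auto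
  then show "\<exists>z\<in>carrier B. g \<otimes> b i = c \<otimes> z" using C_split[OF i] by simp
qed auto

text \<open>The alternatives demanded by \<open>div_closure_tensor\<close>: either all generators
  vanish, or m^n clears for any nonzero generator m.\<close>

lemma full_power:
  assumes I: "I \<subseteq> R" and n: "0 < n"
  shows "div_closure (ideal_power I n) \<subseteq> {\<zero>} \<or>
    (\<exists>m\<in>R. m ~= \<zero> & (\<forall>x\<in>carrier B. m \<otimes> x \<in> ideal_power I n))"
proof (cases "I \<subseteq> {\<zero>}")
  case True
  obtain l where l: "n = Suc l" using n by (cases n) auto
  have "ideal_power I n \<subseteq> {\<zero>}"
  proof
    fix y assume "y \<in> ideal_power I n"
    then obtain s z where s: "y = s \<otimes> z" "s \<in> I" "z \<in> ideal_power I l" unfolding l by auto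
    then have "s = \<zero>" "z \<in> carrier B" using True ideal_power_carrier[OF I, of l] by auto
    then show "y \<in> {\<zero>}" using s(1) by simp
  qed
  then show ?thesis using div_closure_zero_set by (intro disjI1)
next
  case False
  then obtain m where m: "m \<in> I" "m ~= \<zero>" by blast
  have "m [^] n \<in> R" "m [^] n ~= \<zero>" using m I R_pow[of m n] R_pow_nonzero[of m n] by auto
  then show ?thesis using ideal_power_full[OF I m(1)] by (intro disjI2 bexI[of _ "m [^] n"] conjI ballI)
qed

end

lemma (in quasi_coordinates) quasi_trace_exists:
  assumes "trace_in_base B R" shows "\<exists>tr. quasi_trace B R w b c C tr"
proof -
  have "\<forall>x\<in>carrier B. \<exists>t. t \<in> R & c \<otimes> t = (\<Oplus>\<^bsub>RR\<^esub>i\<in>{..<w}. C i (x \<otimes> b i))"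
    using assms unfolding trace_in_base_iff by (simp only: Bex_def)
  then have "\<exists>tr. \<forall>x\<in>carrier B. tr x \<in> R & c \<otimes> tr x = (\<Oplus>\<^bsub>RR\<^esub>i\<in>{..<w}. C i (x \<otimes> b i))" by (rule bchoice)
  then obtain tr where "\<forall>x\<in>carrier B. tr x \<in> R & c \<otimes> tr x = (\<Oplus>\<^bsub>RR\<^esub>i\<in>{..<w}. C i (x \<otimes> b i))" ..
  then have "quasi_trace B R w b c C tr"
    by (intro quasi_trace.intro quasi_coordinates_axioms quasi_trace_axioms.intro) simp_all
  then show ?thesis by (rule exI[of _ tr])
qed

text \<open>Combines two reductions, from the double dual to the closure and from the ideal to its
  generators.\<close>

lemma (in central_domain) hull_MD_ideal:
  assumes Q: "Q \<subseteq> R" and MD: "MD_ideal B R = Idl\<^bsub>RR\<^esub> Q"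
  shows "reflexive_hull B R (ideal_prod B (MD_ideal B R) (carrier B)) =
    div_closure {r \<otimes> a | r a. r \<in> Q & a \<in> carrier B}"
proof -
  have I: "ideal (Idl\<^bsub>RR\<^esub> Q) RR" by (rule R.genideal_ideal) (simp add: Q)
  show ?thesis unfolding MD reflexive_hull_ideal_prod[OF I] by (rule div_closure_ideal_prod[OF Q])
qed

section \<open>Subrings, centers, normal elements and module-finiteness under tensor
  products\<close>

context tensor_space
begin

lemma \<tau>_minus_right:
  assumes "x \<in> carrier A" "y \<in> carrier B" shows "\<tau> x (\<ominus>\<^bsub>B\<^esub> y) = \<ominus>\<^bsub>T\<^esub> (\<tau> x y)"
proof (rule T.minus_equality[symmetric])
  show "\<tau> x (\<ominus>\<^bsub>B\<^esub> y) \<oplus>\<^bsub>T\<^esub> \<tau> x y = \<zero>\<^bsub>T\<^esub>" using assms \<tau>_r_distr[of x "\<ominus>\<^bsub>B\<^esub> y" y] by (simp add: B.l_neg)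
qed (use assms in auto)

lemma tspan_subring:
  assumes U: "subring U A" and V: "subring V B" shows "subring (tspan U V) T"
proof -
  note Uc = subringE(1)[OF U] and Vc = subringE(1)[OF V]
  note gens = tspan_gens[OF Uc Vc]
  show ?thesis
  proof (rule T.subringI)
    show "tspan U V \<subseteq> carrier T" using tspan_closed[OF Uc Vc] by blast
    show "\<one>\<^bsub>T\<^esub> \<in> tspan U V"
      unfolding \<tau>_one[symmetric] by (rule tspan_tens) (use subringE(3)[OF U] subringE(3)[OF V] in auto)
    show "\<ominus>\<^bsub>T\<^esub> t \<in> tspan U V" if "t \<in> tspan U V" for t
      using that unfolding tspan_def by (rule T.aspan_minus[OF gens])
    show "s \<otimes>\<^bsub>T\<^esub> t \<in> tspan U V" if "s \<in> tspan U V" "t \<in> tspan U V" for s t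
      unfolding tspan_def
    proof (rule T.aspan_mult[OF gens gens that[unfolded tspan_def] gens])
      fix a a' assume "a \<in> {\<tau> x y | x y. x \<in> U & y \<in> V}" "a' \<in> {\<tau> x y | x y. x \<in> U & y \<in> V}"
      then obtain x y x' y' where xy: "a = \<tau> x y" "x \<in> U" "y \<in> V" "a' = \<tau> x' y'" "x' \<in> U" "y' \<in> V"
        by (elim CollectE exE conjE)
      then have "a \<otimes>\<^bsub>T\<^esub> a' = \<tau> (x \<otimes>\<^bsub>A\<^esub> x') (y \<otimes>\<^bsub>B\<^esub> y')" using Uc Vc by (auto simp: \<tau>_mult subset_iff)
      moreover have "\<dots> \<in> tspan U V"
        by (rule tspan_tens) (use xy subringE(6)[OF U] subringE(6)[OF V] in auto)
      ultimately show "a \<otimes>\<^bsub>T\<^esub> a' \<in> generate (add_monoid T) {\<tau> x y | x y. x \<in> U & y \<in> V}"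
        by (simp add: tspan_def)
    qed
    show "s \<oplus>\<^bsub>T\<^esub> t \<in> tspan U V" if "s \<in> tspan U V" "t \<in> tspan U V" for s t
      using that by (rule tspan_add)
  qed
qed

lemma tspan_center:
  assumes U: "U \<subseteq> center A" and V: "V \<subseteq> center B" shows "tspan U V \<subseteq> center T"
proof
  fix s assume s: "s \<in> tspan U V"
  have Uc: "U \<subseteq> carrier A" and Vc: "V \<subseteq> carrier B" using U V by (auto simp: center_def)
  have comm: "x \<otimes>\<^bsub>A\<^esub> a = a \<otimes>\<^bsub>A\<^esub> x" if "x \<in> U" "a \<in> carrier A" for x a using U that by (auto simp: center_def)
  have comm': "y \<otimes>\<^bsub>B\<^esub> a = a \<otimes>\<^bsub>B\<^esub> y" if "y \<in> V" "a \<in> carrier B" for y a using V that by (auto simp: center_def)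
  have "s \<otimes>\<^bsub>T\<^esub> t = t \<otimes>\<^bsub>T\<^esub> s" if t: "t \<in> carrier T" for t
    using tspan_gens[OF Uc Vc] s[unfolded tspan_def]
  proof (induction rule: T.aspan_induct)
    case (incl s)
    then obtain x y where xy: "s = \<tau> x y" "x \<in> U" "y \<in> V" by (elim CollectE exE conjE)
    have c: "x \<in> carrier A" "y \<in> carrier B" using xy Uc Vc by auto
    show ?case using t unfolding xy(1)
    proof (induction rule: T_induct)
      case (tens a a')
      then show ?case using c comm[OF xy(2) tens(1)] comm'[OF xy(3) tens(2)] by (simp add: \<tau>_mult)
    qed (use c in \<open>simp_all add: T.l_distr T.r_distr\<close>)
  next
    case (minus s)
    then obtain x y where "s = \<tau> x y" "x \<in> U" "y \<in> V" by (elim CollectE exE conjE)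
    then have "s \<in> carrier T" using \<tau>_closed[OF subsetD[OF Uc] subsetD[OF Vc]] by blast
    then show ?case using minus t by (simp add: T.l_minus T.r_minus)
  next
    case (add s s')
    then show ?case using t tspan_closed[OF Uc Vc, unfolded tspan_def] by (simp add: T.l_distr T.r_distr)
  qed (use t in simp)
  then show "s \<in> center T" using tspan_closed[OF Uc Vc s] by (simp add: center_def)
qed

end

context central_tensor
begin

lemma tspan_smult:
  assumes d: "d \<in> carrier A" and d': "d' \<in> carrier B"
  shows "tspan {d \<otimes>\<^bsub>A\<^esub> x | x. x \<in> carrier A} {d' \<otimes>\<^bsub>B\<^esub> y | y. y \<in> carrier B} = {\<tau> d d' \<otimes>\<^bsub>T\<^esub> t | t. t \<in> carrier T}"
    (is "tspan ?U ?V = ?W")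
proof (intro equalityI subsetI)
  have gens: "?U \<subseteq> carrier A" "?V \<subseteq> carrier B" using d d' by auto
  fix t assume "t \<in> tspan ?U ?V"
  with tspan_gens[OF gens] have "\<exists>u\<in>carrier T. t = \<tau> d d' \<otimes>\<^bsub>T\<^esub> u"
    unfolding tspan_def
  proof (induction rule: T.aspan_induct)
    case (incl t)
    then obtain x y where "t = \<tau> (d \<otimes>\<^bsub>A\<^esub> x) (d' \<otimes>\<^bsub>B\<^esub> y)" "x \<in> carrier A" "y \<in> carrier B" by blast
    then have "t = \<tau> d d' \<otimes>\<^bsub>T\<^esub> \<tau> x y" "\<tau> x y \<in> carrier T" using d d' by (simp_all add: \<tau>_mult)
    then show ?case by (rule rev_bexI[rotated])
  next
    case zero
    have "\<zero>\<^bsub>T\<^esub> = \<tau> d d' \<otimes>\<^bsub>T\<^esub> \<zero>\<^bsub>T\<^esub>" using d d' by simp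
    then show ?case using T.zero_closed by (rule rev_bexI[rotated])
  next
    case (minus t)
    then obtain u where "u \<in> carrier T" "t = \<tau> d d' \<otimes>\<^bsub>T\<^esub> u" by (elim bexE)
    then have "\<ominus>\<^bsub>T\<^esub> t = \<tau> d d' \<otimes>\<^bsub>T\<^esub> (\<ominus>\<^bsub>T\<^esub> u)" "\<ominus>\<^bsub>T\<^esub> u \<in> carrier T" using d d' by (simp_all add: T.r_minus)
    then show ?case by (rule rev_bexI[rotated])
  next
    case (add s t)
    then obtain u v where "u \<in> carrier T" "s = \<tau> d d' \<otimes>\<^bsub>T\<^esub> u" "v \<in> carrier T" "t = \<tau> d d' \<otimes>\<^bsub>T\<^esub> v" by (elim bexE)
    then have "s \<oplus>\<^bsub>T\<^esub> t = \<tau> d d' \<otimes>\<^bsub>T\<^esub> (u \<oplus>\<^bsub>T\<^esub> v)" "u \<oplus>\<^bsub>T\<^esub> v \<in> carrier T" using d d' by (simp_all add: T.r_distr)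
    then show ?case by (rule rev_bexI[rotated])
  qed
  then show "t \<in> ?W" by blast
next
  fix t assume "t \<in> ?W"
  then obtain u where t: "t = \<tau> d d' \<otimes>\<^bsub>T\<^esub> u" and u: "u \<in> carrier T" by blast
  show "t \<in> tspan ?U ?V" using u unfolding t
  proof (induction rule: T_induct)
    case zero
    then show ?case using d d' tspan_zero by simp
  next
    case (tens x y)
    have "\<tau> (d \<otimes>\<^bsub>A\<^esub> x) (d' \<otimes>\<^bsub>B\<^esub> y) \<in> tspan ?U ?V" by (rule tspan_tens) (use tens in blast)+
    then show ?case using tens d d' by (simp add: \<tau>_mult)
  next
    case (add s t)
    then show ?case using d d' tspan_add by (simp add: T.r_distr)
  qed
qed

lemma normal_tensor:
  assumes d: "normal_element A d" and d': "normal_element B d'"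
  shows "normal_element T (\<tau> d d')"
  unfolding T.normal_element_iff
proof (intro conjI ballI)
  have dc: "d \<in> carrier A" "d' \<in> carrier B" using d d' by (simp_all add: normal_element_def)
  show "\<tau> d d' \<in> carrier T" using dc by simp
  fix t assume t: "t \<in> carrier T"
  show "\<exists>u\<in>carrier T. \<tau> d d' \<otimes>\<^bsub>T\<^esub> t = u \<otimes>\<^bsub>T\<^esub> \<tau> d d'" using t
  proof (induction rule: T_induct)
    case zero
    have "\<tau> d d' \<otimes>\<^bsub>T\<^esub> \<zero>\<^bsub>T\<^esub> = \<zero>\<^bsub>T\<^esub> \<otimes>\<^bsub>T\<^esub> \<tau> d d'" using dc by simp
    then show ?case using T.zero_closed by (rule rev_bexI[rotated])
  next
    case (tens x y)
    obtain u where u: "u \<in> carrier A" "d \<otimes>\<^bsub>A\<^esub> x = u \<otimes>\<^bsub>A\<^esub> d" using d tens unfolding A.normal_element_iff by blast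
    obtain v where v: "v \<in> carrier B" "d' \<otimes>\<^bsub>B\<^esub> y = v \<otimes>\<^bsub>B\<^esub> d'" using d' tens unfolding B.normal_element_iff by blast
    have "\<tau> d d' \<otimes>\<^bsub>T\<^esub> \<tau> x y = \<tau> u v \<otimes>\<^bsub>T\<^esub> \<tau> d d'" "\<tau> u v \<in> carrier T" using tens u v dc by (simp_all add: \<tau>_mult)
    then show ?case by (rule rev_bexI[rotated])
  next
    case (add s t)
    then obtain u v where "u \<in> carrier T" "\<tau> d d' \<otimes>\<^bsub>T\<^esub> s = u \<otimes>\<^bsub>T\<^esub> \<tau> d d'"
      "v \<in> carrier T" "\<tau> d d' \<otimes>\<^bsub>T\<^esub> t = v \<otimes>\<^bsub>T\<^esub> \<tau> d d'" by (elim bexE)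
    then have "\<tau> d d' \<otimes>\<^bsub>T\<^esub> (s \<oplus>\<^bsub>T\<^esub> t) = (u \<oplus>\<^bsub>T\<^esub> v) \<otimes>\<^bsub>T\<^esub> \<tau> d d'" "u \<oplus>\<^bsub>T\<^esub> v \<in> carrier T"
      using add dc by (simp_all add: T.l_distr T.r_distr)
    then show ?case by (rule rev_bexI[rotated])
  qed
  show "\<exists>u\<in>carrier T. t \<otimes>\<^bsub>T\<^esub> \<tau> d d' = \<tau> d d' \<otimes>\<^bsub>T\<^esub> u" using t
  proof (induction rule: T_induct)
    case zero
    have "\<zero>\<^bsub>T\<^esub> \<otimes>\<^bsub>T\<^esub> \<tau> d d' = \<tau> d d' \<otimes>\<^bsub>T\<^esub> \<zero>\<^bsub>T\<^esub>" using dc by simp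
    then show ?case using T.zero_closed by (rule rev_bexI[rotated])
  next
    case (tens x y)
    obtain u where u: "u \<in> carrier A" "x \<otimes>\<^bsub>A\<^esub> d = d \<otimes>\<^bsub>A\<^esub> u" using d tens unfolding A.normal_element_iff by blast
    obtain v where v: "v \<in> carrier B" "y \<otimes>\<^bsub>B\<^esub> d' = d' \<otimes>\<^bsub>B\<^esub> v" using d' tens unfolding B.normal_element_iff by blast
    have "\<tau> x y \<otimes>\<^bsub>T\<^esub> \<tau> d d' = \<tau> d d' \<otimes>\<^bsub>T\<^esub> \<tau> u v" "\<tau> u v \<in> carrier T" using tens u v dc by (simp_all add: \<tau>_mult)
    then show ?case by (rule rev_bexI[rotated])
  next
    case (add s t)
    then obtain u v where "u \<in> carrier T" "s \<otimes>\<^bsub>T\<^esub> \<tau> d d' = \<tau> d d' \<otimes>\<^bsub>T\<^esub> u"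
      "v \<in> carrier T" "t \<otimes>\<^bsub>T\<^esub> \<tau> d d' = \<tau> d d' \<otimes>\<^bsub>T\<^esub> v" by (elim bexE)
    then have "(s \<oplus>\<^bsub>T\<^esub> t) \<otimes>\<^bsub>T\<^esub> \<tau> d d' = \<tau> d d' \<otimes>\<^bsub>T\<^esub> (u \<oplus>\<^bsub>T\<^esub> v)" "u \<oplus>\<^bsub>T\<^esub> v \<in> carrier T"
      using add dc by (simp_all add: T.l_distr T.r_distr)
    then show ?case by (rule rev_bexI[rotated])
  qed
qed

lemma module_finite_tensor:
  assumes "module_finite A Z" "module_finite B Z'" shows "module_finite T S"
proof -
  obtain V V' where V: "finite V" "V \<subseteq> carrier A" "linear_span A Z V = carrier A"
    and V': "finite V'" "V' \<subseteq> carrier B" "linear_span B Z' V' = carrier B"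
    using assms unfolding module_finite_def by (elim exE conjE)
  let ?W = "(%(x, y). \<tau> x y) ` (V \<times> V')"
  let ?L = "{r \<otimes>\<^bsub>T\<^esub> x | r x. r \<in> S & x \<in> ?W}"
  let ?LA = "{r \<otimes>\<^bsub>A\<^esub> x | r x. r \<in> Z & x \<in> V}" and ?LB = "{r \<otimes>\<^bsub>B\<^esub> x | r x. r \<in> Z' & x \<in> V'}"
  have W: "?W \<subseteq> carrier T" using \<tau>_closed[OF subsetD[OF V(2)] subsetD[OF V'(2)]] by auto
  have L: "?L \<subseteq> carrier T" using W by auto
  have LA: "?LA \<subseteq> carrier A" and LB: "?LB \<subseteq> carrier B" using V(2) V'(2) by auto
  have gen: "\<tau> (r \<otimes>\<^bsub>A\<^esub> v) y \<in> generate (add_monoid T) ?L" if r: "r \<in> Z" "v \<in> V" and y: "y \<in> carrier B" for r v y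
  proof -
    have c: "r \<otimes>\<^bsub>A\<^esub> v \<in> carrier A" "v \<in> carrier A" using r V(2) by auto
    have "y \<in> generate (add_monoid B) ?LB" using y V'(3) by (simp add: linear_span_def)
    with LB show ?thesis
    proof (induction rule: B.aspan_induct)
      case (incl y)
      then obtain r' v' where r': "y = r' \<otimes>\<^bsub>B\<^esub> v'" "r' \<in> Z'" "v' \<in> V'" by blast
      have "\<tau> (r \<otimes>\<^bsub>A\<^esub> v) y = \<tau> r r' \<otimes>\<^bsub>T\<^esub> \<tau> v v'" using r r' c V'(2) by (auto simp: \<tau>_mult subset_iff)
      moreover have "\<tau> r r' \<in> S" using \<tau>_S r r' by simp
      moreover have "\<tau> v v' \<in> ?W" using r r' by blast
      ultimately have "\<tau> (r \<otimes>\<^bsub>A\<^esub> v) y \<in> ?L" by blast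
      then show ?case by (rule T.aspan_incl)
    next
      case zero
      then show ?case using c T.aspan_zero by simp
    next
      case (minus y)
      then have "y \<in> carrier B" using LB by blast
      then show ?case using minus c T.aspan_minus[OF L] by (simp add: \<tau>_minus_right)
    next
      case (add y y')
      then show ?case using c B.aspan_closed[OF LB] T.aspan_add by (simp add: \<tau>_r_distr)
    qed
  qed
  have tens: "\<tau> x y \<in> generate (add_monoid T) ?L" if x: "x \<in> carrier A" and y: "y \<in> carrier B" for x y
  proof -
    have "x \<in> generate (add_monoid A) ?LA" using x V(3) by (simp add: linear_span_def)
    with LA show ?thesis
    proof (induction rule: A.aspan_induct)
      case (incl x)
      then show ?case using gen[OF _ _ y] by blast
    next
      case zero
      then show ?case using y T.aspan_zero by simp
    next
      case (minus x)
      then have "x \<in> carrier A" using LA by blast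
      then show ?case using minus y T.aspan_minus[OF L] by (simp add: \<tau>_minus[symmetric])
    next
      case (add x x')
      then show ?case using y A.aspan_closed[OF LA] T.aspan_add by (simp add: \<tau>_l_distr)
    qed
  qed
  have "t \<in> generate (add_monoid T) ?L" if "t \<in> carrier T" for t
    using that by (induction rule: T_induct) (auto intro: T.aspan_zero T.aspan_add tens)
  then have "linear_span T S ?W = carrier T"
    unfolding linear_span_def using T.aspan_closed[OF L] by (intro equalityI subsetI)
  moreover have "finite ?W" using V(1) V'(1) by simp
  ultimately show ?thesis unfolding module_finite_def using W by (intro exI[of _ ?W] conjI)
qed

end

section \<open>Ideal, hull, reflexivity and trace of the tensor product\<close>

context tensor_discriminant
begin

lemma MD_ideal_tensor: "MD_ideal T S = Idl\<^bsub>CT.RR\<^esub> (QT.split_disc GT)"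
proof (rule QT.MD_ideal_split)
  fix n assume n: "n < w * w'"
  note i = index_bounds[OF n]
  show "GT n \<subseteq> S"
  proof
    fix g assume "g \<in> GT n"
    then obtain p p' where "g = \<tau> p p'" "p \<in> C (n div w') ` carrier A" "p' \<in> C' (n mod w') ` carrier B"
      by (elim CollectE exE conjE)
    then show "g \<in> S" using \<tau>_S C_image(1)[OF i(1)] C_image(2)[OF i(2)] by simp
  qed
  show "D n t \<in> generate (add_monoid CT.RR) (GT n)" if "t \<in> carrier T" for t
    using that
  proof (induction rule: T_induct)
    case zero
    then show ?case using CT.functionalD(4)[OF QT.C_functional[OF n]] CT.R.aspan_zero by simp
  next
    case (tens x y)
    have "D n (\<tau> x y) \<in> GT n" unfolding D_tens[OF n tens] using tens by blast
    then show ?case by (rule CT.R.aspan_incl)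
  next
    case (add s t)
    have "D n (s \<oplus>\<^bsub>T\<^esub> t) = D n s \<oplus>\<^bsub>CT.RR\<^esub> D n t" using add QT.C_add[OF n] by simp
    then show ?case using CT.R.aspan_add[OF add(3,4)] by simp
  qed
  fix g assume "g \<in> GT n"
  then obtain p p' where g: "g = \<tau> p p'" "p \<in> C (n div w') ` carrier A" "p' \<in> C' (n mod w') ` carrier B"
    by (elim CollectE exE conjE)
  then obtain x y where xy: "x \<in> carrier A" "p = C (n div w') x" "y \<in> carrier B" "p' = C' (n mod w') y"
    by (elim imageE)
  obtain z z' where z: "z \<in> carrier A" "C (n div w') x \<otimes>\<^bsub>A\<^esub> b (n div w') = c \<otimes>\<^bsub>A\<^esub> z"
    "z' \<in> carrier B" "C' (n mod w') y \<otimes>\<^bsub>B\<^esub> b' (n mod w') = c' \<otimes>\<^bsub>B\<^esub> z'"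
    using QA.C_split[OF i(1) xy(1)] QB.C_split[OF i(2) xy(3)] by (elim bexE)
  have "g \<otimes>\<^bsub>T\<^esub> bT n = \<tau> c c' \<otimes>\<^bsub>T\<^esub> \<tau> z z'" using g xy z i by (simp add: \<tau>_mult)
  moreover have "\<tau> z z' \<in> carrier T" using z by simp
  ultimately show "\<exists>z\<in>carrier T. g \<otimes>\<^bsub>T\<^esub> bT n = \<tau> c c' \<otimes>\<^bsub>T\<^esub> z" by (rule rev_bexI[rotated])
qed

lemma EA_subset: "EA \<subseteq> Z" and EB_subset: "EB \<subseteq> Z'"
  using EA_Z EB_Z by blast+

text \<open>The link is (r \<otimes> r')(x \<otimes> x') = r x \<otimes> r' x'. The left set
  contains multiples by arbitrary tensors and the right one only pure tensors, so the comparison is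
  between closures, which absorb sums.\<close>

lemma div_closure_split_tensor:
  "CT.div_closure {s \<otimes>\<^bsub>T\<^esub> t | s t. s \<in> QT.split_disc GT & t \<in> carrier T} =
    CT.div_closure {\<tau> p p' | p p'. p \<in> CA.ideal_power EA w' & p' \<in> CB.ideal_power EB w}"
    (is "CT.div_closure ?L = CT.div_closure ?M")
proof (rule CT.div_closure_eqI)
  have ip: "CA.ideal_power EA w' \<subseteq> carrier A" "CB.ideal_power EB w \<subseteq> carrier B"
    by (rule CA.ideal_power_carrier[OF EA_subset] CB.ideal_power_carrier[OF EB_subset])+
  have ES: "s \<in> carrier T" if "s \<in> QT.split_disc GT" for s
    using that by (simp add: QT.split_disc_def)
  have L: "?L \<subseteq> carrier T" using ES by auto
  have M: "?M \<subseteq> carrier T" using \<tau>_closed[OF subsetD[OF ip(1)] subsetD[OF ip(2)]] by blast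
  have pZ: "(\<Otimes>\<^bsub>CA.RR\<^esub>j\<in>{..<w'}. r j) \<in> carrier A" if "\<forall>j<w'. r j \<in> EA" for r
  proof -
    have "(\<Otimes>\<^bsub>CA.RR\<^esub>j\<in>{..<w'}. r j) \<in> Z" by (rule QA.prod_R) (use that EA_Z in auto)
    then show ?thesis by simp
  qed
  have pZ': "(\<Otimes>\<^bsub>CB.RR\<^esub>j\<in>{..<w}. r j) \<in> carrier B" if "\<forall>j<w. r j \<in> EB" for r
  proof -
    have "(\<Otimes>\<^bsub>CB.RR\<^esub>j\<in>{..<w}. r j) \<in> Z'" by (rule QB.prod_R) (use that EB_Z in auto)
    then show ?thesis by simp
  qed
  show "?L \<subseteq> CT.div_closure ?M"
  proof
    fix y assume "y \<in> ?L"
    then obtain s t where y: "y = s \<otimes>\<^bsub>T\<^esub> t" and s: "s \<in> QT.split_disc GT" and t: "t \<in> carrier T" by blast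
    obtain r r' where r: "\<forall>j<w'. r j \<in> EA" "\<forall>i<w. r' i \<in> EB"
      and sr: "s = \<tau> (\<Otimes>\<^bsub>CA.RR\<^esub>j\<in>{..<w'}. r j) (\<Otimes>\<^bsub>CB.RR\<^esub>i\<in>{..<w}. r' i)"
      using split_disc_tensor[OF s] by (elim exE conjE)
    have sc: "s \<in> carrier T" using ES s by simp
    show "y \<in> CT.div_closure ?M" using t unfolding y
    proof (induction rule: T_induct)
      case zero
      then show ?case using sc CT.div_closure_zero by simp
    next
      case (tens x x')
      let ?p = "(\<Otimes>\<^bsub>CA.RR\<^esub>j\<in>{..<w'}. r j) \<otimes>\<^bsub>A\<^esub> x" and ?p' = "(\<Otimes>\<^bsub>CB.RR\<^esub>i\<in>{..<w}. r' i) \<otimes>\<^bsub>B\<^esub> x'"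
      have "?p \<in> CA.ideal_power EA w'" unfolding CA.ideal_power_iff[OF EA_subset]
        using r tens by (intro exI[of _ r, OF exI[of _ x]]) simp
      moreover have "?p' \<in> CB.ideal_power EB w" unfolding CB.ideal_power_iff[OF EB_subset]
        using r tens by (intro exI[of _ r', OF exI[of _ x']]) simp
      moreover have "s \<otimes>\<^bsub>T\<^esub> \<tau> x x' = \<tau> ?p ?p'"
        unfolding sr using tens pZ[OF r(1)] pZ'[OF r(2)] by (simp add: \<tau>_mult)
      ultimately have "s \<otimes>\<^bsub>T\<^esub> \<tau> x x' \<in> ?M" by blast
      then show ?case using CT.div_closure_incl[OF M] by blast
    next
      case (add t u)
      then show ?case using sc CT.div_closure_add by (simp add: T.r_distr)
    qed
  qed
  show "?M \<subseteq> CT.div_closure ?L"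
  proof
    fix y assume "y \<in> ?M"
    then obtain p p' where y: "y = \<tau> p p'" and p: "p \<in> CA.ideal_power EA w'" "p' \<in> CB.ideal_power EB w" by blast
    obtain r x where r: "\<forall>j<w'. r j \<in> EA" "x \<in> carrier A" "p = (\<Otimes>\<^bsub>CA.RR\<^esub>j\<in>{..<w'}. r j) \<otimes>\<^bsub>A\<^esub> x"
      using p(1) unfolding CA.ideal_power_iff[OF EA_subset] by (elim exE conjE)
    obtain r' x' where r': "\<forall>i<w. r' i \<in> EB" "x' \<in> carrier B" "p' = (\<Otimes>\<^bsub>CB.RR\<^esub>i\<in>{..<w}. r' i) \<otimes>\<^bsub>B\<^esub> x'"
      using p(2) unfolding CB.ideal_power_iff[OF EB_subset] by (elim exE conjE)
    have "y = \<tau> (\<Otimes>\<^bsub>CA.RR\<^esub>j\<in>{..<w'}. r j) (\<Otimes>\<^bsub>CB.RR\<^esub>i\<in>{..<w}. r' i) \<otimes>\<^bsub>T\<^esub> \<tau> x x'"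
      unfolding y using r r' pZ[OF r(1)] pZ'[OF r'(1)] by (simp add: \<tau>_mult)
    moreover have "\<tau> x x' \<in> carrier T" using r r' by simp
    ultimately have "y \<in> ?L" using split_disc_tensorI[OF r(1) r'(1)] by blast
    then show "y \<in> CT.div_closure ?L" using CT.div_closure_incl[OF L] by blast
  qed
qed

text \<open>The closure of tensors from the ideal powers splits into the closures of the factors,
  which are d^w' A and d'^w B; their tensor span consists of the multiples of d^w' \<otimes>
  d'^w.\<close>

lemma hull_tensor:
  assumes d: "normal_element A d" and d': "normal_element B d'"
    and hull: "reflexive_hull A Z (ideal_prod A (MD_ideal A Z) (carrier A)) = {d \<otimes>\<^bsub>A\<^esub> x | x. x \<in> carrier A}"
    and hull': "reflexive_hull B Z' (ideal_prod B (MD_ideal B Z') (carrier B)) = {d' \<otimes>\<^bsub>B\<^esub> y | y. y \<in> carrier B}"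
  shows "reflexive_hull T S (ideal_prod T (MD_ideal T S) (carrier T)) =
    {\<tau> (d [^]\<^bsub>A\<^esub> w') (d' [^]\<^bsub>B\<^esub> w) \<otimes>\<^bsub>T\<^esub> t | t. t \<in> carrier T}"
proof -
  have ES: "QT.split_disc GT \<subseteq> S" by (auto simp: QT.split_disc_def)
  have base: "CA.div_closure {r \<otimes>\<^bsub>A\<^esub> a | r a. r \<in> EA & a \<in> carrier A} = {d \<otimes>\<^bsub>A\<^esub> x | x. x \<in> carrier A}"
    using CA.hull_MD_ideal[OF EA_subset QA.MD_ideal_image] hull by simp
  have base': "CB.div_closure {r \<otimes>\<^bsub>B\<^esub> a | r a. r \<in> EB & a \<in> carrier B} = {d' \<otimes>\<^bsub>B\<^esub> y | y. y \<in> carrier B}"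
    using CB.hull_MD_ideal[OF EB_subset QB.MD_ideal_image] hull' by simp
  have dc: "d [^]\<^bsub>A\<^esub> w' \<in> carrier A" "d' [^]\<^bsub>B\<^esub> w \<in> carrier B" using d d' by (simp_all add: normal_element_def)
  have "reflexive_hull T S (ideal_prod T (MD_ideal T S) (carrier T)) =
      CT.div_closure {s \<otimes>\<^bsub>T\<^esub> t | s t. s \<in> QT.split_disc GT & t \<in> carrier T}"
    by (rule CT.hull_MD_ideal[OF ES MD_ideal_tensor])
  also have "\<dots> = CT.div_closure {\<tau> p p' | p p'. p \<in> CA.ideal_power EA w' & p' \<in> CB.ideal_power EB w}"
    by (rule div_closure_split_tensor)
  also have "\<dots> = tspan (CA.div_closure (CA.ideal_power EA w')) (CB.div_closure (CB.ideal_power EB w))"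
    by (rule div_closure_tensor[OF CA.ideal_power_carrier[OF EA_subset] CB.ideal_power_carrier[OF EB_subset]
          QA.torsionless QB.torsionless QA.full_power[OF EA_subset QB.w_pos] QB.full_power[OF EB_subset QA.w_pos]])
  also have "CA.div_closure (CA.ideal_power EA w') = {d [^]\<^bsub>A\<^esub> w' \<otimes>\<^bsub>A\<^esub> x | x. x \<in> carrier A}"
    by (rule CA.div_closure_ideal_power[OF d EA_subset QA.torsionless base])
  also have "CB.div_closure (CB.ideal_power EB w) = {d' [^]\<^bsub>B\<^esub> w \<otimes>\<^bsub>B\<^esub> x | x. x \<in> carrier B}"
    by (rule CB.div_closure_ideal_power[OF d' EB_subset QB.torsionless base'])
  also have "tspan {d [^]\<^bsub>A\<^esub> w' \<otimes>\<^bsub>A\<^esub> x | x. x \<in> carrier A} {d' [^]\<^bsub>B\<^esub> w \<otimes>\<^bsub>B\<^esub> x | x. x \<in> carrier B} =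
      {\<tau> (d [^]\<^bsub>A\<^esub> w') (d' [^]\<^bsub>B\<^esub> w) \<otimes>\<^bsub>T\<^esub> t | t. t \<in> carrier T}"
    by (rule tspan_smult[OF dc])
  finally show ?thesis .
qed

text \<open>Reflexivity is closedness of the multiples of the denominator. Closedness of c A and c'
  B passes to their tensor span by \<open>div_closure_tensor\<close>, and that span is (c \<otimes>
  c') T.\<close>

lemma reflexive_tensor:
  assumes refl: "reflexive_module CA.RR CA.BM" and refl': "reflexive_module CB.RR CB.BM"
  shows "reflexive_module CT.RR CT.BM"
proof (rule QT.reflexive_if_closed)
  let ?P = "{c \<otimes>\<^bsub>A\<^esub> x | x. x \<in> carrier A}" and ?P' = "{c' \<otimes>\<^bsub>B\<^esub> y | y. y \<in> carrier B}"
  let ?M = "{\<tau> p p' | p p'. p \<in> ?P & p' \<in> ?P'}"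
  have P: "?P \<subseteq> carrier A" "?P' \<subseteq> carrier B" by auto
  have M: "?M \<subseteq> carrier T" using P by auto
  have sub: "{\<tau> c c' \<otimes>\<^bsub>T\<^esub> t | t. t \<in> carrier T} \<subseteq> CT.div_closure ?M"
  proof
    fix y assume "y \<in> {\<tau> c c' \<otimes>\<^bsub>T\<^esub> t | t. t \<in> carrier T}"
    then obtain t where y: "y = \<tau> c c' \<otimes>\<^bsub>T\<^esub> t" and t: "t \<in> carrier T" by blast
    show "y \<in> CT.div_closure ?M" using t unfolding y
    proof (induction rule: T_induct)
      case zero
      then show ?case using CT.div_closure_zero by simp
    next
      case (tens x x')
      then have "\<tau> c c' \<otimes>\<^bsub>T\<^esub> \<tau> x x' = \<tau> (c \<otimes>\<^bsub>A\<^esub> x) (c' \<otimes>\<^bsub>B\<^esub> x')" by (simp add: \<tau>_mult)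
      then have "\<tau> c c' \<otimes>\<^bsub>T\<^esub> \<tau> x x' \<in> ?M" using tens by blast
      then show ?case using CT.div_closure_incl[OF M] by blast
    next
      case (add t u)
      then show ?case using CT.div_closure_add by (simp add: T.r_distr)
    qed
  qed
  have full: "\<exists>m\<in>Z. m ~= \<zero>\<^bsub>A\<^esub> & (\<forall>x\<in>carrier A. m \<otimes>\<^bsub>A\<^esub> x \<in> ?P)"
    using QA.c_R QA.c_nonzero by (intro bexI[of _ c]) blast+
  have full': "\<exists>m\<in>Z'. m ~= \<zero>\<^bsub>B\<^esub> & (\<forall>x\<in>carrier B. m \<otimes>\<^bsub>B\<^esub> x \<in> ?P')"
    using QB.c_R QB.c_nonzero by (intro bexI[of _ c']) blast+
  have "CT.div_closure ?M = tspan (CA.div_closure ?P) (CB.div_closure ?P')"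
    by (rule div_closure_tensor[OF P QA.torsionless QB.torsionless disjI2[OF full] disjI2[OF full']])
  also have "\<dots> \<subseteq> tspan ?P ?P'"
  proof (rule tspan_mono)
    show "CA.div_closure ?P \<subseteq> ?P" using QA.reflexive_imp_closed[OF refl] by blast
    show "CB.div_closure ?P' \<subseteq> ?P'" using QB.reflexive_imp_closed[OF refl'] by blast
  qed
  also have "\<dots> = {\<tau> c c' \<otimes>\<^bsub>T\<^esub> t | t. t \<in> carrier T}" by (rule tspan_smult) auto
  finally have closed: "CT.div_closure ?M \<subseteq> {\<tau> c c' \<otimes>\<^bsub>T\<^esub> t | t. t \<in> carrier T}" .
  fix y assume "y \<in> CT.div_closure {\<tau> c c' \<otimes>\<^bsub>T\<^esub> t | t. t \<in> carrier T}"
  then have "y \<in> CT.div_closure ?M" using CT.div_closure_least[OF sub] by blast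
  then have "y \<in> {\<tau> c c' \<otimes>\<^bsub>T\<^esub> t | t. t \<in> carrier T}" using closed by (rule rev_subsetD)
  then show "\<exists>x\<in>carrier T. y = \<tau> c c' \<otimes>\<^bsub>T\<^esub> x" by blast
qed

lemma trace_in_base_tensor: "trace_in_base T S"
  unfolding QT.trace_in_base_iff
proof
  fix x assume x: "x \<in> carrier T"
  show "\<exists>t\<in>S. \<tau> c c' \<otimes>\<^bsub>T\<^esub> t = (\<Oplus>\<^bsub>CT.RR\<^esub>i\<in>{..<w * w'}. D i (x \<otimes>\<^bsub>T\<^esub> bT i))"
    using QT.c_tr[OF x] QT.tr_R[OF x] by (intro bexI[of _ "trT x"])
qed

end

section \<open>The discriminant of a tensor product\<close>

lemma l_coset_carrier: "x <#\<^bsub>G\<^esub> carrier G = {x \<otimes>\<^bsub>G\<^esub> y | y. y \<in> carrier G}"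
  by (auto simp: l_coset_def)

lemma smult_one_center:
  assumes "assoc_algebra k A" "a \<in> carrier k" shows "a \<odot>\<^bsub>A\<^esub> \<one>\<^bsub>A\<^esub> \<in> center A"
proof -
  interpret A: ring A using assms(1) by (simp add: assoc_algebra_def)
  interpret M: module k A using assms(1) by (simp add: assoc_algebra_def)
  have "(a \<odot>\<^bsub>A\<^esub> \<one>\<^bsub>A\<^esub>) \<otimes>\<^bsub>A\<^esub> x = a \<odot>\<^bsub>A\<^esub> x" "x \<otimes>\<^bsub>A\<^esub> (a \<odot>\<^bsub>A\<^esub> \<one>\<^bsub>A\<^esub>) = a \<odot>\<^bsub>A\<^esub> x" if "x \<in> carrier A" for x
    using assms that by (simp_all add: assoc_algebra_def)
  then show ?thesis using assms(2) by (simp add: center_def)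
qed

section \<open>The concrete tensor algebra as an instance of the abstract interface\<close>

context tensor_pair
begin

text \<open>The slices come from the universal property applied to (x, y) -> \<mu>(y) x and (x, y)
  -> \<nu>(x) y; these maps are balanced because the forms are linear.\<close>

lemma tensor_space:
  assumes k: "field k" shows "tensor_space k A B T (pure_tensor k A B)"
proof (rule tensor_space.intro[OF k assocA assocB T.ring_axioms])
  have gens: "{pure_tensor k A B x y | x y. x \<in> carrier A & y \<in> carrier B} \<subseteq> carrier T"
    using tens_closed by blast
  show "carrier T = generate (add_monoid T) {pure_tensor k A B x y | x y. x \<in> carrier A & y \<in> carrier B}"
    (is "_ = generate _ ?G")
  proof (intro equalityI subsetI)
    fix t assume "t \<in> carrier T"
    then show "t \<in> generate (add_monoid T) ?G"
    proof (induction rule: tensor_induct)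
      case zero
      then show ?case by (rule T.aspan_zero)
    next
      case (tens x y)
      have "pure_tensor k A B x y \<in> ?G" using tens by blast
      then show ?case by (rule T.aspan_incl)
    next
      case (add s t)
      show ?case by (rule T.aspan_add[OF add(3,4)])
    qed
  next
    fix t assume "t \<in> generate (add_monoid T) ?G"
    then show "t \<in> carrier T" by (rule T.aspan_closed[OF gens])
  qed
next
  fix \<mu> assume \<mu>: "linear_form k B \<mu>"
  note D = linear_formD[OF \<mu>]
  show "\<exists>g. (\<forall>t\<in>carrier T. g t \<in> carrier A) &
      (\<forall>s\<in>carrier T. \<forall>t\<in>carrier T. g (s \<oplus>\<^bsub>T\<^esub> t) = g s \<oplus>\<^bsub>A\<^esub> g t) &
      (\<forall>x\<in>carrier A. \<forall>y\<in>carrier B. g (pure_tensor k A B x y) = \<mu> y \<odot>\<^bsub>A\<^esub> x)"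
  proof (rule tensor_universal[OF A.abelian_group_axioms, where h = "%x y. \<mu> y \<odot>\<^bsub>A\<^esub> x"])
    fix a x y assume "a \<in> carrier k" "x \<in> carrier A" "y \<in> carrier B"
    then show "\<mu> y \<odot>\<^bsub>A\<^esub> (a \<odot>\<^bsub>A\<^esub> x) = \<mu> (a \<odot>\<^bsub>B\<^esub> y) \<odot>\<^bsub>A\<^esub> x"
      using D(1)[of y] D(3)[of a y] k.m_comm[of a "\<mu> y"] by (simp add: MA.smult_assoc1)
  next
    fix f assume f: "!!t. t \<in> carrier T ==> f t \<in> carrier A"
      "!!s t. s \<in> carrier T ==> t \<in> carrier T ==> f (s \<oplus>\<^bsub>T\<^esub> t) = f s \<oplus>\<^bsub>A\<^esub> f t"
      "!!x y. x \<in> carrier A ==> y \<in> carrier B ==> f (pure_tensor k A B x y) = \<mu> y \<odot>\<^bsub>A\<^esub> x"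
    show ?thesis by (intro exI[of _ f] conjI ballI f)
  qed (use D in \<open>simp_all add: MA.smult_r_distr MA.smult_l_distr\<close>)
next
  fix \<nu> assume \<nu>: "linear_form k A \<nu>"
  note D = linear_formD[OF \<nu>]
  show "\<exists>g. (\<forall>t\<in>carrier T. g t \<in> carrier B) &
      (\<forall>s\<in>carrier T. \<forall>t\<in>carrier T. g (s \<oplus>\<^bsub>T\<^esub> t) = g s \<oplus>\<^bsub>B\<^esub> g t) &
      (\<forall>x\<in>carrier A. \<forall>y\<in>carrier B. g (pure_tensor k A B x y) = \<nu> x \<odot>\<^bsub>B\<^esub> y)"
  proof (rule tensor_universal[OF B.abelian_group_axioms, where h = "%x y. \<nu> x \<odot>\<^bsub>B\<^esub> y"])
    fix a x y assume "a \<in> carrier k" "x \<in> carrier A" "y \<in> carrier B"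
    then show "\<nu> (a \<odot>\<^bsub>A\<^esub> x) \<odot>\<^bsub>B\<^esub> y = \<nu> x \<odot>\<^bsub>B\<^esub> (a \<odot>\<^bsub>B\<^esub> y)"
      using D(1)[of x] D(3)[of a x] k.m_comm[of a "\<nu> x"] by (simp add: MB.smult_assoc1)
  next
    fix f assume f: "!!t. t \<in> carrier T ==> f t \<in> carrier B"
      "!!s t. s \<in> carrier T ==> t \<in> carrier T ==> f (s \<oplus>\<^bsub>T\<^esub> t) = f s \<oplus>\<^bsub>B\<^esub> f t"
      "!!x y. x \<in> carrier A ==> y \<in> carrier B ==> f (pure_tensor k A B x y) = \<nu> x \<odot>\<^bsub>B\<^esub> y"
    show ?thesis by (intro exI[of _ f] conjI ballI f)
  qed (use D in \<open>simp_all add: MB.smult_r_distr MB.smult_l_distr\<close>)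
qed (simp_all add: tens_mult tens_one tens_l_distr tens_r_distr tens_balanced)

lemma tensor_endo:
  assumes f: "!!x. x \<in> carrier A ==> f x \<in> carrier A"
      "!!x y. x \<in> carrier A ==> y \<in> carrier A ==> f (x \<oplus>\<^bsub>A\<^esub> y) = f x \<oplus>\<^bsub>A\<^esub> f y"
      "!!a x. a \<in> carrier k ==> x \<in> carrier A ==> f (a \<odot>\<^bsub>A\<^esub> x) = a \<odot>\<^bsub>A\<^esub> f x"
    and f': "!!y. y \<in> carrier B ==> f' y \<in> carrier B"
      "!!x y. x \<in> carrier B ==> y \<in> carrier B ==> f' (x \<oplus>\<^bsub>B\<^esub> y) = f' x \<oplus>\<^bsub>B\<^esub> f' y"
      "!!a y. a \<in> carrier k ==> y \<in> carrier B ==> f' (a \<odot>\<^bsub>B\<^esub> y) = a \<odot>\<^bsub>B\<^esub> f' y"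
  shows "\<exists>h. (\<forall>t\<in>carrier T. h t \<in> carrier T) &
        (\<forall>s\<in>carrier T. \<forall>t\<in>carrier T. h (s \<oplus>\<^bsub>T\<^esub> t) = h s \<oplus>\<^bsub>T\<^esub> h t) &
        (\<forall>x\<in>carrier A. \<forall>y\<in>carrier B. h (pure_tensor k A B x y) = pure_tensor k A B (f x) (f' y))"
proof (rule tensor_universal[OF T.abelian_group_axioms, where h = "%x y. pure_tensor k A B (f x) (f' y)"])
  fix h assume h: "!!t. t \<in> carrier T ==> h t \<in> carrier T"
    "!!s t. s \<in> carrier T ==> t \<in> carrier T ==> h (s \<oplus>\<^bsub>T\<^esub> t) = h s \<oplus>\<^bsub>T\<^esub> h t"
    "!!x y. x \<in> carrier A ==> y \<in> carrier B ==> h (pure_tensor k A B x y) = pure_tensor k A B (f x) (f' y)"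
  show ?thesis by (intro exI[of _ h] conjI ballI h)
qed (simp_all add: f f' tens_l_distr tens_r_distr tens_balanced)

end

theorem theorem0p4:
  fixes k :: "('k, 'l) ring_scheme"
    and A :: "('k, 'a, 'm) module_scheme" and A' :: "('k, 'b, 'n) module_scheme"
    and w w' :: nat and d :: 'a and d' :: 'b
  assumes "field k"
    and "assoc_algebra k A" and "assoc_algebra k A'"
    and "prime_ring A" and "prime_ring A'"
    and "module_finite A (center A)" and "module_finite A' (center A')"
    and "w = rank A (center A)" and "w' = rank A' (center A')"
    and "prime_ring (tensor_algebra k A A')"
    and "trace_in_base A (center A)" and "trace_in_base A' (center A')"
    and "affine_subalgebra k A (center A)" and "affine_subalgebra k A' (center A')"
    and "cohen_macaulay (A\<lparr>carrier := center A\<rparr>)"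
    and "cohen_macaulay (A'\<lparr>carrier := center A'\<rparr>)"
    and "\<exists>bs V. quasi_basis A (center A) bs V"
    and "\<exists>bs V. quasi_basis A' (center A') bs V"
    and "is_reflexive_discriminant A (center A) d"
    and "is_reflexive_discriminant A' (center A') d'"
  shows "is_reflexive_discriminant (tensor_algebra k A A')
           (tensor_subalgebra k A A' (center A) (center A'))
           (pure_tensor k A A' (d [^]\<^bsub>A\<^esub> w') (d' [^]\<^bsub>A'\<^esub> w))"
proof -
  let ?T = "tensor_algebra k A A'" and ?\<tau> = "pure_tensor k A A'"
    and ?S = "tensor_subalgebra k A A' (center A) (center A')"
  interpret TP: tensor_pair k A A' by (rule tensor_pair.intro[OF assms(2,3)])
  note ts = TP.tensor_space[OF assms(1)]
  interpret TS: tensor_space k A A' ?T ?\<tau> by (rule ts)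
  \<comment> \<open>The notion of a discriminant includes the standing assumptions, among them that
    each center is a subring.\<close>
  have sub: "subring (center A) A" "subring (center A') A'"
    and refl: "reflexive_module (A\<lparr>carrier := center A\<rparr>) (algebra_via (%r. r) A)"
      "reflexive_module (A'\<lparr>carrier := center A'\<rparr>) (algebra_via (%r. r) A')"
    and normal: "normal_element A d" "normal_element A' d'"
    and hull: "reflexive_hull A (center A) (ideal_prod A (MD_ideal A (center A)) (carrier A)) = d <#\<^bsub>A\<^esub> carrier A"
      "reflexive_hull A' (center A') (ideal_prod A' (MD_ideal A' (center A')) (carrier A')) = d' <#\<^bsub>A'\<^esub> carrier A'"
    using assms(19,20) by (simp_all add: is_reflexive_discriminant_def discriminant_setting_def)
  have S: "?S = TS.tspan (center A) (center A')" by (simp add: tensor_subalgebra_def TS.tspan_def)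
  have subS: "subring ?S ?T" unfolding S by (rule TS.tspan_subring[OF sub])
  have cenS: "?S \<subseteq> center ?T" unfolding S by (rule TS.tspan_center) simp_all
  have CA: "central_domain A (center A)" by (rule prime_ring_central_domain[OF assms(4) sub(1) subset_refl])
  have CB: "central_domain A' (center A')" by (rule prime_ring_central_domain[OF assms(5) sub(2) subset_refl])
  \<comment> \<open>Primeness of the tensor product enters here: it makes \<open>?S\<close> a domain
    over which \<open>?T\<close> is torsion free.\<close>
  have CT: "central_domain ?T ?S" by (rule prime_ring_central_domain[OF assms(10) subS cenS])
  have ct: "central_tensor k A A' ?T ?\<tau> (center A) (center A') ?S"
  proof (rule central_tensor.intro[OF ts CA CB CT], rule central_tensor_axioms.intro)
    show "?S = generate (add_monoid ?T) {?\<tau> x y | x y. x \<in> center A & y \<in> center A'}"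
      by (rule tensor_subalgebra_def)
  qed (rule smult_one_center[OF assms(2)] smult_one_center[OF assms(3)] TP.tensor_endo; assumption)+
  obtain bs V where qb: "quasi_basis A (center A) bs V" using assms(17) by (elim exE)
  obtain bs' V' where qb': "quasi_basis A' (center A') bs' V'" using assms(18) by (elim exE)
  have "length bs = w" using qb assms(8) by (simp add: quasi_basis_def)
  then obtain c C where qc: "quasi_coordinates A (center A) w ((!) bs) c C"
    using central_domain.quasi_coordinates_exist[OF CA qb] by blast
  have "length bs' = w'" using qb' assms(9) by (simp add: quasi_basis_def)
  then obtain c' C' where qc': "quasi_coordinates A' (center A') w' ((!) bs') c' C'"
    using central_domain.quasi_coordinates_exist[OF CB qb'] by blast
  obtain tr where tr: "quasi_trace A (center A) w ((!) bs) c C tr"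
    using quasi_coordinates.quasi_trace_exists[OF qc assms(11)] by (elim exE)
  obtain tr' where tr': "quasi_trace A' (center A') w' ((!) bs') c' C' tr'"
    using quasi_coordinates.quasi_trace_exists[OF qc' assms(12)] by (elim exE)
  note tt = tensor_trace.intro[OF ct tr tr']
  have dom: "domain (?T\<lparr>carrier := ?S\<rparr>)" using CT by (simp add: central_domain_def central_domain_axioms_def)
  have fin: "module_finite ?T ?S" by (rule central_tensor.module_finite_tensor[OF ct assms(6,7)])
  have nrm: "normal_element ?T (?\<tau> (d [^]\<^bsub>A\<^esub> w') (d' [^]\<^bsub>A'\<^esub> w))"
    by (rule central_tensor.normal_tensor[OF ct TP.A.normal_element_pow[OF normal(1)] TP.B.normal_element_pow[OF normal(2)]])
  show ?thesis
  proof (rule tensor_trace.tensor_quasi_trace[OF tt])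
    fix D trT
    assume qt: "quasi_trace ?T ?S (w * w') (%n. ?\<tau> (bs ! (n div w')) (bs' ! (n mod w'))) (?\<tau> c c') D trT"
      and D: "!!n x y. n < w * w' ==> x \<in> carrier A ==> y \<in> carrier A' ==>
        D n (?\<tau> x y) = ?\<tau> (C (n div w') x) (C' (n mod w') y)"
      and trT: "!!x y. x \<in> carrier A ==> y \<in> carrier A' ==> trT (?\<tau> x y) = ?\<tau> (tr x) (tr' y)"
    have td: "tensor_discriminant k A A' ?T ?\<tau> (center A) (center A') ?S w ((!) bs) c C tr w' ((!) bs') c' C' tr' D trT"
      by (rule tensor_discriminant.intro[OF tt qt], rule tensor_discriminant_axioms.intro) (rule D trT; assumption)+
    show ?thesis
      unfolding is_reflexive_discriminant_def discriminant_setting_def l_coset_carrier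
      using assms(10) subS cenS dom fin tensor_discriminant.trace_in_base_tensor[OF td]
        tensor_discriminant.reflexive_tensor[OF td refl] nrm
        tensor_discriminant.hull_tensor[OF td normal hull[unfolded l_coset_carrier]]
      by (intro conjI)
  qed
qed

end
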